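(* Let $\mathcal C$ be a $BTC^*$ and $\mathcal S\subset\mathcal C$ an even symmetric subcategory all of whose irreducible objects have dimension one. The irreducible sectors (isomorphism classes of irreducible objects) of $\mathcal C\rtimes\mathcal S$ are labeled by pairs $(\underline\rho,\chi)$, where $\underline\rho\in\Delta/\Delta_{\mathcal S}$ is an orbit of the set $\Delta$ of irreducible sectors of $\mathcal C$ under the action of the group $\Delta_{\mathcal S}$ of irreducible sectors of $\mathcal S$ by multiplication, and $\chi$ is a character of the subgroup $L_{\underline\rho}\subset K_{\underline\rho}$. That is, choosing a representative $\rho$ of each orbit $\underline\rho$, and writing $\rho^\chi$ ($\chi\in\widehat{L_\rho}$) for the mutually inequivalent irreducible components of $\rho$ in $\mathcal C\rtimes\mathcal S$, indexed by characters, the map $(\underline\rho,\chi)\mapsto[\rho^\chi]$ is a bijection onto the set of irreducible sectors of $\mathcal C\rtimes\mathcal S$.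
   Context: Tensor categories. All are small and strict; $\rho\sigma$ is the tensor product of objects, $\times$ that of arrows, $\circ$ is composition, $\iota$ the unit. A tensor $*$-category has complex vector spaces as Hom-sets, bilinear $\circ,\times$, and a positive $*$-operation (antilinear, involutive, contravariant, monoidal, and $X^*\circ X=0\Rightarrow X=0$). $\rho$ is irreducible if $\mathrm{Hom}(\rho,\rho)=\mathbb C\,\mathrm{id}_\rho$. Subobjects (for every projection $E=E^*=E^2\in\mathrm{Hom}(\rho,\rho)$ an isometry $V$ with $VV^*=E$), direct sums (isometries $V_i\in\mathrm{Hom}(\rho_i,\tau)$ with $V_1V_1^*+V_2V_2^*=\mathrm{id}_\tau$) and conjugates ($R\in\mathrm{Hom}(\iota,\bar\rho\rho)$, $\bar R\in\mathrm{Hom}(\iota,\rho\bar\rho)$ with $(\bar R^*\times\mathrm{id}_\rho)\circ(\mathrm{id}_\rho\times R)=\mathrm{id}_\rho$, $(R^*\times\mathrm{id}_{\bar\rho})\circ(\mathrm{id}_{\bar\rho}\times\bar R)=\mathrm{id}_{\bar\rho}$, normalized by $R^*R=\bar R^*\bar R=d(\rho)\mathrm{id}_\iota$ for $\rho$ irreducible; $d(\rho)$ is the dimension) are meant in the $*$-sense. For reducible $\rho$ only standard solutions $R_\rho=\sum_i(\bar W_i\times W_i)\circ R_i$, built from a decomposition into irreducibles, are used. A $TC^*$ is a tensor $*$-category with conjugates, direct sums, subobjects, finite dimensional Hom-spaces and irreducible unit; a $BTC^*$ is a $TC^*$ with unitary braiding $\varepsilon$. The twist is $\kappa(\rho)=(R_\rho^*\times\mathrm{id}_\rho)\circ(\mathrm{id}_{\bar\rho}\times\varepsilon(\rho,\rho))\circ(R_\rho\times\mathrm{id}_\rho)$.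 Even symmetric subcategory $\mathcal S\subset\mathcal C$: a replete full tensor subcategory on which $\varepsilon$ is symmetric, closed under conjugates, direct sums and subobjects, with all twists $\kappa(\rho)=\mathrm{id}_\rho$, $\rho\in\mathcal S$. By Doplicher–Roberts there are a compact group $G=\mathrm{Gal}(\mathcal S)$, unique up to isomorphism, and an isomorphism $F:\mathcal S\to U(G)$ of symmetric tensor $*$-categories onto a category $U(G)$ of finite dimensional continuous unitary representations of $G$ closed under direct sums and subrepresentations and containing members of all classes of irreducibles. Tensor product in $U(G)$ is $\boxtimes$; $F(\iota)=\mathbb C$ contains a unit vector $\Omega$ with $\Omega\boxtimes\psi=\psi\boxtimes\Omega=\psi$. If all irreducibles of $\mathcal S$ have dimension one, their classes form a discrete abelian group $K=\Delta_{\mathcal S}$ under tensor product, which acts on $\Delta$ by $\rho\mapsto\gamma\rho$. Crossed product: let $\gamma_k$ be representatives of the isomorphism classes $k$ of irreducible objects of $\mathcal S$ (here $k\in K$), $\gamma_0=\iota$ the one of the unit class (also written $e$), $\mathcal H_k=F(\gamma_k)$; choose orthonormal bases $\{V_{k,l}^{m,\alpha}\}$ of $\mathrm{Hom}(\gamma_m,\gamma_k\gamma_l)$ ($V^*\circ W=\langle V,W\rangle\mathrm{id}$), and normalized solutions $R_k\in\mathrm{Hom}(\iota,\gamma_{\bar k}\gamma_k)$, $\bar R_k\in\mathrm{Hom}(\iota,\gamma_k\gamma_{\bar k})$ of the conjugate equations with $R_{\bar k}=\bar R_k$, $\bar R_{\bar k}=R_k$ if $\bar k\neq k$ and $\bar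 R_k=\pm R_k$ if $\bar k=k$. $\mathcal C\rtimes_0\mathcal S$ has the objects and tensor product of objects of $\mathcal C$, and $\mathrm{Hom}_{\mathcal C\rtimes_0\mathcal S}(\rho,\sigma)=\bigoplus_k\mathrm{Hom}_{\mathcal C}(\gamma_k\rho,\sigma)\otimes\mathcal H_k$. For $S\in\mathrm{Hom}(\gamma_k\sigma,\delta)$, $T\in\mathrm{Hom}(\gamma_l\rho,\sigma)$, $\psi_k\in\mathcal H_k,\psi_l\in\mathcal H_l$, $$(S\otimes\psi_k)\circ(T\otimes\psi_l)=\bigoplus_{m}\sum_\alpha\big[S\circ(\mathrm{id}_{\gamma_k}\times T)\circ(V_{k,l}^{m,\alpha}\times\mathrm{id}_\rho)\big]\otimes F(V_{k,l}^{m,\alpha})^*(\psi_k\boxtimes\psi_l);$$ for $S\in\mathrm{Hom}(\gamma_k\rho_1,\sigma_1)$, $T\in\mathrm{Hom}(\gamma_l\rho_2,\sigma_2)$, $$(S\otimes\psi_k)\times(T\otimes\psi_l)=\bigoplus_{m}\sum_\alpha\big[(S\times T)\circ(\mathrm{id}_{\gamma_k}\times\varepsilon(\gamma_l,\rho_1)\times\mathrm{id}_{\rho_2})\circ(V_{k,l}^{m,\alpha}\times\mathrm{id}_{\rho_1\rho_2})\big]\otimes F(V_{k,l}^{m,\alpha})^*(\psi_k\boxtimes\psi_l);$$ for $S\in\mathrm{Hom}(\gamma_k\rho,\sigma)$, $(S\otimes\psi_k)^*=\big[(R_k^*\times\mathrm{id}_\rho)\circ(\mathrm{id}_{\gamma_{\bar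 k}}\times S^* )\big]\otimes\bar\psi$, where $\bar\psi\in\mathcal H_{\bar k}$ is defined by $\langle a,\bar\psi\rangle=\langle\psi_k\boxtimes a,F(\bar R_k)\Omega\rangle$ for all $a\in\mathcal H_{\bar k}$ (inner products antilinear in the first variable). $\mathcal C\rtimes\mathcal S$ is the closure of $\mathcal C\rtimes_0\mathcal S$ under subobjects: objects are pairs $(\rho,E)$ with $E=E^2=E^*\in\mathrm{Hom}_{\mathcal C\rtimes_0\mathcal S}(\rho,\rho)$, $\mathrm{Hom}((\rho,E),(\sigma,E'))=E'\circ\mathrm{Hom}_{\mathcal C\rtimes_0\mathcal S}(\rho,\sigma)\circ E$, $\mathrm{id}_{(\rho,E)}=E$, $(\rho,E)(\sigma,E')=(\rho\sigma,E\times E')$, arrows as in $\mathcal C\rtimes_0\mathcal S$; $\rho\in\mathcal C$ is identified with $(\rho,\mathrm{id}_\rho)$. The groups $K_\rho,L_\rho$ for irreducible $\rho\in\mathcal C$: $K_\rho=\{k\in K:\gamma_k\rho\cong\rho\}$, a finite subgroup of $K$. Choose unitaries $T_k\in\mathrm{Hom}_{\mathcal C}(\gamma_k\rho,\rho)$ (with $T_e=\mathrm{id}_\rho$) and unit vectors $\psi_k\in\mathcal H_k$, $k\in K_\rho$, and put $U_k=T_k\otimes\psi_k\in\mathrm{Hom}_{\mathcal C\rtimes\mathcal S}(\rho,\rho)$. Then $U_k\circ U_l=c(k,l)U_{kl}$ with a 2-cocycle $c\in Z^2(K_\rho,\mathbb T)$, and $L_\rho=\{k\in K_\rho: c(k,l)=c(l,k)\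 \forall l\in K_\rho\}$. The groups depend only on the orbit and are also written $K_{\underline\rho},L_{\underline\rho}$. In $\mathcal C\rtimes\mathcal S$ one has $\rho\cong N_\rho\bigoplus_{\chi\in\widehat{L_\rho}}\rho^\chi$ with $\rho^\chi$ irreducible and mutually inequivalent and $N_\rho=\sqrt{|K_\rho|/|L_\rho|}$. *)

theory Defs
  imports "HOL-Analysis.Analysis" "HOL-Algebra.Group" "HOL-Library.Function_Algebras"
begin

section \<open>Strict tensor *-categories\<close>

text \<open>
  All arrows of a category live in one additive group \<open>'a\<close>, and each Hom-space is a complex subspace
  of it; so the operations need no object arguments, and zero arrows of different Hom-spaces are
  identified.  This is no loss of generality: take for \<open>'a\<close> the direct sum of all Hom-spaces.
  Nothing is assumed about \<open>cmp\<close>, \<open>tens\<close>, \<open>adj\<close> outside the Hom-spaces of objects in \<open>Obj\<close>.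
\<close>

record ('o, 'a) tensor_star_cat =
  Obj :: "'o set"
  Hom :: "'o \<Rightarrow> 'o \<Rightarrow> 'a set"
  ide :: "'o \<Rightarrow> 'a"
  cmp :: "'a \<Rightarrow> 'a \<Rightarrow> 'a"  (infixl "\<cdot>\<index>" 70)
  scl :: "complex \<Rightarrow> 'a \<Rightarrow> 'a"
  adj :: "'a \<Rightarrow> 'a"
  unt :: "'o"
  prd :: "'o \<Rightarrow> 'o \<Rightarrow> 'o"  (infixl "\<odot>\<index>" 75)
  tens :: "'a \<Rightarrow> 'a \<Rightarrow> 'a"  (infixl "\<parallel>\<index>" 75)

record ('o, 'a) braided_cat = "('o, 'a) tensor_star_cat" +
  eps :: "'o \<Rightarrow> 'o \<Rightarrow> 'a"

locale tensor_star_category =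
  fixes C :: "('o, 'a::ab_group_add, 'z) tensor_star_cat_scheme" (structure)
  assumes unt_Obj: "unt C \<in> Obj C"
    and prd_Obj: "\<lbrakk>\<rho> \<in> Obj C; \<sigma> \<in> Obj C\<rbrakk> \<Longrightarrow> \<rho> \<odot> \<sigma> \<in> Obj C"
    and prd_assoc: "\<lbrakk>\<rho> \<in> Obj C; \<sigma> \<in> Obj C; \<tau> \<in> Obj C\<rbrakk> \<Longrightarrow> (\<rho> \<odot> \<sigma>) \<odot> \<tau> = \<rho> \<odot> (\<sigma> \<odot> \<tau>)"
    and prd_unt: "\<rho> \<in> Obj C \<Longrightarrow> unt C \<odot> \<rho> = \<rho>" "\<rho> \<in> Obj C \<Longrightarrow> \<rho> \<odot> unt C = \<rho>"
    and vs: "vector_space (scl C)"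
    and Hom_subspace: "\<lbrakk>\<rho> \<in> Obj C; \<sigma> \<in> Obj C\<rbrakk> \<Longrightarrow> module.subspace (scl C) (Hom C \<rho> \<sigma>)"
    and ide_Hom: "\<rho> \<in> Obj C \<Longrightarrow> ide C \<rho> \<in> Hom C \<rho> \<rho>"
    and cmp_Hom: "\<lbrakk>\<rho> \<in> Obj C; \<sigma> \<in> Obj C; \<tau> \<in> Obj C; X \<in> Hom C \<sigma> \<tau>; Y \<in> Hom C \<rho> \<sigma>\<rbrakk>
          \<Longrightarrow> X \<cdot> Y \<in> Hom C \<rho> \<tau>"
    and cmp_assoc: "\<lbrakk>\<rho> \<in> Obj C; \<sigma> \<in> Obj C; \<tau> \<in> Obj C; \<upsilon> \<in> Obj C;
          X \<in> Hom C \<tau> \<upsilon>; Y \<in> Hom C \<sigma> \<tau>; Z \<in> Hom C \<rho> \<sigma>\<rbrakk> \<Longrightarrow> (X \<cdot> Y) \<cdot> Z = X \<cdot> (Y \<cdot> Z)"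
    and cmp_ide: "\<lbrakk>\<rho> \<in> Obj C; \<sigma> \<in> Obj C; X \<in> Hom C \<rho> \<sigma>\<rbrakk> \<Longrightarrow> ide C \<sigma> \<cdot> X = X"
      "\<lbrakk>\<rho> \<in> Obj C; \<sigma> \<in> Obj C; X \<in> Hom C \<rho> \<sigma>\<rbrakk> \<Longrightarrow> X \<cdot> ide C \<rho> = X"
    and cmp_add: "\<lbrakk>\<rho> \<in> Obj C; \<sigma> \<in> Obj C; \<tau> \<in> Obj C;
          X \<in> Hom C \<sigma> \<tau>; X' \<in> Hom C \<sigma> \<tau>; Y \<in> Hom C \<rho> \<sigma>\<rbrakk> \<Longrightarrow> (X + X') \<cdot> Y = X \<cdot> Y + X' \<cdot> Y"
      "\<lbrakk>\<rho> \<in> Obj C; \<sigma> \<in> Obj C; \<tau> \<in> Obj C;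
          X \<in> Hom C \<sigma> \<tau>; Y \<in> Hom C \<rho> \<sigma>; Y' \<in> Hom C \<rho> \<sigma>\<rbrakk> \<Longrightarrow> X \<cdot> (Y + Y') = X \<cdot> Y + X \<cdot> Y'"
    and cmp_scl: "\<lbrakk>\<rho> \<in> Obj C; \<sigma> \<in> Obj C; \<tau> \<in> Obj C; X \<in> Hom C \<sigma> \<tau>; Y \<in> Hom C \<rho> \<sigma>\<rbrakk>
          \<Longrightarrow> scl C z X \<cdot> Y = scl C z (X \<cdot> Y)"
      "\<lbrakk>\<rho> \<in> Obj C; \<sigma> \<in> Obj C; \<tau> \<in> Obj C; X \<in> Hom C \<sigma> \<tau>; Y \<in> Hom C \<rho> \<sigma>\<rbrakk>
          \<Longrightarrow> X \<cdot> scl C z Y = scl C z (X \<cdot> Y)"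
    and tens_Hom: "\<lbrakk>\<rho> \<in> Obj C; \<sigma> \<in> Obj C; \<rho>' \<in> Obj C; \<sigma>' \<in> Obj C;
          X \<in> Hom C \<rho> \<sigma>; X' \<in> Hom C \<rho>' \<sigma>'\<rbrakk> \<Longrightarrow> X \<parallel> X' \<in> Hom C (\<rho> \<odot> \<rho>') (\<sigma> \<odot> \<sigma>')"
    and tens_add: "\<lbrakk>\<rho> \<in> Obj C; \<sigma> \<in> Obj C; \<rho>' \<in> Obj C; \<sigma>' \<in> Obj C;
          X \<in> Hom C \<rho> \<sigma>; Y \<in> Hom C \<rho> \<sigma>; X' \<in> Hom C \<rho>' \<sigma>'\<rbrakk>
          \<Longrightarrow> (X + Y) \<parallel> X' = X \<parallel> X' + Y \<parallel> X'"
      "\<lbrakk>\<rho> \<in> Obj C; \<sigma> \<in> Obj C; \<rho>' \<in> Obj C; \<sigma>' \<in> Obj C;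
          X \<in> Hom C \<rho> \<sigma>; X' \<in> Hom C \<rho>' \<sigma>'; Y' \<in> Hom C \<rho>' \<sigma>'\<rbrakk>
          \<Longrightarrow> X \<parallel> (X' + Y') = X \<parallel> X' + X \<parallel> Y'"
    and tens_scl: "\<lbrakk>\<rho> \<in> Obj C; \<sigma> \<in> Obj C; \<rho>' \<in> Obj C; \<sigma>' \<in> Obj C;
          X \<in> Hom C \<rho> \<sigma>; X' \<in> Hom C \<rho>' \<sigma>'\<rbrakk> \<Longrightarrow> scl C z X \<parallel> X' = scl C z (X \<parallel> X')"
      "\<lbrakk>\<rho> \<in> Obj C; \<sigma> \<in> Obj C; \<rho>' \<in> Obj C; \<sigma>' \<in> Obj C;
          X \<in> Hom C \<rho> \<sigma>; X' \<in> Hom C \<rho>' \<sigma>'\<rbrakk> \<Longrightarrow> X \<parallel> scl C z X' = scl C z (X \<parallel> X')"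
    and tens_ide: "\<lbrakk>\<rho> \<in> Obj C; \<sigma> \<in> Obj C\<rbrakk> \<Longrightarrow> ide C \<rho> \<parallel> ide C \<sigma> = ide C (\<rho> \<odot> \<sigma>)"
    and tens_cmp: "\<lbrakk>\<rho> \<in> Obj C; \<sigma> \<in> Obj C; \<tau> \<in> Obj C; \<rho>' \<in> Obj C; \<sigma>' \<in> Obj C; \<tau>' \<in> Obj C;
          X \<in> Hom C \<sigma> \<tau>; Y \<in> Hom C \<rho> \<sigma>; X' \<in> Hom C \<sigma>' \<tau>'; Y' \<in> Hom C \<rho>' \<sigma>'\<rbrakk>
          \<Longrightarrow> (X \<cdot> Y) \<parallel> (X' \<cdot> Y') = (X \<parallel> X') \<cdot> (Y \<parallel> Y')"
    and tens_assoc: "\<lbrakk>\<rho> \<in> Obj C; \<sigma> \<in> Obj C; \<rho>' \<in> Obj C; \<sigma>' \<in> Obj C; \<rho>'' \<in> Obj C; \<sigma>'' \<in> Obj C;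
          X \<in> Hom C \<rho> \<sigma>; X' \<in> Hom C \<rho>' \<sigma>'; X'' \<in> Hom C \<rho>'' \<sigma>''\<rbrakk>
          \<Longrightarrow> (X \<parallel> X') \<parallel> X'' = X \<parallel> (X' \<parallel> X'')"
    and tens_unt: "\<lbrakk>\<rho> \<in> Obj C; \<sigma> \<in> Obj C; X \<in> Hom C \<rho> \<sigma>\<rbrakk> \<Longrightarrow> ide C (unt C) \<parallel> X = X"
      "\<lbrakk>\<rho> \<in> Obj C; \<sigma> \<in> Obj C; X \<in> Hom C \<rho> \<sigma>\<rbrakk> \<Longrightarrow> X \<parallel> ide C (unt C) = X"
    and adj_Hom: "\<lbrakk>\<rho> \<in> Obj C; \<sigma> \<in> Obj C; X \<in> Hom C \<rho> \<sigma>\<rbrakk> \<Longrightarrow> adj C X \<in> Hom C \<sigma> \<rho>"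
    and adj_adj: "\<lbrakk>\<rho> \<in> Obj C; \<sigma> \<in> Obj C; X \<in> Hom C \<rho> \<sigma>\<rbrakk> \<Longrightarrow> adj C (adj C X) = X"
    and adj_add: "\<lbrakk>\<rho> \<in> Obj C; \<sigma> \<in> Obj C; X \<in> Hom C \<rho> \<sigma>; Y \<in> Hom C \<rho> \<sigma>\<rbrakk>
          \<Longrightarrow> adj C (X + Y) = adj C X + adj C Y"
    and adj_scl: "\<lbrakk>\<rho> \<in> Obj C; \<sigma> \<in> Obj C; X \<in> Hom C \<rho> \<sigma>\<rbrakk>
          \<Longrightarrow> adj C (scl C z X) = scl C (cnj z) (adj C X)"
    and adj_cmp: "\<lbrakk>\<rho> \<in> Obj C; \<sigma> \<in> Obj C; \<tau> \<in> Obj C; X \<in> Hom C \<sigma> \<tau>; Y \<in> Hom C \<rho> \<sigma>\<rbrakk>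
          \<Longrightarrow> adj C (X \<cdot> Y) = adj C Y \<cdot> adj C X"
    and adj_tens: "\<lbrakk>\<rho> \<in> Obj C; \<sigma> \<in> Obj C; \<rho>' \<in> Obj C; \<sigma>' \<in> Obj C;
          X \<in> Hom C \<rho> \<sigma>; X' \<in> Hom C \<rho>' \<sigma>'\<rbrakk> \<Longrightarrow> adj C (X \<parallel> X') = adj C X \<parallel> adj C X'"
    and adj_positive: "\<lbrakk>\<rho> \<in> Obj C; \<sigma> \<in> Obj C; X \<in> Hom C \<rho> \<sigma>; adj C X \<cdot> X = 0\<rbrakk> \<Longrightarrow> X = 0"

text \<open>Zero objects (which closure under subobjects produces) are not irreducible.\<close>

definition irreducible_obj :: "('o, 'a::ab_group_add, 'z) tensor_star_cat_scheme \<Rightarrow> 'o \<Rightarrow> bool" where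
  "irreducible_obj C \<rho> \<longleftrightarrow>
     \<rho> \<in> Obj C \<and> ide C \<rho> \<noteq> 0 \<and> Hom C \<rho> \<rho> = {scl C z (ide C \<rho>) |z. True}"

definition isometry :: "('o, 'a, 'z) tensor_star_cat_scheme \<Rightarrow> 'o \<Rightarrow> 'o \<Rightarrow> 'a \<Rightarrow> bool" where
  "isometry C \<rho> \<sigma> V \<longleftrightarrow> V \<in> Hom C \<rho> \<sigma> \<and> adj C V \<cdot>\<^bsub>C\<^esub> V = ide C \<rho>"

definition unitary_arr :: "('o, 'a, 'z) tensor_star_cat_scheme \<Rightarrow> 'o \<Rightarrow> 'o \<Rightarrow> 'a \<Rightarrow> bool" where
  "unitary_arr C \<rho> \<sigma> V \<longleftrightarrow> isometry C \<rho> \<sigma> V \<and> V \<cdot>\<^bsub>C\<^esub> adj C V = ide C \<sigma>"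

definition isomorphic_obj :: "('o, 'a, 'z) tensor_star_cat_scheme \<Rightarrow> 'o \<Rightarrow> 'o \<Rightarrow> bool" where
  "isomorphic_obj C \<rho> \<sigma> \<longleftrightarrow>
     (\<exists>X \<in> Hom C \<rho> \<sigma>. \<exists>Y \<in> Hom C \<sigma> \<rho>. Y \<cdot>\<^bsub>C\<^esub> X = ide C \<rho> \<and> X \<cdot>\<^bsub>C\<^esub> Y = ide C \<sigma>)"

definition iso_class :: "('o, 'a, 'z) tensor_star_cat_scheme \<Rightarrow> 'o \<Rightarrow> 'o set" where
  "iso_class C \<rho> = {\<sigma> \<in> Obj C. isomorphic_obj C \<rho> \<sigma>}"

definition sectors :: "('o, 'a::ab_group_add, 'z) tensor_star_cat_scheme \<Rightarrow> 'o set set" where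
  "sectors C = iso_class C ` {\<rho>. irreducible_obj C \<rho>}"

definition is_direct_sum ::
  "('o, 'a::ab_group_add, 'z) tensor_star_cat_scheme \<Rightarrow> 'o \<Rightarrow> 'o \<Rightarrow> 'o \<Rightarrow> bool" where
  "is_direct_sum C \<rho>1 \<rho>2 \<tau> \<longleftrightarrow> (\<exists>V1 V2. isometry C \<rho>1 \<tau> V1 \<and> isometry C \<rho>2 \<tau> V2 \<and>
     V1 \<cdot>\<^bsub>C\<^esub> adj C V1 + V2 \<cdot>\<^bsub>C\<^esub> adj C V2 = ide C \<tau>)"

definition projection :: "('o, 'a, 'z) tensor_star_cat_scheme \<Rightarrow> 'o \<Rightarrow> 'a \<Rightarrow> bool" where
  "projection C \<rho> E \<longleftrightarrow> E \<in> Hom C \<rho> \<rho> \<and> E \<cdot>\<^bsub>C\<^esub> E = E \<and> adj C E = E"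

definition conj_solution ::
  "('o, 'a, 'z) tensor_star_cat_scheme \<Rightarrow> 'o \<Rightarrow> 'o \<Rightarrow> 'a \<Rightarrow> 'a \<Rightarrow> bool" where
  "conj_solution C \<rho> \<rho>b R Rb \<longleftrightarrow>
     R \<in> Hom C (unt C) (\<rho>b \<odot>\<^bsub>C\<^esub> \<rho>) \<and> Rb \<in> Hom C (unt C) (\<rho> \<odot>\<^bsub>C\<^esub> \<rho>b) \<and>
     (adj C Rb \<parallel>\<^bsub>C\<^esub> ide C \<rho>) \<cdot>\<^bsub>C\<^esub> (ide C \<rho> \<parallel>\<^bsub>C\<^esub> R) = ide C \<rho> \<and>
     (adj C R \<parallel>\<^bsub>C\<^esub> ide C \<rho>b) \<cdot>\<^bsub>C\<^esub> (ide C \<rho>b \<parallel>\<^bsub>C\<^esub> Rb) = ide C \<rho>b"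

definition normalized_solution ::
  "('o, 'a, 'z) tensor_star_cat_scheme \<Rightarrow> 'o \<Rightarrow> 'o \<Rightarrow> 'a \<Rightarrow> 'a \<Rightarrow> real \<Rightarrow> bool" where
  "normalized_solution C \<rho> \<rho>b R Rb d \<longleftrightarrow> conj_solution C \<rho> \<rho>b R Rb \<and>
     adj C R \<cdot>\<^bsub>C\<^esub> R = scl C (of_real d) (ide C (unt C)) \<and>
     adj C Rb \<cdot>\<^bsub>C\<^esub> Rb = scl C (of_real d) (ide C (unt C))"

text \<open>Dimension of an irreducible object; a relation because uniqueness of \<open>d\<close> needs proof.\<close>

definition has_dimension :: "('o, 'a, 'z) tensor_star_cat_scheme \<Rightarrow> 'o \<Rightarrow> real \<Rightarrow> bool" where
  "has_dimension C \<rho> d \<longleftrightarrow> (\<exists>\<rho>b \<in> Obj C. \<exists>R Rb. normalized_solution C \<rho> \<rho>b R Rb d)"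

definition standard_solution ::
  "('o, 'a::ab_group_add, 'z) tensor_star_cat_scheme \<Rightarrow> 'o \<Rightarrow> 'o \<Rightarrow> 'a \<Rightarrow> 'a \<Rightarrow> bool" where
  "standard_solution C \<rho> \<rho>b R Rb \<longleftrightarrow>
     (\<exists>(n::nat) \<rho>i \<rho>bi Ri Rbi W Wb.
        (\<forall>i<n. irreducible_obj C (\<rho>i i) \<and> \<rho>bi i \<in> Obj C \<and>
               (\<exists>d. normalized_solution C (\<rho>i i) (\<rho>bi i) (Ri i) (Rbi i) d) \<and>
               isometry C (\<rho>i i) \<rho> (W i) \<and> isometry C (\<rho>bi i) \<rho>b (Wb i)) \<and>
        (\<Sum>i<n. W i \<cdot>\<^bsub>C\<^esub> adj C (W i)) = ide C \<rho> \<and>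
        (\<Sum>i<n. Wb i \<cdot>\<^bsub>C\<^esub> adj C (Wb i)) = ide C \<rho>b \<and>
        R = (\<Sum>i<n. (Wb i \<parallel>\<^bsub>C\<^esub> W i) \<cdot>\<^bsub>C\<^esub> Ri i) \<and>
        Rb = (\<Sum>i<n. (W i \<parallel>\<^bsub>C\<^esub> Wb i) \<cdot>\<^bsub>C\<^esub> Rbi i))"

locale TC_star = tensor_star_category +
  assumes conjugates: "\<rho> \<in> Obj C \<Longrightarrow> \<exists>\<rho>b \<in> Obj C. \<exists>R Rb. conj_solution C \<rho> \<rho>b R Rb \<and>
        (irreducible_obj C \<rho> \<longrightarrow> (\<exists>d. normalized_solution C \<rho> \<rho>b R Rb d))"
    and direct_sums: "\<lbrakk>\<rho>1 \<in> Obj C; \<rho>2 \<in> Obj C\<rbrakk> \<Longrightarrow> \<exists>\<tau> \<in> Obj C. is_direct_sum C \<rho>1 \<rho>2 \<tau>"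
    and subobjects: "\<lbrakk>\<rho> \<in> Obj C; projection C \<rho> E\<rbrakk>
        \<Longrightarrow> \<exists>\<sigma> \<in> Obj C. \<exists>V. isometry C \<sigma> \<rho> V \<and> V \<cdot> adj C V = E"
    and Hom_fin_dim: "\<lbrakk>\<rho> \<in> Obj C; \<sigma> \<in> Obj C\<rbrakk>
        \<Longrightarrow> \<exists>B. finite B \<and> module.span (scl C) B = Hom C \<rho> \<sigma>"
    and unt_irreducible: "irreducible_obj C (unt C)"

locale BTC_star = TC_star C for C :: "('o, 'a::ab_group_add, 'z) braided_cat_scheme" (structure) +
  assumes eps_unitary: "\<lbrakk>\<rho> \<in> Obj C; \<sigma> \<in> Obj C\<rbrakk>
        \<Longrightarrow> unitary_arr C (\<rho> \<odot> \<sigma>) (\<sigma> \<odot> \<rho>) (eps C \<rho> \<sigma>)"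
    and eps_natural: "\<lbrakk>\<rho> \<in> Obj C; \<sigma> \<in> Obj C; \<rho>' \<in> Obj C; \<sigma>' \<in> Obj C;
          X \<in> Hom C \<rho> \<rho>'; Y \<in> Hom C \<sigma> \<sigma>'\<rbrakk>
        \<Longrightarrow> eps C \<rho>' \<sigma>' \<cdot> (X \<parallel> Y) = (Y \<parallel> X) \<cdot> eps C \<rho> \<sigma>"
    and eps_prd_right: "\<lbrakk>\<rho> \<in> Obj C; \<sigma> \<in> Obj C; \<tau> \<in> Obj C\<rbrakk>
        \<Longrightarrow> eps C \<rho> (\<sigma> \<odot> \<tau>) = (ide C \<sigma> \<parallel> eps C \<rho> \<tau>) \<cdot> (eps C \<rho> \<sigma> \<parallel> ide C \<tau>)"
    and eps_prd_left: "\<lbrakk>\<rho> \<in> Obj C; \<sigma> \<in> Obj C; \<tau> \<in> Obj C\<rbrakk>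
        \<Longrightarrow> eps C (\<rho> \<odot> \<sigma>) \<tau> = (eps C \<rho> \<tau> \<parallel> ide C \<sigma>) \<cdot> (ide C \<rho> \<parallel> eps C \<sigma> \<tau>)"

text \<open>The twist does not depend on the standard solution used; \<open>is_twist\<close> leaves that choice open.\<close>

definition is_twist ::
  "('o, 'a::ab_group_add, 'z) braided_cat_scheme \<Rightarrow> 'o \<Rightarrow> 'a \<Rightarrow> bool" where
  "is_twist C \<rho> X \<longleftrightarrow> (\<exists>\<rho>b \<in> Obj C. \<exists>R Rb. standard_solution C \<rho> \<rho>b R Rb \<and>
     X = (adj C R \<parallel>\<^bsub>C\<^esub> ide C \<rho>) \<cdot>\<^bsub>C\<^esub> (ide C \<rho>b \<parallel>\<^bsub>C\<^esub> eps C \<rho> \<rho>) \<cdot>\<^bsub>C\<^esub> (R \<parallel>\<^bsub>C\<^esub> ide C \<rho>))"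

text \<open>A full subcategory is given by its set of objects \<open>S\<close>.\<close>

locale even_symmetric_subcategory =
  fixes C :: "('o, 'a::ab_group_add, 'z) braided_cat_scheme" (structure) and S :: "'o set"
  assumes S_Obj: "S \<subseteq> Obj C"
    and S_unt: "unt C \<in> S"
    and S_prd: "\<lbrakk>\<rho> \<in> S; \<sigma> \<in> S\<rbrakk> \<Longrightarrow> \<rho> \<odot> \<sigma> \<in> S"
    and S_replete: "\<lbrakk>\<rho> \<in> S; \<sigma> \<in> Obj C; isomorphic_obj C \<rho> \<sigma>\<rbrakk> \<Longrightarrow> \<sigma> \<in> S"
    and S_conj: "\<lbrakk>\<rho> \<in> S; \<rho>b \<in> Obj C; conj_solution C \<rho> \<rho>b R Rb\<rbrakk> \<Longrightarrow> \<rho>b \<in> S"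
    and S_sum: "\<lbrakk>\<rho>1 \<in> S; \<rho>2 \<in> S; \<tau> \<in> Obj C; is_direct_sum C \<rho>1 \<rho>2 \<tau>\<rbrakk> \<Longrightarrow> \<tau> \<in> S"
    and S_sub: "\<lbrakk>\<rho> \<in> S; \<sigma> \<in> Obj C; isometry C \<sigma> \<rho> V\<rbrakk> \<Longrightarrow> \<sigma> \<in> S"
    and S_symmetric: "\<lbrakk>\<rho> \<in> S; \<sigma> \<in> S\<rbrakk> \<Longrightarrow> eps C \<sigma> \<rho> \<cdot> eps C \<rho> \<sigma> = ide C (\<rho> \<odot> \<sigma>)"
    and S_even: "\<rho> \<in> S \<Longrightarrow> is_twist C \<rho> (ide C \<rho>)"


section \<open>Categories of finite dimensional representations of a compact group\<close>

locale compact_group = group G for G :: "('g, 'm) monoid_scheme" (structure) +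
  fixes T :: "'g topology"
  assumes topspace_T: "topspace T = carrier G"
    and compact_T: "compact_space T"
    and Hausdorff_T: "Hausdorff_space T"
    and continuous_mult: "continuous_map (prod_topology T T) T (\<lambda>(x, y). x \<otimes> y)"
    and continuous_inv: "continuous_map T T (\<lambda>x. inv x)"

text \<open>
  An object \<open>r\<close> is a label for a Hilbert space \<open>hsp U r\<close> with a representation \<open>act U r\<close>.  As for arrows
  above, all these spaces are subspaces of one type \<open>'h\<close>; the inner product (antilinear in the first
  variable) is only used between vectors of the same space.
\<close>

record ('r, 'h, 'g) rep_cat =
  rObj :: "'r set"
  hsp :: "'r \<Rightarrow> 'h set"
  act :: "'r \<Rightarrow> 'g \<Rightarrow> 'h \<Rightarrow> 'h"
  hscl :: "complex \<Rightarrow> 'h \<Rightarrow> 'h"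
  ip :: "'h \<Rightarrow> 'h \<Rightarrow> complex"
  runt :: "'r"
  rprd :: "'r \<Rightarrow> 'r \<Rightarrow> 'r"
  box :: "'h \<Rightarrow> 'h \<Rightarrow> 'h"  (infixl "\<boxtimes>\<index>" 75)
  vac :: "'h"  ("\<Omega>\<index>")

definition linear_on ::
  "(complex \<Rightarrow> 'h::ab_group_add \<Rightarrow> 'h) \<Rightarrow> 'h set \<Rightarrow> ('h \<Rightarrow> 'h) \<Rightarrow> bool" where
  "linear_on s A f \<longleftrightarrow> (\<forall>a\<in>A. \<forall>b\<in>A. f (a + b) = f a + f b) \<and> (\<forall>z. \<forall>a\<in>A. f (s z a) = s z (f a))"

definition intertwiners ::
  "('g, 'm) monoid_scheme \<Rightarrow> ('r, 'h::ab_group_add, 'g, 'y) rep_cat_scheme \<Rightarrow> 'r \<Rightarrow> 'r \<Rightarrow> ('h \<Rightarrow> 'h) set"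
  where "intertwiners G U r s = {f \<in> hsp U r \<rightarrow>\<^sub>E hsp U s. linear_on (hscl U) (hsp U r) f \<and>
           (\<forall>g \<in> carrier G. \<forall>a \<in> hsp U r. f (act U r g a) = act U s g (f a))}"

definition orthonormal_basis ::
  "('r, 'h::ab_group_add, 'g, 'y) rep_cat_scheme \<Rightarrow> 'r \<Rightarrow> 'h set \<Rightarrow> bool" where
  "orthonormal_basis U r B \<longleftrightarrow> finite B \<and> module.span (hscl U) B = hsp U r \<and>
     (\<forall>a\<in>B. \<forall>b\<in>B. ip U a b = (if a = b then 1 else 0))"

text \<open>
  Irreducible continuous unitary representations, up to equivalence: every finite dimensional one
  is equivalent to a representation by unitary \<open>n \<times> n\<close> matrices.
\<close>

definition irreducible_matrix_rep ::
  "('g, 'm) monoid_scheme \<Rightarrow> 'g topology \<Rightarrow> nat \<Rightarrow> ('g \<Rightarrow> nat \<Rightarrow> nat \<Rightarrow> complex) \<Rightarrow> bool" where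
  "irreducible_matrix_rep G T n \<pi> \<longleftrightarrow> n > 0 \<and>
     (\<forall>i<n. \<forall>j<n. \<pi> \<one>\<^bsub>G\<^esub> i j = (if i = j then 1 else 0)) \<and>
     (\<forall>g \<in> carrier G. \<forall>h \<in> carrier G. \<forall>i<n. \<forall>j<n. \<pi> (g \<otimes>\<^bsub>G\<^esub> h) i j = (\<Sum>k<n. \<pi> g i k * \<pi> h k j)) \<and>
     (\<forall>g \<in> carrier G. \<forall>i<n. \<forall>j<n. (\<Sum>k<n. cnj (\<pi> g k i) * \<pi> g k j) = (if i = j then 1 else 0)) \<and>
     (\<forall>i<n. \<forall>j<n. continuous_map T euclidean (\<lambda>g. \<pi> g i j)) \<and>
     (\<forall>A. (\<forall>g \<in> carrier G. \<forall>i<n. \<forall>j<n. (\<Sum>k<n. A i k * \<pi> g k j) = (\<Sum>k<n. \<pi> g i k * A k j))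
        \<longrightarrow> (\<exists>z. \<forall>i<n. \<forall>j<n. A i j = (if i = j then z else 0)))"

locale rep_category = compact_group G T
  for G :: "('g, 'm) monoid_scheme" and T :: "'g topology" +
  fixes U :: "('r, 'h::ab_group_add, 'g, 'y) rep_cat_scheme" (structure)
  assumes hvs: "vector_space (hscl U)"
    and hsp_subspace: "r \<in> rObj U \<Longrightarrow> module.subspace (hscl U) (hsp U r)"
    and hsp_fin_dim: "r \<in> rObj U \<Longrightarrow> \<exists>B. finite B \<and> module.span (hscl U) B = hsp U r"
    and ip_add: "\<lbrakk>r \<in> rObj U; a \<in> hsp U r; b \<in> hsp U r; c \<in> hsp U r\<rbrakk>
          \<Longrightarrow> ip U a (b + c) = ip U a b + ip U a c"
    and ip_scl: "\<lbrakk>r \<in> rObj U; a \<in> hsp U r; b \<in> hsp U r\<rbrakk> \<Longrightarrow> ip U a (hscl U z b) = z * ip U a b"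
    and ip_cnj: "\<lbrakk>r \<in> rObj U; a \<in> hsp U r; b \<in> hsp U r\<rbrakk> \<Longrightarrow> ip U b a = cnj (ip U a b)"
    and ip_pos: "\<lbrakk>r \<in> rObj U; a \<in> hsp U r; a \<noteq> 0\<rbrakk> \<Longrightarrow> Re (ip U a a) > 0"
    and act_hsp: "\<lbrakk>r \<in> rObj U; g \<in> carrier G; a \<in> hsp U r\<rbrakk> \<Longrightarrow> act U r g a \<in> hsp U r"
    and act_linear: "\<lbrakk>r \<in> rObj U; g \<in> carrier G\<rbrakk> \<Longrightarrow> linear_on (hscl U) (hsp U r) (act U r g)"
    and act_one: "\<lbrakk>r \<in> rObj U; a \<in> hsp U r\<rbrakk> \<Longrightarrow> act U r \<one>\<^bsub>G\<^esub> a = a"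
    and act_mult: "\<lbrakk>r \<in> rObj U; g \<in> carrier G; h \<in> carrier G; a \<in> hsp U r\<rbrakk>
          \<Longrightarrow> act U r (g \<otimes>\<^bsub>G\<^esub> h) a = act U r g (act U r h a)"
    and act_unitary: "\<lbrakk>r \<in> rObj U; g \<in> carrier G; a \<in> hsp U r; b \<in> hsp U r\<rbrakk>
          \<Longrightarrow> ip U (act U r g a) (act U r g b) = ip U a b"
    and act_continuous: "\<lbrakk>r \<in> rObj U; a \<in> hsp U r; b \<in> hsp U r\<rbrakk>
          \<Longrightarrow> continuous_map T euclidean (\<lambda>g. ip U a (act U r g b))"
    and rprd_rObj: "\<lbrakk>r \<in> rObj U; s \<in> rObj U\<rbrakk> \<Longrightarrow> rprd U r s \<in> rObj U"
    and rprd_assoc: "\<lbrakk>r \<in> rObj U; s \<in> rObj U; t \<in> rObj U\<rbrakk>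
          \<Longrightarrow> rprd U (rprd U r s) t = rprd U r (rprd U s t)"
    and box_add: "\<lbrakk>r \<in> rObj U; s \<in> rObj U; a \<in> hsp U r; a' \<in> hsp U r; b \<in> hsp U s\<rbrakk>
          \<Longrightarrow> (a + a') \<boxtimes> b = a \<boxtimes> b + a' \<boxtimes> b"
      "\<lbrakk>r \<in> rObj U; s \<in> rObj U; a \<in> hsp U r; b \<in> hsp U s; b' \<in> hsp U s\<rbrakk>
          \<Longrightarrow> a \<boxtimes> (b + b') = a \<boxtimes> b + a \<boxtimes> b'"
    and box_scl: "\<lbrakk>r \<in> rObj U; s \<in> rObj U; a \<in> hsp U r; b \<in> hsp U s\<rbrakk>
          \<Longrightarrow> hscl U z a \<boxtimes> b = hscl U z (a \<boxtimes> b)"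
      "\<lbrakk>r \<in> rObj U; s \<in> rObj U; a \<in> hsp U r; b \<in> hsp U s\<rbrakk>
          \<Longrightarrow> a \<boxtimes> hscl U z b = hscl U z (a \<boxtimes> b)"
    and box_assoc: "\<lbrakk>r \<in> rObj U; s \<in> rObj U; t \<in> rObj U; a \<in> hsp U r; b \<in> hsp U s; c \<in> hsp U t\<rbrakk>
          \<Longrightarrow> (a \<boxtimes> b) \<boxtimes> c = a \<boxtimes> (b \<boxtimes> c)"
    and box_ip: "\<lbrakk>r \<in> rObj U; s \<in> rObj U; a \<in> hsp U r; a' \<in> hsp U r; b \<in> hsp U s; b' \<in> hsp U s\<rbrakk>
          \<Longrightarrow> ip U (a \<boxtimes> b) (a' \<boxtimes> b') = ip U a a' * ip U b b'"
    and box_span: "\<lbrakk>r \<in> rObj U; s \<in> rObj U\<rbrakk>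
          \<Longrightarrow> hsp U (rprd U r s) = module.span (hscl U) {a \<boxtimes> b |a b. a \<in> hsp U r \<and> b \<in> hsp U s}"
    and box_act: "\<lbrakk>r \<in> rObj U; s \<in> rObj U; g \<in> carrier G; a \<in> hsp U r; b \<in> hsp U s\<rbrakk>
          \<Longrightarrow> act U (rprd U r s) g (a \<boxtimes> b) = act U r g a \<boxtimes> act U s g b"
    and runt_rObj: "runt U \<in> rObj U"
    and rprd_runt: "r \<in> rObj U \<Longrightarrow> rprd U (runt U) r = r" "r \<in> rObj U \<Longrightarrow> rprd U r (runt U) = r"
    and runt_hsp: "hsp U (runt U) = {hscl U z \<Omega> |z. True}"
    and vac_unit: "ip U \<Omega> \<Omega> = 1"
    and vac_act: "g \<in> carrier G \<Longrightarrow> act U (runt U) g \<Omega> = \<Omega>"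
    and vac_box: "\<lbrakk>r \<in> rObj U; a \<in> hsp U r\<rbrakk> \<Longrightarrow> \<Omega> \<boxtimes> a = a"
      "\<lbrakk>r \<in> rObj U; a \<in> hsp U r\<rbrakk> \<Longrightarrow> a \<boxtimes> \<Omega> = a"
    and rep_direct_sums: "\<lbrakk>r \<in> rObj U; s \<in> rObj U\<rbrakk> \<Longrightarrow>
          \<exists>t \<in> rObj U. \<exists>f \<in> intertwiners G U r t. \<exists>h \<in> intertwiners G U s t.
            (\<forall>a \<in> hsp U r. \<forall>a' \<in> hsp U r. ip U (f a) (f a') = ip U a a') \<and>
            (\<forall>b \<in> hsp U s. \<forall>b' \<in> hsp U s. ip U (h b) (h b') = ip U b b') \<and>
            (\<forall>a \<in> hsp U r. \<forall>b \<in> hsp U s. ip U (f a) (h b) = 0) \<and>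
            hsp U t = {f a + h b |a b. a \<in> hsp U r \<and> b \<in> hsp U s}"
    and rep_subreps: "\<lbrakk>r \<in> rObj U; module.subspace (hscl U) W; W \<subseteq> hsp U r;
          \<And>g a. \<lbrakk>g \<in> carrier G; a \<in> W\<rbrakk> \<Longrightarrow> act U r g a \<in> W\<rbrakk> \<Longrightarrow>
          \<exists>t \<in> rObj U. \<exists>f \<in> intertwiners G U t r. f ` hsp U t = W \<and>
            (\<forall>a \<in> hsp U t. \<forall>a' \<in> hsp U t. ip U (f a) (f a') = ip U a a')"
    and rep_irreducibles: "irreducible_matrix_rep G T n \<pi> \<Longrightarrow>
          \<exists>r \<in> rObj U. \<exists>e. inj_on e {..<n} \<and> orthonormal_basis U r (e ` {..<n}) \<and>
            (\<forall>g \<in> carrier G. \<forall>j<n. act U r g (e j) = (\<Sum>i<n. hscl U (\<pi> g i j) (e i)))"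

text \<open>Isomorphisms \<open>F\<close> from \<open>S\<close> to \<open>U(G)\<close>; of \<open>Fa X\<close> only the restriction to the source space matters.\<close>

locale symmetric_tensor_iso =
  fixes C :: "('o, 'a::ab_group_add, 'z) braided_cat_scheme" and S :: "'o set"
    and G :: "('g, 'm) monoid_scheme"
    and U :: "('r, 'h::ab_group_add, 'g, 'y) rep_cat_scheme"
    and Fo :: "'o \<Rightarrow> 'r" and Fa :: "'a \<Rightarrow> 'h \<Rightarrow> 'h"
  assumes Fo_bij: "bij_betw Fo S (rObj U)"
    and Fo_unt: "Fo (unt C) = runt U"
    and Fo_prd: "\<lbrakk>\<rho> \<in> S; \<sigma> \<in> S\<rbrakk> \<Longrightarrow> Fo (\<rho> \<odot>\<^bsub>C\<^esub> \<sigma>) = rprd U (Fo \<rho>) (Fo \<sigma>)"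
    and Fa_bij: "\<lbrakk>\<rho> \<in> S; \<sigma> \<in> S\<rbrakk> \<Longrightarrow>
          bij_betw (\<lambda>X. restrict (Fa X) (hsp U (Fo \<rho>))) (Hom C \<rho> \<sigma>) (intertwiners G U (Fo \<rho>) (Fo \<sigma>))"
    and Fa_ide: "\<lbrakk>\<rho> \<in> S; a \<in> hsp U (Fo \<rho>)\<rbrakk> \<Longrightarrow> Fa (ide C \<rho>) a = a"
    and Fa_cmp: "\<lbrakk>\<rho> \<in> S; \<sigma> \<in> S; \<tau> \<in> S; X \<in> Hom C \<sigma> \<tau>; Y \<in> Hom C \<rho> \<sigma>; a \<in> hsp U (Fo \<rho>)\<rbrakk>
          \<Longrightarrow> Fa (X \<cdot>\<^bsub>C\<^esub> Y) a = Fa X (Fa Y a)"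
    and Fa_add: "\<lbrakk>\<rho> \<in> S; \<sigma> \<in> S; X \<in> Hom C \<rho> \<sigma>; Y \<in> Hom C \<rho> \<sigma>; a \<in> hsp U (Fo \<rho>)\<rbrakk>
          \<Longrightarrow> Fa (X + Y) a = Fa X a + Fa Y a"
    and Fa_scl: "\<lbrakk>\<rho> \<in> S; \<sigma> \<in> S; X \<in> Hom C \<rho> \<sigma>; a \<in> hsp U (Fo \<rho>)\<rbrakk>
          \<Longrightarrow> Fa (scl C z X) a = hscl U z (Fa X a)"
    and Fa_adj: "\<lbrakk>\<rho> \<in> S; \<sigma> \<in> S; X \<in> Hom C \<rho> \<sigma>; a \<in> hsp U (Fo \<rho>); b \<in> hsp U (Fo \<sigma>)\<rbrakk>
          \<Longrightarrow> ip U (Fa (adj C X) b) a = ip U b (Fa X a)"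
    and Fa_tens: "\<lbrakk>\<rho> \<in> S; \<sigma> \<in> S; \<rho>' \<in> S; \<sigma>' \<in> S; X \<in> Hom C \<rho> \<sigma>; X' \<in> Hom C \<rho>' \<sigma>';
          a \<in> hsp U (Fo \<rho>); b \<in> hsp U (Fo \<rho>')\<rbrakk>
          \<Longrightarrow> Fa (X \<parallel>\<^bsub>C\<^esub> X') (a \<boxtimes>\<^bsub>U\<^esub> b) = Fa X a \<boxtimes>\<^bsub>U\<^esub> Fa X' b"
    and Fa_eps: "\<lbrakk>\<rho> \<in> S; \<sigma> \<in> S; a \<in> hsp U (Fo \<rho>); b \<in> hsp U (Fo \<sigma>)\<rbrakk>
          \<Longrightarrow> Fa (eps C \<rho> \<sigma>) (a \<boxtimes>\<^bsub>U\<^esub> b) = b \<boxtimes>\<^bsub>U\<^esub> a"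


section \<open>Sectors of \<open>S\<close> and their action\<close>

definition sub_sectors :: "('o, 'a::ab_group_add, 'z) tensor_star_cat_scheme \<Rightarrow> 'o set \<Rightarrow> 'o set set" where
  "sub_sectors C S = iso_class C ` {\<rho> \<in> S. irreducible_obj C \<rho>}"

definition sector_mult ::
  "('o, 'a, 'z) tensor_star_cat_scheme \<Rightarrow> 'o set \<Rightarrow> 'o set \<Rightarrow> 'o set" where
  "sector_mult C k l = {\<tau> \<in> Obj C. \<exists>\<rho>\<in>k. \<exists>\<sigma>\<in>l. isomorphic_obj C (\<rho> \<odot>\<^bsub>C\<^esub> \<sigma>) \<tau>}"

definition sector_conj :: "('o, 'a, 'z) tensor_star_cat_scheme \<Rightarrow> 'o set \<Rightarrow> 'o set" where
  "sector_conj C k = {\<rho>b \<in> Obj C. \<exists>\<rho>\<in>k. \<exists>R Rb. conj_solution C \<rho> \<rho>b R Rb}"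

text \<open>A group only if all irreducible objects of \<open>S\<close> have dimension one.\<close>

definition sector_group ::
  "('o, 'a::ab_group_add, 'z) tensor_star_cat_scheme \<Rightarrow> 'o set \<Rightarrow> 'o set monoid" where
  "sector_group C S =
     \<lparr>carrier = sub_sectors C S, mult = sector_mult C, one = iso_class C (unt C)\<rparr>"

definition sector_orbit ::
  "('o, 'a::ab_group_add, 'z) tensor_star_cat_scheme \<Rightarrow> 'o set \<Rightarrow> 'o set \<Rightarrow> 'o set set" where
  "sector_orbit C S x = {sector_mult C k x |k. k \<in> sub_sectors C S}"

definition sector_orbits ::
  "('o, 'a::ab_group_add, 'z) tensor_star_cat_scheme \<Rightarrow> 'o set \<Rightarrow> 'o set set set" where
  "sector_orbits C S = sector_orbit C S ` sectors C"


section \<open>The crossed product\<close>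

text \<open>
  The choices entering the construction, for \<open>k, l, m\<close> in \<open>sub_sectors C S\<close>: representatives \<open>rep\<close>,
  the functor \<open>F\<close>, orthonormal bases \<open>hbas k\<close> of \<open>F (rep k)\<close> and \<open>vbas k l m\<close> of
  \<open>Hom (rep m) (rep k \<odot> rep l)\<close>, solutions of the conjugate equations.
\<close>

record ('o, 'a, 'r, 'h) crossed_data =
  Fobj :: "'o \<Rightarrow> 'r"
  Farr :: "'a \<Rightarrow> 'h \<Rightarrow> 'h"
  rep :: "'o set \<Rightarrow> 'o"
  hbas :: "'o set \<Rightarrow> 'h set"
  vbas :: "'o set \<Rightarrow> 'o set \<Rightarrow> 'o set \<Rightarrow> 'a set"
  csol :: "'o set \<Rightarrow> 'a"
  csolb :: "'o set \<Rightarrow> 'a"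

definition Hsp ::
  "('r, 'h, 'g, 'y) rep_cat_scheme \<Rightarrow> ('o, 'a, 'r, 'h, 'x) crossed_data_scheme \<Rightarrow> 'o set \<Rightarrow> 'h set" where
  "Hsp U D k = hsp U (Fobj D (rep D k))"

locale crossed_product_data =
  fixes C :: "('o, 'a::ab_group_add, 'z) braided_cat_scheme" (structure) and S :: "'o set"
    and G :: "('g, 'm) monoid_scheme" and T :: "'g topology"
    and U :: "('r, 'h::ab_group_add, 'g, 'y) rep_cat_scheme"
    and D :: "('o, 'a, 'r, 'h, 'x) crossed_data_scheme"
  assumes reps: "rep_category G T U"
    and F_iso: "symmetric_tensor_iso C S G U (Fobj D) (Farr D)"
    and rep: "k \<in> sub_sectors C S \<Longrightarrow> rep D k \<in> k"
    and rep_unt: "rep D (iso_class C (unt C)) = unt C"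
    and hbas: "k \<in> sub_sectors C S \<Longrightarrow> orthonormal_basis U (Fobj D (rep D k)) (hbas D k)"
    and vbas_span: "\<lbrakk>k \<in> sub_sectors C S; l \<in> sub_sectors C S; m \<in> sub_sectors C S\<rbrakk> \<Longrightarrow>
        finite (vbas D k l m) \<and>
        module.span (scl C) (vbas D k l m) = Hom C (rep D m) (rep D k \<odot> rep D l)"
    and vbas_orthonormal: "\<lbrakk>k \<in> sub_sectors C S; l \<in> sub_sectors C S; m \<in> sub_sectors C S;
        V \<in> vbas D k l m; W \<in> vbas D k l m\<rbrakk> \<Longrightarrow>
        adj C V \<cdot> W = (if V = W then ide C (rep D m) else 0)"
    and csol: "k \<in> sub_sectors C S \<Longrightarrow> \<exists>d. normalized_solution C
        (rep D k) (rep D (sector_conj C k)) (csol D k) (csolb D k) d"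
    and csol_conj: "\<lbrakk>k \<in> sub_sectors C S; sector_conj C k \<noteq> k\<rbrakk> \<Longrightarrow>
        csol D (sector_conj C k) = csolb D k \<and> csolb D (sector_conj C k) = csol D k"
    and csol_self: "\<lbrakk>k \<in> sub_sectors C S; sector_conj C k = k\<rbrakk> \<Longrightarrow>
        csolb D k = csol D k \<or> csolb D k = - csol D k"

text \<open>
  An arrow of \<open>C \<rtimes>\<^sub>0 S\<close> from \<open>\<rho>\<close> to \<open>\<sigma>\<close> is a finitely supported function \<open>X\<close> of \<open>(\<rho>', \<sigma>', k, b)\<close> that
  vanishes unless \<open>(\<rho>', \<sigma>') = (\<rho>, \<sigma>)\<close>, \<open>k\<close> is a sector of \<open>S\<close> and \<open>b \<in> hbas k\<close>.  It stands for
  \<open>\<Sum>k. \<Sum>b\<in>hbas k. X (\<rho>, \<sigma>, k, b) \<otimes> b\<close> in the direct sum of the spaces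
  \<open>Hom (rep k \<odot> \<rho>) \<sigma> \<otimes> H\<^sub>k\<close>; that is, the tensor product with \<open>H\<^sub>k\<close> is written in
  coordinates with respect to \<open>hbas k\<close>, and \<open>Y \<otimes> \<psi>\<close> has the coordinates \<open>\<langle>b, \<psi>\<rangle> Y\<close>.
\<close>

type_synonym ('o, 'a, 'h) xarr = "'o \<times> 'o \<times> 'o set \<times> 'h \<Rightarrow> 'a"

definition xsupp :: "('o, 'a::ab_group_add, 'h) xarr \<Rightarrow> ('o \<times> 'o \<times> 'o set \<times> 'h) set" where
  "xsupp X = {p. X p \<noteq> 0}"

definition xHom ::
  "('o, 'a::ab_group_add, 'z) braided_cat_scheme \<Rightarrow> 'o set \<Rightarrow> ('o, 'a, 'r, 'h, 'x) crossed_data_scheme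
    \<Rightarrow> 'o \<Rightarrow> 'o \<Rightarrow> ('o, 'a, 'h) xarr set" where
  "xHom C S D \<rho> \<sigma> = {X. finite (xsupp X) \<and>
     xsupp X \<subseteq> {(\<rho>, \<sigma>, k, b) |k b. k \<in> sub_sectors C S \<and> b \<in> hbas D k} \<and>
     (\<forall>k \<in> sub_sectors C S. \<forall>b. X (\<rho>, \<sigma>, k, b) \<in> Hom C (rep D k \<odot>\<^bsub>C\<^esub> \<rho>) \<sigma>)}"

text \<open>\<open>etens C U D \<rho> \<sigma> k Y \<psi>\<close> is the elementary tensor \<open>Y \<otimes> \<psi>\<close>, with \<open>Y \<in> Hom (rep k \<odot> \<rho>) \<sigma>\<close>.\<close>

definition etens ::
  "('o, 'a::ab_group_add, 'z) braided_cat_scheme \<Rightarrow> ('r, 'h, 'g, 'y) rep_cat_scheme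
    \<Rightarrow> ('o, 'a, 'r, 'h, 'x) crossed_data_scheme
    \<Rightarrow> 'o \<Rightarrow> 'o \<Rightarrow> 'o set \<Rightarrow> 'a \<Rightarrow> 'h \<Rightarrow> ('o, 'a, 'h) xarr" where
  "etens C U D \<rho> \<sigma> k Y \<psi> = (\<lambda>(\<rho>', \<sigma>', k', b).
     if \<rho>' = \<rho> \<and> \<sigma>' = \<sigma> \<and> k' = k \<and> b \<in> hbas D k then scl C (ip U b \<psi>) Y else 0)"

text \<open>
  The operations on elementary tensors.  \<open>Farr D (adj C V)\<close> is the adjoint of \<open>Farr D V\<close>, since \<open>F\<close>
  preserves the *-operation.  The outer sum runs over the sectors that occur in \<open>rep k \<odot> rep l\<close>.
\<close>

definition ecmp ::
  "('o, 'a::ab_group_add, 'z) braided_cat_scheme \<Rightarrow> 'o set \<Rightarrow> ('r, 'h, 'g, 'y) rep_cat_scheme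
    \<Rightarrow> ('o, 'a, 'r, 'h, 'x) crossed_data_scheme
    \<Rightarrow> 'o \<Rightarrow> 'o \<Rightarrow> 'o set \<Rightarrow> 'o set \<Rightarrow> 'a \<Rightarrow> 'h \<Rightarrow> 'a \<Rightarrow> 'h \<Rightarrow> ('o, 'a, 'h) xarr" where
  "ecmp C S U D \<rho> \<delta> k l X \<psi> Y \<phi> =
     (\<Sum>m | m \<in> sub_sectors C S \<and> vbas D k l m \<noteq> {}. \<Sum>V \<in> vbas D k l m.
        etens C U D \<rho> \<delta> m
          (X \<cdot>\<^bsub>C\<^esub> (ide C (rep D k) \<parallel>\<^bsub>C\<^esub> Y) \<cdot>\<^bsub>C\<^esub> (V \<parallel>\<^bsub>C\<^esub> ide C \<rho>))
          (Farr D (adj C V) (\<psi> \<boxtimes>\<^bsub>U\<^esub> \<phi>)))"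

definition eprod ::
  "('o, 'a::ab_group_add, 'z) braided_cat_scheme \<Rightarrow> 'o set \<Rightarrow> ('r, 'h, 'g, 'y) rep_cat_scheme
    \<Rightarrow> ('o, 'a, 'r, 'h, 'x) crossed_data_scheme
    \<Rightarrow> 'o \<Rightarrow> 'o \<Rightarrow> 'o \<Rightarrow> 'o \<Rightarrow> 'o set \<Rightarrow> 'o set \<Rightarrow> 'a \<Rightarrow> 'h \<Rightarrow> 'a \<Rightarrow> 'h \<Rightarrow> ('o, 'a, 'h) xarr" where
  "eprod C S U D \<rho>1 \<sigma>1 \<rho>2 \<sigma>2 k l X \<psi> Y \<phi> =
     (\<Sum>m | m \<in> sub_sectors C S \<and> vbas D k l m \<noteq> {}. \<Sum>V \<in> vbas D k l m.
        etens C U D (\<rho>1 \<odot>\<^bsub>C\<^esub> \<rho>2) (\<sigma>1 \<odot>\<^bsub>C\<^esub> \<sigma>2) m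
          ((X \<parallel>\<^bsub>C\<^esub> Y) \<cdot>\<^bsub>C\<^esub> (ide C (rep D k) \<parallel>\<^bsub>C\<^esub> eps C (rep D l) \<rho>1 \<parallel>\<^bsub>C\<^esub> ide C \<rho>2)
             \<cdot>\<^bsub>C\<^esub> (V \<parallel>\<^bsub>C\<^esub> ide C (\<rho>1 \<odot>\<^bsub>C\<^esub> \<rho>2)))
          (Farr D (adj C V) (\<psi> \<boxtimes>\<^bsub>U\<^esub> \<phi>)))"

definition vbar ::
  "('o, 'a, 'z) braided_cat_scheme \<Rightarrow> ('r, 'h, 'g, 'y) rep_cat_scheme
    \<Rightarrow> ('o, 'a, 'r, 'h, 'x) crossed_data_scheme \<Rightarrow> 'o set \<Rightarrow> 'h \<Rightarrow> 'h" where
  "vbar C U D k \<psi> = (THE \<phi>. \<phi> \<in> Hsp U D (sector_conj C k) \<and>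
     (\<forall>a \<in> Hsp U D (sector_conj C k). ip U a \<phi> = ip U (\<psi> \<boxtimes>\<^bsub>U\<^esub> a) (Farr D (csolb D k) \<Omega>\<^bsub>U\<^esub>)))"

definition eadj ::
  "('o, 'a::ab_group_add, 'z) braided_cat_scheme \<Rightarrow> ('r, 'h, 'g, 'y) rep_cat_scheme
    \<Rightarrow> ('o, 'a, 'r, 'h, 'x) crossed_data_scheme
    \<Rightarrow> 'o \<Rightarrow> 'o \<Rightarrow> 'o set \<Rightarrow> 'a \<Rightarrow> 'h \<Rightarrow> ('o, 'a, 'h) xarr" where
  "eadj C U D \<rho> \<sigma> k X \<psi> = etens C U D \<sigma> \<rho> (sector_conj C k)
     ((adj C (csol D k) \<parallel>\<^bsub>C\<^esub> ide C \<rho>) \<cdot>\<^bsub>C\<^esub> (ide C (rep D (sector_conj C k)) \<parallel>\<^bsub>C\<^esub> adj C X))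
     (vbar C U D k \<psi>)"

text \<open>
  \<open>C \<rtimes>\<^sub>0 S\<close>: the operations are the bilinear (antilinear) extensions of those on elementary
  tensors, computed from the expansion of arrows in the elementary tensors \<open>X p \<otimes> b\<close>.
\<close>

definition crossed_product0 ::
  "('o, 'a::ab_group_add, 'z) braided_cat_scheme \<Rightarrow> 'o set \<Rightarrow> ('r, 'h, 'g, 'y) rep_cat_scheme
    \<Rightarrow> ('o, 'a, 'r, 'h, 'x) crossed_data_scheme \<Rightarrow> ('o, ('o, 'a, 'h) xarr) tensor_star_cat" where
  "crossed_product0 C S U D = \<lparr>
     Obj = Obj C,
     Hom = xHom C S D,
     ide = (\<lambda>\<rho>. etens C U D \<rho> \<rho> (iso_class C (unt C)) (ide C \<rho>) \<Omega>\<^bsub>U\<^esub>),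
     cmp = (\<lambda>X Y. \<Sum>(\<sigma>, \<delta>, k, b) \<in> xsupp X. \<Sum>(\<rho>, \<sigma>', l, b') \<in> xsupp Y.
        if \<sigma>' = \<sigma> then ecmp C S U D \<rho> \<delta> k l (X (\<sigma>, \<delta>, k, b)) b (Y (\<rho>, \<sigma>, l, b')) b' else 0),
     scl = (\<lambda>z X p. scl C z (X p)),
     adj = (\<lambda>X. \<Sum>(\<rho>, \<sigma>, k, b) \<in> xsupp X. eadj C U D \<rho> \<sigma> k (X (\<rho>, \<sigma>, k, b)) b),
     unt = unt C,
     prd = prd C,
     tens = (\<lambda>X Y. \<Sum>(\<rho>1, \<sigma>1, k, b) \<in> xsupp X. \<Sum>(\<rho>2, \<sigma>2, l, b') \<in> xsupp Y.
        eprod C S U D \<rho>1 \<sigma>1 \<rho>2 \<sigma>2 k l (X (\<rho>1, \<sigma>1, k, b)) b (Y (\<rho>2, \<sigma>2, l, b')) b')\<rparr>"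

definition subobject_closure ::
  "('o, 'a) tensor_star_cat \<Rightarrow> ('o \<times> 'a, 'a) tensor_star_cat" where
  "subobject_closure A = \<lparr>
     Obj = {(\<rho>, E). \<rho> \<in> Obj A \<and> projection A \<rho> E},
     Hom = (\<lambda>(\<rho>, E) (\<sigma>, E'). {E' \<cdot>\<^bsub>A\<^esub> X \<cdot>\<^bsub>A\<^esub> E |X. X \<in> Hom A \<rho> \<sigma>}),
     ide = (\<lambda>(\<rho>, E). E),
     cmp = cmp A,
     scl = scl A,
     adj = adj A,
     unt = (unt A, ide A (unt A)),
     prd = (\<lambda>(\<rho>, E) (\<sigma>, E'). (\<rho> \<odot>\<^bsub>A\<^esub> \<sigma>, E \<parallel>\<^bsub>A\<^esub> E')),
     tens = tens A\<rparr>"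

definition crossed_product ::
  "('o, 'a::ab_group_add, 'z) braided_cat_scheme \<Rightarrow> 'o set \<Rightarrow> ('r, 'h, 'g, 'y) rep_cat_scheme
    \<Rightarrow> ('o, 'a, 'r, 'h, 'x) crossed_data_scheme
    \<Rightarrow> ('o \<times> ('o, 'a, 'h) xarr, ('o, 'a, 'h) xarr) tensor_star_cat" where
  "crossed_product C S U D = subobject_closure (crossed_product0 C S U D)"

definition crossed_embed ::
  "('o, 'a::ab_group_add, 'z) braided_cat_scheme \<Rightarrow> 'o set \<Rightarrow> ('r, 'h, 'g, 'y) rep_cat_scheme
    \<Rightarrow> ('o, 'a, 'r, 'h, 'x) crossed_data_scheme \<Rightarrow> 'o \<Rightarrow> 'o \<times> ('o, 'a, 'h) xarr" where
  "crossed_embed C S U D \<rho> = (\<rho>, ide (crossed_product0 C S U D) \<rho>)"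


section \<open>The groups \<open>K\<^sub>\<rho>\<close> and \<open>L\<^sub>\<rho>\<close>\<close>

definition Kgrp ::
  "('o, 'a::ab_group_add, 'z) braided_cat_scheme \<Rightarrow> 'o set
    \<Rightarrow> ('o, 'a, 'r, 'h, 'x) crossed_data_scheme \<Rightarrow> 'o \<Rightarrow> 'o set set" where
  "Kgrp C S D \<rho> = {k \<in> sub_sectors C S. isomorphic_obj C (rep D k \<odot>\<^bsub>C\<^esub> \<rho>) \<rho>}"

definition stabilizer_choice ::
  "('o, 'a::ab_group_add, 'z) braided_cat_scheme \<Rightarrow> 'o set \<Rightarrow> ('r, 'h, 'g, 'y) rep_cat_scheme
    \<Rightarrow> ('o, 'a, 'r, 'h, 'x) crossed_data_scheme
    \<Rightarrow> 'o \<Rightarrow> ('o set \<Rightarrow> 'a) \<Rightarrow> ('o set \<Rightarrow> 'h) \<Rightarrow> bool" where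
  "stabilizer_choice C S U D \<rho> t \<psi> \<longleftrightarrow>
     (\<forall>k \<in> Kgrp C S D \<rho>. unitary_arr C (rep D k \<odot>\<^bsub>C\<^esub> \<rho>) \<rho> (t k) \<and>
        \<psi> k \<in> Hsp U D k \<and> ip U (\<psi> k) (\<psi> k) = 1) \<and>
     t (iso_class C (unt C)) = ide C \<rho>"

text \<open>The scalars \<open>c(k,l)\<close> with \<open>U\<^sub>k \<circ> U\<^sub>l = c(k,l) U\<^sub>k\<^sub>l\<close>, where \<open>U\<^sub>k = t\<^sub>k \<otimes> \<psi>\<^sub>k\<close>.\<close>

definition cocycle ::
  "('o, 'a::ab_group_add, 'z) braided_cat_scheme \<Rightarrow> 'o set \<Rightarrow> ('r, 'h, 'g, 'y) rep_cat_scheme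
    \<Rightarrow> ('o, 'a, 'r, 'h, 'x) crossed_data_scheme
    \<Rightarrow> 'o \<Rightarrow> ('o set \<Rightarrow> 'a) \<Rightarrow> ('o set \<Rightarrow> 'h) \<Rightarrow> 'o set \<Rightarrow> 'o set \<Rightarrow> complex" where
  "cocycle C S U D \<rho> t \<psi> k l =
     (let A = crossed_product C S U D; u = (\<lambda>j. etens C U D \<rho> \<rho> j (t j) (\<psi> j))
      in THE z. u k \<cdot>\<^bsub>A\<^esub> u l = scl A z (u (sector_mult C k l)))"

definition Lgrp ::
  "('o, 'a::ab_group_add, 'z) braided_cat_scheme \<Rightarrow> 'o set \<Rightarrow> ('r, 'h, 'g, 'y) rep_cat_scheme
    \<Rightarrow> ('o, 'a, 'r, 'h, 'x) crossed_data_scheme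
    \<Rightarrow> 'o \<Rightarrow> ('o set \<Rightarrow> 'a) \<Rightarrow> ('o set \<Rightarrow> 'h) \<Rightarrow> 'o set set" where
  "Lgrp C S U D \<rho> t \<psi> = {k \<in> Kgrp C S D \<rho>. \<forall>l \<in> Kgrp C S D \<rho>.
     cocycle C S U D \<rho> t \<psi> k l = cocycle C S U D \<rho> t \<psi> l k}"

definition circle_group :: "complex monoid" where
  "circle_group = \<lparr>carrier = {z. cmod z = 1}, mult = (*), one = 1\<rparr>"

text \<open>Characters of a subgroup \<open>L\<close> of \<open>K\<close>; extensional, so that they are determined by their values on \<open>L\<close>.\<close>

definition characters :: "('k, 'm) monoid_scheme \<Rightarrow> 'k set \<Rightarrow> ('k \<Rightarrow> complex) set" where
  "characters K L = hom (K\<lparr>carrier := L\<rparr>) circle_group \<inter> extensional L"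

text \<open>
  \<open>\<rho> \<cong> N \<Oplus>\<^sub>\<chi> \<rho>\<^sup>\<chi>\<close> in \<open>A\<close>, for a family \<open>r \<chi> = \<rho>\<^sup>\<chi>\<close>, \<open>\<chi> \<in> X\<close>, of mutually inequivalent irreducible objects.
\<close>

definition decomposes ::
  "('p, 'b::ab_group_add, 'z) tensor_star_cat_scheme \<Rightarrow> 'p \<Rightarrow> nat \<Rightarrow> 'i set \<Rightarrow> ('i \<Rightarrow> 'p) \<Rightarrow> bool" where
  "decomposes A \<rho> N X r \<longleftrightarrow>
     (\<forall>c\<in>X. irreducible_obj A (r c)) \<and>
     (\<forall>c\<in>X. \<forall>c'\<in>X. c \<noteq> c' \<longrightarrow> \<not> isomorphic_obj A (r c) (r c')) \<and>
     (\<exists>V. (\<forall>c\<in>X. \<forall>i<N. isometry A (r c) \<rho> (V c i)) \<and>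
          (\<Sum>c\<in>X. \<Sum>i<N. V c i \<cdot>\<^bsub>A\<^esub> adj A (V c i)) = ide A \<rho>)"

text \<open>\<open>r\<close> is an indexing by the characters of \<open>L\<^sub>\<rho>\<close> of the irreducible components of \<open>\<rho>\<close> in \<open>C \<rtimes> S\<close>.\<close>

definition component_family ::
  "('o, 'a::ab_group_add, 'z) braided_cat_scheme \<Rightarrow> 'o set \<Rightarrow> ('r, 'h, 'g, 'y) rep_cat_scheme
    \<Rightarrow> ('o, 'a, 'r, 'h, 'x) crossed_data_scheme
    \<Rightarrow> 'o \<Rightarrow> ('o set \<Rightarrow> 'a) \<Rightarrow> ('o set \<Rightarrow> 'h)
    \<Rightarrow> (('o set \<Rightarrow> complex) \<Rightarrow> 'o \<times> ('o, 'a, 'h) xarr) \<Rightarrow> bool" where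
  "component_family C S U D \<rho> t \<psi> r \<longleftrightarrow>
     (\<exists>N. real N = sqrt (real (card (Kgrp C S D \<rho>)) / real (card (Lgrp C S U D \<rho> t \<psi>))) \<and>
        decomposes (crossed_product C S U D) (crossed_embed C S U D \<rho>) N
          (characters (sector_group C S) (Lgrp C S U D \<rho> t \<psi>)) r)"

end

theory Submission
  imports Defs "HOL-Computational_Algebra.Fundamental_Theorem_Algebra"
begin

text \<open>
  Sectors are isomorphism classes, so only the Hom-spaces, the composition and the *-operation of \<open>C \<rtimes> S\<close> matter, not
  its tensor product.  This part of the structure can be understood as follows.

  Since the irreducible objects of \<open>S\<close> have dimension one, the spaces \<open>H\<^sub>k = F (\<gamma>\<^sub>k)\<close> are one-dimensional
  (\<open>irreducible_line\<close>).  Choose unit vectors \<open>h k\<close>, with \<open>h\<close> of the unit sector equal to \<open>\<Omega>\<close>.  Then there are unique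
  arrows \<open>W k l\<close> from \<open>\<gamma>\<^sub>k\<^sub>l\<close> to \<open>\<gamma>\<^sub>k \<gamma>\<^sub>l\<close> with \<open>F (W k l) h\<^sub>k\<^sub>l = h\<^sub>k \<otimes> h\<^sub>l\<close>.  Diagrams of such arrows commute, because \<open>F\<close> is faithful
  and all paths send a product of the vectors \<open>h\<close> to the same vector.  So \<open>k \<mapsto> \<gamma>\<^sub>k \<otimes> -\<close> is an action of the abelian group \<open>K\<close> of
  sectors of \<open>S\<close> on \<open>C\<close>, and \<open>C \<rtimes>\<^sub>0 S\<close> is its orbit category: an arrow from \<open>\<rho>\<close> to \<open>\<sigma>\<close> is a finite
  family of arrows \<open>\<gamma>\<^sub>k \<rho> \<rightarrow> \<sigma>\<close>.  The scalar factors that come from the choices of bases and of solutions of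
  the conjugate equations cancel.  For the orbit category the *-category axioms are consequences of the coherence of
  the action (\<open>star_category_A\<close>).

  Let \<open>\<rho>\<close> be irreducible in \<open>C\<close>.  By Schur's lemma \<open>End \<rho>\<close> in the orbit category has a basis of unitaries \<open>u k\<close>, one for each \<open>k\<close> in the
  stabilizer \<open>K\<^sub>\<rho>\<close>, with \<open>u k u l = c k l u (kl)\<close>: it is a twisted group algebra of a finite abelian group.  Its center is
  spanned by the \<open>u l\<close>, \<open>l \<in> L\<^sub>\<rho>\<close>.  Call the coefficient of the unit the trace.  Every minimal projection \<open>z\<close> of the center has
  trace \<open>1 / |L\<^sub>\<rho>|\<close>, and \<open>u l z = \<mu> l z\<close> for a function \<open>\<mu>\<close> on \<open>L\<^sub>\<rho>\<close> that trivializes the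
  cocycle; two such functions differ by a character, so these projections correspond to the characters of
  \<open>L\<^sub>\<rho>\<close> once one of them is fixed.  All minimal projections \<open>p\<close> below \<open>z\<close> are equivalent, and averaging
  \<open>p\<close> over the \<open>u k\<close> yields \<open>(tr p)\<^sup>2 |K\<^sub>\<rho>| |L\<^sub>\<rho>| = 1\<close>.  Hence \<open>z\<close> is a sum of \<open>N = sqrt (|K\<^sub>\<rho>| / |L\<^sub>\<rho>|)\<close> of them
  (\<open>twisted_group_algebra.decomposition\<close>), which is the decomposition of \<open>\<rho>\<close>.

  Finally, an isomorphism between components of \<open>\<rho>\<close> and \<open>\<sigma>\<close> yields a nonzero arrow from \<open>\<rho>\<close> to \<open>\<sigma>\<close> in the orbit category, hence
  an isomorphism \<open>\<gamma>\<^sub>k \<rho> \<cong> \<sigma>\<close> for some \<open>k\<close>; so different orbits have no common components.  And if \<open>(\<tau>, E)\<close> is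
  irreducible in \<open>C \<rtimes> S\<close>, then \<open>E\<close> does not vanish on some irreducible summand of \<open>\<tau>\<close> in \<open>C\<close>, which makes
  \<open>(\<tau>, E)\<close> a component of that summand, and of every other member of its orbit.
\<close>

section \<open>Finite dimensional positive *-algebras\<close>

text \<open>The carrier \<open>M\<close> allows the operations to be shared by an algebra and its center.\<close>

locale star_algebra = vector_space scl
  for scl :: "complex \<Rightarrow> 'b::ab_group_add \<Rightarrow> 'b" (infixr \<open>*\<^sub>C\<close> 75) +
  fixes M :: "'b set"
    and mul :: "'b \<Rightarrow> 'b \<Rightarrow> 'b" (infixl \<open>\<star>\<close> 70)
    and star :: "'b \<Rightarrow> 'b" (\<open>_\<^sup>\<dagger>\<close> [1000] 1000)
    and e :: 'b
  assumes subspace_M: "subspace M"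
    and fin_dim: "\<exists>B. finite B \<and> M \<subseteq> span B"
    and e_M [simp, intro]: "e \<in> M"
    and mul_M [simp, intro]: "\<lbrakk>x \<in> M; y \<in> M\<rbrakk> \<Longrightarrow> x \<star> y \<in> M"
    and mul_assoc: "\<lbrakk>x \<in> M; y \<in> M; z \<in> M\<rbrakk> \<Longrightarrow> x \<star> y \<star> z = x \<star> (y \<star> z)"
    and mul_e [simp]: "x \<in> M \<Longrightarrow> e \<star> x = x" "x \<in> M \<Longrightarrow> x \<star> e = x"
    and mul_add: "\<lbrakk>x \<in> M; y \<in> M; z \<in> M\<rbrakk> \<Longrightarrow> (x + y) \<star> z = x \<star> z + y \<star> z"
      "\<lbrakk>x \<in> M; y \<in> M; z \<in> M\<rbrakk> \<Longrightarrow> x \<star> (y + z) = x \<star> y + x \<star> z"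
    and mul_scl: "\<lbrakk>x \<in> M; y \<in> M\<rbrakk> \<Longrightarrow> (a *\<^sub>C x) \<star> y = a *\<^sub>C (x \<star> y)"
      "\<lbrakk>x \<in> M; y \<in> M\<rbrakk> \<Longrightarrow> x \<star> (a *\<^sub>C y) = a *\<^sub>C (x \<star> y)"
    and star_M [simp, intro]: "x \<in> M \<Longrightarrow> x\<^sup>\<dagger> \<in> M"
    and star_star [simp]: "x \<in> M \<Longrightarrow> x\<^sup>\<dagger>\<^sup>\<dagger> = x"
    and star_add: "\<lbrakk>x \<in> M; y \<in> M\<rbrakk> \<Longrightarrow> (x + y)\<^sup>\<dagger> = x\<^sup>\<dagger> + y\<^sup>\<dagger>"
    and star_scl: "x \<in> M \<Longrightarrow> (a *\<^sub>C x)\<^sup>\<dagger> = cnj a *\<^sub>C x\<^sup>\<dagger>"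
    and star_mul: "\<lbrakk>x \<in> M; y \<in> M\<rbrakk> \<Longrightarrow> (x \<star> y)\<^sup>\<dagger> = y\<^sup>\<dagger> \<star> x\<^sup>\<dagger>"
    and positive: "\<lbrakk>x \<in> M; x\<^sup>\<dagger> \<star> x = 0\<rbrakk> \<Longrightarrow> x = 0"
begin

lemma zero_M [simp, intro]: "0 \<in> M"
  and add_M [simp, intro]: "\<lbrakk>x \<in> M; y \<in> M\<rbrakk> \<Longrightarrow> x + y \<in> M"
  and scl_M [simp, intro]: "x \<in> M \<Longrightarrow> a *\<^sub>C x \<in> M"
  and minus_M [simp, intro]: "x \<in> M \<Longrightarrow> - x \<in> M"
  and diff_M [simp, intro]: "\<lbrakk>x \<in> M; y \<in> M\<rbrakk> \<Longrightarrow> x - y \<in> M"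
  and sum_M [simp, intro]: "\<lbrakk>\<And>i. i \<in> I \<Longrightarrow> f i \<in> M\<rbrakk> \<Longrightarrow> sum f I \<in> M"
  using subspace_M by (simp_all add: subspace_0 subspace_add subspace_scale subspace_neg
      subspace_diff subspace_sum)

lemma mul_zero [simp]: "x \<in> M \<Longrightarrow> 0 \<star> x = 0" "x \<in> M \<Longrightarrow> x \<star> 0 = 0"
  using mul_scl(1)[of 0 x 0] mul_scl(2)[of x 0 0] by simp_all

lemma star_zero [simp]: "0\<^sup>\<dagger> = 0"
  using star_scl[of 0 0] by simp

lemma mul_minus: "\<lbrakk>x \<in> M; y \<in> M\<rbrakk> \<Longrightarrow> (- x) \<star> y = - (x \<star> y)"
  "\<lbrakk>x \<in> M; y \<in> M\<rbrakk> \<Longrightarrow> x \<star> (- y) = - (x \<star> y)"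
  using mul_scl(1)[of x y "-1"] mul_scl(2)[of x y "-1"] by simp_all

lemma mul_diff: "\<lbrakk>x \<in> M; y \<in> M; z \<in> M\<rbrakk> \<Longrightarrow> (x - y) \<star> z = x \<star> z - y \<star> z"
  "\<lbrakk>x \<in> M; y \<in> M; z \<in> M\<rbrakk> \<Longrightarrow> x \<star> (y - z) = x \<star> y - x \<star> z"
  using mul_add(1)[of x "- y" z] mul_add(2)[of x y "- z"] by (simp_all add: mul_minus)

lemma star_minus: "x \<in> M \<Longrightarrow> (- x)\<^sup>\<dagger> = - x\<^sup>\<dagger>"
  using star_scl[of x "-1"] by simp

lemma star_diff: "\<lbrakk>x \<in> M; y \<in> M\<rbrakk> \<Longrightarrow> (x - y)\<^sup>\<dagger> = x\<^sup>\<dagger> - y\<^sup>\<dagger>"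
  using star_add[of x "- y"] by (simp add: star_minus)

lemma mul_sum_left:
  assumes "\<And>i. i \<in> I \<Longrightarrow> f i \<in> M" "y \<in> M"
  shows "sum f I \<star> y = (\<Sum>i\<in>I. f i \<star> y)"
  using assms by (induction I rule: infinite_finite_induct) (simp_all add: mul_add)

lemma mul_sum_right:
  assumes "\<And>i. i \<in> I \<Longrightarrow> f i \<in> M" "y \<in> M"
  shows "y \<star> sum f I = (\<Sum>i\<in>I. y \<star> f i)"
  using assms by (induction I rule: infinite_finite_induct) (simp_all add: mul_add)

lemma star_sum:
  assumes "\<And>i. i \<in> I \<Longrightarrow> f i \<in> M"
  shows "(sum f I)\<^sup>\<dagger> = (\<Sum>i\<in>I. (f i)\<^sup>\<dagger>)"
  using assms by (induction I rule: infinite_finite_induct) (simp_all add: star_add)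

lemma positive': "\<lbrakk>x \<in> M; x \<star> x\<^sup>\<dagger> = 0\<rbrakk> \<Longrightarrow> x = 0"
  using positive[of "x\<^sup>\<dagger>"] star_star[of x] by auto

definition proj :: "'b \<Rightarrow> bool" where
  "proj p \<longleftrightarrow> p \<in> M \<and> p \<star> p = p \<and> p\<^sup>\<dagger> = p"

lemma proj_absorb: "\<lbrakk>proj q; x \<in> M\<rbrakk> \<Longrightarrow> q \<star> (q \<star> x) = q \<star> x"
  by (simp add: proj_def flip: mul_assoc)

definition minimal_proj :: "'b \<Rightarrow> bool" where
  "minimal_proj p \<longleftrightarrow> proj p \<and> p \<noteq> 0 \<and> (\<forall>x\<in>M. \<exists>a. p \<star> x \<star> p = a *\<^sub>C p)"

lemma projD: assumes "proj p" shows "p \<in> M" "p \<star> p = p" "p\<^sup>\<dagger> = p"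
  using assms by (simp_all add: proj_def)

lemma minimal_projD:
  assumes "minimal_proj p"
  shows "proj p" "p \<in> M" "p \<star> p = p" "p\<^sup>\<dagger> = p" "p \<noteq> 0"
  using assms by (simp_all add: minimal_proj_def proj_def)

lemma proj_e: "proj e"
proof -
  have "e\<^sup>\<dagger> = e \<star> e\<^sup>\<dagger>" by simp
  also have "\<dots> = e"
    by (metis e_M mul_e(1,2) star_M star_mul star_star)
  finally show ?thesis by (simp add: proj_def)
qed

text \<open>
  The spectral theorem, in the form of a single nontrivial spectral projection of \<open>x\<close>.  If \<open>s\<close> is
  obtained from the minimal polynomial of \<open>x\<close> by splitting off the factor \<open>X - a\<close>, then
  \<open>y = s(x)\<close> is a nonzero eigenvector for the eigenvalue \<open>a\<close> of \<open>x\<close>, so \<open>g(x) y = g(a) y\<close> for all polynomials \<open>g\<close>;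
  in particular \<open>y\<^sup>2 = s(a) y\<close>, and \<open>y / s(a)\<close> is the projection.  Positivity enters twice: it
  makes \<open>a\<close> real and \<open>s(a)\<close> nonzero.
\<close>

lemma nontrivial_proj_exists:
  assumes q: "proj q" and x: "x \<in> M" "x\<^sup>\<dagger> = x" "q \<star> x = x" and nq: "\<And>a. x \<noteq> a *\<^sub>C q"
  shows "\<exists>r. proj r \<and> q \<star> r = r \<and> r \<noteq> 0 \<and> r \<noteq> q"
proof -
  note qM = projD[OF q]
  have q0: "q \<noteq> 0" using x(3) nq[of 0] x(1) by auto
  have xq: "x \<star> q = x"
    using star_mul[of q x] qM x by simp
  define pw where "pw = rec_nat q (\<lambda>_ y. x \<star> y)"
  have pw0: "pw 0 = q" and pwS: "\<And>n. pw (Suc n) = x \<star> pw n" by (simp_all add: pw_def)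
  have pwM [simp]: "pw n \<in> M" for n
    by (induction n) (simp_all add: pw0 pwS qM x)
  have qpw: "q \<star> pw n = pw n" for n
    by (cases n) (simp_all add: pw0 pwS qM x flip: mul_assoc)
  define pev where "pev p = (\<Sum>i\<le>degree p. coeff p i *\<^sub>C pw i)" for p
  have pevM [simp]: "pev p \<in> M" for p by (auto simp: pev_def)
  have pev_bound: "pev p = (\<Sum>i\<le>n. coeff p i *\<^sub>C pw i)" if "degree p \<le> n" for p n
    unfolding pev_def by (rule sum.mono_neutral_left) (use that in \<open>auto simp: coeff_eq_0\<close>)
  have pev_add: "pev (p + s) = pev p + pev s" for p s
    using degree_add_le_max[of p s]
    by (simp add: pev_bound[of _ "max (degree p) (degree s)"] scale_left_distrib sum.distrib)
  have pev_smult: "pev (smult a p) = a *\<^sub>C pev p" for a p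
    by (simp add: pev_bound[of _ "degree p"] degree_smult_le scale_sum_right)
  have pev_pCons: "pev (pCons a p) = a *\<^sub>C q + x \<star> pev p" for a p
  proof -
    have "pev (pCons a p) = (\<Sum>i\<le>Suc (degree p). coeff (pCons a p) i *\<^sub>C pw i)"
      by (rule pev_bound) (simp add: degree_pCons_le)
    also have "\<dots> = a *\<^sub>C pw 0 + (\<Sum>i\<le>degree p. coeff p i *\<^sub>C pw (Suc i))"
      by (simp add: sum.atMost_Suc_shift del: sum.atMost_Suc)
    also have "(\<Sum>i\<le>degree p. coeff p i *\<^sub>C pw (Suc i)) = x \<star> pev p"
      by (simp add: pev_def mul_sum_right x pwS mul_scl)
    finally show ?thesis by (simp add: pw0)
  qed
  have pev_0 [simp]: "pev 0 = 0" by (simp add: pev_def)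
  \<comment> \<open>The powers of \<open>x\<close> are linearly dependent, so a nonzero polynomial of least degree annihilates \<open>x\<close>.\<close>
  have "\<exists>p. p \<noteq> 0 \<and> pev p = 0"
  proof -
    obtain B where B: "finite B" "M \<subseteq> span B" using fin_dim by auto
    show ?thesis
    proof (cases "inj pw")
      case False
      then obtain i j where ij: "pw i = pw j" "i < j"
        by (metis injI linorder_neqE_nat)
      have mon: "pev (monom 1 i) = pw i" for i
      proof -
        have "pev (monom 1 i) = (\<Sum>j\<le>i. (if j = i then pw j else 0))"
          unfolding pev_def by (rule sum.cong) (auto simp: degree_monom_eq)
        then show ?thesis by simp
      qed
      have "pev (monom 1 i + smult (-1) (monom 1 j)) = 0"
        by (simp only: pev_add pev_smult mon ij) simp
      moreover have "coeff (monom 1 i + smult (-1) (monom 1 j)) i = (1::complex)"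
        using ij by (simp add: coeff_monom)
      then have "monom 1 i + smult (-1) (monom 1 j) \<noteq> (0 :: complex poly)"
        by (metis coeff_0 zero_neq_one)
      ultimately show ?thesis by blast
    next
      case True
      then have inj: "inj_on pw {..card B}" by (rule inj_on_subset) simp
      then have "card (pw ` {..card B}) = Suc (card B)" by (simp add: card_image)
      moreover have "pw ` {..card B} \<subseteq> span B" using B(2) by auto
      ultimately have "dependent (pw ` {..card B})"
        using independent_span_bound[OF B(1)] by fastforce
      then obtain u where u: "\<exists>v\<in>pw ` {..card B}. u v \<noteq> 0" "(\<Sum>v\<in>pw ` {..card B}. u v *\<^sub>C v) = 0"
        by (subst (asm) dependent_finite) auto
      then obtain j where j: "j \<le> card B" "u (pw j) \<noteq> 0" by auto
      define p where "p = (\<Sum>i\<le>card B. monom (u (pw i)) i)"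
      have cp: "coeff p i = (if i \<le> card B then u (pw i) else 0)" for i
        by (simp add: p_def coeff_sum coeff_monom)
      then have dp: "degree p \<le> card B" by (intro degree_le) auto
      have "pev p = (\<Sum>i\<le>card B. u (pw i) *\<^sub>C pw i)"
        by (subst pev_bound[OF dp]) (auto simp: cp intro: sum.cong)
      also have "\<dots> = (\<Sum>v\<in>pw ` {..card B}. u v *\<^sub>C v)"
        using inj by (simp add: sum.reindex)
      finally have "pev p = 0" using u by simp
      moreover have "p \<noteq> 0" using cp[of j] j by auto
      ultimately show ?thesis by auto
    qed
  qed
  then obtain p where p: "p \<noteq> 0" "pev p = 0" and min: "\<And>s. s \<noteq> 0 \<Longrightarrow> pev s = 0 \<Longrightarrow> degree p \<le> degree s"
    using exists_least_iff[of "\<lambda>n. \<exists>p. p \<noteq> 0 \<and> pev p = 0 \<and> degree p = n"] by (metis not_less)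
  have "degree p \<noteq> 0"
  proof
    assume "degree p = 0"
    then obtain c where "p = [:c:]" using degree_eq_zeroE by blast
    then show False using p q0 pev_pCons[of c 0] by (auto simp: x qM)
  qed
  then obtain a where "poly p a = 0"
    using fundamental_theorem_of_algebra constant_degree by metis
  then obtain s where s: "p = [:- a, 1:] * s" by (auto simp: poly_eq_0_iff_dvd dvd_def)
  have s0: "s \<noteq> 0" using s p by auto
  have "degree p = Suc (degree s)" using s s0 by (simp add: degree_mult_eq del: mult_pCons_left)
  then have y0: "pev s \<noteq> 0" using min[OF s0] by auto
  define y where "y = pev s"
  have yM: "y \<in> M" by (simp add: y_def)
  have "p = smult (- a) s + pCons 0 s" using s by simp
  then have "(- a) *\<^sub>C y + x \<star> y = 0"
    using p(2) by (simp only: pev_add pev_smult pev_pCons y_def) simp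
  then have xy: "x \<star> y = a *\<^sub>C y" by (simp add: eq_neg_iff_add_eq_0[symmetric])
  have qpev: "q \<star> pev g = pev g" for g
    unfolding pev_def by (subst mul_sum_right) (auto simp: qM mul_scl qpw)
  have eig: "pev g \<star> v = poly g a *\<^sub>C v" if v: "v \<in> M" "x \<star> v = a *\<^sub>C v" "q \<star> v = v" for g v
  proof (induction g)
    case (pCons c g)
    have "pev (pCons c g) \<star> v = c *\<^sub>C v + x \<star> (pev g \<star> v)"
      using v qM x by (simp add: pev_pCons mul_add mul_scl mul_assoc)
    then show ?case using v x pCons by (simp add: mul_scl scale_left_distrib mult.commute)
  qed (simp add: v)
  have commute: "pev g \<star> x = x \<star> pev g" for g
  proof (induction g)
    case (pCons c g)
    then show ?case using qM x xq by (simp add: pev_pCons mul_add mul_scl mul_assoc)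
  qed (simp add: x)
  have star_neq: "y\<^sup>\<dagger> \<star> y \<noteq> 0" using positive[OF yM] y0 y_def by auto
  have yx: "y\<^sup>\<dagger> \<star> x = cnj a *\<^sub>C y\<^sup>\<dagger>"
    using arg_cong[OF xy, of star] x yM by (simp add: star_mul star_scl)
  have "a *\<^sub>C (y\<^sup>\<dagger> \<star> y) = (y\<^sup>\<dagger> \<star> x) \<star> y"
    using x yM by (simp add: mul_assoc xy mul_scl)
  also have "\<dots> = cnj a *\<^sub>C (y\<^sup>\<dagger> \<star> y)" using yM by (simp add: yx mul_scl)
  finally have real_a: "cnj a = a" using star_neq by simp
  have "y \<star> x = a *\<^sub>C y" using commute[of s] xy by (simp add: y_def)
  from arg_cong[OF this, of star] have xys: "x \<star> y\<^sup>\<dagger> = a *\<^sub>C y\<^sup>\<dagger>"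
    using x yM by (simp add: star_mul star_scl real_a)
  have qy: "q \<star> y = y" by (simp add: y_def qpev)
  have "y \<star> q = y"
  proof -
    have "pev g \<star> q = pev g" for g
      by (induction g) (simp_all add: pev_pCons mul_add mul_scl mul_assoc qM x xq)
    then show ?thesis by (simp add: y_def)
  qed
  from arg_cong[OF this, of star] have qys: "q \<star> y\<^sup>\<dagger> = y\<^sup>\<dagger>"
    using yM qM by (simp add: star_mul)
  define b where "b = poly s a"
  have yy: "y \<star> y = b *\<^sub>C y" and yys: "y \<star> y\<^sup>\<dagger> = b *\<^sub>C y\<^sup>\<dagger>"
    using eig[OF yM xy qy, of s] eig[OF _ xys qys, of s] yM by (auto simp: y_def b_def)
  have b0: "b \<noteq> 0" using yys positive'[OF yM] y0 yM by (auto simp: y_def)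
  have yys': "y \<star> y\<^sup>\<dagger> = cnj b *\<^sub>C y"
    using arg_cong[OF yys, of star] yM by (simp add: star_mul star_scl)
  define r where "r = (1 / b) *\<^sub>C y"
  have ys: "y\<^sup>\<dagger> = (cnj b / b) *\<^sub>C y"
  proof -
    have "(1 / b) *\<^sub>C b *\<^sub>C y\<^sup>\<dagger> = (1 / b) *\<^sub>C cnj b *\<^sub>C y" by (simp only: yys' flip: yys)
    then show ?thesis using b0 by simp
  qed
  have "proj r"
    unfolding proj_def r_def using yM b0 by (auto simp: mul_scl star_scl yy ys)
  moreover have "q \<star> r = r" using qM yM by (simp add: r_def mul_scl qy)
  moreover have "r \<noteq> 0" using y0 b0 by (simp add: r_def y_def)
  moreover have "r \<noteq> q"
  proof
    assume "r = q"
    then have "x = x \<star> r" by (simp add: xq)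
    also have "\<dots> = a *\<^sub>C r" using x yM by (simp add: r_def mul_scl xy mult.commute)
    finally show False using nq \<open>r = q\<close> by auto
  qed
  ultimately show ?thesis by blast
qed

text \<open>A projection that is not minimal splits, because one of the hermitian parts of a non-scalar
  element of its corner is not scalar.\<close>

lemma proj_split:
  assumes q: "proj q" "q \<noteq> 0" "\<not> minimal_proj q"
  shows "\<exists>r. proj r \<and> q \<star> r = r \<and> r \<noteq> 0 \<and> r \<noteq> q"
proof -
  note qM = projD[OF q(1)]
  obtain x where x: "x \<in> M" "\<And>a. q \<star> x \<star> q \<noteq> a *\<^sub>C q"
    using q by (auto simp: minimal_proj_def)
  define w where "w = q \<star> x \<star> q"
  have w: "w \<in> M" "q \<star> w = w" "w \<star> q = w"
    using x qM by (auto simp: w_def mul_assoc proj_absorb[OF q(1)])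
  have ws: "q \<star> w\<^sup>\<dagger> = w\<^sup>\<dagger>"
    using star_mul[of w q] w qM by simp
  define h where "h = w + w\<^sup>\<dagger>"
  define k where "k = \<i> *\<^sub>C (w - w\<^sup>\<dagger>)"
  have h: "h \<in> M" "h\<^sup>\<dagger> = h" "q \<star> h = h"
    using w ws qM by (auto simp: h_def star_add mul_add add.commute)
  have k: "k \<in> M" "k\<^sup>\<dagger> = k" "q \<star> k = k"
    using w ws qM by (auto simp: k_def star_scl star_diff mul_scl mul_diff scale_right_diff_distrib)
  show ?thesis
  proof (cases "\<forall>a. h \<noteq> a *\<^sub>C q")
    case True
    then show ?thesis using nontrivial_proj_exists[OF q(1) h] by auto
  next
    case False
    then obtain a where a: "h = a *\<^sub>C q" by auto
    have "k \<noteq> b *\<^sub>C q" for b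
    proof
      assume b: "k = b *\<^sub>C q"
      have "2 *\<^sub>C w = h + (- \<i>) *\<^sub>C k"
        using scale_left_distrib[of 1 1 w] by (simp add: h_def k_def)
      then have "2 *\<^sub>C w = (a - \<i> * b) *\<^sub>C q" using a b by (simp add: scale_left_diff_distrib)
      then have "(1/2) *\<^sub>C 2 *\<^sub>C w = ((a - \<i> * b) / 2) *\<^sub>C q" by simp
      then show False using x(2)[of "(a - \<i> * b) / 2"] by (simp add: w_def)
    qed
    then show ?thesis using nontrivial_proj_exists[OF q(1) k] by auto
  qed
qed

definition orth_decomp :: "'b \<Rightarrow> 'b set \<Rightarrow> bool" where
  "orth_decomp p Q \<longleftrightarrow> finite Q \<and> (\<forall>q\<in>Q. proj q \<and> q \<noteq> 0) \<and>
     (\<forall>q\<in>Q. \<forall>r\<in>Q. q \<noteq> r \<longrightarrow> q \<star> r = 0) \<and> \<Sum>Q = p"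

lemma orth_decomp_independent:
  assumes "orth_decomp p Q" shows "independent Q"
proof -
  have fin: "finite Q" and Q: "\<And>q. q \<in> Q \<Longrightarrow> proj q \<and> q \<noteq> 0"
    and orth: "\<And>q r. q \<in> Q \<Longrightarrow> r \<in> Q \<Longrightarrow> q \<noteq> r \<Longrightarrow> q \<star> r = 0"
    using assms by (auto simp: orth_decomp_def)
  show ?thesis
  proof (subst independent_explicit_finite_subsets, intro allI impI ballI)
    fix S u v assume S: "S \<subseteq> Q" "finite S" "(\<Sum>v\<in>S. u v *\<^sub>C v) = 0" and v: "v \<in> S"
    have SM: "w \<in> M" if "w \<in> S" for w using Q S that by (auto dest: projD)
    have "0 = v \<star> (\<Sum>w\<in>S. u w *\<^sub>C w)" using S v SM by simp
    also have "\<dots> = (\<Sum>w\<in>S. v \<star> (u w *\<^sub>C w))" using SM v by (intro mul_sum_right) auto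
    also have "\<dots> = (\<Sum>w\<in>S. if w = v then u v *\<^sub>C v else 0)"
    proof (rule sum.cong)
      fix w assume "w \<in> S"
      then show "v \<star> (u w *\<^sub>C w) = (if w = v then u v *\<^sub>C v else 0)"
        using SM v orth[of v w] S Q by (auto simp: mul_scl projD)
    qed simp
    also have "\<dots> = u v *\<^sub>C v" using v S by simp
    finally show "u v = 0" using Q v S by auto
  qed
qed

text \<open>Orthogonal nonzero projections are linearly independent, so a decomposition of \<open>p\<close> into
  the largest possible number of them exists; its members cannot be split any further.\<close>

lemma minimal_decomposition:
  assumes "proj p" "p \<noteq> 0"
  shows "\<exists>Q. orth_decomp p Q \<and> (\<forall>q\<in>Q. minimal_proj q)"
proof -
  obtain B where B: "finite B" "M \<subseteq> span B" using fin_dim by auto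
  have bound: "card Q \<le> card B" if "orth_decomp p Q" for Q
    using independent_span_bound[OF B(1) orth_decomp_independent[OF that]] that B(2)
    by (auto simp: orth_decomp_def dest: projD)
  have "orth_decomp p {p}" using assms by (simp add: orth_decomp_def)
  then obtain Q where Q: "orth_decomp p Q" and max: "\<And>Q'. orth_decomp p Q' \<Longrightarrow> card Q' \<le> card Q"
    using ex_has_greatest_nat[of "orth_decomp p" "{p}" card "Suc (card B)"] bound
    by (metis le_imp_less_Suc)
  have fin: "finite Q" and Qp: "\<And>q. q \<in> Q \<Longrightarrow> proj q" "\<And>q. q \<in> Q \<Longrightarrow> q \<noteq> 0"
    and orth: "\<And>q r. q \<in> Q \<Longrightarrow> r \<in> Q \<Longrightarrow> q \<noteq> r \<Longrightarrow> q \<star> r = 0" and sm: "\<Sum>Q = p"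
    using Q by (auto simp: orth_decomp_def)
  have "minimal_proj q" if q: "q \<in> Q" for q
  proof (rule ccontr)
    assume "\<not> minimal_proj q"
    with q Qp obtain r where r: "proj r" "q \<star> r = r" "r \<noteq> 0" "r \<noteq> q"
      using proj_split by blast
    note qM = projD[OF Qp(1)[OF q]] and rM = projD[OF r(1)]
    have rq: "r \<star> q = r" using arg_cong[OF r(2), of star] qM rM by (simp add: star_mul)
    define s where "s = q - r"
    have s: "proj s" "s \<noteq> 0" "r \<star> s = 0" "s \<star> r = 0"
      using r qM rM rq by (auto simp: s_def proj_def mul_diff star_diff)
    have sM: "s \<in> M" using s by (simp add: proj_def)
    have qs: "q \<star> s = s" "s \<star> q = s" using qM rM r rq by (auto simp: s_def mul_diff)
    have ann: "t \<star> r = 0 \<and> r \<star> t = 0 \<and> t \<star> s = 0 \<and> s \<star> t = 0" if t: "t \<in> Q - {q}" for t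
    proof -
      have tM: "t \<in> M" using Qp t by (auto dest: projD)
      have "t \<star> q = 0" "q \<star> t = 0" using orth t q by auto
      then have "t \<star> (q \<star> r) = 0" "(r \<star> q) \<star> t = 0" "t \<star> (q \<star> s) = 0" "(s \<star> q) \<star> t = 0"
        using tM rM qM sM by (simp_all add: mul_assoc flip: mul_assoc[of t])
      then show ?thesis by (simp add: r(2) rq qs)
    qed
    have rs: "r \<noteq> s" using s rM r(3) by auto
    have notin: "r \<notin> Q - {q}" "s \<notin> Q - {q}"
      using ann r(3) s(2) rM s projD(2)[OF s(1)] by metis+
    let ?Q = "insert r (insert s (Q - {q}))"
    have "\<Sum>?Q = r + s + \<Sum>(Q - {q})" using fin notin rs by (simp add: add.assoc)
    also have "\<dots> = p" using fin q sm by (simp add: s_def sum.remove)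
    finally have "orth_decomp p ?Q"
      using fin Qp r s orth ann unfolding orth_decomp_def by auto
    then have "card ?Q \<le> card Q" by (rule max)
    moreover have "card ?Q = Suc (Suc (card (Q - {q})))" using fin notin rs by simp
    ultimately show False using q fin by (simp add: card_Diff_singleton)
  qed
  with Q show ?thesis by blast
qed

end

section \<open>Twisted group algebras of finite abelian groups\<close>

text \<open>
  \<open>tr\<close> is the coefficient of the unit, of which \<open>u \<one>\<close> is a multiple.  By associativity, the scalars \<open>c\<close> form a
  2-cocycle.
\<close>

locale twisted_group_algebra = star_algebra scl M mul star e + comm_group K
  for scl :: "complex \<Rightarrow> 'b::ab_group_add \<Rightarrow> 'b" (infixr \<open>*\<^sub>C\<close> 75)
    and M and mul (infixl \<open>\<star>\<close> 70) and star (\<open>_\<^sup>\<dagger>\<close> [1000] 1000) and e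
    and K :: "('c, 'm) monoid_scheme" (structure) +
  fixes u :: "'c \<Rightarrow> 'b" and c :: "'c \<Rightarrow> 'c \<Rightarrow> complex" and tr :: "'b \<Rightarrow> complex"
  assumes finite_K: "finite (carrier K)"
    and u_M [simp, intro]: "k \<in> carrier K \<Longrightarrow> u k \<in> M"
    and u_unitary [simp]: "k \<in> carrier K \<Longrightarrow> (u k)\<^sup>\<dagger> \<star> u k = e" "k \<in> carrier K \<Longrightarrow> u k \<star> (u k)\<^sup>\<dagger> = e"
    and u_mul: "\<lbrakk>k \<in> carrier K; l \<in> carrier K\<rbrakk> \<Longrightarrow> u k \<star> u l = c k l *\<^sub>C u (k \<otimes> l)"
    and u_span: "x \<in> M \<Longrightarrow> \<exists>z. x = (\<Sum>k\<in>carrier K. z k *\<^sub>C u k)"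
    and tr_add: "\<lbrakk>x \<in> M; y \<in> M\<rbrakk> \<Longrightarrow> tr (x + y) = tr x + tr y"
    and tr_scl: "x \<in> M \<Longrightarrow> tr (a *\<^sub>C x) = a * tr x"
    and tr_e: "tr e = 1"
    and tr_u: "\<lbrakk>k \<in> carrier K; k \<noteq> \<one>\<rbrakk> \<Longrightarrow> tr (u k) = 0"
begin

lemma tr_0: "tr 0 = 0"
  using tr_scl[of 0 0] by simp

lemma e_nonzero: "e \<noteq> 0"
  using tr_e tr_0 by auto

lemma tr_sum: "(\<And>i. i \<in> I \<Longrightarrow> f i \<in> M) \<Longrightarrow> tr (sum f I) = (\<Sum>i\<in>I. tr (f i))"
  by (induction I rule: infinite_finite_induct) (simp_all add: tr_0 tr_add)

lemma cancel_u:
  assumes "k \<in> carrier K" "x \<in> M"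
  shows "(u k)\<^sup>\<dagger> \<star> (u k \<star> x) = x" "u k \<star> ((u k)\<^sup>\<dagger> \<star> x) = x"
  using assms by (simp_all flip: mul_assoc)

lemma u_nonzero: "k \<in> carrier K \<Longrightarrow> u k \<noteq> 0"
  using u_unitary(1)[of k] e_nonzero mul_zero(2)[of "(u k)\<^sup>\<dagger>"] by (metis star_M u_M)

lemma c_nonzero: assumes "k \<in> carrier K" "l \<in> carrier K" shows "c k l \<noteq> 0"
proof
  assume "c k l = 0"
  then have "u k \<star> u l = 0" using assms u_mul by simp
  then have "u l = 0" using cancel_u(1)[of k "u l"] assms by simp
  then show False using u_nonzero assms by simp
qed

lemma u_one: "u \<one> = c \<one> \<one> *\<^sub>C e"
  using cancel_u(1)[of \<one> "u \<one>"] u_mul[of \<one> \<one>] by (simp add: mul_scl)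

lemma u_star: assumes k: "k \<in> carrier K" shows "\<exists>a. (u k)\<^sup>\<dagger> = a *\<^sub>C u (inv k)"
proof -
  have "u (inv k) \<star> u k = (c (inv k) k * c \<one> \<one>) *\<^sub>C e"
    using k by (simp add: u_mul u_one)
  then have "(u (inv k) \<star> u k) \<star> (u k)\<^sup>\<dagger> = (c (inv k) k * c \<one> \<one>) *\<^sub>C (u k)\<^sup>\<dagger>"
    using k by (simp add: mul_scl)
  then have "u (inv k) = (c (inv k) k * c \<one> \<one>) *\<^sub>C (u k)\<^sup>\<dagger>"
    using k by (simp add: mul_assoc)
  then have "(u k)\<^sup>\<dagger> = (1 / (c (inv k) k * c \<one> \<one>)) *\<^sub>C u (inv k)"
    using k c_nonzero by simp
  then show ?thesis by blast
qed

lemma tr_star_u: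
  assumes "k \<in> carrier K" "l \<in> carrier K"
  shows "tr ((u k)\<^sup>\<dagger> \<star> u l) = (if k = l then 1 else 0)"
proof (cases "k = l")
  case False
  obtain a where a: "(u k)\<^sup>\<dagger> = a *\<^sub>C u (inv k)" using u_star assms by auto
  have "inv k \<otimes> l \<noteq> \<one>" using False assms by (metis inv_closed inv_inv inv_equality)
  then show ?thesis
    using assms False by (simp add: a mul_scl u_mul tr_scl tr_u)
qed (use assms tr_e in simp)

lemma expand: assumes "x \<in> M" shows "x = (\<Sum>k\<in>carrier K. tr ((u k)\<^sup>\<dagger> \<star> x) *\<^sub>C u k)"
proof -
  obtain z where z: "x = (\<Sum>k\<in>carrier K. z k *\<^sub>C u k)" using u_span[OF assms] by auto
  have "tr ((u k)\<^sup>\<dagger> \<star> x) = z k" if k: "k \<in> carrier K" for k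
  proof -
    have "(u k)\<^sup>\<dagger> \<star> x = (\<Sum>l\<in>carrier K. (u k)\<^sup>\<dagger> \<star> (z l *\<^sub>C u l))"
      unfolding z by (rule mul_sum_right) (use k in auto)
    then have "tr ((u k)\<^sup>\<dagger> \<star> x) = (\<Sum>l\<in>carrier K. tr ((u k)\<^sup>\<dagger> \<star> (z l *\<^sub>C u l)))"
      using k by (simp add: tr_sum)
    also have "\<dots> = (\<Sum>l\<in>carrier K. if k = l then z l else 0)"
      using k by (intro sum.cong) (simp_all add: mul_scl tr_scl tr_star_u)
    finally show ?thesis using k finite_K by simp
  qed
  then show ?thesis using z by simp
qed

lemma u_conj:
  assumes "k \<in> carrier K" "l \<in> carrier K"
  shows "u k \<star> u l \<star> (u k)\<^sup>\<dagger> = (c k l / c l k) *\<^sub>C u l"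
proof -
  have "u k \<star> u l = (c k l / c l k) *\<^sub>C (u l \<star> u k)"
    using assms c_nonzero[of l k] by (simp add: u_mul m_comm)
  then show ?thesis using assms by (simp add: mul_scl mul_assoc)
qed

text \<open>Conjugation by \<open>u k\<close> multiplies each \<open>u l\<close> by a scalar and fixes the unit, so it preserves \<open>tr\<close>.  Therefore \<open>tr\<close> is a trace.\<close>

lemma tr_conj:
  assumes k: "k \<in> carrier K" and x: "x \<in> M"
  shows "tr (u k \<star> x \<star> (u k)\<^sup>\<dagger>) = tr x"
proof -
  have ul: "tr (u k \<star> u l \<star> (u k)\<^sup>\<dagger>) = tr (u l)" if l: "l \<in> carrier K" for l
  proof (cases "l = \<one>")
    case True
    then show ?thesis using k by (simp add: u_one mul_scl)
  qed (use k l in \<open>simp add: u_conj tr_scl tr_u\<close>)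
  obtain z where z: "x = (\<Sum>l\<in>carrier K. z l *\<^sub>C u l)" using u_span[OF x] by auto
  have "u k \<star> x \<star> (u k)\<^sup>\<dagger> = (\<Sum>l\<in>carrier K. z l *\<^sub>C (u k \<star> u l \<star> (u k)\<^sup>\<dagger>))"
    unfolding z using k by (simp add: mul_sum_right mul_sum_left mul_scl)
  then have "tr (u k \<star> x \<star> (u k)\<^sup>\<dagger>) = (\<Sum>l\<in>carrier K. z l * tr (u l))"
    using k by (simp add: tr_sum tr_scl ul)
  then show ?thesis by (simp add: z tr_sum tr_scl)
qed

lemma tr_comm:
  assumes "x \<in> M" "y \<in> M" shows "tr (x \<star> y) = tr (y \<star> x)"
proof -
  have u: "tr (x \<star> u k) = tr (u k \<star> x)" if "k \<in> carrier K" for k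
    using tr_conj[of k "x \<star> u k"] that assms by (simp add: mul_assoc)
  obtain z where z: "y = (\<Sum>k\<in>carrier K. z k *\<^sub>C u k)" using u_span assms by auto
  show ?thesis unfolding z using assms
    by (simp add: mul_sum_right mul_sum_left mul_scl tr_sum tr_scl u)
qed

lemma tr_star: assumes "x \<in> M" shows "tr (x\<^sup>\<dagger>) = cnj (tr x)"
proof -
  have u: "tr ((u k)\<^sup>\<dagger>) = cnj (tr (u k))" if k: "k \<in> carrier K" for k
  proof (cases "k = \<one>")
    case True
    then show ?thesis using projD(3)[OF proj_e] by (simp add: u_one star_scl tr_scl tr_e)
  next
    case False
    obtain a where a: "(u k)\<^sup>\<dagger> = a *\<^sub>C u (inv k)" using u_star k by auto
    have "inv k \<noteq> \<one>" using False k by simp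
    then show ?thesis using k False by (simp add: a tr_scl tr_u)
  qed
  obtain z where z: "x = (\<Sum>k\<in>carrier K. z k *\<^sub>C u k)" using u_span assms by auto
  show ?thesis unfolding z by (simp add: star_sum star_scl tr_sum tr_scl u)
qed

lemma tr_square:
  assumes "x \<in> M"
  shows "tr (x\<^sup>\<dagger> \<star> x) = of_real (\<Sum>k\<in>carrier K. (cmod (tr ((u k)\<^sup>\<dagger> \<star> x)))\<^sup>2)"
proof -
  have "tr (x\<^sup>\<dagger> \<star> x) = tr (\<Sum>k\<in>carrier K. x\<^sup>\<dagger> \<star> (tr ((u k)\<^sup>\<dagger> \<star> x) *\<^sub>C u k))"
    by (subst (2) expand[OF assms]) (use assms in \<open>simp add: mul_sum_right\<close>)
  also have "\<dots> = (\<Sum>k\<in>carrier K. tr ((u k)\<^sup>\<dagger> \<star> x) * tr (x\<^sup>\<dagger> \<star> u k))"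
    using assms by (simp add: tr_sum mul_scl tr_scl)
  also have "\<dots> = (\<Sum>k\<in>carrier K. of_real ((cmod (tr ((u k)\<^sup>\<dagger> \<star> x)))\<^sup>2))"
  proof (rule sum.cong)
    fix k assume k: "k \<in> carrier K"
    have "tr (x\<^sup>\<dagger> \<star> u k) = cnj (tr ((u k)\<^sup>\<dagger> \<star> x))"
      using tr_star[of "(u k)\<^sup>\<dagger> \<star> x"] k assms by (simp add: star_mul)
    then show "tr ((u k)\<^sup>\<dagger> \<star> x) * tr (x\<^sup>\<dagger> \<star> u k) = of_real ((cmod (tr ((u k)\<^sup>\<dagger> \<star> x)))\<^sup>2)"
      by (simp flip: complex_norm_square)
  qed simp
  finally show ?thesis by simp
qed

lemma tr_proj:
  assumes "proj p" "p \<noteq> 0" shows "\<exists>t>0. tr p = of_real t"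
proof -
  note p = projD[OF assms(1)]
  let ?t = "\<Sum>k\<in>carrier K. (cmod (tr ((u k)\<^sup>\<dagger> \<star> p)))\<^sup>2"
  have eq: "tr p = of_real ?t" using tr_square[OF p(1)] p by simp
  have "?t \<noteq> 0"
  proof
    assume "?t = 0"
    then have "\<forall>k\<in>carrier K. tr ((u k)\<^sup>\<dagger> \<star> p) = 0"
      using finite_K by (simp add: sum_nonneg_eq_0_iff)
    then show False using expand[OF p(1)] assms(2) by simp
  qed
  moreover have "?t \<ge> 0" by (rule sum_nonneg) simp
  ultimately show ?thesis using eq by (intro exI[of _ ?t]) auto
qed

definition Z :: "'b set" where
  "Z = {x \<in> M. \<forall>k\<in>carrier K. u k \<star> x = x \<star> u k}"

definition L :: "'c set" where
  "L = {k \<in> carrier K. \<forall>l\<in>carrier K. c k l = c l k}"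

lemma ZD: "x \<in> Z \<Longrightarrow> x \<in> M" "\<lbrakk>x \<in> Z; k \<in> carrier K\<rbrakk> \<Longrightarrow> u k \<star> x = x \<star> u k"
  by (simp_all add: Z_def)

lemma Z_central: assumes "x \<in> Z" "y \<in> M" shows "y \<star> x = x \<star> y"
proof -
  obtain z where z: "y = (\<Sum>k\<in>carrier K. z k *\<^sub>C u k)" using u_span assms by auto
  show ?thesis unfolding z using ZD[OF assms(1)]
    by (simp add: mul_sum_right mul_sum_left mul_scl)
qed

lemma center_star_algebra: "star_algebra scl Z mul star e"
proof
  show "subspace Z"
    unfolding subspace_def by (auto simp: Z_def mul_add mul_scl)
  show "\<exists>B. finite B \<and> Z \<subseteq> span B" using fin_dim by (auto simp: Z_def)
  show "x \<star> y \<in> Z" if "x \<in> Z" "y \<in> Z" for x y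
  proof -
    have xy: "x \<in> M" "y \<in> M" using that by (simp_all add: ZD)
    have "u k \<star> (x \<star> y) = x \<star> y \<star> u k" if k: "k \<in> carrier K" for k
    proof -
      have "u k \<star> (x \<star> y) = (u k \<star> x) \<star> y" using xy k by (simp add: mul_assoc)
      also have "\<dots> = x \<star> (u k \<star> y)" using xy k \<open>x \<in> Z\<close> by (simp add: ZD mul_assoc)
      also have "\<dots> = x \<star> y \<star> u k" using xy k \<open>y \<in> Z\<close> by (simp add: ZD mul_assoc)
      finally show ?thesis .
    qed
    then show ?thesis using xy by (simp add: Z_def)
  qed
  show "x\<^sup>\<dagger> \<in> Z" if "x \<in> Z" for x
  proof -
    have x: "x \<in> M" using that by (simp add: ZD)
    have "u k \<star> x\<^sup>\<dagger> = x\<^sup>\<dagger> \<star> u k" if k: "k \<in> carrier K" for k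
      using Z_central[OF \<open>x \<in> Z\<close>, of "(u k)\<^sup>\<dagger>"] x k
        star_mul[of x "(u k)\<^sup>\<dagger>"] star_mul[of "(u k)\<^sup>\<dagger>" x] by simp
    then show ?thesis using x by (simp add: Z_def)
  qed
qed (auto simp: Z_def mul_assoc mul_add mul_scl star_add star_scl star_mul intro: positive)

interpretation cen: star_algebra scl Z mul star e
  by (rule center_star_algebra)

lemma L_iff: assumes k: "k \<in> carrier K" shows "k \<in> L \<longleftrightarrow> u k \<in> Z"
proof -
  have "u l \<star> u k = u k \<star> u l \<longleftrightarrow> c k l = c l k" if l: "l \<in> carrier K" for l
    using k l u_nonzero[of "k \<otimes> l"] by (auto simp: u_mul m_comm[of l k])
  then show ?thesis using k by (auto simp: L_def Z_def)
qed

lemma L_carrier: "L \<subseteq> carrier K" and L_carrierD: "k \<in> L \<Longrightarrow> k \<in> carrier K"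
  and finite_L: "finite L"
  using finite_K by (auto simp: L_def intro: finite_subset[of L])

lemma L_one: "\<one> \<in> L"
  using L_iff[of \<one>] by (simp add: u_one)

lemma L_mult: assumes "k \<in> L" "l \<in> L" shows "k \<otimes> l \<in> L"
proof -
  have kl: "k \<in> carrier K" "l \<in> carrier K" using assms L_carrier by auto
  have "u k \<star> u l \<in> Z" using assms kl by (simp add: L_iff)
  then have "(1 / c k l) *\<^sub>C (u k \<star> u l) \<in> Z" by simp
  then show ?thesis using kl c_nonzero[of k l] by (simp add: L_iff u_mul)
qed

lemma card_L_pos: "card L > 0"
  using finite_L L_one card_gt_0_iff by blast

text \<open>If \<open>u k\<close> does not commute with \<open>u l\<close>, then conjugation by \<open>u l\<close> multiplies the coefficient at \<open>k\<close> by a scalar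
  other than \<open>1\<close>, but it fixes central elements.\<close>

lemma Z_coeff: assumes x: "x \<in> Z" and k: "k \<in> carrier K" "k \<notin> L" shows "tr ((u k)\<^sup>\<dagger> \<star> x) = 0"
proof -
  note xM = ZD(1)[OF x]
  obtain l where l: "l \<in> carrier K" "c k l \<noteq> c l k" using k by (auto simp: L_def)
  define s where "s = c l k / c k l"
  have s: "s \<noteq> 1" using l c_nonzero[of k l] k by (simp add: s_def)
  have "u l \<star> (u k)\<^sup>\<dagger> \<star> (u l)\<^sup>\<dagger> = (u l \<star> u k \<star> (u l)\<^sup>\<dagger>)\<^sup>\<dagger>"
    using k l by (simp add: star_mul mul_assoc)
  also have "\<dots> = cnj s *\<^sub>C (u k)\<^sup>\<dagger>" using k l by (simp add: u_conj star_scl s_def)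
  finally have conj: "u l \<star> (u k)\<^sup>\<dagger> \<star> (u l)\<^sup>\<dagger> = cnj s *\<^sub>C (u k)\<^sup>\<dagger>" .
  have "tr ((u k)\<^sup>\<dagger> \<star> x) = tr (u l \<star> ((u k)\<^sup>\<dagger> \<star> x) \<star> (u l)\<^sup>\<dagger>)"
    using tr_conj k l xM by simp
  also have "u l \<star> ((u k)\<^sup>\<dagger> \<star> x) \<star> (u l)\<^sup>\<dagger> = u l \<star> (u k)\<^sup>\<dagger> \<star> (x \<star> (u l)\<^sup>\<dagger>)"
    using k l xM by (simp add: mul_assoc)
  also have "\<dots> = u l \<star> (u k)\<^sup>\<dagger> \<star> (u l)\<^sup>\<dagger> \<star> x"
    using k l xM by (simp add: Z_central[OF x, symmetric] mul_assoc)
  also have "\<dots> = cnj s *\<^sub>C ((u k)\<^sup>\<dagger> \<star> x)" using k xM by (simp add: conj mul_scl)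
  finally have "tr ((u k)\<^sup>\<dagger> \<star> x) = cnj s * tr ((u k)\<^sup>\<dagger> \<star> x)" using k xM by (simp add: tr_scl)
  then show ?thesis using s by auto
qed

lemma cen_proj: "cen.proj z \<Longrightarrow> proj z"
  by (auto simp: cen.proj_def proj_def ZD)

subsection \<open>Minimal central projections and characters\<close>

text \<open>The eigenvalue of \<open>u l\<close> on \<open>z\<close>, if \<open>z\<close> is a minimal central projection and \<open>l \<in> L\<close>.\<close>

definition mu :: "'b \<Rightarrow> 'c \<Rightarrow> complex" where
  "mu z l = tr (u l \<star> z) / tr z"

lemma cen_scalar:
  assumes z: "cen.minimal_proj z" and x: "x \<in> Z"
  shows "\<exists>a. x \<star> z = a *\<^sub>C z"
proof -
  note zZ = cen.minimal_projD[OF z]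
  obtain a where "z \<star> x \<star> z = a *\<^sub>C z" using z x by (auto simp: cen.minimal_proj_def)
  moreover have "z \<star> x \<star> z = x \<star> z"
    using zZ x ZD(1)[of z] ZD(1)[of x] by (simp add: Z_central[of z x, symmetric] mul_assoc)
  ultimately show ?thesis by auto
qed

lemma cen_tr: assumes "cen.minimal_proj z" shows "\<exists>t>0. tr z = of_real t"
  using tr_proj cen_proj cen.minimal_projD(1,5)[OF assms] by blast

lemma mu_eqI:
  assumes z: "cen.minimal_proj z" and "u l \<star> z = a *\<^sub>C z"
  shows "mu z l = a"
  using assms cen_tr[OF z] cen.minimal_projD(2)[OF z, THEN ZD(1)] by (auto simp: mu_def tr_scl)

lemma mu: assumes z: "cen.minimal_proj z" and l: "l \<in> L" shows "u l \<star> z = mu z l *\<^sub>C z"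
proof -
  obtain a where a: "u l \<star> z = a *\<^sub>C z" using cen_scalar[OF z] l L_iff L_carrier by blast
  with mu_eqI[OF z a] show ?thesis by simp
qed

lemma mu_norm: assumes z: "cen.minimal_proj z" and l: "l \<in> L" shows "cnj (mu z l) * mu z l = 1"
proof -
  note zZ = cen.minimal_projD[OF z]
  have zM: "z \<in> M" and lK: "l \<in> carrier K" using zZ l L_carrier by (auto simp: ZD)
  have "z = (u l \<star> z)\<^sup>\<dagger> \<star> (u l \<star> z)" using zM lK zZ by (simp add: star_mul mul_assoc cancel_u)
  also have "\<dots> = (cnj (mu z l) * mu z l) *\<^sub>C z"
    using zM zZ by (simp add: mu[OF z l] star_scl mul_scl mult.commute)
  finally show ?thesis using zZ(5) scale_cancel_right[of 1 z] by simp
qed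

lemma mu_cmod: assumes "cen.minimal_proj z" "l \<in> L" shows "cmod (mu z l) = 1"
  using mu_norm[OF assms] complex_norm_square[of "mu z l"]
  by (metis mult.commute norm_one of_real_1 of_real_eq_iff power2_eq_1_iff norm_ge_zero
      le_minus_one_simps(3) neg_0_le_iff_le not_one_le_zero)

lemma mu_mult:
  assumes z: "cen.minimal_proj z" and k: "k \<in> L" and l: "l \<in> L"
  shows "mu z k * mu z l = c k l * mu z (k \<otimes> l)"
proof -
  note zZ = cen.minimal_projD[OF z]
  have zM: "z \<in> M" and kl: "k \<in> carrier K" "l \<in> carrier K" using zZ k l L_carrier by (auto simp: ZD)
  have "(u k \<star> u l) \<star> z = (mu z k * mu z l) *\<^sub>C z"
    using zM kl by (simp add: mul_assoc mu[OF z] k l mul_scl mult.commute)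
  moreover have "(u k \<star> u l) \<star> z = (c k l * mu z (k \<otimes> l)) *\<^sub>C z"
    using zM kl by (simp add: u_mul mul_scl mu[OF z] L_mult k l)
  ultimately show ?thesis using zZ(5) by simp
qed

lemma cen_coeff:
  assumes z: "cen.minimal_proj z" and l: "l \<in> L"
  shows "tr ((u l)\<^sup>\<dagger> \<star> z) = cnj (mu z l) * tr z"
proof -
  have zM: "z \<in> M" and lK: "l \<in> carrier K"
    using cen.minimal_projD(2)[OF z] l L_carrier by (auto simp: ZD)
  have "(u l)\<^sup>\<dagger> \<star> z = (cnj (mu z l) * mu z l) *\<^sub>C ((u l)\<^sup>\<dagger> \<star> z)"
    by (simp add: mu_norm[OF z l])
  also have "\<dots> = cnj (mu z l) *\<^sub>C ((u l)\<^sup>\<dagger> \<star> (u l \<star> z))"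
    using zM lK by (simp add: mu[OF z l] mul_scl)
  also have "\<dots> = cnj (mu z l) *\<^sub>C z" using zM lK by (simp add: cancel_u)
  finally show ?thesis using zM by (simp add: tr_scl)
qed

text \<open>The coefficients of \<open>z\<close> on \<open>L\<close> all have modulus \<open>tr z\<close>, so that \<open>tr z = tr (z\<^sup>\<dagger> z) = |L| (tr z)\<^sup>2\<close>.\<close>

lemma cen_tr_eq: assumes z: "cen.minimal_proj z" shows "tr z = 1 / of_nat (card L)"
proof -
  note zZ = cen.minimal_projD[OF z]
  have zM: "z \<in> M" using zZ by (simp add: ZD)
  obtain t where t: "t > 0" "tr z = of_real t" using cen_tr[OF z] by auto
  have n: "cmod (mu z l) = 1" if "l \<in> L" for l by (rule mu_cmod[OF z that])
  have "complex_of_real t = tr (z\<^sup>\<dagger> \<star> z)" using zZ t by simp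
  also have "\<dots> = of_real (\<Sum>k\<in>carrier K. (cmod (tr ((u k)\<^sup>\<dagger> \<star> z)))\<^sup>2)" by (rule tr_square[OF zM])
  also have "(\<Sum>k\<in>carrier K. (cmod (tr ((u k)\<^sup>\<dagger> \<star> z)))\<^sup>2) = (\<Sum>k\<in>L. (cmod (tr ((u k)\<^sup>\<dagger> \<star> z)))\<^sup>2)"
    using L_carrier finite_K Z_coeff[OF zZ(2)] by (intro sum.mono_neutral_right) auto
  also have "\<dots> = (\<Sum>k\<in>L. t\<^sup>2)"
    using t by (intro sum.cong) (simp_all add: cen_coeff[OF z] norm_mult n)
  finally have "t = real (card L) * t\<^sup>2" by (simp only: of_real_eq_iff) simp
  then have "t = 1 / real (card L)" using t card_L_pos by (simp add: power2_eq_square field_simps)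
  then show ?thesis using t by simp
qed

lemma mu_inject:
  assumes z: "cen.minimal_proj z" and z': "cen.minimal_proj z'" and "\<And>l. l \<in> L \<Longrightarrow> mu z l = mu z' l"
  shows "z = z'"
proof -
  have co: "tr ((u k)\<^sup>\<dagger> \<star> z) = tr ((u k)\<^sup>\<dagger> \<star> z')" if k: "k \<in> carrier K" for k
  proof (cases "k \<in> L")
    case True
    then show ?thesis using assms by (simp add: cen_coeff cen_tr_eq)
  qed (use Z_coeff cen.minimal_projD(2) z z' k in simp)
  show ?thesis
    using expand[of z] expand[of z'] co cen.minimal_projD(2)[OF z] cen.minimal_projD(2)[OF z']
    by (simp add: ZD(1))
qed

text \<open>
  Both \<open>mu z\<close> and \<open>mu z0\<close> trivialize the cocycle \<open>c\<close> on \<open>L\<close>, so they differ by a character; thus one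
  minimal central projection yields a labeling of all of them.  Conversely, a character
  \<open>\<eta>\<close> yields the central element \<open>y\<close> on which each \<open>u l\<close> acts by \<open>\<eta> l * mu z0 l\<close>, and the
  minimal central projections below the support of \<open>y\<close> have this eigenvalue.
\<close>

lemma minimal_central_projs_characters:
  assumes Q: "cen.orth_decomp e Q" "\<And>z. z \<in> Q \<Longrightarrow> cen.minimal_proj z" and z0: "z0 \<in> Q"
  shows "bij_betw (\<lambda>z. restrict (\<lambda>l. mu z l * cnj (mu z0 l)) L) Q (characters K L)"
    (is "bij_betw ?f Q _")
proof (rule bij_betw_imageI)
  note z0m = Q(2)[OF z0]
  show "inj_on ?f Q"
  proof (rule inj_onI)
    fix z z' assume zz: "z \<in> Q" "z' \<in> Q" "?f z = ?f z'"
    show "z = z'"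
    proof (rule mu_inject)
      fix l assume l: "l \<in> L"
      have "mu z l * cnj (mu z0 l) = mu z' l * cnj (mu z0 l)"
        using fun_cong[OF zz(3), of l] l by simp
      moreover have "cnj (mu z0 l) \<noteq> 0" using mu_norm[OF z0m l] by auto
      ultimately show "mu z l = mu z' l" by simp
    qed (use zz Q in auto)
  qed
  show "?f ` Q = characters K L"
  proof
    show "?f ` Q \<subseteq> characters K L"
    proof
      fix \<eta> assume "\<eta> \<in> ?f ` Q"
      then obtain z where z: "z \<in> Q" and \<eta>: "\<eta> = ?f z" by auto
      note zm = Q(2)[OF z]
      have "\<eta> (k \<otimes> l) = \<eta> k * \<eta> l" if kl: "k \<in> L" "l \<in> L" for k l
      proof -
        have "c k l \<noteq> 0" using c_nonzero kl L_carrier by blast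
        moreover have "cnj (mu z0 k) * cnj (mu z0 l) = cnj (c k l) * cnj (mu z0 (k \<otimes> l))"
          using arg_cong[OF mu_mult[OF z0m kl], of cnj] by simp
        moreover have "cnj (c k l) * c k l = 1"
        proof -
          have "(cnj (mu z k) * mu z k) * (cnj (mu z l) * mu z l)
              = cnj (mu z k * mu z l) * (mu z k * mu z l)" by simp
          also have "\<dots> = (cnj (c k l) * c k l) * (cnj (mu z (k \<otimes> l)) * mu z (k \<otimes> l))"
            by (simp only: mu_mult[OF zm kl]) simp
          finally show ?thesis using kl by (simp only: mu_norm[OF zm] L_mult) simp
        qed
        ultimately show ?thesis
          using mu_mult[OF zm kl] kl L_mult[OF kl] by (simp add: \<eta>) algebra
      qed
      then show "\<eta> \<in> characters K L"
        by (auto simp: characters_def hom_def circle_group_def \<eta> norm_mult mu_cmod zm z0m)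
    qed
    show "characters K L \<subseteq> ?f ` Q"
    proof
      fix \<eta> assume \<eta>X: "\<eta> \<in> characters K L"
      have \<eta>m: "\<eta> (k \<otimes> l) = \<eta> k * \<eta> l" if "k \<in> L" "l \<in> L" for k l
        using \<eta>X that by (auto simp: characters_def hom_def circle_group_def)
      have \<eta>n: "cnj (\<eta> k) * \<eta> k = 1" if "k \<in> L" for k
      proof -
        have "cmod (\<eta> k) = 1"
          using \<eta>X that by (auto simp: characters_def hom_def circle_group_def)
        then show ?thesis using complex_norm_square[of "\<eta> k"] by (simp add: mult.commute)
      qed
      define \<nu> where "\<nu> l = \<eta> l * mu z0 l" for l
      have \<nu>m: "\<nu> k * \<nu> l = c k l * \<nu> (k \<otimes> l)" if "k \<in> L" "l \<in> L" for k l
        using mu_mult[OF z0m that] \<eta>m[OF that] by (simp add: \<nu>_def algebra_simps)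
      have \<nu>n: "cnj (\<nu> k) * \<nu> k = 1" if "k \<in> L" for k
        using mu_norm[OF z0m that] \<eta>n[OF that] by (simp add: \<nu>_def) algebra
      define y where "y = (\<Sum>l\<in>L. cnj (\<nu> l) *\<^sub>C u l)"
      have uZ: "u l \<in> Z" "u l \<in> M" if "l \<in> L" for l using that L_iff L_carrier ZD by blast+
      have yZ: "y \<in> Z" and yM: "y \<in> M" unfolding y_def using uZ by auto
      have uy: "u k \<star> y = \<nu> k *\<^sub>C y" if k: "k \<in> L" for k
      proof -
        have kK: "k \<in> carrier K" using k L_carrier by auto
        have "u k \<star> y = (\<Sum>l\<in>L. cnj (\<nu> l) *\<^sub>C (u k \<star> u l))"
          unfolding y_def using uZ k by (simp add: mul_sum_right mul_scl)
        also have "\<dots> = (\<Sum>l\<in>L. (\<nu> k * cnj (\<nu> (k \<otimes> l))) *\<^sub>C u (k \<otimes> l))"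
        proof (rule sum.cong)
          fix l assume l: "l \<in> L"
          have lK: "l \<in> carrier K" using l L_carrier by auto
          have "c k l * cnj (\<nu> l) * (cnj (\<nu> (k \<otimes> l)) * \<nu> (k \<otimes> l)) =
                \<nu> k * cnj (\<nu> (k \<otimes> l)) * (cnj (\<nu> l) * \<nu> l)"
            using \<nu>m[OF k l] by algebra
          then have "c k l * cnj (\<nu> l) = \<nu> k * cnj (\<nu> (k \<otimes> l))"
            using \<nu>n k l L_mult by simp
          then show "cnj (\<nu> l) *\<^sub>C (u k \<star> u l) = (\<nu> k * cnj (\<nu> (k \<otimes> l))) *\<^sub>C u (k \<otimes> l)"
            using kK lK by (simp add: u_mul mult.commute)
        qed simp
        also have "\<dots> = (\<Sum>l\<in>L. (\<nu> k * cnj (\<nu> l)) *\<^sub>C u l)"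
        proof (rule sum.reindex_bij_betw[where g = "\<lambda>l. (\<nu> k * cnj (\<nu> l)) *\<^sub>C u l"])
          have "inj_on (\<lambda>l. k \<otimes> l) L" using kK L_carrierD by (auto simp: inj_on_def)
          moreover have "(\<lambda>l. k \<otimes> l) ` L \<subseteq> L" using k L_mult by auto
          ultimately show "bij_betw (\<lambda>l. k \<otimes> l) L L"
            by (simp add: bij_betw_def endo_inj_surj finite_L)
        qed
        finally show ?thesis by (simp add: y_def scale_sum_right)
      qed
      have "y \<noteq> 0"
      proof
        assume "y = 0"
        then have "0 = tr ((u \<one>)\<^sup>\<dagger> \<star> y)" by (simp add: tr_0)
        also have "\<dots> = (\<Sum>l\<in>L. cnj (\<nu> l) * tr ((u \<one>)\<^sup>\<dagger> \<star> u l))"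
          unfolding y_def using uZ by (simp add: mul_sum_right mul_scl tr_sum tr_scl)
        also have "\<dots> = (\<Sum>l\<in>L. if l = \<one> then cnj (\<nu> l) else 0)"
          using L_carrier by (intro sum.cong) (auto simp: tr_star_u tr_e)
        also have "\<dots> = cnj (\<nu> \<one>)" using L_one finite_L by simp
        finally show False using \<nu>n[OF L_one] by simp
      qed
      have "y = y \<star> (\<Sum>z\<in>Q. z)" using Q(1) yM by (simp add: cen.orth_decomp_def)
      also have "\<dots> = (\<Sum>z\<in>Q. y \<star> z)"
        using yM Q(2) cen.minimal_projD(2) ZD(1) by (intro mul_sum_right) auto
      finally obtain z where z: "z \<in> Q" "y \<star> z \<noteq> 0"
        using \<open>y \<noteq> 0\<close> by (metis sum.neutral)
      note zm = Q(2)[OF z(1)]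
      have zM: "z \<in> M" using cen.minimal_projD(2)[OF zm] by (simp add: ZD)
      obtain a where a: "y \<star> z = a *\<^sub>C z" using cen_scalar[OF zm yZ] by auto
      then have a0: "a \<noteq> 0" using z by auto
      have muz: "mu z l = \<nu> l" if l: "l \<in> L" for l
      proof (rule mu_eqI[OF zm])
        have "a *\<^sub>C (u l \<star> z) = u l \<star> (y \<star> z)" using uZ[OF l] zM by (simp add: a mul_scl)
        also have "\<dots> = \<nu> l *\<^sub>C (y \<star> z)"
          using uZ[OF l] zM yM uy[OF l] by (simp add: mul_scl flip: mul_assoc)
        also have "\<dots> = a *\<^sub>C \<nu> l *\<^sub>C z" by (simp add: a mult.commute)
        finally show "u l \<star> z = \<nu> l *\<^sub>C z" using a0 by (simp only: scale_cancel_left) simp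
      qed
      have "\<eta> = ?f z"
      proof (rule extensionalityI[of _ L])
        show "\<eta> l = ?f z l" if l: "l \<in> L" for l
          using mu_norm[OF z0m l] l by (simp add: muz \<nu>_def mult.commute)
      qed (use \<eta>X in \<open>auto simp: characters_def\<close>)
      then show "\<eta> \<in> ?f ` Q" using z by auto
    qed
  qed
qed

subsection \<open>The blocks\<close>

lemma c_norm: assumes "k \<in> carrier K" "l \<in> carrier K" shows "c k l * cnj (c k l) = 1"
proof -
  have "(u k \<star> u l)\<^sup>\<dagger> \<star> (u k \<star> u l) = e"
    using assms by (simp add: star_mul mul_assoc cancel_u)
  then have "(c k l * cnj (c k l)) *\<^sub>C e = 1 *\<^sub>C e"
    using assms by (simp add: u_mul star_scl mul_scl mult.commute)
  then show ?thesis using e_nonzero by (simp only: scale_cancel_right) simp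
qed

definition avg :: "'b \<Rightarrow> 'b" where
  "avg x = (\<Sum>k\<in>carrier K. u k \<star> x \<star> (u k)\<^sup>\<dagger>)"

lemma avg_M [simp]: "x \<in> M \<Longrightarrow> avg x \<in> M"
  by (auto simp: avg_def)

lemma tr_avg: "x \<in> M \<Longrightarrow> tr (avg x) = of_nat (card (carrier K)) * tr x"
  by (simp add: avg_def tr_sum tr_conj)

lemma avg_Z: assumes x: "x \<in> M" shows "avg x \<in> Z"
proof -
  have "u l \<star> avg x = avg x \<star> u l" if l: "l \<in> carrier K" for l
  proof -
    have "u l \<star> avg x \<star> (u l)\<^sup>\<dagger> = (\<Sum>k\<in>carrier K. u l \<star> (u k \<star> x \<star> (u k)\<^sup>\<dagger>) \<star> (u l)\<^sup>\<dagger>)"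
      unfolding avg_def using x l by (simp add: mul_sum_left mul_sum_right)
    also have "\<dots> = (\<Sum>k\<in>carrier K. u (l \<otimes> k) \<star> x \<star> (u (l \<otimes> k))\<^sup>\<dagger>)"
    proof (rule sum.cong)
      fix k assume k: "k \<in> carrier K"
      have "u l \<star> (u k \<star> x \<star> (u k)\<^sup>\<dagger>) \<star> (u l)\<^sup>\<dagger> = (u l \<star> u k) \<star> x \<star> (u l \<star> u k)\<^sup>\<dagger>"
        using x k l by (simp add: mul_assoc star_mul)
      also have "\<dots> = (c l k * cnj (c l k)) *\<^sub>C (u (l \<otimes> k) \<star> x \<star> (u (l \<otimes> k))\<^sup>\<dagger>)"
        using x k l by (simp add: u_mul star_scl mul_scl mult.commute)
      finally show "u l \<star> (u k \<star> x \<star> (u k)\<^sup>\<dagger>) \<star> (u l)\<^sup>\<dagger> = u (l \<otimes> k) \<star> x \<star> (u (l \<otimes> k))\<^sup>\<dagger>"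
        using k l by (simp add: c_norm)
    qed simp
    also have "\<dots> = avg x"
      unfolding avg_def
    proof (rule sum.reindex_bij_betw[where g = "\<lambda>k. u k \<star> x \<star> (u k)\<^sup>\<dagger>"])
      have "inj_on (\<lambda>k. l \<otimes> k) (carrier K)" using l by (auto simp: inj_on_def)
      moreover have "(\<lambda>k. l \<otimes> k) ` carrier K \<subseteq> carrier K" using l by auto
      ultimately show "bij_betw (\<lambda>k. l \<otimes> k) (carrier K) (carrier K)"
        by (simp add: bij_betw_def endo_inj_surj finite_K)
    qed
    finally have "u l \<star> avg x \<star> (u l)\<^sup>\<dagger> \<star> u l = avg x \<star> u l" by simp
    then show ?thesis using x l by (simp add: mul_assoc)
  qed
  then show ?thesis using x by (simp add: Z_def)
qed

text \<open>The average of \<open>x\<close> is central and lies below \<open>z\<close>, hence it is a multiple of \<open>z\<close>; the trace gives the factor.\<close>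

lemma avg_below:
  assumes z: "cen.minimal_proj z" and x: "x \<in> M" "z \<star> x = x"
  shows "avg x = (of_nat (card (carrier K)) * of_nat (card L) * tr x) *\<^sub>C z"
proof -
  note zZ = cen.minimal_projD[OF z]
  have zM: "z \<in> M" using zZ by (simp add: ZD)
  obtain a where a: "avg x \<star> z = a *\<^sub>C z" using cen_scalar[OF z avg_Z[OF x(1)]] by auto
  have "avg x \<star> z = z \<star> avg x" using Z_central[OF avg_Z[OF x(1)] zM] by simp
  also have "\<dots> = (\<Sum>k\<in>carrier K. z \<star> (u k \<star> x \<star> (u k)\<^sup>\<dagger>))"
    unfolding avg_def using x zM by (simp add: mul_sum_right)
  also have "\<dots> = avg x" unfolding avg_def
  proof (rule sum.cong)
    fix k assume k: "k \<in> carrier K"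
    have "z \<star> (u k \<star> x \<star> (u k)\<^sup>\<dagger>) = (z \<star> u k) \<star> x \<star> (u k)\<^sup>\<dagger>"
      using zM x k by (simp add: mul_assoc)
    also have "\<dots> = u k \<star> (z \<star> x) \<star> (u k)\<^sup>\<dagger>"
      using zM x k zZ(2) by (simp add: ZD(2)[symmetric] mul_assoc)
    finally show "z \<star> (u k \<star> x \<star> (u k)\<^sup>\<dagger>) = u k \<star> x \<star> (u k)\<^sup>\<dagger>" by (simp only: x(2))
  qed simp
  finally have az: "avg x = a *\<^sub>C z" using a by simp
  from arg_cong[OF this, of tr] have "a = of_nat (card (carrier K)) * of_nat (card L) * tr x"
    using x zM card_L_pos by (simp add: tr_avg tr_scl cen_tr_eq[OF z] field_simps)
  with az show ?thesis by simp
qed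

lemma tr_minimal_pos: assumes "minimal_proj p" shows "\<exists>t>0. tr p = of_real t"
  using tr_proj minimal_projD(1,5)[OF assms] by blast

lemma card_K_pos: "card (carrier K) > 0"
  using finite_K one_closed card_gt_0_iff by blast

text \<open>If \<open>q u\<^sub>k p = 0\<close> for all \<open>k\<close>, then \<open>q\<close> is orthogonal to \<open>avg p\<close>, which is a nonzero multiple of \<open>z\<close>.\<close>

lemma minimal_projs_equivalent:
  assumes z: "cen.minimal_proj z" and p: "minimal_proj p" "z \<star> p = p" and q: "minimal_proj q" "z \<star> q = q"
  shows "\<exists>V\<in>M. V\<^sup>\<dagger> \<star> V = p \<and> V \<star> V\<^sup>\<dagger> = q \<and> V \<star> p = V"
proof -
  note zZ = cen.minimal_projD[OF z] and pp = minimal_projD[OF p(1)] and qq = minimal_projD[OF q(1)]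
  have zM: "z \<in> M" using zZ by (simp add: ZD)
  have "\<exists>k\<in>carrier K. q \<star> u k \<star> p \<noteq> 0"
  proof (rule ccontr)
    assume "\<not> ?thesis"
    then have "q \<star> (u k \<star> p \<star> (u k)\<^sup>\<dagger>) = 0" if "k \<in> carrier K" for k
      using that pp qq by (simp add: mul_assoc[symmetric])
    then have "q \<star> avg p = 0" using pp qq by (simp add: avg_def mul_sum_right)
    moreover have "q \<star> z = q" using Z_central[OF zZ(2) qq(2)] q(2) by simp
    ultimately have "(of_nat (card (carrier K)) * of_nat (card L) * tr p) *\<^sub>C q = 0"
      using avg_below[OF z pp(2) p(2)] qq zM by (simp add: mul_scl)
    moreover have "tr p \<noteq> 0" using tr_minimal_pos[OF p(1)] by auto
    ultimately show False using card_K_pos card_L_pos qq(5) by simp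
  qed
  then obtain k where k: "k \<in> carrier K" "q \<star> u k \<star> p \<noteq> 0" by auto
  define x where "x = q \<star> u k \<star> p"
  have xM: "x \<in> M" using k pp qq by (simp add: x_def)
  have qx: "q \<star> x = x" and xp: "x \<star> p = x"
    using k pp qq by (simp_all add: x_def mul_assoc proj_absorb)
  have pxs: "p \<star> x\<^sup>\<dagger> = x\<^sup>\<dagger>" and xsq: "x\<^sup>\<dagger> \<star> q = x\<^sup>\<dagger>"
    using star_mul[of x p] star_mul[of q x] xM pp qq by (simp_all add: xp qx)
  obtain a where a0: "p \<star> (x\<^sup>\<dagger> \<star> x) \<star> p = a *\<^sub>C p"
    using p(1) xM by (auto simp: minimal_proj_def)
  have "p \<star> (x\<^sup>\<dagger> \<star> x) \<star> p = (p \<star> x\<^sup>\<dagger>) \<star> (x \<star> p)" using xM pp by (simp add: mul_assoc)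
  with a0 have a: "x\<^sup>\<dagger> \<star> x = a *\<^sub>C p" by (simp only: pxs xp)
  have "a \<noteq> 0" using a positive[OF xM] k by (auto simp: x_def)
  obtain t where t: "t > 0" "tr p = of_real t" using tr_minimal_pos[OF p(1)] by auto
  let ?s = "\<Sum>k\<in>carrier K. (cmod (tr ((u k)\<^sup>\<dagger> \<star> x)))\<^sup>2"
  have "a * of_real t = of_real ?s" using tr_square[OF xM] pp by (simp add: a tr_scl t)
  then have "a = of_real (?s / t)" using t by (simp add: field_simps)
  moreover have "?s \<ge> 0" by (rule sum_nonneg) simp
  ultimately obtain b where b: "b > 0" "a = of_real b"
    using \<open>a \<noteq> 0\<close> t by (metis divide_nonneg_pos less_eq_real_def of_real_0)
  define V where "V = of_real (1 / sqrt b) *\<^sub>C x"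
  have VM: "V \<in> M" using xM by (simp add: V_def)
  have "V\<^sup>\<dagger> \<star> V = (of_real (1 / sqrt b) * of_real (1 / sqrt b) * of_real b) *\<^sub>C p"
    using xM by (simp add: V_def star_scl mul_scl a b)
  also have "complex_of_real (1 / sqrt b) * of_real (1 / sqrt b) * of_real b = of_real 1"
    using b by (simp only: flip: of_real_mult) (simp add: field_simps)
  finally have VV: "V\<^sup>\<dagger> \<star> V = p" by simp
  have Vp: "V \<star> p = V" using xM pp by (simp add: V_def mul_scl xp)
  have qV: "q \<star> V = V" using xM qq by (simp add: V_def mul_scl qx)
  have Vq: "V\<^sup>\<dagger> \<star> q = V\<^sup>\<dagger>" using xM qq by (simp add: V_def mul_scl star_scl xsq)
  obtain d where d0: "q \<star> (V \<star> V\<^sup>\<dagger>) \<star> q = d *\<^sub>C q"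
    using q(1) VM by (auto simp: minimal_proj_def)
  have "q \<star> (V \<star> V\<^sup>\<dagger>) \<star> q = (q \<star> V) \<star> (V\<^sup>\<dagger> \<star> q)" using VM qq by (simp add: mul_assoc)
  with d0 have d: "V \<star> V\<^sup>\<dagger> = d *\<^sub>C q" by (simp only: qV Vq)
  have "(V \<star> V\<^sup>\<dagger>) \<star> (V \<star> V\<^sup>\<dagger>) = V \<star> (V\<^sup>\<dagger> \<star> V) \<star> V\<^sup>\<dagger>" using VM by (simp add: mul_assoc)
  then have "(d * d) *\<^sub>C q = d *\<^sub>C q" using qq by (simp add: VV Vp d mul_scl)
  then have "d = 0 \<or> d = 1" using qq(5) by simp
  moreover have "d \<noteq> 0" using d positive'[OF VM] VV pp VM by auto
  ultimately show ?thesis using VM VV Vp d by auto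
qed

text \<open>
  Compress \<open>avg p = \<lambda> z\<close>, \<open>\<lambda> = |K| |L| tr p\<close>, to the corner of \<open>p\<close>: with \<open>p u\<^sub>k p = f k p\<close> this reads
  \<open>(\<Sum>k. |f k|\<^sup>2) = \<lambda>\<close>.  On the other hand, the coefficients of \<open>p\<close> itself are \<open>cnj (f k) tr p\<close>, so that
  \<open>tr p = (tr p)\<^sup>2 (\<Sum>k. |f k|\<^sup>2)\<close>.
\<close>

lemma tr_minimal_proj:
  assumes z: "cen.minimal_proj z" and p: "minimal_proj p" "z \<star> p = p"
  shows "tr p * tr p * of_nat (card (carrier K)) * of_nat (card L) = 1"
proof -
  note zZ = cen.minimal_projD[OF z] and pp = minimal_projD[OF p(1)]
  have zM: "z \<in> M" using zZ by (simp add: ZD)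
  obtain t where t: "t > 0" "tr p = of_real t" using tr_minimal_pos[OF p(1)] by auto
  have "\<forall>k\<in>carrier K. \<exists>a. p \<star> u k \<star> p = a *\<^sub>C p" using p(1) by (simp add: minimal_proj_def)
  then obtain f where f: "\<And>k. k \<in> carrier K \<Longrightarrow> p \<star> u k \<star> p = f k *\<^sub>C p" by metis
  have f': "p \<star> (u k)\<^sup>\<dagger> \<star> p = cnj (f k) *\<^sub>C p" if k: "k \<in> carrier K" for k
    using arg_cong[OF f[OF k], of star] pp k by (simp add: star_mul star_scl mul_assoc)
  define la where "la = of_nat (card (carrier K)) * of_nat (card L) * tr p"
  have "p \<star> avg p \<star> p = (\<Sum>k\<in>carrier K. p \<star> (u k \<star> p \<star> (u k)\<^sup>\<dagger>) \<star> p)"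
    unfolding avg_def using pp by (simp add: mul_sum_left mul_sum_right)
  also have "\<dots> = (\<Sum>k\<in>carrier K. of_real ((cmod (f k))\<^sup>2) *\<^sub>C p)"
  proof (rule sum.cong)
    fix k assume k: "k \<in> carrier K"
    have "p \<star> (u k \<star> p \<star> (u k)\<^sup>\<dagger>) \<star> p = (p \<star> u k \<star> p) \<star> ((u k)\<^sup>\<dagger> \<star> p)"
      using pp k by (simp add: mul_assoc)
    also have "\<dots> = f k *\<^sub>C (p \<star> ((u k)\<^sup>\<dagger> \<star> p))" using pp k by (simp add: f mul_scl)
    also have "p \<star> ((u k)\<^sup>\<dagger> \<star> p) = p \<star> (u k)\<^sup>\<dagger> \<star> p" using pp k by (simp add: mul_assoc)
    finally show "p \<star> (u k \<star> p \<star> (u k)\<^sup>\<dagger>) \<star> p = of_real ((cmod (f k))\<^sup>2) *\<^sub>C p"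
      using k by (simp only: f' scale_scale complex_norm_square)
  qed simp
  also have "\<dots> = of_real (\<Sum>k\<in>carrier K. (cmod (f k))\<^sup>2) *\<^sub>C p" by (simp add: scale_sum_left)
  finally have "la *\<^sub>C p = of_real (\<Sum>k\<in>carrier K. (cmod (f k))\<^sup>2) *\<^sub>C p"
    using avg_below[OF z pp(2) p(2)] pp zM p(2) by (simp add: la_def mul_scl mul_assoc)
  then have la: "la = of_real (\<Sum>k\<in>carrier K. (cmod (f k))\<^sup>2)" using pp(5) by (simp only: scale_cancel_right) simp
  have co: "cmod (tr ((u k)\<^sup>\<dagger> \<star> p)) = cmod (f k) * t" if k: "k \<in> carrier K" for k
  proof -
    have "tr ((u k)\<^sup>\<dagger> \<star> p) = tr (((u k)\<^sup>\<dagger> \<star> p) \<star> p)" using pp k by (simp add: mul_assoc)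
    also have "\<dots> = tr (p \<star> (u k)\<^sup>\<dagger> \<star> p)"
      using tr_comm[of "(u k)\<^sup>\<dagger> \<star> p" p] pp k by (simp add: mul_assoc)
    also have "\<dots> = cnj (f k) * tr p" using pp k by (simp add: f' tr_scl)
    finally show ?thesis using t by (simp add: norm_mult)
  qed
  have "tr p = of_real (\<Sum>k\<in>carrier K. (cmod (tr ((u k)\<^sup>\<dagger> \<star> p)))\<^sup>2)"
    using tr_square[OF pp(2)] pp by simp
  also have "(\<Sum>k\<in>carrier K. (cmod (tr ((u k)\<^sup>\<dagger> \<star> p)))\<^sup>2) = (\<Sum>k\<in>carrier K. (cmod (f k))\<^sup>2) * t\<^sup>2"
    by (simp add: co power_mult_distrib sum_distrib_right)
  finally have "tr p = la * (tr p)\<^sup>2" by (simp add: la t)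
  moreover have "tr p \<noteq> 0" using t by simp
  ultimately show ?thesis by (simp add: la_def power2_eq_square field_simps)
qed

text \<open>The \<open>n\<close> minimal projections below \<open>z\<close> have the same trace, so \<open>n tr p = tr z = 1 / |L|\<close>, and \<open>(tr p)\<^sup>2 |K| |L| = 1\<close>.\<close>

lemma central_block:
  assumes z: "cen.minimal_proj z"
  shows "\<exists>n p V. n * n * card L = card (carrier K) \<and> minimal_proj p \<and> z \<star> p = p \<and>
    (\<forall>i<n. V i \<in> M \<and> (V i)\<^sup>\<dagger> \<star> V i = p \<and> V i \<star> p = V i) \<and> (\<Sum>i<n. V i \<star> (V i)\<^sup>\<dagger>) = z"
proof -
  note zZ = cen.minimal_projD[OF z]
  obtain P where P: "orth_decomp z P" and mP: "\<And>q. q \<in> P \<Longrightarrow> minimal_proj q"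
    using minimal_decomposition[OF cen_proj[OF zZ(1)] zZ(5)] by auto
  have fin: "finite P" and sP: "\<Sum>P = z" and orth: "\<And>q r. q \<in> P \<Longrightarrow> r \<in> P \<Longrightarrow> q \<noteq> r \<Longrightarrow> q \<star> r = 0"
    using P by (auto simp: orth_decomp_def)
  have PM: "q \<in> M" "q \<star> q = q" if "q \<in> P" for q using mP[OF that] minimal_projD by blast+
  have zq: "z \<star> q = q" if q: "q \<in> P" for q
  proof -
    have "z \<star> q = (\<Sum>r\<in>P. r \<star> q)" unfolding sP[symmetric] using PM q by (simp add: mul_sum_left)
    also have "\<dots> = (\<Sum>r\<in>P. if r = q then q else 0)" using PM q orth by (intro sum.cong) auto
    finally show ?thesis using fin q by simp
  qed
  have "P \<noteq> {}" using sP zZ(5) by auto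
  then obtain p where p: "p \<in> P" by auto
  have "\<forall>q\<in>P. \<exists>V. V \<in> M \<and> V\<^sup>\<dagger> \<star> V = p \<and> V \<star> V\<^sup>\<dagger> = q \<and> V \<star> p = V"
    using minimal_projs_equivalent[OF z mP[OF p] zq[OF p]] mP zq by blast
  then obtain W where W: "\<And>q. q \<in> P \<Longrightarrow> W q \<in> M \<and> (W q)\<^sup>\<dagger> \<star> W q = p \<and> W q \<star> (W q)\<^sup>\<dagger> = q \<and> W q \<star> p = W q"
    by metis
  define n where "n = card P"
  obtain h where h: "bij_betw h {..<n} P"
    using ex_bij_betw_nat_finite[OF fin] by (auto simp: n_def atLeast0LessThan)
  have hP: "h i \<in> P" if "i < n" for i using h that by (auto simp: bij_betw_def)
  have "(\<Sum>i<n. W (h i) \<star> (W (h i))\<^sup>\<dagger>) = (\<Sum>q\<in>P. W q \<star> (W q)\<^sup>\<dagger>)"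
    by (rule sum.reindex_bij_betw[OF h])
  also have "\<dots> = z" using W sP by simp
  finally have sW: "(\<Sum>i<n. W (h i) \<star> (W (h i))\<^sup>\<dagger>) = z" .
  have "tr q = tr p" if "q \<in> P" for q using W[OF that] tr_comm[of "W q" "(W q)\<^sup>\<dagger>"] by auto
  then have "tr z = of_nat n * tr p" unfolding sP[symmetric] using PM by (simp add: tr_sum n_def)
  then have nt: "of_nat n * tr p * of_nat (card L) = 1"
    using card_L_pos by (simp add: cen_tr_eq[OF z] field_simps)
  have "of_nat (n * n * card L) = (of_nat n * of_nat n * of_nat (card L)) *
      (tr p * tr p * of_nat (card (carrier K)) * of_nat (card L))"
    by (simp add: tr_minimal_proj[OF z mP[OF p] zq[OF p]])
  also have "\<dots> = (of_nat n * tr p * of_nat (card L)) * (of_nat n * tr p * of_nat (card L)) *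
      of_nat (card (carrier K))"
    by (simp only: mult_ac)
  finally have "of_nat (n * n * card L) = (of_nat (card (carrier K)) :: complex)"
    by (simp only: nt) simp
  then have "n * n * card L = card (carrier K)" by (simp only: of_nat_eq_iff)
  then show ?thesis using mP[OF p] zq[OF p] W hP sW by (intro exI[of _ n] exI[of _ p] exI[of _ "\<lambda>i. W (h i)"]) auto
qed

theorem decomposition:
  shows "\<exists>N p V. N * N * card L = card (carrier K) \<and> finite (characters K L) \<and>
    (\<forall>\<eta>\<in>characters K L. minimal_proj (p \<eta>) \<and>
       (\<forall>i<N. V \<eta> i \<in> M \<and> (V \<eta> i)\<^sup>\<dagger> \<star> V \<eta> i = p \<eta> \<and> V \<eta> i \<star> p \<eta> = V \<eta> i)) \<and>
    (\<forall>\<eta>\<in>characters K L. \<forall>\<theta>\<in>characters K L. \<eta> \<noteq> \<theta> \<longrightarrow> (\<forall>x\<in>M. p \<eta> \<star> x \<star> p \<theta> = 0)) \<and>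
    (\<Sum>\<eta>\<in>characters K L. \<Sum>i<N. V \<eta> i \<star> (V \<eta> i)\<^sup>\<dagger>) = e"
proof -
  obtain Q where Q: "cen.orth_decomp e Q" and mQ: "\<And>z. z \<in> Q \<Longrightarrow> cen.minimal_proj z"
    using cen.minimal_decomposition[OF cen.proj_e e_nonzero] by auto
  have fin: "finite Q" and sQ: "\<Sum>Q = e" and orth: "\<And>q r. q \<in> Q \<Longrightarrow> r \<in> Q \<Longrightarrow> q \<noteq> r \<Longrightarrow> q \<star> r = 0"
    using Q by (auto simp: cen.orth_decomp_def)
  have QZ: "z \<in> Z" "z \<in> M" if "z \<in> Q" for z using cen.minimal_projD(2)[OF mQ[OF that]] ZD by auto
  have "Q \<noteq> {}" using sQ e_nonzero by auto
  then obtain z0 where "z0 \<in> Q" by auto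
  from minimal_central_projs_characters[OF Q mQ this]
  obtain g where "bij_betw g Q (characters K L)" by auto
  then obtain f where f: "bij_betw f (characters K L) Q" using bij_betw_inv by blast
  then have fQ: "f \<eta> \<in> Q" if "\<eta> \<in> characters K L" for \<eta> using that by (auto simp: bij_betw_def)
  define N where "N = (THE n. n * n * card L = card (carrier K))"
  have N: "n = N" if n: "n * n * card L = card (carrier K)" for n
  proof -
    have uniq: "m = n" if m: "m * m * card L = card (carrier K)" for m
    proof -
      have "m * m = n * n" using m n card_L_pos by (metis mult_cancel2 not_less0)
      then show ?thesis
        using mult_strict_mono'[of m n m n] mult_strict_mono'[of n m n m] by (cases m n rule: linorder_cases) auto
    qed
    show ?thesis unfolding N_def by (rule the_equality[symmetric]) (fact n, rule uniq)
  qed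
  \<comment> \<open>By its square, \<open>N\<close> is the same for all blocks.\<close>
  define R where "R z p V \<longleftrightarrow> N * N * card L = card (carrier K) \<and> minimal_proj p \<and> z \<star> p = p \<and>
    (\<forall>i<N. V i \<in> M \<and> (V i)\<^sup>\<dagger> \<star> V i = p \<and> V i \<star> p = V i) \<and> (\<Sum>i<N. V i \<star> (V i)\<^sup>\<dagger>) = z"
    for z p V
  have "\<exists>p V. R z p V" if z: "z \<in> Q" for z
  proof -
    obtain n p V where "n * n * card L = card (carrier K) \<and> minimal_proj p \<and> z \<star> p = p \<and>
      (\<forall>i<n. V i \<in> M \<and> (V i)\<^sup>\<dagger> \<star> V i = p \<and> V i \<star> p = V i) \<and> (\<Sum>i<n. V i \<star> (V i)\<^sup>\<dagger>) = z"
      using central_block[OF mQ[OF z]] by (elim exE) (rule that)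
    moreover from this have "n = N" by (intro N) (elim conjE)
    ultimately show ?thesis unfolding R_def by (intro exI[of _ p] exI[of _ V]) simp
  qed
  then obtain p V where R: "\<And>z. z \<in> Q \<Longrightarrow> R z (p z) (V z)" by metis
  have NN: "N * N * card L = card (carrier K)" using R[OF \<open>z0 \<in> Q\<close>] by (simp add: R_def)
  have p: "minimal_proj (p z)" "z \<star> p z = p z"
    and V: "\<forall>i<N. V z i \<in> M \<and> (V z i)\<^sup>\<dagger> \<star> V z i = p z \<and> V z i \<star> p z = V z i"
      "(\<Sum>i<N. V z i \<star> (V z i)\<^sup>\<dagger>) = z" if "z \<in> Q" for z
    using R[OF that] by (simp_all add: R_def)
  have "p z \<star> x \<star> p z' = 0" if z: "z \<in> Q" "z' \<in> Q" "z \<noteq> z'" and x: "x \<in> M" for z z' x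
  proof -
    have pM: "p z \<in> M" "p z' \<in> M" using p(1) z minimal_projD(2) by auto
    have pz: "p z \<star> z = p z" using Z_central[OF QZ(1)[OF z(1)] pM(1)] p(2)[OF z(1)] by simp
    have "p z \<star> x \<star> p z' = (p z \<star> z) \<star> x \<star> (z' \<star> p z')" by (simp only: pz p(2)[OF z(2)])
    also have "\<dots> = p z \<star> (z \<star> x) \<star> (z' \<star> p z')" using pM x QZ z by (simp add: mul_assoc)
    also have "z \<star> x = x \<star> z" using Z_central[OF QZ(1)[OF z(1)] x] by simp
    also have "p z \<star> (x \<star> z) \<star> (z' \<star> p z') = p z \<star> x \<star> ((z \<star> z') \<star> p z')"
      using pM x QZ z by (simp add: mul_assoc)
    finally show ?thesis using pM x z by (simp add: orth)
  qed
  moreover have "f \<eta> \<noteq> f \<theta>" if "\<eta> \<in> characters K L" "\<theta> \<in> characters K L" "\<eta> \<noteq> \<theta>" for \<eta> \<theta>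
    using f that by (auto simp: bij_betw_def inj_on_def)
  moreover have "(\<Sum>\<eta>\<in>characters K L. \<Sum>i<N. V (f \<eta>) i \<star> (V (f \<eta>) i)\<^sup>\<dagger>) = e"
  proof -
    have "(\<Sum>\<eta>\<in>characters K L. \<Sum>i<N. V (f \<eta>) i \<star> (V (f \<eta>) i)\<^sup>\<dagger>) = (\<Sum>\<eta>\<in>characters K L. f \<eta>)"
      by (rule sum.cong) (simp_all add: V(2) fQ)
    then show ?thesis using sum.reindex_bij_betw[OF f, of "\<lambda>z. z"] sQ by simp
  qed
  moreover have "finite (characters K L)" using bij_betw_finite[OF f] fin by simp
  ultimately show ?thesis
    using NN p(1) V(1) fQ
    by (intro exI[of _ N] exI[of _ "\<lambda>\<eta>. p (f \<eta>)"] exI[of _ "\<lambda>\<eta>. V (f \<eta>)"]) simp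
qed

end

section \<open>Linear *-categories\<close>

text \<open>The part of the structure of a tensor *-category that sectors depend on: no tensor product.\<close>

locale star_category =
  fixes C :: "('o, 'a::ab_group_add, 'z) tensor_star_cat_scheme" (structure)
  assumes vs: "vector_space (scl C)"
    and Hom_subspace: "\<lbrakk>\<rho> \<in> Obj C; \<sigma> \<in> Obj C\<rbrakk> \<Longrightarrow> module.subspace (scl C) (Hom C \<rho> \<sigma>)"
    and ide_Hom: "\<rho> \<in> Obj C \<Longrightarrow> ide C \<rho> \<in> Hom C \<rho> \<rho>"
    and cmp_Hom: "\<lbrakk>\<rho> \<in> Obj C; \<sigma> \<in> Obj C; \<tau> \<in> Obj C; X \<in> Hom C \<sigma> \<tau>; Y \<in> Hom C \<rho> \<sigma>\<rbrakk>
          \<Longrightarrow> X \<cdot> Y \<in> Hom C \<rho> \<tau>"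
    and cmp_assoc: "\<lbrakk>\<rho> \<in> Obj C; \<sigma> \<in> Obj C; \<tau> \<in> Obj C; \<upsilon> \<in> Obj C;
          X \<in> Hom C \<tau> \<upsilon>; Y \<in> Hom C \<sigma> \<tau>; Z \<in> Hom C \<rho> \<sigma>\<rbrakk> \<Longrightarrow> (X \<cdot> Y) \<cdot> Z = X \<cdot> (Y \<cdot> Z)"
    and cmp_ide: "\<lbrakk>\<rho> \<in> Obj C; \<sigma> \<in> Obj C; X \<in> Hom C \<rho> \<sigma>\<rbrakk> \<Longrightarrow> ide C \<sigma> \<cdot> X = X"
      "\<lbrakk>\<rho> \<in> Obj C; \<sigma> \<in> Obj C; X \<in> Hom C \<rho> \<sigma>\<rbrakk> \<Longrightarrow> X \<cdot> ide C \<rho> = X"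
    and cmp_add: "\<lbrakk>\<rho> \<in> Obj C; \<sigma> \<in> Obj C; \<tau> \<in> Obj C;
          X \<in> Hom C \<sigma> \<tau>; X' \<in> Hom C \<sigma> \<tau>; Y \<in> Hom C \<rho> \<sigma>\<rbrakk> \<Longrightarrow> (X + X') \<cdot> Y = X \<cdot> Y + X' \<cdot> Y"
      "\<lbrakk>\<rho> \<in> Obj C; \<sigma> \<in> Obj C; \<tau> \<in> Obj C;
          X \<in> Hom C \<sigma> \<tau>; Y \<in> Hom C \<rho> \<sigma>; Y' \<in> Hom C \<rho> \<sigma>\<rbrakk> \<Longrightarrow> X \<cdot> (Y + Y') = X \<cdot> Y + X \<cdot> Y'"
    and cmp_scl: "\<lbrakk>\<rho> \<in> Obj C; \<sigma> \<in> Obj C; \<tau> \<in> Obj C; X \<in> Hom C \<sigma> \<tau>; Y \<in> Hom C \<rho> \<sigma>\<rbrakk>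
          \<Longrightarrow> scl C z X \<cdot> Y = scl C z (X \<cdot> Y)"
      "\<lbrakk>\<rho> \<in> Obj C; \<sigma> \<in> Obj C; \<tau> \<in> Obj C; X \<in> Hom C \<sigma> \<tau>; Y \<in> Hom C \<rho> \<sigma>\<rbrakk>
          \<Longrightarrow> X \<cdot> scl C z Y = scl C z (X \<cdot> Y)"
    and adj_Hom: "\<lbrakk>\<rho> \<in> Obj C; \<sigma> \<in> Obj C; X \<in> Hom C \<rho> \<sigma>\<rbrakk> \<Longrightarrow> adj C X \<in> Hom C \<sigma> \<rho>"
    and adj_adj: "\<lbrakk>\<rho> \<in> Obj C; \<sigma> \<in> Obj C; X \<in> Hom C \<rho> \<sigma>\<rbrakk> \<Longrightarrow> adj C (adj C X) = X"
    and adj_add: "\<lbrakk>\<rho> \<in> Obj C; \<sigma> \<in> Obj C; X \<in> Hom C \<rho> \<sigma>; Y \<in> Hom C \<rho> \<sigma>\<rbrakk>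
          \<Longrightarrow> adj C (X + Y) = adj C X + adj C Y"
    and adj_scl: "\<lbrakk>\<rho> \<in> Obj C; \<sigma> \<in> Obj C; X \<in> Hom C \<rho> \<sigma>\<rbrakk>
          \<Longrightarrow> adj C (scl C z X) = scl C (cnj z) (adj C X)"
    and adj_cmp: "\<lbrakk>\<rho> \<in> Obj C; \<sigma> \<in> Obj C; \<tau> \<in> Obj C; X \<in> Hom C \<sigma> \<tau>; Y \<in> Hom C \<rho> \<sigma>\<rbrakk>
          \<Longrightarrow> adj C (X \<cdot> Y) = adj C Y \<cdot> adj C X"
    and adj_positive: "\<lbrakk>\<rho> \<in> Obj C; \<sigma> \<in> Obj C; X \<in> Hom C \<rho> \<sigma>; adj C X \<cdot> X = 0\<rbrakk> \<Longrightarrow> X = 0"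

lemma (in tensor_star_category) star_category: "star_category C"
  by (rule star_category.intro)
    (fact vs Hom_subspace ide_Hom cmp_Hom cmp_assoc cmp_ide cmp_add cmp_scl
      adj_Hom adj_adj adj_add adj_scl adj_cmp adj_positive)+

context star_category
begin

interpretation V: vector_space "scl C" by (rule vs)

definition in_hom :: "'a \<Rightarrow> 'o \<Rightarrow> 'o \<Rightarrow> bool" (\<open>\<guillemotleft>_ : _ \<rightarrow> _\<guillemotright>\<close>) where
  "\<guillemotleft>X : \<rho> \<rightarrow> \<sigma>\<guillemotright> \<longleftrightarrow> \<rho> \<in> Obj C \<and> \<sigma> \<in> Obj C \<and> X \<in> Hom C \<rho> \<sigma>"

lemma in_homI: "\<lbrakk>\<rho> \<in> Obj C; \<sigma> \<in> Obj C; X \<in> Hom C \<rho> \<sigma>\<rbrakk> \<Longrightarrow> \<guillemotleft>X : \<rho> \<rightarrow> \<sigma>\<guillemotright>"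
  by (simp add: in_hom_def)

lemma in_homD: assumes "\<guillemotleft>X : \<rho> \<rightarrow> \<sigma>\<guillemotright>" shows "\<rho> \<in> Obj C" "\<sigma> \<in> Obj C" "X \<in> Hom C \<rho> \<sigma>"
  using assms by (simp_all add: in_hom_def)

lemma hom_ide: "\<rho> \<in> Obj C \<Longrightarrow> \<guillemotleft>ide C \<rho> : \<rho> \<rightarrow> \<rho>\<guillemotright>"
  and hom_cmp: "\<lbrakk>\<guillemotleft>X : \<sigma> \<rightarrow> \<tau>\<guillemotright>; \<guillemotleft>Y : \<rho> \<rightarrow> \<sigma>\<guillemotright>\<rbrakk> \<Longrightarrow> \<guillemotleft>X \<cdot> Y : \<rho> \<rightarrow> \<tau>\<guillemotright>"
  and hom_adj: "\<guillemotleft>X : \<rho> \<rightarrow> \<sigma>\<guillemotright> \<Longrightarrow> \<guillemotleft>adj C X : \<sigma> \<rightarrow> \<rho>\<guillemotright>"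
  and hom_zero: "\<lbrakk>\<rho> \<in> Obj C; \<sigma> \<in> Obj C\<rbrakk> \<Longrightarrow> \<guillemotleft>0 : \<rho> \<rightarrow> \<sigma>\<guillemotright>"
  and hom_add: "\<lbrakk>\<guillemotleft>X : \<rho> \<rightarrow> \<sigma>\<guillemotright>; \<guillemotleft>Y : \<rho> \<rightarrow> \<sigma>\<guillemotright>\<rbrakk> \<Longrightarrow> \<guillemotleft>X + Y : \<rho> \<rightarrow> \<sigma>\<guillemotright>"
  and hom_scl: "\<guillemotleft>X : \<rho> \<rightarrow> \<sigma>\<guillemotright> \<Longrightarrow> \<guillemotleft>scl C z X : \<rho> \<rightarrow> \<sigma>\<guillemotright>"
  by (simp_all add: in_hom_def ide_Hom cmp_Hom[of \<rho> \<sigma> \<tau>] adj_Hom[of \<rho> \<sigma>] Hom_subspace[of \<rho> \<sigma>] V.subspace_0 V.subspace_add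
      V.subspace_scale)

lemma hom_sum:
  assumes "\<rho> \<in> Obj C" "\<sigma> \<in> Obj C" "\<And>i. i \<in> I \<Longrightarrow> \<guillemotleft>f i : \<rho> \<rightarrow> \<sigma>\<guillemotright>"
  shows "\<guillemotleft>sum f I : \<rho> \<rightarrow> \<sigma>\<guillemotright>"
  using assms by (induction I rule: infinite_finite_induct) (auto intro: hom_zero hom_add)

lemma assoc:
  "\<lbrakk>\<guillemotleft>X : \<tau> \<rightarrow> \<upsilon>\<guillemotright>; \<guillemotleft>Y : \<sigma> \<rightarrow> \<tau>\<guillemotright>; \<guillemotleft>Z : \<rho> \<rightarrow> \<sigma>\<guillemotright>\<rbrakk> \<Longrightarrow> (X \<cdot> Y) \<cdot> Z = X \<cdot> (Y \<cdot> Z)"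
  and ide_left: "\<guillemotleft>X : \<rho> \<rightarrow> \<sigma>\<guillemotright> \<Longrightarrow> ide C \<sigma> \<cdot> X = X"
  and ide_right: "\<guillemotleft>X : \<rho> \<rightarrow> \<sigma>\<guillemotright> \<Longrightarrow> X \<cdot> ide C \<rho> = X"
  and add_cmp: "\<lbrakk>\<guillemotleft>X : \<sigma> \<rightarrow> \<tau>\<guillemotright>; \<guillemotleft>X' : \<sigma> \<rightarrow> \<tau>\<guillemotright>; \<guillemotleft>Y : \<rho> \<rightarrow> \<sigma>\<guillemotright>\<rbrakk>
    \<Longrightarrow> (X + X') \<cdot> Y = X \<cdot> Y + X' \<cdot> Y"
  and cmp_add': "\<lbrakk>\<guillemotleft>X : \<sigma> \<rightarrow> \<tau>\<guillemotright>; \<guillemotleft>Y : \<rho> \<rightarrow> \<sigma>\<guillemotright>; \<guillemotleft>Y' : \<rho> \<rightarrow> \<sigma>\<guillemotright>\<rbrakk>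
    \<Longrightarrow> X \<cdot> (Y + Y') = X \<cdot> Y + X \<cdot> Y'"
  and scl_cmp: "\<lbrakk>\<guillemotleft>X : \<sigma> \<rightarrow> \<tau>\<guillemotright>; \<guillemotleft>Y : \<rho> \<rightarrow> \<sigma>\<guillemotright>\<rbrakk> \<Longrightarrow> scl C z X \<cdot> Y = scl C z (X \<cdot> Y)"
  and cmp_scl': "\<lbrakk>\<guillemotleft>X : \<sigma> \<rightarrow> \<tau>\<guillemotright>; \<guillemotleft>Y : \<rho> \<rightarrow> \<sigma>\<guillemotright>\<rbrakk> \<Longrightarrow> X \<cdot> scl C z Y = scl C z (X \<cdot> Y)"
  and star_cmp: "\<lbrakk>\<guillemotleft>X : \<sigma> \<rightarrow> \<tau>\<guillemotright>; \<guillemotleft>Y : \<rho> \<rightarrow> \<sigma>\<guillemotright>\<rbrakk> \<Longrightarrow> adj C (X \<cdot> Y) = adj C Y \<cdot> adj C X"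
  and star_star: "\<guillemotleft>X : \<rho> \<rightarrow> \<sigma>\<guillemotright> \<Longrightarrow> adj C (adj C X) = X"
  and star_add: "\<lbrakk>\<guillemotleft>X : \<rho> \<rightarrow> \<sigma>\<guillemotright>; \<guillemotleft>Y : \<rho> \<rightarrow> \<sigma>\<guillemotright>\<rbrakk> \<Longrightarrow> adj C (X + Y) = adj C X + adj C Y"
  and star_scl: "\<guillemotleft>X : \<rho> \<rightarrow> \<sigma>\<guillemotright> \<Longrightarrow> adj C (scl C z X) = scl C (cnj z) (adj C X)"
  and positive: "\<lbrakk>\<guillemotleft>X : \<rho> \<rightarrow> \<sigma>\<guillemotright>; adj C X \<cdot> X = 0\<rbrakk> \<Longrightarrow> X = 0"
  by (simp_all add: in_hom_def cmp_assoc[of \<rho> \<sigma> \<tau> \<upsilon>] cmp_ide[of \<rho> \<sigma>] cmp_add[of \<rho> \<sigma> \<tau>]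
      cmp_scl[of \<rho> \<sigma> \<tau>] adj_cmp[of \<rho> \<sigma> \<tau>] adj_adj[of \<rho> \<sigma>] adj_add[of \<rho> \<sigma>] adj_scl[of \<rho> \<sigma>]
      adj_positive[of \<rho> \<sigma>])

lemma zero_cmp: assumes "\<guillemotleft>Y : \<rho> \<rightarrow> \<sigma>\<guillemotright>" "\<tau> \<in> Obj C" shows "0 \<cdot> Y = 0"
  using scl_cmp[OF hom_zero[OF in_homD(2)[OF assms(1)] assms(2)] assms(1), of 0] by simp

lemma cmp_zero: assumes "\<guillemotleft>X : \<sigma> \<rightarrow> \<tau>\<guillemotright>" "\<rho> \<in> Obj C" shows "X \<cdot> 0 = 0"
  using cmp_scl'[OF assms(1) hom_zero[OF assms(2) in_homD(1)[OF assms(1)]], of 0] by simp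

lemma star_zero: assumes "\<rho> \<in> Obj C" shows "adj C 0 = 0"
  using star_scl[OF hom_zero[OF assms assms], of 0] by simp

lemma star_ide: assumes "\<rho> \<in> Obj C" shows "adj C (ide C \<rho>) = ide C \<rho>"
  using star_cmp[OF hom_adj[OF hom_ide] hom_ide, OF assms assms] star_star[OF hom_ide[OF assms]]
    ide_right[OF hom_adj[OF hom_ide[OF assms]]] by simp

lemma sum_cmp:
  assumes "\<guillemotleft>Y : \<rho> \<rightarrow> \<sigma>\<guillemotright>" "\<tau> \<in> Obj C" "\<And>i. i \<in> I \<Longrightarrow> \<guillemotleft>f i : \<sigma> \<rightarrow> \<tau>\<guillemotright>"
  shows "sum f I \<cdot> Y = (\<Sum>i\<in>I. f i \<cdot> Y)"
  using assms(3)
proof (induction I rule: infinite_finite_induct)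
  case (insert i I)
  then show ?case
    using add_cmp[of "f i" \<sigma> \<tau> "sum f I" Y \<rho>] hom_sum[of \<sigma> \<tau> I f] assms(1,2) in_homD[OF assms(1)]
    by simp
qed (simp_all add: zero_cmp[OF assms(1,2)])

lemma cmp_sum:
  assumes "\<guillemotleft>X : \<sigma> \<rightarrow> \<tau>\<guillemotright>" "\<rho> \<in> Obj C" "\<And>i. i \<in> I \<Longrightarrow> \<guillemotleft>f i : \<rho> \<rightarrow> \<sigma>\<guillemotright>"
  shows "X \<cdot> sum f I = (\<Sum>i\<in>I. X \<cdot> f i)"
  using assms(3)
proof (induction I rule: infinite_finite_induct)
  case (insert i I)
  then show ?case
    using cmp_add'[of X \<sigma> \<tau> "f i" \<rho> "sum f I"] hom_sum[of \<rho> \<sigma> I f] assms(1,2) in_homD[OF assms(1)]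
    by simp
qed (simp_all add: cmp_zero[OF assms(1,2)])

subsection \<open>Isomorphism and irreducibility\<close>

lemma isomorphicI:
  "\<lbrakk>\<guillemotleft>X : \<rho> \<rightarrow> \<sigma>\<guillemotright>; \<guillemotleft>Y : \<sigma> \<rightarrow> \<rho>\<guillemotright>; Y \<cdot> X = ide C \<rho>; X \<cdot> Y = ide C \<sigma>\<rbrakk> \<Longrightarrow> isomorphic_obj C \<rho> \<sigma>"
  unfolding isomorphic_obj_def in_hom_def by (elim conjE) (intro bexI[of _ X] bexI[of _ Y] conjI)

lemma isomorphicE:
  assumes "isomorphic_obj C \<rho> \<sigma>" "\<rho> \<in> Obj C" "\<sigma> \<in> Obj C"
  obtains X Y where "\<guillemotleft>X : \<rho> \<rightarrow> \<sigma>\<guillemotright>" "\<guillemotleft>Y : \<sigma> \<rightarrow> \<rho>\<guillemotright>" "Y \<cdot> X = ide C \<rho>" "X \<cdot> Y = ide C \<sigma>"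
proof -
  obtain X Y where "X \<in> Hom C \<rho> \<sigma>" "Y \<in> Hom C \<sigma> \<rho>" "Y \<cdot> X = ide C \<rho>" "X \<cdot> Y = ide C \<sigma>"
    using assms(1) unfolding isomorphic_obj_def by (elim bexE conjE)
  then show ?thesis using assms(2,3) by (intro that[of X Y]) (simp_all add: in_hom_def)
qed

lemma isomorphic_refl: "\<rho> \<in> Obj C \<Longrightarrow> isomorphic_obj C \<rho> \<rho>"
  by (rule isomorphicI[OF hom_ide hom_ide]) (simp_all add: ide_left[OF hom_ide])

lemma isomorphic_sym: "isomorphic_obj C \<rho> \<sigma> \<Longrightarrow> isomorphic_obj C \<sigma> \<rho>"
  by (auto simp: isomorphic_obj_def)

lemma isomorphic_trans:
  assumes "isomorphic_obj C \<rho> \<sigma>" "isomorphic_obj C \<sigma> \<tau>" and O: "\<rho> \<in> Obj C" "\<sigma> \<in> Obj C" "\<tau> \<in> Obj C"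
  shows "isomorphic_obj C \<rho> \<tau>"
proof -
  obtain X Y where X: "\<guillemotleft>X : \<rho> \<rightarrow> \<sigma>\<guillemotright>" and Y: "\<guillemotleft>Y : \<sigma> \<rightarrow> \<rho>\<guillemotright>" and YX: "Y \<cdot> X = ide C \<rho>" "X \<cdot> Y = ide C \<sigma>"
    by (rule isomorphicE[OF assms(1) O(1,2)])
  obtain X' Y' where X': "\<guillemotleft>X' : \<sigma> \<rightarrow> \<tau>\<guillemotright>" and Y': "\<guillemotleft>Y' : \<tau> \<rightarrow> \<sigma>\<guillemotright>" and YX': "Y' \<cdot> X' = ide C \<sigma>" "X' \<cdot> Y' = ide C \<tau>"
    by (rule isomorphicE[OF assms(2) O(2,3)])
  have "(Y \<cdot> Y') \<cdot> (X' \<cdot> X) = Y \<cdot> ((Y' \<cdot> X') \<cdot> X)"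
    by (simp add: assoc[OF Y Y' hom_cmp[OF X' X]] assoc[OF Y' X' X])
  moreover have "(X' \<cdot> X) \<cdot> (Y \<cdot> Y') = X' \<cdot> ((X \<cdot> Y) \<cdot> Y')"
    by (simp add: assoc[OF X' X hom_cmp[OF Y Y']] assoc[OF X Y Y'])
  ultimately show ?thesis
    by (intro isomorphicI[OF hom_cmp[OF X' X] hom_cmp[OF Y Y']])
      (simp_all add: YX YX' ide_left[OF X] ide_left[OF Y'])
qed

lemma iso_class_eq_iff:
  assumes "\<rho> \<in> Obj C" "\<sigma> \<in> Obj C"
  shows "iso_class C \<rho> = iso_class C \<sigma> \<longleftrightarrow> isomorphic_obj C \<rho> \<sigma>"
proof
  assume "iso_class C \<rho> = iso_class C \<sigma>"
  moreover have "\<sigma> \<in> iso_class C \<sigma>" using isomorphic_refl assms by (simp add: iso_class_def)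
  ultimately show "isomorphic_obj C \<rho> \<sigma>" by (auto simp: iso_class_def)
next
  assume iso: "isomorphic_obj C \<rho> \<sigma>"
  have "isomorphic_obj C \<rho> \<tau> \<longleftrightarrow> isomorphic_obj C \<sigma> \<tau>" if "\<tau> \<in> Obj C" for \<tau>
    using isomorphic_trans[OF iso, of \<tau>] isomorphic_trans[OF isomorphic_sym[OF iso], of \<tau>] assms that by blast
  then show "iso_class C \<rho> = iso_class C \<sigma>" by (auto simp: iso_class_def)
qed

lemma irreducibleD:
  assumes "irreducible_obj C \<rho>"
  shows "\<rho> \<in> Obj C" "ide C \<rho> \<noteq> 0" "\<guillemotleft>X : \<rho> \<rightarrow> \<rho>\<guillemotright> \<Longrightarrow> \<exists>z. X = scl C z (ide C \<rho>)"
  using assms by (auto simp: irreducible_obj_def in_hom_def)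

lemma irreducibleI:
  assumes "\<rho> \<in> Obj C" "ide C \<rho> \<noteq> 0" "\<And>X. \<guillemotleft>X : \<rho> \<rightarrow> \<rho>\<guillemotright> \<Longrightarrow> \<exists>z. X = scl C z (ide C \<rho>)"
  shows "irreducible_obj C \<rho>"
  unfolding irreducible_obj_def
  using assms hom_scl[OF hom_ide[OF assms(1)]] by (auto simp: in_hom_def)

lemma irreducible_iso:
  assumes "isomorphic_obj C \<rho> \<sigma>" "irreducible_obj C \<rho>" "\<sigma> \<in> Obj C"
  shows "irreducible_obj C \<sigma>"
proof -
  note \<rho> = irreducibleD(1)[OF assms(2)]
  obtain X Y where X: "\<guillemotleft>X : \<rho> \<rightarrow> \<sigma>\<guillemotright>" and Y: "\<guillemotleft>Y : \<sigma> \<rightarrow> \<rho>\<guillemotright>" and YX: "Y \<cdot> X = ide C \<rho>" "X \<cdot> Y = ide C \<sigma>"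
    by (rule isomorphicE[OF assms(1) \<rho> assms(3)])
  show ?thesis
  proof (rule irreducibleI)
    show "ide C \<sigma> \<noteq> 0"
    proof
      assume "ide C \<sigma> = 0"
      then have "X = 0" using ide_left[OF X] zero_cmp[OF X assms(3)] by simp
      then show False using YX(1) cmp_zero[OF Y \<rho>] irreducibleD(2)[OF assms(2)] by simp
    qed
    fix Z assume Z: "\<guillemotleft>Z : \<sigma> \<rightarrow> \<sigma>\<guillemotright>"
    obtain a where a: "Y \<cdot> (Z \<cdot> X) = scl C a (ide C \<rho>)"
      using irreducibleD(3)[OF assms(2) hom_cmp[OF Y hom_cmp[OF Z X]]] by blast
    have "Z = (X \<cdot> Y) \<cdot> (Z \<cdot> (X \<cdot> Y))" by (simp add: YX ide_left[OF Z] ide_right[OF Z])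
    also have "\<dots> = X \<cdot> ((Y \<cdot> (Z \<cdot> X)) \<cdot> Y)"
      by (simp add: assoc[OF X Y hom_cmp[OF Z hom_cmp[OF X Y]]]
          assoc[OF Y hom_cmp[OF Z X] Y] assoc[OF Z X Y])
    also have "\<dots> = scl C a (ide C \<sigma>)"
      by (simp add: a scl_cmp[OF hom_ide[OF \<rho>] Y] ide_left[OF Y] cmp_scl'[OF X Y] YX)
    finally show "\<exists>z. Z = scl C z (ide C \<sigma>)" by blast
  qed (rule assms(3))
qed

lemma schur:
  assumes \<rho>: "irreducible_obj C \<rho>" and \<sigma>: "irreducible_obj C \<sigma>" and X: "\<guillemotleft>X : \<rho> \<rightarrow> \<sigma>\<guillemotright>" "X \<noteq> 0"
  shows "isomorphic_obj C \<rho> \<sigma>"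
proof -
  note X' = hom_adj[OF X(1)]
  obtain a where a: "adj C X \<cdot> X = scl C a (ide C \<rho>)"
    using irreducibleD(3)[OF \<rho> hom_cmp[OF X' X(1)]] by blast
  obtain b where b: "X \<cdot> adj C X = scl C b (ide C \<sigma>)"
    using irreducibleD(3)[OF \<sigma> hom_cmp[OF X(1) X']] by blast
  have a0: "a \<noteq> 0" using positive[OF X(1)] X(2) a by auto
  have "scl C b X = (X \<cdot> adj C X) \<cdot> X"
    by (simp add: b scl_cmp[OF hom_ide[OF irreducibleD(1)[OF \<sigma>]] X(1)] ide_left[OF X(1)])
  also have "\<dots> = scl C a X"
    by (simp add: assoc[OF X(1) X' X(1)] a cmp_scl'[OF X(1) hom_ide[OF irreducibleD(1)[OF \<rho>]]]
        ide_right[OF X(1)])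
  finally have "b = a" using X(2) by simp
  then show ?thesis
    by (intro isomorphicI[OF X(1) hom_scl[OF X', of "1 / a"]])
      (simp_all add: scl_cmp[OF X' X(1)] cmp_scl'[OF X(1) X'] a b a0)
qed

lemma isometryD: assumes "isometry C \<rho> \<sigma> V" "\<rho> \<in> Obj C" "\<sigma> \<in> Obj C"
  shows "\<guillemotleft>V : \<rho> \<rightarrow> \<sigma>\<guillemotright>" "\<guillemotleft>adj C V : \<sigma> \<rightarrow> \<rho>\<guillemotright>" "adj C V \<cdot> V = ide C \<rho>"
  using assms by (auto simp: isometry_def in_hom_def adj_Hom)

lemma endomorphism_algebra:
  assumes "\<rho> \<in> Obj C" "finite B" "Hom C \<rho> \<rho> \<subseteq> module.span (scl C) B"
  shows "star_algebra (scl C) (Hom C \<rho> \<rho>) (cmp C) (adj C) (ide C \<rho>)"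
proof
  show "V.subspace (Hom C \<rho> \<rho>)" using assms(1) by (rule Hom_subspace[OF _ assms(1)])
qed (use assms in \<open>auto simp: ide_Hom cmp_Hom cmp_assoc cmp_ide cmp_add cmp_scl adj_Hom adj_adj
  adj_add adj_scl adj_cmp intro: adj_positive\<close>)

text \<open>A sum of positive endomorphisms is positive: take the arrow into the direct sum with the
  given components.\<close>

lemma sum_positive_zero:
  assumes sums: "\<And>\<rho>1 \<rho>2. \<rho>1 \<in> Obj C \<Longrightarrow> \<rho>2 \<in> Obj C \<Longrightarrow> \<exists>\<tau>\<in>Obj C. is_direct_sum C \<rho>1 \<rho>2 \<tau>"
    and \<rho>: "\<rho> \<in> Obj C" and I: "finite I" and y: "\<And>i. i \<in> I \<Longrightarrow> \<guillemotleft>y i : \<rho> \<rightarrow> \<sigma> i\<guillemotright>"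
    and zero: "(\<Sum>i\<in>I. adj C (y i) \<cdot> y i) = 0" and i: "i \<in> I"
  shows "y i = 0"
proof -
  have add: "\<exists>\<tau> Z. \<guillemotleft>Z : \<rho> \<rightarrow> \<tau>\<guillemotright> \<and> adj C Z \<cdot> Z = adj C X \<cdot> X + adj C Y \<cdot> Y \<and> (Z = 0 \<longrightarrow> X = 0)"
    if X: "\<guillemotleft>X : \<rho> \<rightarrow> \<sigma>1\<guillemotright>" and Y: "\<guillemotleft>Y : \<rho> \<rightarrow> \<sigma>2\<guillemotright>" for X Y \<sigma>1 \<sigma>2
  proof -
    note O = in_homD(2)[OF X] in_homD(2)[OF Y]
    obtain \<tau> V W where \<tau>: "\<tau> \<in> Obj C" and iV: "isometry C \<sigma>1 \<tau> V" and iW: "isometry C \<sigma>2 \<tau> W"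
      and VW: "V \<cdot> adj C V + W \<cdot> adj C W = ide C \<tau>"
      using sums[OF O] by (auto simp: is_direct_sum_def)
    note V = isometryD[OF iV O(1) \<tau>] and W = isometryD[OF iW O(2) \<tau>]
    \<comment> \<open>Orthogonality: this chain reads \<open>V\<^sup>* W = V\<^sup>* W + V\<^sup>* W\<close>.\<close>
    have "adj C V \<cdot> W = adj C V \<cdot> ((V \<cdot> adj C V + W \<cdot> adj C W) \<cdot> W)"
      by (simp add: VW ide_left[OF W(1)])
    also have "(V \<cdot> adj C V + W \<cdot> adj C W) \<cdot> W = V \<cdot> (adj C V \<cdot> W) + W"
      by (simp add: add_cmp[OF hom_cmp[OF V(1,2)] hom_cmp[OF W(1,2)] W(1)]
          assoc[OF V(1,2) W(1)] assoc[OF W(1,2,1)] W(3) ide_right[OF W(1)])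
    also have "adj C V \<cdot> \<dots> = adj C V \<cdot> W + adj C V \<cdot> W"
      by (simp add: cmp_add'[OF V(2) hom_cmp[OF V(1) hom_cmp[OF V(2) W(1)]] W(1)]
          assoc[OF V(2,1) hom_cmp[OF V(2) W(1)], symmetric] V(3) ide_left[OF hom_cmp[OF V(2) W(1)]])
    finally have vw: "adj C V \<cdot> W = 0" by simp
    have wv: "adj C W \<cdot> V = 0"
      using arg_cong[OF vw, of "adj C"] by (simp add: star_cmp[OF V(2) W(1)] star_star[OF V(1)] star_zero[OF \<tau>])
    note VX = hom_cmp[OF V(1) X] and WY = hom_cmp[OF W(1) Y]
    define Z where "Z = V \<cdot> X + W \<cdot> Y"
    have Z: "\<guillemotleft>Z : \<rho> \<rightarrow> \<tau>\<guillemotright>" unfolding Z_def by (intro hom_add VX WY)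
    have VZ: "adj C V \<cdot> Z = X"
      unfolding Z_def
      by (simp add: cmp_add'[OF V(2) VX WY] V(3) vw ide_left[OF X] zero_cmp[OF Y O(1)]
          flip: assoc[OF V(2,1) X] assoc[OF V(2) W(1) Y])
    have WZ: "adj C W \<cdot> Z = Y"
      unfolding Z_def
      by (simp add: cmp_add'[OF W(2) VX WY] W(3) wv ide_left[OF Y] zero_cmp[OF X O(2)]
          flip: assoc[OF W(2) V(1) X] assoc[OF W(2,1) Y])
    have "adj C Z = adj C X \<cdot> adj C V + adj C Y \<cdot> adj C W"
      unfolding Z_def by (simp add: star_add[OF VX WY] star_cmp[OF V(1) X] star_cmp[OF W(1) Y])
    then have "adj C Z \<cdot> Z = adj C X \<cdot> X + adj C Y \<cdot> Y"
      by (simp add: add_cmp[OF hom_cmp[OF hom_adj[OF X] V(2)] hom_cmp[OF hom_adj[OF Y] W(2)] Z]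
          assoc[OF hom_adj[OF X] V(2) Z] assoc[OF hom_adj[OF Y] W(2) Z] VZ WZ)
    moreover have "Z = 0 \<longrightarrow> X = 0" using VZ cmp_zero[OF V(2) \<rho>] by auto
    ultimately show ?thesis using Z by blast
  qed
  have "\<exists>\<tau> Z. \<guillemotleft>Z : \<rho> \<rightarrow> \<tau>\<guillemotright> \<and> adj C Z \<cdot> Z = (\<Sum>j\<in>J. adj C (y j) \<cdot> y j)" if "finite J" "J \<subseteq> I" for J
    using that
  proof (induction J)
    case empty
    then show ?case
      using hom_zero[OF \<rho> \<rho>] cmp_zero[OF hom_adj[OF hom_zero[OF \<rho> \<rho>]] \<rho>] by auto
  next
    case (insert j J)
    then obtain \<tau> Z where Z: "\<guillemotleft>Z : \<rho> \<rightarrow> \<tau>\<guillemotright>" "adj C Z \<cdot> Z = (\<Sum>j\<in>J. adj C (y j) \<cdot> y j)" by auto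
    then show ?case using add[OF y[of j] Z(1)] insert by auto
  qed
  from this[of "I - {i}"] obtain \<tau> Z where Z: "\<guillemotleft>Z : \<rho> \<rightarrow> \<tau>\<guillemotright>"
    "adj C Z \<cdot> Z = (\<Sum>j\<in>I - {i}. adj C (y j) \<cdot> y j)"
    using I by auto
  with add[OF y[OF i] Z(1)] obtain \<tau>' Z' where Z': "\<guillemotleft>Z' : \<rho> \<rightarrow> \<tau>'\<guillemotright>"
    "adj C Z' \<cdot> Z' = (\<Sum>j\<in>I. adj C (y j) \<cdot> y j)" "Z' = 0 \<longrightarrow> y i = 0"
    using I i by (auto simp: sum.remove[of I i])
  then show ?thesis using positive[OF Z'(1)] zero by simp
qed

text \<open>The range of a minimal projection of \<open>End \<sigma>\<close> is irreducible.\<close>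

lemma decomposition_into_irreducibles:
  assumes subobjects: "\<And>\<rho> E. \<rho> \<in> Obj C \<Longrightarrow> projection C \<rho> E \<Longrightarrow> \<exists>\<sigma>\<in>Obj C. \<exists>V. isometry C \<sigma> \<rho> V \<and> V \<cdot> adj C V = E"
    and \<sigma>: "\<sigma> \<in> Obj C" and B: "finite B" "Hom C \<sigma> \<sigma> \<subseteq> module.span (scl C) B"
  shows "\<exists>(P::'a set) \<rho> V. finite P \<and> (\<forall>p\<in>P. irreducible_obj C (\<rho> p) \<and> isometry C (\<rho> p) \<sigma> (V p)) \<and>
    (\<Sum>p\<in>P. V p \<cdot> adj C (V p)) = ide C \<sigma>"
proof (cases "ide C \<sigma> = 0")
  case True
  then show ?thesis by (intro exI[of _ "{}"]) simp
next
  case False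
  interpret E: star_algebra "scl C" "Hom C \<sigma> \<sigma>" "cmp C" "adj C" "ide C \<sigma>"
    by (rule endomorphism_algebra[OF \<sigma> B])
  obtain P where P: "E.orth_decomp (ide C \<sigma>) P" and mP: "\<And>p. p \<in> P \<Longrightarrow> E.minimal_proj p"
    using E.minimal_decomposition[OF E.proj_e False] by auto
  have "\<exists>\<rho> V. irreducible_obj C \<rho> \<and> isometry C \<rho> \<sigma> V \<and> V \<cdot> adj C V = p" if pP: "p \<in> P" for p
  proof -
    note p = E.minimal_projD[OF mP[OF pP]]
    then have "projection C \<sigma> p" by (simp add: projection_def)
    then obtain \<rho> V where \<rho>: "\<rho> \<in> Obj C" and iV: "isometry C \<rho> \<sigma> V" and VV: "V \<cdot> adj C V = p"
      using subobjects[OF \<sigma>] by blast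
    note V = isometryD[OF iV \<rho> \<sigma>]
    have "irreducible_obj C \<rho>"
    proof (rule irreducibleI[OF \<rho>])
      show "ide C \<rho> \<noteq> 0"
      proof
        assume "ide C \<rho> = 0"
        then have "V = 0" using ide_right[OF V(1)] cmp_zero[OF V(1) \<rho>] by simp
        then show False using VV zero_cmp[OF V(2) \<sigma>] p(5) by simp
      qed
      fix X assume X: "\<guillemotleft>X : \<rho> \<rightarrow> \<rho>\<guillemotright>"
      note XV = hom_cmp[OF X V(2)] and VX = hom_cmp[OF V(1) X]
      have VXV: "\<guillemotleft>V \<cdot> (X \<cdot> adj C V) : \<sigma> \<rightarrow> \<sigma>\<guillemotright>" by (rule hom_cmp[OF V(1) XV])
      obtain a where a: "p \<cdot> (V \<cdot> (X \<cdot> adj C V)) \<cdot> p = scl C a p"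
        using mP[OF pP] in_homD(3)[OF VXV] by (auto simp: E.minimal_proj_def)
      have Vp: "adj C V \<cdot> p = adj C V" and pV: "p \<cdot> V = V"
        by (simp_all add: assoc[OF V(2,1,2), symmetric] assoc[OF V(1,2,1)] V(3) ide_left[OF V(2)]
            ide_right[OF V(1)] flip: VV)
      have pp: "\<guillemotleft>p : \<sigma> \<rightarrow> \<sigma>\<guillemotright>" using p \<sigma> by (simp add: in_hom_def)
      have pVXV: "p \<cdot> (V \<cdot> (X \<cdot> adj C V)) = V \<cdot> (X \<cdot> adj C V)"
        by (simp add: pV flip: assoc[OF pp V(1) XV])
      have VXVp: "V \<cdot> (X \<cdot> adj C V) \<cdot> p = V \<cdot> (X \<cdot> adj C V)"
        by (simp add: assoc[OF V(1) XV pp] assoc[OF X V(2) pp] Vp)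
      have "X = (adj C V \<cdot> V) \<cdot> (X \<cdot> (adj C V \<cdot> V))"
        by (simp add: V(3) ide_left[OF X] ide_right[OF X])
      also have "\<dots> = adj C V \<cdot> ((V \<cdot> (X \<cdot> adj C V)) \<cdot> V)"
        by (simp add: assoc[OF V(2,1) hom_cmp[OF X hom_cmp[OF V(2,1)]]] assoc[OF V(1) XV V(1)] assoc[OF X V(2,1)])
      also have "V \<cdot> (X \<cdot> adj C V) = scl C a p" using a by (simp only: pVXV VXVp)
      also have "adj C V \<cdot> (scl C a p \<cdot> V) = scl C a (ide C \<rho>)"
        by (simp add: scl_cmp[OF pp V(1)] pV cmp_scl'[OF V(2,1)] V(3))
      finally show "\<exists>z. X = scl C z (ide C \<rho>)" by blast
    qed
    then show ?thesis using iV VV by blast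
  qed
  then obtain \<rho> V where "\<And>p. p \<in> P \<Longrightarrow> irreducible_obj C (\<rho> p) \<and> isometry C (\<rho> p) \<sigma> (V p) \<and> V p \<cdot> adj C (V p) = p"
    by metis
  then show ?thesis using P by (intro exI[of _ P] exI[of _ \<rho>] exI[of _ V]) (simp add: E.orth_decomp_def)
qed

end

subsection \<open>Closure under subobjects\<close>

lemma subobject_closure_simps [simp]:
  "Obj (subobject_closure A) = {(\<rho>, E). \<rho> \<in> Obj A \<and> projection A \<rho> E}"
  "ide (subobject_closure A) p = snd p"
  "cmp (subobject_closure A) = cmp A"
  "scl (subobject_closure A) = scl A"
  "adj (subobject_closure A) = adj A"
  by (simp_all add: subobject_closure_def case_prod_unfold)

lemma (in star_category) projectionD:
  assumes "projection C \<rho> E" "\<rho> \<in> Obj C"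
  shows "\<guillemotleft>E : \<rho> \<rightarrow> \<rho>\<guillemotright>" "E \<cdot> E = E" "adj C E = E"
  using assms by (simp_all add: projection_def in_hom_def)

lemma Hom_subobject_closure:
  fixes A :: "('o, 'a::ab_group_add) tensor_star_cat"
  assumes "star_category A" "(\<rho>, E) \<in> Obj (subobject_closure A)" "(\<sigma>, E') \<in> Obj (subobject_closure A)"
  shows "X \<in> Hom (subobject_closure A) (\<rho>, E) (\<sigma>, E') \<longleftrightarrow>
    X \<in> Hom A \<rho> \<sigma> \<and> E' \<cdot>\<^bsub>A\<^esub> X = X \<and> X \<cdot>\<^bsub>A\<^esub> E = X"
proof -
  interpret star_category A by fact
  have O: "\<rho> \<in> Obj A" "\<sigma> \<in> Obj A" and pE: "projection A \<rho> E" and pE': "projection A \<sigma> E'"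
    using assms(2,3) by auto
  note E = projectionD[OF pE O(1)] and E' = projectionD[OF pE' O(2)]
  have "E' \<cdot>\<^bsub>A\<^esub> Y \<cdot>\<^bsub>A\<^esub> E \<in> Hom A \<rho> \<sigma> \<and> E' \<cdot>\<^bsub>A\<^esub> (E' \<cdot>\<^bsub>A\<^esub> Y \<cdot>\<^bsub>A\<^esub> E) = E' \<cdot>\<^bsub>A\<^esub> Y \<cdot>\<^bsub>A\<^esub> E \<and>
    (E' \<cdot>\<^bsub>A\<^esub> Y \<cdot>\<^bsub>A\<^esub> E) \<cdot>\<^bsub>A\<^esub> E = E' \<cdot>\<^bsub>A\<^esub> Y \<cdot>\<^bsub>A\<^esub> E" if "Y \<in> Hom A \<rho> \<sigma>" for Y
  proof -
    have Y: "in_hom Y \<rho> \<sigma>" using that O by (simp add: in_hom_def)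
    note E'Y = hom_cmp[OF E'(1) Y] and YE = hom_cmp[OF Y E(1)]
    show ?thesis
      using in_homD(3)[OF hom_cmp[OF E'Y E(1)]]
      by (simp add: assoc[OF E'Y E(1) E(1)] E(2) assoc[OF E'(1) E'(1) E'Y, symmetric]
          assoc[OF E'(1) E'Y E(1), symmetric] assoc[OF E'(1) E'(1) Y, symmetric] E'(2))
  qed
  then show ?thesis
    by (auto simp: subobject_closure_def) metis
qed

lemma star_category_subobject_closure:
  fixes A :: "('o, 'a::ab_group_add) tensor_star_cat"
  assumes "star_category A"
  shows "star_category (subobject_closure A)"
proof -
  interpret star_category A by fact
  interpret V: vector_space "scl A" by (rule vs)
  let ?B = "subobject_closure A"
  have O: "fst p \<in> Obj A" and P: "projection A (fst p) (snd p)" if "p \<in> Obj ?B" for p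
    using that by (auto split: prod.splits)
  have H: "X \<in> Hom ?B p q \<longleftrightarrow> X \<in> Hom A (fst p) (fst q) \<and> snd q \<cdot>\<^bsub>A\<^esub> X = X \<and> X \<cdot>\<^bsub>A\<^esub> snd p = X"
    if "p \<in> Obj ?B" "q \<in> Obj ?B" for X p q
    using Hom_subobject_closure[OF assms, of "fst p" "snd p" "fst q" "snd q" X] that by simp
  have h: "in_hom X (fst p) (fst q)" "snd q \<cdot>\<^bsub>A\<^esub> X = X" "X \<cdot>\<^bsub>A\<^esub> snd p = X"
    if "X \<in> Hom ?B p q" "p \<in> Obj ?B" "q \<in> Obj ?B" for X p q
    using that(1) O[OF that(2)] O[OF that(3)] by (simp_all add: H[OF that(2,3)] in_hom_def)
  have e: "in_hom (snd p) (fst p) (fst p)" "snd p \<cdot>\<^bsub>A\<^esub> snd p = snd p" "adj A (snd p) = snd p"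
    if "p \<in> Obj ?B" for p
    using projectionD[OF P[OF that] O[OF that]] by simp_all
  have I: "X \<in> Hom ?B p q" if "in_hom X (fst p) (fst q)" "snd q \<cdot>\<^bsub>A\<^esub> X = X" "X \<cdot>\<^bsub>A\<^esub> snd p = X"
    "p \<in> Obj ?B" "q \<in> Obj ?B" for X p q
    using that(1-3) by (simp add: H[OF that(4,5)] in_hom_def)
  show ?thesis
  proof (rule star_category.intro, unfold subobject_closure_simps(2-5))
    show "vector_space (scl A)" by (rule vs)
    fix p q assume pq: "p \<in> Obj ?B" "q \<in> Obj ?B"
    note ep = e[OF pq(1)] and eq = e[OF pq(2)]
    show "V.subspace (Hom ?B p q)"
      unfolding V.subspace_def
    proof (intro conjI ballI allI)
      show "0 \<in> Hom ?B p q"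
        using hom_zero[OF O O] zero_cmp[OF ep(1) O] cmp_zero[OF eq(1) O] pq by (intro I) auto
      fix X Y z assume X: "X \<in> Hom ?B p q"
      note hX = h[OF X pq]
      show "scl A z X \<in> Hom ?B p q"
        using hom_scl[OF hX(1)] scl_cmp[OF hX(1) ep(1)] cmp_scl'[OF eq(1) hX(1)] pq hX by (intro I) auto
      assume Y: "Y \<in> Hom ?B p q"
      note hY = h[OF Y pq]
      show "X + Y \<in> Hom ?B p q"
        using hom_add[OF hX(1) hY(1)] add_cmp[OF hX(1) hY(1) ep(1)] cmp_add'[OF eq(1) hX(1) hY(1)] pq hX hY
        by (intro I) auto
    qed
    show "snd p \<in> Hom ?B p p" using ep pq by (intro I)
    fix X assume X: "X \<in> Hom ?B p q"
    note hX = h[OF X pq]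
    show "snd q \<cdot>\<^bsub>A\<^esub> X = X" "X \<cdot>\<^bsub>A\<^esub> snd p = X" by (fact hX)+
    show "adj A X \<in> Hom ?B q p"
      using hom_adj[OF hX(1)] star_cmp[OF eq(1) hX(1)] star_cmp[OF hX(1) ep(1)] hX ep eq pq by (intro I) auto
    show "adj A (adj A X) = X" by (rule star_star[OF hX(1)])
    show "adj A (scl A z X) = scl A (cnj z) (adj A X)" for z by (rule star_scl[OF hX(1)])
    show "X = 0" if "adj A X \<cdot>\<^bsub>A\<^esub> X = 0" by (rule positive[OF hX(1) that])
    show "adj A (X + Y) = adj A X + adj A Y" if Y: "Y \<in> Hom ?B p q" for Y
      by (rule star_add[OF hX(1) h(1)[OF Y pq]])
    fix r assume r: "r \<in> Obj ?B"
    fix Y assume Y: "Y \<in> Hom ?B q r"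
    note hY = h[OF Y pq(2) r]
    show "Y \<cdot>\<^bsub>A\<^esub> X \<in> Hom ?B p r"
      using hom_cmp[OF hY(1) hX(1)] assoc[OF e(1)[OF r] hY(1) hX(1)] assoc[OF hY(1) hX(1) ep(1)] hX hY pq r
      by (intro I) auto
    show "scl A z Y \<cdot>\<^bsub>A\<^esub> X = scl A z (Y \<cdot>\<^bsub>A\<^esub> X)" "Y \<cdot>\<^bsub>A\<^esub> scl A z X = scl A z (Y \<cdot>\<^bsub>A\<^esub> X)" for z
      by (rule scl_cmp[OF hY(1) hX(1)], rule cmp_scl'[OF hY(1) hX(1)])
    show "adj A (Y \<cdot>\<^bsub>A\<^esub> X) = adj A X \<cdot>\<^bsub>A\<^esub> adj A Y" by (rule star_cmp[OF hY(1) hX(1)])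
    show "(Y + Y') \<cdot>\<^bsub>A\<^esub> X = Y \<cdot>\<^bsub>A\<^esub> X + Y' \<cdot>\<^bsub>A\<^esub> X" if "Y' \<in> Hom ?B q r" for Y'
      by (rule add_cmp[OF hY(1) h(1)[OF that pq(2) r] hX(1)])
    show "Y \<cdot>\<^bsub>A\<^esub> (X + X') = Y \<cdot>\<^bsub>A\<^esub> X + Y \<cdot>\<^bsub>A\<^esub> X'" if "X' \<in> Hom ?B p q" for X'
      by (rule cmp_add'[OF hY(1) hX(1) h(1)[OF that pq]])
    show "Z \<cdot>\<^bsub>A\<^esub> Y \<cdot>\<^bsub>A\<^esub> X = Z \<cdot>\<^bsub>A\<^esub> (Y \<cdot>\<^bsub>A\<^esub> X)" if s: "s \<in> Obj ?B" and "Z \<in> Hom ?B r s" for s Z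
      by (rule assoc[OF h(1)[OF that(2) r s] hY(1) hX(1)])
  qed
qed

section \<open>Arrows with source and target\<close>

text \<open>
  Since the Hom-spaces may overlap, an arrow does not determine its source and target.  Attaching them makes
  the typing conditions of long composites decidable by rewriting.
\<close>

definition src :: "'o \<times> 'o \<times> 'a \<Rightarrow> 'o" where "src f = fst f"
definition tgt :: "'o \<times> 'o \<times> 'a \<Rightarrow> 'o" where "tgt f = fst (snd f)"
definition arw :: "'o \<times> 'o \<times> 'a \<Rightarrow> 'a" where "arw f = snd (snd f)"

lemma triple_simps [simp]: "src (\<rho>, \<sigma>, X) = \<rho>" "tgt (\<rho>, \<sigma>, X) = \<sigma>" "arw (\<rho>, \<sigma>, X) = X"
  by (simp_all add: src_def tgt_def arw_def)

lemma triple_eqI: "\<lbrakk>src f = src g; tgt f = tgt g; arw f = arw g\<rbrakk> \<Longrightarrow> f = g"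
  by (cases f, cases g) simp

context star_category
begin

definition typed :: "'o \<times> 'o \<times> 'a \<Rightarrow> bool" where
  "typed f \<longleftrightarrow> \<guillemotleft>arw f : src f \<rightarrow> tgt f\<guillemotright>"

definition tcmp :: "'o \<times> 'o \<times> 'a \<Rightarrow> 'o \<times> 'o \<times> 'a \<Rightarrow> 'o \<times> 'o \<times> 'a" (infixl \<open>\<ggreater>\<close> 70) where
  "f \<ggreater> g = (src g, tgt f, arw f \<cdot> arw g)"

definition tstar :: "'o \<times> 'o \<times> 'a \<Rightarrow> 'o \<times> 'o \<times> 'a" where
  "tstar f = (tgt f, src f, adj C (arw f))"

definition tide :: "'o \<Rightarrow> 'o \<times> 'o \<times> 'a" where
  "tide \<rho> = (\<rho>, \<rho>, ide C \<rho>)"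

lemma typed_simps [simp]:
  "src (f \<ggreater> g) = src g" "tgt (f \<ggreater> g) = tgt f" "arw (f \<ggreater> g) = arw f \<cdot> arw g"
  "src (tstar f) = tgt f" "tgt (tstar f) = src f" "arw (tstar f) = adj C (arw f)"
  "src (tide \<rho>) = \<rho>" "tgt (tide \<rho>) = \<rho>" "arw (tide \<rho>) = ide C \<rho>"
  by (simp_all add: tcmp_def tstar_def tide_def)

lemma typed_triple [simp]: "typed (\<rho>, \<sigma>, X) \<longleftrightarrow> \<guillemotleft>X : \<rho> \<rightarrow> \<sigma>\<guillemotright>"
  by (simp add: typed_def)

lemma typed_cmp [simp]: "\<lbrakk>typed f; typed g; src f = tgt g\<rbrakk> \<Longrightarrow> typed (f \<ggreater> g)"
  and typed_star [simp]: "typed f \<Longrightarrow> typed (tstar f)"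
  and typed_ide [simp]: "\<rho> \<in> Obj C \<Longrightarrow> typed (tide \<rho>)"
  and typed_Obj [simp]: "typed f \<Longrightarrow> src f \<in> Obj C" "typed f \<Longrightarrow> tgt f \<in> Obj C"
  by (auto simp: typed_def intro: hom_cmp hom_adj hom_ide in_homD)

lemma tcmp_assoc [simp]:
  "\<lbrakk>typed f; typed g; typed h; src f = tgt g; src g = tgt h\<rbrakk> \<Longrightarrow> f \<ggreater> g \<ggreater> h = f \<ggreater> (g \<ggreater> h)"
  by (rule triple_eqI) (simp_all add: typed_def assoc[of "arw f" _ _ "arw g" _ "arw h"])

lemma tcmp_ide [simp]: "\<lbrakk>typed f; tgt f = \<rho>\<rbrakk> \<Longrightarrow> tide \<rho> \<ggreater> f = f" "\<lbrakk>typed f; src f = \<rho>\<rbrakk> \<Longrightarrow> f \<ggreater> tide \<rho> = f"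
  by (auto intro!: triple_eqI simp: typed_def ide_left ide_right)

lemma tstar_cmp [simp]: "\<lbrakk>typed f; typed g; src f = tgt g\<rbrakk> \<Longrightarrow> tstar (f \<ggreater> g) = tstar g \<ggreater> tstar f"
  by (rule triple_eqI) (simp_all add: typed_def star_cmp[of "arw f" "src f" _ "arw g"])

lemma tstar_tstar [simp]: "typed f \<Longrightarrow> tstar (tstar f) = f"
  by (rule triple_eqI) (simp_all add: typed_def star_star)

end

section \<open>Group actions on *-categories and their orbit categories\<close>

text \<open>
  \<open>K\<close> acts by the functors \<open>gO k\<close>, \<open>gA k\<close>, strictly unital and associative up to the coherent unitaries
  \<open>w k l \<rho>\<close>.
\<close>

locale category_action = star_category C + comm_group K
  for C :: "('o, 'a::ab_group_add, 'z) tensor_star_cat_scheme" (structure) and K :: "('k, 'm) monoid_scheme" +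
  fixes gO :: "'k \<Rightarrow> 'o \<Rightarrow> 'o" and gA :: "'k \<Rightarrow> 'a \<Rightarrow> 'a" and w :: "'k \<Rightarrow> 'k \<Rightarrow> 'o \<Rightarrow> 'a"
  assumes gO [simp]: "\<lbrakk>k \<in> carrier K; \<rho> \<in> Obj C\<rbrakk> \<Longrightarrow> gO k \<rho> \<in> Obj C"
    and gO_one [simp]: "\<rho> \<in> Obj C \<Longrightarrow> gO \<one>\<^bsub>K\<^esub> \<rho> = \<rho>"
    and gA: "\<lbrakk>k \<in> carrier K; \<guillemotleft>X : \<rho> \<rightarrow> \<sigma>\<guillemotright>\<rbrakk> \<Longrightarrow> \<guillemotleft>gA k X : gO k \<rho> \<rightarrow> gO k \<sigma>\<guillemotright>"
    and gA_one: "\<guillemotleft>X : \<rho> \<rightarrow> \<sigma>\<guillemotright> \<Longrightarrow> gA \<one>\<^bsub>K\<^esub> X = X"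
    and gA_ide: "\<lbrakk>k \<in> carrier K; \<rho> \<in> Obj C\<rbrakk> \<Longrightarrow> gA k (ide C \<rho>) = ide C (gO k \<rho>)"
    and gA_cmp: "\<lbrakk>k \<in> carrier K; \<guillemotleft>X : \<sigma> \<rightarrow> \<tau>\<guillemotright>; \<guillemotleft>Y : \<rho> \<rightarrow> \<sigma>\<guillemotright>\<rbrakk> \<Longrightarrow> gA k (X \<cdot> Y) = gA k X \<cdot> gA k Y"
    and gA_add: "\<lbrakk>k \<in> carrier K; \<guillemotleft>X : \<rho> \<rightarrow> \<sigma>\<guillemotright>; \<guillemotleft>Y : \<rho> \<rightarrow> \<sigma>\<guillemotright>\<rbrakk> \<Longrightarrow> gA k (X + Y) = gA k X + gA k Y"
    and gA_scl: "\<lbrakk>k \<in> carrier K; \<guillemotleft>X : \<rho> \<rightarrow> \<sigma>\<guillemotright>\<rbrakk> \<Longrightarrow> gA k (scl C z X) = scl C z (gA k X)"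
    and gA_adj: "\<lbrakk>k \<in> carrier K; \<guillemotleft>X : \<rho> \<rightarrow> \<sigma>\<guillemotright>\<rbrakk> \<Longrightarrow> gA k (adj C X) = adj C (gA k X)"
    and w: "\<lbrakk>k \<in> carrier K; l \<in> carrier K; \<rho> \<in> Obj C\<rbrakk> \<Longrightarrow> \<guillemotleft>w k l \<rho> : gO (k \<otimes>\<^bsub>K\<^esub> l) \<rho> \<rightarrow> gO k (gO l \<rho>)\<guillemotright>"
    and w_unitary: "\<lbrakk>k \<in> carrier K; l \<in> carrier K; \<rho> \<in> Obj C\<rbrakk> \<Longrightarrow> adj C (w k l \<rho>) \<cdot> w k l \<rho> = ide C (gO (k \<otimes>\<^bsub>K\<^esub> l) \<rho>)"
      "\<lbrakk>k \<in> carrier K; l \<in> carrier K; \<rho> \<in> Obj C\<rbrakk> \<Longrightarrow> w k l \<rho> \<cdot> adj C (w k l \<rho>) = ide C (gO k (gO l \<rho>))"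
    and w_natural: "\<lbrakk>k \<in> carrier K; l \<in> carrier K; \<guillemotleft>X : \<rho> \<rightarrow> \<sigma>\<guillemotright>\<rbrakk>
      \<Longrightarrow> w k l \<sigma> \<cdot> gA (k \<otimes>\<^bsub>K\<^esub> l) X = gA k (gA l X) \<cdot> w k l \<rho>"
    and w_assoc: "\<lbrakk>k \<in> carrier K; l \<in> carrier K; m \<in> carrier K; \<rho> \<in> Obj C\<rbrakk>
      \<Longrightarrow> gA k (w l m \<rho>) \<cdot> w k (l \<otimes>\<^bsub>K\<^esub> m) \<rho> = w k l (gO m \<rho>) \<cdot> w (k \<otimes>\<^bsub>K\<^esub> l) m \<rho>"
    and w_unit: "\<lbrakk>k \<in> carrier K; \<rho> \<in> Obj C\<rbrakk> \<Longrightarrow> w \<one>\<^bsub>K\<^esub> k \<rho> = ide C (gO k \<rho>)"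
      "\<lbrakk>k \<in> carrier K; \<rho> \<in> Obj C\<rbrakk> \<Longrightarrow> w k \<one>\<^bsub>K\<^esub> \<rho> = ide C (gO k \<rho>)"
begin

text \<open>The action and its coherence arrows, and below the graded operations, for arrows with source and target.\<close>

definition G :: "'k \<Rightarrow> 'o \<times> 'o \<times> 'a \<Rightarrow> 'o \<times> 'o \<times> 'a" where
  "G k f = (gO k (src f), gO k (tgt f), gA k (arw f))"

definition W :: "'k \<Rightarrow> 'k \<Rightarrow> 'o \<Rightarrow> 'o \<times> 'o \<times> 'a" where
  "W k l \<rho> = (gO (k \<otimes>\<^bsub>K\<^esub> l) \<rho>, gO k (gO l \<rho>), w k l \<rho>)"

lemma G_simps [simp]: "src (G k f) = gO k (src f)" "tgt (G k f) = gO k (tgt f)" "arw (G k f) = gA k (arw f)"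
  "src (W k l \<rho>) = gO (k \<otimes>\<^bsub>K\<^esub> l) \<rho>" "tgt (W k l \<rho>) = gO k (gO l \<rho>)" "arw (W k l \<rho>) = w k l \<rho>"
  by (simp_all add: G_def W_def)

lemma typed_G [simp]: "\<lbrakk>k \<in> carrier K; typed f\<rbrakk> \<Longrightarrow> typed (G k f)"
  and typed_W [simp]: "\<lbrakk>k \<in> carrier K; l \<in> carrier K; \<rho> \<in> Obj C\<rbrakk> \<Longrightarrow> typed (W k l \<rho>)"
  by (simp_all add: typed_def gA w)

lemma G_cmp [simp]: "\<lbrakk>k \<in> carrier K; typed f; typed g; src f = tgt g\<rbrakk> \<Longrightarrow> G k (f \<ggreater> g) = G k f \<ggreater> G k g"
  by (rule triple_eqI) (simp_all add: typed_def gA_cmp[of k "arw f" "src f" _ "arw g"])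

lemma G_star [simp]: "\<lbrakk>k \<in> carrier K; typed f\<rbrakk> \<Longrightarrow> G k (tstar f) = tstar (G k f)"
  by (rule triple_eqI) (simp_all add: typed_def gA_adj)

lemma G_one [simp]: "typed f \<Longrightarrow> G \<one>\<^bsub>K\<^esub> f = f"
  by (rule triple_eqI) (simp_all add: typed_def gA_one in_homD)

lemma G_ide [simp]: "\<lbrakk>k \<in> carrier K; \<rho> \<in> Obj C\<rbrakk> \<Longrightarrow> G k (tide \<rho>) = tide (gO k \<rho>)"
  by (rule triple_eqI) (simp_all add: gA_ide)

lemma W_unitary:
  assumes "k \<in> carrier K" "l \<in> carrier K" "\<rho> \<in> Obj C"
  shows "tstar (W k l \<rho>) \<ggreater> W k l \<rho> = tide (gO (k \<otimes>\<^bsub>K\<^esub> l) \<rho>)"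
    "W k l \<rho> \<ggreater> tstar (W k l \<rho>) = tide (gO k (gO l \<rho>))"
  using assms by (auto intro!: triple_eqI simp: w_unitary)

lemma W_cancel:
  assumes "k \<in> carrier K" "l \<in> carrier K" "\<rho> \<in> Obj C" "typed f"
  shows "tgt f = gO (k \<otimes>\<^bsub>K\<^esub> l) \<rho> \<Longrightarrow> tstar (W k l \<rho>) \<ggreater> (W k l \<rho> \<ggreater> f) = f"
    "tgt f = gO k (gO l \<rho>) \<Longrightarrow> W k l \<rho> \<ggreater> (tstar (W k l \<rho>) \<ggreater> f) = f"
  using assms tcmp_assoc[of "tstar (W k l \<rho>)" "W k l \<rho>" f] tcmp_assoc[of "W k l \<rho>" "tstar (W k l \<rho>)" f]
  by (simp_all add: W_unitary)

lemma W_natural: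
  assumes "k \<in> carrier K" "l \<in> carrier K" "typed f"
  shows "W k l (tgt f) \<ggreater> G (k \<otimes>\<^bsub>K\<^esub> l) f = G k (G l f) \<ggreater> W k l (src f)"
  using assms by (auto intro!: triple_eqI simp: w_natural typed_def)

lemma W_assoc:
  assumes "k \<in> carrier K" "l \<in> carrier K" "m \<in> carrier K" "\<rho> \<in> Obj C"
  shows "G k (W l m \<rho>) \<ggreater> W k (l \<otimes>\<^bsub>K\<^esub> m) \<rho> = W k l (gO m \<rho>) \<ggreater> W (k \<otimes>\<^bsub>K\<^esub> l) m \<rho>"
  using assms by (auto intro!: triple_eqI simp: w_assoc m_assoc)

lemma W_unit [simp]:
  assumes "k \<in> carrier K" "\<rho> \<in> Obj C"
  shows "W \<one>\<^bsub>K\<^esub> k \<rho> = tide (gO k \<rho>)" "W k \<one>\<^bsub>K\<^esub> \<rho> = tide (gO k \<rho>)"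
  using assms by (auto intro!: triple_eqI simp: w_unit)

lemma W_inv:
  assumes k: "k \<in> carrier K" and \<rho>: "\<rho> \<in> Obj C"
  shows "G k (W (inv\<^bsub>K\<^esub> k) k \<rho>) = W k (inv\<^bsub>K\<^esub> k) (gO k \<rho>)"
  using W_assoc[OF k inv_closed[OF k] k \<rho>] k \<rho> by simp

text \<open>
  Composition and *-operation of the homogeneous arrows of the orbit category, that is of arrows
  \<open>gO k \<rho> \<rightarrow> \<sigma>\<close>, considered as arrows of degree \<open>k\<close> from \<open>\<rho>\<close> to \<open>\<sigma>\<close>.
\<close>

definition gcmp :: "'k \<Rightarrow> 'k \<Rightarrow> 'o \<Rightarrow> 'a \<Rightarrow> 'a \<Rightarrow> 'a" where
  "gcmp k l \<rho> x y = x \<cdot> gA k y \<cdot> w k l \<rho>"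

definition gstar :: "'k \<Rightarrow> 'o \<Rightarrow> 'a \<Rightarrow> 'a" where
  "gstar k \<rho> x = adj C (w (inv\<^bsub>K\<^esub> k) k \<rho>) \<cdot> gA (inv\<^bsub>K\<^esub> k) (adj C x)"

definition Gcmp where
  "Gcmp k l \<rho> f g = f \<ggreater> G k g \<ggreater> W k l \<rho>"

definition Gstar where
  "Gstar k \<rho> f = tstar (W (inv\<^bsub>K\<^esub> k) k \<rho>) \<ggreater> G (inv\<^bsub>K\<^esub> k) (tstar f)"

lemma Gcmp_simps [simp]:
  "arw (Gcmp k l \<rho> f g) = gcmp k l \<rho> (arw f) (arw g)" "src (Gcmp k l \<rho> f g) = gO (k \<otimes>\<^bsub>K\<^esub> l) \<rho>"
  "tgt (Gcmp k l \<rho> f g) = tgt f" "arw (Gstar k \<rho> f) = gstar k \<rho> (arw f)"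
  "src (Gstar k \<rho> f) = gO (inv\<^bsub>K\<^esub> k) (tgt f)" "tgt (Gstar k \<rho> f) = gO (inv\<^bsub>K\<^esub> k \<otimes>\<^bsub>K\<^esub> k) \<rho>"
  by (simp_all add: Gcmp_def gcmp_def Gstar_def gstar_def)

lemma gcmp_hom:
  assumes "k \<in> carrier K" "l \<in> carrier K" "\<guillemotleft>x : gO k \<sigma> \<rightarrow> \<delta>\<guillemotright>" "\<guillemotleft>y : gO l \<rho> \<rightarrow> \<sigma>\<guillemotright>" "\<rho> \<in> Obj C"
  shows "\<guillemotleft>gcmp k l \<rho> x y : gO (k \<otimes>\<^bsub>K\<^esub> l) \<rho> \<rightarrow> \<delta>\<guillemotright>"
  using hom_cmp[OF hom_cmp[OF assms(3) gA[OF assms(1,4)]] w[OF assms(1,2,5)]] by (simp add: gcmp_def)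

lemma gstar_hom:
  assumes "k \<in> carrier K" "\<guillemotleft>x : gO k \<rho> \<rightarrow> \<sigma>\<guillemotright>" "\<rho> \<in> Obj C"
  shows "\<guillemotleft>gstar k \<rho> x : gO (inv\<^bsub>K\<^esub> k) \<sigma> \<rightarrow> \<rho>\<guillemotright>"
  using hom_cmp[OF hom_adj[OF w[OF inv_closed[OF assms(1)] assms(1,3)]] gA[OF inv_closed[OF assms(1)] hom_adj[OF assms(2)]]] assms
  by (simp add: gstar_def)

lemma gcmp_assoc:
  assumes k: "k \<in> carrier K" "l \<in> carrier K" "m \<in> carrier K"
    and x: "\<guillemotleft>x : gO k \<tau> \<rightarrow> \<upsilon>\<guillemotright>" and y: "\<guillemotleft>y : gO l \<sigma> \<rightarrow> \<tau>\<guillemotright>" and z: "\<guillemotleft>z : gO m \<rho> \<rightarrow> \<sigma>\<guillemotright>"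
    and O: "\<rho> \<in> Obj C" "\<sigma> \<in> Obj C" "\<tau> \<in> Obj C"
  shows "gcmp (k \<otimes>\<^bsub>K\<^esub> l) m \<rho> (gcmp k l \<sigma> x y) z = gcmp k (l \<otimes>\<^bsub>K\<^esub> m) \<rho> x (gcmp l m \<rho> y z)"
proof -
  let ?X = "(gO k \<tau>, \<upsilon>, x)" and ?Y = "(gO l \<sigma>, \<tau>, y)" and ?Z = "(gO m \<rho>, \<sigma>, z)"
  have nat: "W k l \<sigma> \<ggreater> (G (k \<otimes>\<^bsub>K\<^esub> l) ?Z \<ggreater> h) = G k (G l ?Z) \<ggreater> (W k l (gO m \<rho>) \<ggreater> h)"
    if "typed h" "tgt h = gO (k \<otimes>\<^bsub>K\<^esub> l) (gO m \<rho>)" for h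
    using W_natural[of k l ?Z] tcmp_assoc[of "W k l \<sigma>" "G (k \<otimes>\<^bsub>K\<^esub> l) ?Z" h]
      tcmp_assoc[of "G k (G l ?Z)" "W k l (gO m \<rho>)" h] assms that by simp
  have "Gcmp (k \<otimes>\<^bsub>K\<^esub> l) m \<rho> (Gcmp k l \<sigma> ?X ?Y) ?Z = Gcmp k (l \<otimes>\<^bsub>K\<^esub> m) \<rho> ?X (Gcmp l m \<rho> ?Y ?Z)"
    using assms by (simp add: Gcmp_def nat W_assoc)
  from arg_cong[OF this, of arw] show ?thesis by simp
qed

lemma gcmp_ide:
  assumes k: "k \<in> carrier K" and x: "\<guillemotleft>x : gO k \<rho> \<rightarrow> \<sigma>\<guillemotright>" and O: "\<rho> \<in> Obj C" "\<sigma> \<in> Obj C"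
  shows "gcmp \<one>\<^bsub>K\<^esub> k \<rho> (ide C \<sigma>) x = x" "gcmp k \<one>\<^bsub>K\<^esub> \<rho> x (ide C \<rho>) = x"
  using assms gA[OF one_closed x] by (simp_all add: gcmp_def w_unit gA_one gA_ide ide_left ide_right)

lemma gstar_gstar:
  assumes k: "k \<in> carrier K" and x: "\<guillemotleft>x : gO k \<rho> \<rightarrow> \<sigma>\<guillemotright>" and O: "\<rho> \<in> Obj C" "\<sigma> \<in> Obj C"
  shows "gstar (inv\<^bsub>K\<^esub> k) \<sigma> (gstar k \<rho> x) = x"
proof -
  let ?X = "(gO k \<rho>, \<sigma>, x)"
  note ik = inv_closed[OF k]
  have nat: "W k (inv\<^bsub>K\<^esub> k) \<sigma> \<ggreater> ?X = G k (G (inv\<^bsub>K\<^esub> k) ?X) \<ggreater> W k (inv\<^bsub>K\<^esub> k) (gO k \<rho>)"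
    using W_natural[OF k ik, of ?X] k x by simp
  have "Gstar (inv\<^bsub>K\<^esub> k) \<sigma> (Gstar k \<rho> ?X) = tstar (W k (inv\<^bsub>K\<^esub> k) \<sigma>) \<ggreater> (G k (G (inv\<^bsub>K\<^esub> k) ?X) \<ggreater> W k (inv\<^bsub>K\<^esub> k) (gO k \<rho>))"
    using assms by (simp add: Gstar_def W_inv)
  also have "\<dots> = ?X" using assms by (simp add: W_cancel flip: nat)
  finally show ?thesis by (metis Gcmp_simps(4) triple_simps(3))
qed

lemma gstar_gcmp:
  assumes k: "k \<in> carrier K" "l \<in> carrier K"
    and x: "\<guillemotleft>x : gO k \<sigma> \<rightarrow> \<delta>\<guillemotright>" and y: "\<guillemotleft>y : gO l \<rho> \<rightarrow> \<sigma>\<guillemotright>" and O: "\<rho> \<in> Obj C" "\<sigma> \<in> Obj C" "\<delta> \<in> Obj C"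
  shows "gstar (k \<otimes>\<^bsub>K\<^esub> l) \<rho> (gcmp k l \<rho> x y) = gcmp (inv\<^bsub>K\<^esub> l) (inv\<^bsub>K\<^esub> k) \<delta> (gstar l \<rho> y) (gstar k \<sigma> x)"
proof -
  let ?X = "(gO k \<sigma>, \<delta>, x)" and ?Y = "(gO l \<rho>, \<sigma>, y)"
  \<comment> \<open>Both sides reduce to \<open>gA n\<close> of \<open>(gA k y)\<^sup>* x\<^sup>*\<close>, where \<open>n = (k l)\<^sup>-\<^sup>1\<close>, followed by adjoints of \<open>w\<close>.\<close>
  define i j where "i = inv\<^bsub>K\<^esub> k" and "j = inv\<^bsub>K\<^esub> l"
  define n where "n = j \<otimes>\<^bsub>K\<^esub> i"
  have ij: "i \<in> carrier K" "j \<in> carrier K" "n \<in> carrier K" using k by (simp_all add: i_def j_def n_def)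
  have e: "inv\<^bsub>K\<^esub> (k \<otimes>\<^bsub>K\<^esub> l) = n" "n \<otimes>\<^bsub>K\<^esub> k = j" "n \<otimes>\<^bsub>K\<^esub> (k \<otimes>\<^bsub>K\<^esub> l) = \<one>\<^bsub>K\<^esub>" "i \<otimes>\<^bsub>K\<^esub> k = \<one>\<^bsub>K\<^esub>" "j \<otimes>\<^bsub>K\<^esub> l = \<one>\<^bsub>K\<^esub>"
    using k by (simp_all add: i_def j_def n_def inv_mult_group m_assoc inv_solve_left)
      (simp_all flip: m_assoc)
  have tX: "typed ?X" and tY: "typed ?Y" using x y by simp_all
  have nX: "G j (G i (tstar ?X)) \<ggreater> W j i \<delta> = W j i (gO k \<sigma>) \<ggreater> G n (tstar ?X)"
    using W_natural[OF ij(2,1), of "tstar ?X"] tX ij by (simp add: n_def)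
  have aX: "G j (W i k \<sigma>) = W j i (gO k \<sigma>) \<ggreater> W n k \<sigma>"
    using W_assoc[OF ij(2,1) k(1) O(2)] ij e O k by (simp add: n_def)
  have nY: "W n k \<sigma> \<ggreater> G j ?Y = G n (G k ?Y) \<ggreater> W n k (gO l \<rho>)"
    using W_natural[OF ij(3) k(1) tY] e by simp
  have aY: "G n (W k l \<rho>) \<ggreater> W n (k \<otimes>\<^bsub>K\<^esub> l) \<rho> = W n k (gO l \<rho>) \<ggreater> W j l \<rho>"
    using W_assoc[OF ij(3) k O(1)] e by simp
  have "Gcmp j i \<delta> (Gstar l \<rho> ?Y) (Gstar k \<sigma> ?X)
      = tstar (W j l \<rho>) \<ggreater> (tstar (G j ?Y) \<ggreater> (tstar (G j (W i k \<sigma>)) \<ggreater> (G j (G i (tstar ?X)) \<ggreater> W j i \<delta>)))"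
    using tX tY ij k O e by (simp add: Gcmp_def Gstar_def flip: i_def j_def)
  also have "\<dots> = tstar (W j l \<rho>) \<ggreater> (tstar (G j ?Y) \<ggreater> (tstar (W n k \<sigma>) \<ggreater> G n (tstar ?X)))"
    unfolding nX aX using tX tY ij k O e by (simp add: W_cancel n_def[symmetric])
  also have "\<dots> = tstar (W j l \<rho>) \<ggreater> (tstar (W n k \<sigma> \<ggreater> G j ?Y) \<ggreater> G n (tstar ?X))"
    using tX tY ij k O e by simp
  also have "\<dots> = tstar (W n k (gO l \<rho>) \<ggreater> W j l \<rho>) \<ggreater> (tstar (G n (G k ?Y)) \<ggreater> G n (tstar ?X))"
    unfolding nY using tX tY ij k O e by simp
  also have "\<dots> = tstar (W n (k \<otimes>\<^bsub>K\<^esub> l) \<rho>) \<ggreater> (tstar (G n (W k l \<rho>)) \<ggreater> (tstar (G n (G k ?Y)) \<ggreater> G n (tstar ?X)))"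
    unfolding aY[symmetric] using tX tY ij k O e by simp
  also have "\<dots> = Gstar (k \<otimes>\<^bsub>K\<^esub> l) \<rho> (Gcmp k l \<rho> ?X ?Y)"
    using tX tY ij k O e by (simp add: Gcmp_def Gstar_def)
  finally have "gcmp j i \<delta> (gstar l \<rho> y) (gstar k \<sigma> x) = gstar (k \<otimes>\<^bsub>K\<^esub> l) \<rho> (gcmp k l \<rho> x y)"
    by (metis Gcmp_simps(1,4) triple_simps(3))
  then show ?thesis by (simp add: i_def j_def)
qed

lemma gstar_self:
  assumes k: "k \<in> carrier K" and x: "\<guillemotleft>x : gO k \<rho> \<rightarrow> \<sigma>\<guillemotright>" and \<rho>: "\<rho> \<in> Obj C"
  defines "y \<equiv> gA (inv\<^bsub>K\<^esub> k) x \<cdot> w (inv\<^bsub>K\<^esub> k) k \<rho>"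
  shows "gcmp (inv\<^bsub>K\<^esub> k) k \<rho> (gstar k \<rho> x) x = adj C y \<cdot> y" "\<guillemotleft>y : \<rho> \<rightarrow> gO (inv\<^bsub>K\<^esub> k) \<sigma>\<guillemotright>"
proof -
  let ?X = "(gO k \<rho>, \<sigma>, x)"
  define Y where "Y = G (inv\<^bsub>K\<^esub> k) ?X \<ggreater> W (inv\<^bsub>K\<^esub> k) k \<rho>"
  have tX: "typed ?X" using x by simp
  have "Gcmp (inv\<^bsub>K\<^esub> k) k \<rho> (Gstar k \<rho> ?X) ?X = tstar Y \<ggreater> Y"
    using k tX \<rho> by (simp add: Gcmp_def Gstar_def Y_def)
  from arg_cong[OF this, of arw] show "gcmp (inv\<^bsub>K\<^esub> k) k \<rho> (gstar k \<rho> x) x = adj C y \<cdot> y"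
    by (simp add: Y_def y_def)
  show "\<guillemotleft>y : \<rho> \<rightarrow> gO (inv\<^bsub>K\<^esub> k) \<sigma>\<guillemotright>"
    using hom_cmp[OF gA[OF inv_closed[OF k] x] w[OF inv_closed[OF k] k \<rho>]] k \<rho> by (simp add: y_def)
qed

lemma self_gstar:
  assumes k: "k \<in> carrier K" and x: "\<guillemotleft>x : gO k \<rho> \<rightarrow> \<sigma>\<guillemotright>" and \<rho>: "\<rho> \<in> Obj C"
  shows "gcmp k (inv\<^bsub>K\<^esub> k) \<sigma> x (gstar k \<rho> x) = x \<cdot> adj C x"
proof -
  let ?X = "(gO k \<rho>, \<sigma>, x)" and ?i = "inv\<^bsub>K\<^esub> k"
  have tX: "typed ?X" using x by simp
  note \<sigma> = in_homD(2)[OF x]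
  have nat: "G k (G ?i (tstar ?X)) \<ggreater> W k ?i \<sigma> = W k ?i (gO k \<rho>) \<ggreater> tstar ?X"
    using W_natural[OF k inv_closed[OF k], of "tstar ?X"] k tX \<rho> by simp
  have "Gcmp k ?i \<sigma> ?X (Gstar k \<rho> ?X) = ?X \<ggreater> (tstar (W k ?i (gO k \<rho>)) \<ggreater> (G k (G ?i (tstar ?X)) \<ggreater> W k ?i \<sigma>))"
    using k tX \<rho> \<sigma> by (simp add: Gcmp_def Gstar_def W_inv)
  also have "\<dots> = ?X \<ggreater> tstar ?X" unfolding nat using k tX \<rho> \<sigma> by (simp add: W_cancel)
  finally show ?thesis
    by (metis Gcmp_simps(1,4) triple_simps(3) typed_simps(3,6))
qed

lemma gstar_unitary:
  assumes k: "k \<in> carrier K" and \<rho>: "\<rho> \<in> Obj C" "\<sigma> \<in> Obj C" and x: "unitary_arr C (gO k \<rho>) \<sigma> x"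
  shows "gcmp (inv\<^bsub>K\<^esub> k) k \<rho> (gstar k \<rho> x) x = ide C \<rho>" "gcmp k (inv\<^bsub>K\<^esub> k) \<sigma> x (gstar k \<rho> x) = ide C \<sigma>"
proof -
  let ?i = "inv\<^bsub>K\<^esub> k"
  have x': "\<guillemotleft>x : gO k \<rho> \<rightarrow> \<sigma>\<guillemotright>" "adj C x \<cdot> x = ide C (gO k \<rho>)" "x \<cdot> adj C x = ide C \<sigma>"
    using x k \<rho> by (auto simp: unitary_arr_def isometry_def in_hom_def)
  show "gcmp k ?i \<sigma> x (gstar k \<rho> x) = ide C \<sigma>" by (simp add: self_gstar[OF k x'(1) \<rho>(1)] x')
  note ik = inv_closed[OF k]
  note gx = gA[OF ik x'(1)] and ww = w[OF ik k \<rho>(1)]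
  have "adj C (gA ?i x \<cdot> w ?i k \<rho>) \<cdot> (gA ?i x \<cdot> w ?i k \<rho>) = adj C (w ?i k \<rho>) \<cdot> (gA ?i (adj C x \<cdot> x) \<cdot> w ?i k \<rho>)"
    by (simp add: star_cmp[OF gx ww] gA_cmp[OF ik hom_adj[OF x'(1)] x'(1)] gA_adj[OF ik x'(1)]
        assoc[OF hom_adj[OF ww] hom_adj[OF gx] hom_cmp[OF gx ww]] assoc[OF hom_adj[OF gx] gx ww])
  also have "\<dots> = ide C \<rho>"
    using ide_left[OF ww] k \<rho> by (simp add: x' gA_ide[OF ik] w_unitary)
  finally show "gcmp ?i k \<rho> (gstar k \<rho> x) x = ide C \<rho>" by (simp add: gstar_self[OF k x'(1) \<rho>(1)])
qed

lemma gcmp_add: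
  assumes "k \<in> carrier K" "l \<in> carrier K" "\<rho> \<in> Obj C" "\<guillemotleft>x : gO k \<sigma> \<rightarrow> \<delta>\<guillemotright>" "\<guillemotleft>y : gO l \<rho> \<rightarrow> \<sigma>\<guillemotright>"
  shows "\<guillemotleft>x' : gO k \<sigma> \<rightarrow> \<delta>\<guillemotright> \<Longrightarrow> gcmp k l \<rho> (x + x') y = gcmp k l \<rho> x y + gcmp k l \<rho> x' y"
    "\<guillemotleft>y' : gO l \<rho> \<rightarrow> \<sigma>\<guillemotright> \<Longrightarrow> gcmp k l \<rho> x (y + y') = gcmp k l \<rho> x y + gcmp k l \<rho> x y'"
    "gcmp k l \<rho> (scl C z x) y = scl C z (gcmp k l \<rho> x y)"
    "gcmp k l \<rho> x (scl C z y) = scl C z (gcmp k l \<rho> x y)"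
proof -
  note ww = w[OF assms(1-3)] and gy = gA[OF assms(1,5)]
  note xy = hom_cmp[OF assms(4) gy]
  show "gcmp k l \<rho> (x + x') y = gcmp k l \<rho> x y + gcmp k l \<rho> x' y" if "\<guillemotleft>x' : gO k \<sigma> \<rightarrow> \<delta>\<guillemotright>"
    by (simp add: gcmp_def add_cmp[OF assms(4) that gy] add_cmp[OF xy hom_cmp[OF that gy] ww])
  show "gcmp k l \<rho> x (y + y') = gcmp k l \<rho> x y + gcmp k l \<rho> x y'" if "\<guillemotleft>y' : gO l \<rho> \<rightarrow> \<sigma>\<guillemotright>"
    by (simp add: gcmp_def gA_add[OF assms(1,5) that] cmp_add'[OF assms(4) gy gA[OF assms(1) that]]
        add_cmp[OF xy hom_cmp[OF assms(4) gA[OF assms(1) that]] ww])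
  show "gcmp k l \<rho> (scl C z x) y = scl C z (gcmp k l \<rho> x y)"
    by (simp add: gcmp_def scl_cmp[OF assms(4) gy] scl_cmp[OF xy ww])
  show "gcmp k l \<rho> x (scl C z y) = scl C z (gcmp k l \<rho> x y)"
    by (simp add: gcmp_def gA_scl[OF assms(1,5)] cmp_scl'[OF assms(4) gy] scl_cmp[OF xy ww])
qed

lemma gstar_scl:
  assumes "k \<in> carrier K" "\<rho> \<in> Obj C" "\<guillemotleft>x : gO k \<rho> \<rightarrow> \<sigma>\<guillemotright>"
  shows "gstar k \<rho> (scl C z x) = scl C (cnj z) (gstar k \<rho> x)"
  using cmp_scl'[OF hom_adj[OF w[OF inv_closed[OF assms(1)] assms(1,2)]] gA[OF inv_closed[OF assms(1)] hom_adj[OF assms(3)]]]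
  by (simp add: gstar_def star_scl[OF assms(3)] gA_scl[OF inv_closed[OF assms(1)] hom_adj[OF assms(3)]])

lemma gA_zero: assumes "k \<in> carrier K" "\<rho> \<in> Obj C" shows "gA k 0 = 0"
proof -
  interpret vector_space "scl C" by (rule vs)
  show ?thesis using gA_scl[OF assms(1) hom_zero[OF assms(2,2)], of 0] by simp
qed

text \<open>By naturality of \<open>w\<close>, the functor of \<open>k\<^sup>-\<^sup>1\<close> is a left inverse of that of \<open>k\<close>, up to isomorphism.\<close>

lemma gA_faithful:
  assumes k: "k \<in> carrier K" and X: "\<guillemotleft>X : \<rho> \<rightarrow> \<sigma>\<guillemotright>" and Y: "\<guillemotleft>Y : \<rho> \<rightarrow> \<sigma>\<guillemotright>" and eq: "gA k X = gA k Y"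
  shows "X = Y"
proof -
  let ?i = "inv\<^bsub>K\<^esub> k"
  have "f = tstar (W ?i k (tgt f)) \<ggreater> (G ?i (G k f) \<ggreater> W ?i k (src f))" if f: "typed f" for f
    using W_natural[OF inv_closed[OF k] k f] k f by (simp add: W_cancel flip: W_natural)
  from this[of "(\<rho>, \<sigma>, X)"] this[of "(\<rho>, \<sigma>, Y)"] have "(\<rho>, \<sigma>, X) = (\<rho>, \<sigma>, Y)"
    using X Y eq by (simp add: G_def)
  then show ?thesis by simp
qed

lemma gA_iso:
  assumes k: "k \<in> carrier K" and "isomorphic_obj C \<rho> \<sigma>" and O: "\<rho> \<in> Obj C" "\<sigma> \<in> Obj C"
  shows "isomorphic_obj C (gO k \<rho>) (gO k \<sigma>)"
proof -
  obtain X Y where X: "\<guillemotleft>X : \<rho> \<rightarrow> \<sigma>\<guillemotright>" and Y: "\<guillemotleft>Y : \<sigma> \<rightarrow> \<rho>\<guillemotright>" and e: "Y \<cdot> X = ide C \<rho>" "X \<cdot> Y = ide C \<sigma>"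
    by (rule isomorphicE[OF assms(2) O])
  show ?thesis
    using e by (intro isomorphicI[OF gA[OF k X] gA[OF k Y]])
      (simp_all add: gA_ide[OF k] O flip: gA_cmp[OF k Y X] gA_cmp[OF k X Y])
qed

lemma gO_mult_iso:
  assumes "k \<in> carrier K" "l \<in> carrier K" "\<rho> \<in> Obj C"
  shows "isomorphic_obj C (gO (k \<otimes>\<^bsub>K\<^esub> l) \<rho>) (gO k (gO l \<rho>))"
  by (rule isomorphicI[OF w[OF assms] hom_adj[OF w[OF assms]] w_unitary[OF assms]])

lemma gO_irreducible:
  assumes k: "k \<in> carrier K" and \<rho>: "irreducible_obj C \<rho>"
  shows "irreducible_obj C (gO k \<rho>)"
proof -
  note \<rho>O = irreducibleD(1)[OF \<rho>]
  note ik = inv_closed[OF k]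
  have "isomorphic_obj C \<rho> (gO (inv\<^bsub>K\<^esub> k) (gO k \<rho>))"
    using gO_mult_iso[OF ik k \<rho>O] k \<rho>O by simp
  then have irr: "irreducible_obj C (gO (inv\<^bsub>K\<^esub> k) (gO k \<rho>))"
    using irreducible_iso \<rho> \<rho>O k by simp
  show ?thesis
  proof (rule irreducibleI)
    show "ide C (gO k \<rho>) \<noteq> 0"
      using irreducibleD(2)[OF irr] gA_ide[OF ik, of "gO k \<rho>"] gA_zero[OF ik \<rho>O] k \<rho>O by auto
    fix X assume X: "\<guillemotleft>X : gO k \<rho> \<rightarrow> gO k \<rho>\<guillemotright>"
    obtain a where a: "gA (inv\<^bsub>K\<^esub> k) X = scl C a (ide C (gO (inv\<^bsub>K\<^esub> k) (gO k \<rho>)))"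
      using irreducibleD(3)[OF irr gA[OF ik X]] by blast
    have "X = scl C a (ide C (gO k \<rho>))"
    proof (rule gA_faithful[OF ik X])
      show "\<guillemotleft>scl C a (ide C (gO k \<rho>)) : gO k \<rho> \<rightarrow> gO k \<rho>\<guillemotright>" using hom_scl[OF hom_ide] k \<rho>O by simp
      show "gA (inv\<^bsub>K\<^esub> k) X = gA (inv\<^bsub>K\<^esub> k) (scl C a (ide C (gO k \<rho>)))"
        using a gA_scl[OF ik hom_ide[of "gO k \<rho>"]] gA_ide[OF ik, of "gO k \<rho>"] k \<rho>O by simp
    qed
    then show "\<exists>z. X = scl C z (ide C (gO k \<rho>))" by blast
  qed (use k \<rho>O in simp)
qed

end

text \<open>
  The orbit category \<open>A\<close>: \<open>Hom A \<rho> \<sigma>\<close> is the direct sum of the spaces \<open>Hom C (gO k \<rho>) \<sigma>\<close>, with injections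
  \<open>sg \<rho> \<sigma> k\<close> and coordinates \<open>co \<rho> \<sigma> k\<close>.
\<close>

locale orbit_category = category_action C K gO gA w
  for C :: "('o, 'a::ab_group_add, 'z) tensor_star_cat_scheme" (structure) and K :: "('k, 'm) monoid_scheme"
    and gO gA w +
  fixes A :: "('o, 'b::ab_group_add) tensor_star_cat"
    and sg :: "'o \<Rightarrow> 'o \<Rightarrow> 'k \<Rightarrow> 'a \<Rightarrow> 'b" and co :: "'o \<Rightarrow> 'o \<Rightarrow> 'k \<Rightarrow> 'b \<Rightarrow> 'a"
  assumes sums: "\<lbrakk>\<rho> \<in> Obj C; \<sigma> \<in> Obj C\<rbrakk> \<Longrightarrow> \<exists>\<tau>\<in>Obj C. is_direct_sum C \<rho> \<sigma> \<tau>"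
    and Obj_A [simp]: "Obj A = Obj C"
    and vs_A: "vector_space (scl A)"
    and subspace_A: "\<lbrakk>\<rho> \<in> Obj C; \<sigma> \<in> Obj C\<rbrakk> \<Longrightarrow> module.subspace (scl A) (Hom A \<rho> \<sigma>)"
    and sg_Hom: "\<lbrakk>k \<in> carrier K; \<rho> \<in> Obj C; \<guillemotleft>x : gO k \<rho> \<rightarrow> \<sigma>\<guillemotright>\<rbrakk> \<Longrightarrow> sg \<rho> \<sigma> k x \<in> Hom A \<rho> \<sigma>"
    and co_Hom: "\<lbrakk>k \<in> carrier K; \<rho> \<in> Obj C; \<sigma> \<in> Obj C; X \<in> Hom A \<rho> \<sigma>\<rbrakk> \<Longrightarrow> \<guillemotleft>co \<rho> \<sigma> k X : gO k \<rho> \<rightarrow> \<sigma>\<guillemotright>"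
    and sg_add: "\<lbrakk>k \<in> carrier K; \<rho> \<in> Obj C; \<guillemotleft>x : gO k \<rho> \<rightarrow> \<sigma>\<guillemotright>; \<guillemotleft>y : gO k \<rho> \<rightarrow> \<sigma>\<guillemotright>\<rbrakk>
      \<Longrightarrow> sg \<rho> \<sigma> k (x + y) = sg \<rho> \<sigma> k x + sg \<rho> \<sigma> k y"
    and sg_scl: "\<lbrakk>k \<in> carrier K; \<rho> \<in> Obj C; \<guillemotleft>x : gO k \<rho> \<rightarrow> \<sigma>\<guillemotright>\<rbrakk>
      \<Longrightarrow> sg \<rho> \<sigma> k (scl C z x) = scl A z (sg \<rho> \<sigma> k x)"
    and expand_A: "\<lbrakk>\<rho> \<in> Obj C; \<sigma> \<in> Obj C; X \<in> Hom A \<rho> \<sigma>\<rbrakk>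
      \<Longrightarrow> \<exists>F. finite F \<and> F \<subseteq> carrier K \<and> X = (\<Sum>k\<in>F. sg \<rho> \<sigma> k (co \<rho> \<sigma> k X))"
    and co_sg: "\<lbrakk>k \<in> carrier K; l \<in> carrier K; \<rho> \<in> Obj C; \<guillemotleft>x : gO l \<rho> \<rightarrow> \<sigma>\<guillemotright>\<rbrakk>
      \<Longrightarrow> co \<rho> \<sigma> k (sg \<rho> \<sigma> l x) = (if k = l then x else 0)"
    and co_add: "\<lbrakk>k \<in> carrier K; \<rho> \<in> Obj C; \<sigma> \<in> Obj C; X \<in> Hom A \<rho> \<sigma>; Y \<in> Hom A \<rho> \<sigma>\<rbrakk>
      \<Longrightarrow> co \<rho> \<sigma> k (X + Y) = co \<rho> \<sigma> k X + co \<rho> \<sigma> k Y"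
    and ide_A: "\<rho> \<in> Obj C \<Longrightarrow> ide A \<rho> = sg \<rho> \<rho> \<one>\<^bsub>K\<^esub> (ide C \<rho>)"
    and add_cmp_A: "\<lbrakk>\<rho> \<in> Obj C; \<sigma> \<in> Obj C; \<delta> \<in> Obj C; X \<in> Hom A \<sigma> \<delta>; X' \<in> Hom A \<sigma> \<delta>; Y \<in> Hom A \<rho> \<sigma>\<rbrakk>
      \<Longrightarrow> (X + X') \<cdot>\<^bsub>A\<^esub> Y = X \<cdot>\<^bsub>A\<^esub> Y + X' \<cdot>\<^bsub>A\<^esub> Y"
    and cmp_add_A: "\<lbrakk>\<rho> \<in> Obj C; \<sigma> \<in> Obj C; \<delta> \<in> Obj C; X \<in> Hom A \<sigma> \<delta>; Y \<in> Hom A \<rho> \<sigma>; Y' \<in> Hom A \<rho> \<sigma>\<rbrakk>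
      \<Longrightarrow> X \<cdot>\<^bsub>A\<^esub> (Y + Y') = X \<cdot>\<^bsub>A\<^esub> Y + X \<cdot>\<^bsub>A\<^esub> Y'"
    and cmp_sg: "\<lbrakk>k \<in> carrier K; l \<in> carrier K; \<rho> \<in> Obj C; \<sigma> \<in> Obj C; \<guillemotleft>x : gO k \<sigma> \<rightarrow> \<delta>\<guillemotright>; \<guillemotleft>y : gO l \<rho> \<rightarrow> \<sigma>\<guillemotright>\<rbrakk>
      \<Longrightarrow> sg \<sigma> \<delta> k x \<cdot>\<^bsub>A\<^esub> sg \<rho> \<sigma> l y = sg \<rho> \<delta> (k \<otimes>\<^bsub>K\<^esub> l) (gcmp k l \<rho> x y)"
    and adj_add_A: "\<lbrakk>\<rho> \<in> Obj C; \<sigma> \<in> Obj C; X \<in> Hom A \<rho> \<sigma>; Y \<in> Hom A \<rho> \<sigma>\<rbrakk>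
      \<Longrightarrow> adj A (X + Y) = adj A X + adj A Y"
    and adj_sg: "\<lbrakk>k \<in> carrier K; \<rho> \<in> Obj C; \<guillemotleft>x : gO k \<rho> \<rightarrow> \<sigma>\<guillemotright>\<rbrakk>
      \<Longrightarrow> adj A (sg \<rho> \<sigma> k x) = sg \<sigma> \<rho> (inv\<^bsub>K\<^esub> k) (gstar k \<rho> x)"
begin

interpretation V: vector_space "scl C" by (rule vs)
interpretation VA: vector_space "scl A" by (rule vs_A)

lemma A_closed:
  assumes "\<rho> \<in> Obj C" "\<sigma> \<in> Obj C"
  shows "0 \<in> Hom A \<rho> \<sigma>" "\<lbrakk>X \<in> Hom A \<rho> \<sigma>; Y \<in> Hom A \<rho> \<sigma>\<rbrakk> \<Longrightarrow> X + Y \<in> Hom A \<rho> \<sigma>"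
    "X \<in> Hom A \<rho> \<sigma> \<Longrightarrow> scl A z X \<in> Hom A \<rho> \<sigma>"
  using subspace_A[OF assms] by (simp_all add: VA.subspace_0 VA.subspace_add VA.subspace_scale)

lemma A_sum: "\<lbrakk>\<rho> \<in> Obj C; \<sigma> \<in> Obj C; \<And>i. i \<in> I \<Longrightarrow> g i \<in> Hom A \<rho> \<sigma>\<rbrakk> \<Longrightarrow> sum g I \<in> Hom A \<rho> \<sigma>"
  using subspace_A VA.subspace_sum by metis

lemma additive_sum:
  fixes f :: "'b \<Rightarrow> 'c::ab_group_add"
  assumes O: "\<rho> \<in> Obj C" "\<sigma> \<in> Obj C"
    and f: "\<And>X Y. X \<in> Hom A \<rho> \<sigma> \<Longrightarrow> Y \<in> Hom A \<rho> \<sigma> \<Longrightarrow> f (X + Y) = f X + f Y"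
    and g: "\<And>i. i \<in> I \<Longrightarrow> g i \<in> Hom A \<rho> \<sigma>"
  shows "f (sum g I) = (\<Sum>i\<in>I. f (g i))"
proof -
  have f0: "f 0 = 0" using f[OF A_closed(1) A_closed(1)] O by simp
  show ?thesis using g
    by (induction I rule: infinite_finite_induct) (simp_all add: f0 f A_sum[OF O])
qed

text \<open>The operations are additive, so it suffices to check identities on homogeneous arrows.\<close>

lemma additive_eqI:
  fixes f g :: "'b \<Rightarrow> 'c::ab_group_add"
  assumes O: "\<rho> \<in> Obj C" "\<sigma> \<in> Obj C" and X: "X \<in> Hom A \<rho> \<sigma>"
    and f: "\<And>X Y. X \<in> Hom A \<rho> \<sigma> \<Longrightarrow> Y \<in> Hom A \<rho> \<sigma> \<Longrightarrow> f (X + Y) = f X + f Y"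
    and g: "\<And>X Y. X \<in> Hom A \<rho> \<sigma> \<Longrightarrow> Y \<in> Hom A \<rho> \<sigma> \<Longrightarrow> g (X + Y) = g X + g Y"
    and eq: "\<And>k x. k \<in> carrier K \<Longrightarrow> \<guillemotleft>x : gO k \<rho> \<rightarrow> \<sigma>\<guillemotright> \<Longrightarrow> f (sg \<rho> \<sigma> k x) = g (sg \<rho> \<sigma> k x)"
  shows "f X = g X"
proof -
  obtain F where F: "finite F" "F \<subseteq> carrier K" "X = (\<Sum>k\<in>F. sg \<rho> \<sigma> k (co \<rho> \<sigma> k X))"
    using expand_A[OF O X] by auto
  have h: "\<guillemotleft>co \<rho> \<sigma> k X : gO k \<rho> \<rightarrow> \<sigma>\<guillemotright>" if "k \<in> F" for k using co_Hom O X F that by auto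
  then have s: "sg \<rho> \<sigma> k (co \<rho> \<sigma> k X) \<in> Hom A \<rho> \<sigma>" if "k \<in> F" for k using sg_Hom O F that by auto
  have "f (\<Sum>k\<in>F. sg \<rho> \<sigma> k (co \<rho> \<sigma> k X)) = (\<Sum>k\<in>F. f (sg \<rho> \<sigma> k (co \<rho> \<sigma> k X)))"
    by (rule additive_sum[OF O f s])
  also have "\<dots> = (\<Sum>k\<in>F. g (sg \<rho> \<sigma> k (co \<rho> \<sigma> k X)))" using eq h F by (intro sum.cong) auto
  also have "\<dots> = g (\<Sum>k\<in>F. sg \<rho> \<sigma> k (co \<rho> \<sigma> k X))" by (rule additive_sum[OF O g s, symmetric])
  finally show ?thesis by (simp flip: F(3))
qed

lemma A_hom_induct:
  assumes O: "\<rho> \<in> Obj C" "\<sigma> \<in> Obj C" and X: "X \<in> Hom A \<rho> \<sigma>" and zero: "P 0"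
    and sg: "\<And>k x. k \<in> carrier K \<Longrightarrow> \<guillemotleft>x : gO k \<rho> \<rightarrow> \<sigma>\<guillemotright> \<Longrightarrow> P (sg \<rho> \<sigma> k x)"
    and add: "\<And>X Y. X \<in> Hom A \<rho> \<sigma> \<Longrightarrow> Y \<in> Hom A \<rho> \<sigma> \<Longrightarrow> P X \<Longrightarrow> P Y \<Longrightarrow> P (X + Y)"
  shows "P X"
proof -
  obtain F where F: "finite F" "F \<subseteq> carrier K" "X = (\<Sum>k\<in>F. sg \<rho> \<sigma> k (co \<rho> \<sigma> k X))"
    using expand_A[OF O X] by auto
  have h: "\<guillemotleft>co \<rho> \<sigma> k X : gO k \<rho> \<rightarrow> \<sigma>\<guillemotright>" if "k \<in> F" for k using co_Hom O X F that by auto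
  have "P (\<Sum>k\<in>F. sg \<rho> \<sigma> k (co \<rho> \<sigma> k X))"
    using F(1,2) h
  proof (induction F)
    case (insert k F)
    then have "sg \<rho> \<sigma> k (co \<rho> \<sigma> k X) \<in> Hom A \<rho> \<sigma>" "(\<Sum>k\<in>F. sg \<rho> \<sigma> k (co \<rho> \<sigma> k X)) \<in> Hom A \<rho> \<sigma>"
      by (auto intro!: sg_Hom A_sum O)
    then show ?case using insert by (simp add: add sg)
  qed (simp add: zero)
  then show ?thesis by (simp flip: F(3))
qed

lemma zero_cmp_A: "\<lbrakk>\<rho> \<in> Obj C; \<sigma> \<in> Obj C; \<delta> \<in> Obj C; Y \<in> Hom A \<rho> \<sigma>\<rbrakk> \<Longrightarrow> 0 \<cdot>\<^bsub>A\<^esub> Y = 0"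
  using add_cmp_A[of \<rho> \<sigma> \<delta> 0 0 Y] A_closed(1) by simp

lemma cmp_zero_A: "\<lbrakk>\<rho> \<in> Obj C; \<sigma> \<in> Obj C; \<delta> \<in> Obj C; X \<in> Hom A \<sigma> \<delta>\<rbrakk> \<Longrightarrow> X \<cdot>\<^bsub>A\<^esub> 0 = 0"
  using cmp_add_A[of \<rho> \<sigma> \<delta> X 0 0] A_closed(1) by simp

lemma adj_zero_A: "\<lbrakk>\<rho> \<in> Obj C; \<sigma> \<in> Obj C\<rbrakk> \<Longrightarrow> adj A 0 = 0"
  using adj_add_A[of \<rho> \<sigma> 0 0] A_closed(1) by simp

lemma cmp_Hom_A:
  assumes O: "\<rho> \<in> Obj C" "\<sigma> \<in> Obj C" "\<delta> \<in> Obj C" and X: "X \<in> Hom A \<sigma> \<delta>" and Y: "Y \<in> Hom A \<rho> \<sigma>"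
  shows "X \<cdot>\<^bsub>A\<^esub> Y \<in> Hom A \<rho> \<delta>"
proof (rule A_hom_induct[OF O(2,3) X])
  show "0 \<cdot>\<^bsub>A\<^esub> Y \<in> Hom A \<rho> \<delta>" using O Y by (simp add: zero_cmp_A A_closed)
  show "(X + X') \<cdot>\<^bsub>A\<^esub> Y \<in> Hom A \<rho> \<delta>" if "X \<in> Hom A \<sigma> \<delta>" "X' \<in> Hom A \<sigma> \<delta>"
    "X \<cdot>\<^bsub>A\<^esub> Y \<in> Hom A \<rho> \<delta>" "X' \<cdot>\<^bsub>A\<^esub> Y \<in> Hom A \<rho> \<delta>" for X X'
    using that O Y by (simp add: add_cmp_A A_closed)
  fix k x assume k: "k \<in> carrier K" and x: "\<guillemotleft>x : gO k \<sigma> \<rightarrow> \<delta>\<guillemotright>"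
  note sx = sg_Hom[OF k O(2) x]
  show "sg \<sigma> \<delta> k x \<cdot>\<^bsub>A\<^esub> Y \<in> Hom A \<rho> \<delta>"
  proof (rule A_hom_induct[OF O(1,2) Y])
    show "sg \<sigma> \<delta> k x \<cdot>\<^bsub>A\<^esub> 0 \<in> Hom A \<rho> \<delta>" using O sx by (simp add: cmp_zero_A[of \<rho> \<sigma>] A_closed)
    show "sg \<sigma> \<delta> k x \<cdot>\<^bsub>A\<^esub> (Y + Y') \<in> Hom A \<rho> \<delta>" if "Y \<in> Hom A \<rho> \<sigma>" "Y' \<in> Hom A \<rho> \<sigma>"
      "sg \<sigma> \<delta> k x \<cdot>\<^bsub>A\<^esub> Y \<in> Hom A \<rho> \<delta>" "sg \<sigma> \<delta> k x \<cdot>\<^bsub>A\<^esub> Y' \<in> Hom A \<rho> \<delta>" for Y Y'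
      using that O sx by (simp add: cmp_add_A A_closed)
    show "sg \<sigma> \<delta> k x \<cdot>\<^bsub>A\<^esub> sg \<rho> \<sigma> l y \<in> Hom A \<rho> \<delta>" if l: "l \<in> carrier K" and y: "\<guillemotleft>y : gO l \<rho> \<rightarrow> \<sigma>\<guillemotright>" for l y
      unfolding cmp_sg[OF k l O(1,2) x y]
      by (rule sg_Hom[OF m_closed[OF k l] O(1) gcmp_hom[OF k l x y O(1)]])
  qed
qed

lemma adj_Hom_A:
  assumes O: "\<rho> \<in> Obj C" "\<sigma> \<in> Obj C" and X: "X \<in> Hom A \<rho> \<sigma>"
  shows "adj A X \<in> Hom A \<sigma> \<rho>"
proof (rule A_hom_induct[OF O X])
  show "adj A 0 \<in> Hom A \<sigma> \<rho>" using O by (simp add: adj_zero_A A_closed)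
  show "adj A (X + Y) \<in> Hom A \<sigma> \<rho>" if "X \<in> Hom A \<rho> \<sigma>" "Y \<in> Hom A \<rho> \<sigma>"
    "adj A X \<in> Hom A \<sigma> \<rho>" "adj A Y \<in> Hom A \<sigma> \<rho>" for X Y
    using that O by (simp add: adj_add_A A_closed)
  show "adj A (sg \<rho> \<sigma> k x) \<in> Hom A \<sigma> \<rho>" if k: "k \<in> carrier K" and x: "\<guillemotleft>x : gO k \<rho> \<rightarrow> \<sigma>\<guillemotright>" for k x
    unfolding adj_sg[OF k O(1) x] by (rule sg_Hom[OF inv_closed[OF k] O(2) gstar_hom[OF k x O(1)]])
qed

lemma assoc_A:
  assumes O: "\<rho> \<in> Obj C" "\<sigma> \<in> Obj C" "\<tau> \<in> Obj C" "\<upsilon> \<in> Obj C"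
    and X: "X \<in> Hom A \<tau> \<upsilon>" and Y: "Y \<in> Hom A \<sigma> \<tau>" and Z: "Z \<in> Hom A \<rho> \<sigma>"
  shows "X \<cdot>\<^bsub>A\<^esub> Y \<cdot>\<^bsub>A\<^esub> Z = X \<cdot>\<^bsub>A\<^esub> (Y \<cdot>\<^bsub>A\<^esub> Z)"
proof (rule additive_eqI[OF O(3,4) X, where f = "\<lambda>X. X \<cdot>\<^bsub>A\<^esub> Y \<cdot>\<^bsub>A\<^esub> Z" and g = "\<lambda>X. X \<cdot>\<^bsub>A\<^esub> (Y \<cdot>\<^bsub>A\<^esub> Z)"])
  fix k x assume k: "k \<in> carrier K" and x: "\<guillemotleft>x : gO k \<tau> \<rightarrow> \<upsilon>\<guillemotright>"
  let ?X = "sg \<tau> \<upsilon> k x"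
  note sx = sg_Hom[OF k O(3) x]
  show "?X \<cdot>\<^bsub>A\<^esub> Y \<cdot>\<^bsub>A\<^esub> Z = ?X \<cdot>\<^bsub>A\<^esub> (Y \<cdot>\<^bsub>A\<^esub> Z)"
  proof (rule additive_eqI[OF O(2,3) Y, where f = "\<lambda>Y. ?X \<cdot>\<^bsub>A\<^esub> Y \<cdot>\<^bsub>A\<^esub> Z" and g = "\<lambda>Y. ?X \<cdot>\<^bsub>A\<^esub> (Y \<cdot>\<^bsub>A\<^esub> Z)"])
    fix l y assume l: "l \<in> carrier K" and y: "\<guillemotleft>y : gO l \<sigma> \<rightarrow> \<tau>\<guillemotright>"
    let ?Y = "sg \<sigma> \<tau> l y"
    note sy = sg_Hom[OF l O(2) y]
    show "?X \<cdot>\<^bsub>A\<^esub> ?Y \<cdot>\<^bsub>A\<^esub> Z = ?X \<cdot>\<^bsub>A\<^esub> (?Y \<cdot>\<^bsub>A\<^esub> Z)"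
    proof (rule additive_eqI[OF O(1,2) Z, where f = "\<lambda>Z. ?X \<cdot>\<^bsub>A\<^esub> ?Y \<cdot>\<^bsub>A\<^esub> Z" and g = "\<lambda>Z. ?X \<cdot>\<^bsub>A\<^esub> (?Y \<cdot>\<^bsub>A\<^esub> Z)"])
      fix m z assume m: "m \<in> carrier K" and z: "\<guillemotleft>z : gO m \<rho> \<rightarrow> \<sigma>\<guillemotright>"
      show "?X \<cdot>\<^bsub>A\<^esub> ?Y \<cdot>\<^bsub>A\<^esub> sg \<rho> \<sigma> m z = ?X \<cdot>\<^bsub>A\<^esub> (?Y \<cdot>\<^bsub>A\<^esub> sg \<rho> \<sigma> m z)"
        by (simp add: cmp_sg[OF k l O(2,3) x y] cmp_sg[OF l m O(1,2) y z]
            cmp_sg[OF m_closed[OF k l] m O(1,2) gcmp_hom[OF k l x y O(2)] z]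
            cmp_sg[OF k m_closed[OF l m] O(1,3) x gcmp_hom[OF l m y z O(1)]]
            gcmp_assoc[OF k l m x y z O(1-3)] m_assoc k l m)
    qed (use O sx sy in \<open>simp_all add: cmp_add_A cmp_Hom_A\<close>)
  qed (use O sx Z in \<open>simp_all add: add_cmp_A cmp_add_A cmp_Hom_A\<close>)
qed (use O Y Z in \<open>simp_all add: add_cmp_A cmp_Hom_A\<close>)

lemma adj_cmp_A:
  assumes O: "\<rho> \<in> Obj C" "\<sigma> \<in> Obj C" "\<tau> \<in> Obj C" and X: "X \<in> Hom A \<sigma> \<tau>" and Y: "Y \<in> Hom A \<rho> \<sigma>"
  shows "adj A (X \<cdot>\<^bsub>A\<^esub> Y) = adj A Y \<cdot>\<^bsub>A\<^esub> adj A X"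
proof (rule additive_eqI[OF O(2,3) X, where f = "\<lambda>X. adj A (X \<cdot>\<^bsub>A\<^esub> Y)" and g = "\<lambda>X. adj A Y \<cdot>\<^bsub>A\<^esub> adj A X"])
  fix k x assume k: "k \<in> carrier K" and x: "\<guillemotleft>x : gO k \<sigma> \<rightarrow> \<tau>\<guillemotright>"
  let ?X = "sg \<sigma> \<tau> k x"
  note sx = sg_Hom[OF k O(2) x]
  note ax = adj_Hom_A[OF O(2,3) sx]
  show "adj A (?X \<cdot>\<^bsub>A\<^esub> Y) = adj A Y \<cdot>\<^bsub>A\<^esub> adj A ?X"
  proof (rule additive_eqI[OF O(1,2) Y, where f = "\<lambda>Y. adj A (?X \<cdot>\<^bsub>A\<^esub> Y)" and g = "\<lambda>Y. adj A Y \<cdot>\<^bsub>A\<^esub> adj A ?X"])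
    fix l y assume l: "l \<in> carrier K" and y: "\<guillemotleft>y : gO l \<rho> \<rightarrow> \<sigma>\<guillemotright>"
    show "adj A (?X \<cdot>\<^bsub>A\<^esub> sg \<rho> \<sigma> l y) = adj A (sg \<rho> \<sigma> l y) \<cdot>\<^bsub>A\<^esub> adj A ?X"
      by (simp add: cmp_sg[OF k l O(1,2) x y] adj_sg[OF m_closed[OF k l] O(1) gcmp_hom[OF k l x y O(1)]]
          adj_sg[OF k O(2) x] adj_sg[OF l O(1) y]
          cmp_sg[OF inv_closed[OF l] inv_closed[OF k] O(3,2) gstar_hom[OF l y O(1)] gstar_hom[OF k x O(2)]]
          gstar_gcmp[OF k l x y O] inv_mult_group k l m_comm)
  qed (use O sx ax in \<open>simp_all add: add_cmp_A cmp_add_A cmp_Hom_A adj_add_A adj_Hom_A\<close>)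
qed (use O Y in \<open>simp_all add: add_cmp_A cmp_add_A cmp_Hom_A adj_add_A adj_Hom_A\<close>)

text \<open>
  Positivity: the component of degree \<open>\<one>\<close> of \<open>X\<^sup>* X\<close> is \<open>\<Sum>k. (y k)\<^sup>* (y k)\<close>, where \<open>y k\<close> is
  the component \<open>x k\<close> of \<open>X\<close> transported by the action of \<open>k\<^sup>-\<^sup>1\<close>.
\<close>

lemma positive_A:
  assumes O: "\<rho> \<in> Obj C" "\<sigma> \<in> Obj C" and X: "X \<in> Hom A \<rho> \<sigma>" and zero: "adj A X \<cdot>\<^bsub>A\<^esub> X = 0"
  shows "X = 0"
proof -
  obtain F where F: "finite F" "F \<subseteq> carrier K" "X = (\<Sum>k\<in>F. sg \<rho> \<sigma> k (co \<rho> \<sigma> k X))"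
    using expand_A[OF O X] by auto
  have FK: "k \<in> carrier K" if "k \<in> F" for k using F that by auto
  define x where "x k = co \<rho> \<sigma> k X" for k
  have Xx: "X = (\<Sum>k\<in>F. sg \<rho> \<sigma> k (x k))" using F(3) by (simp add: x_def)
  have x: "\<guillemotleft>x k : gO k \<rho> \<rightarrow> \<sigma>\<guillemotright>" if "k \<in> F" for k unfolding x_def using co_Hom[OF FK O X] that by simp
  have sx: "sg \<rho> \<sigma> k (x k) \<in> Hom A \<rho> \<sigma>" if "k \<in> F" for k by (rule sg_Hom[OF FK[OF that] O(1) x[OF that]])
  define y where "y k = gA (inv\<^bsub>K\<^esub> k) (x k) \<cdot> w (inv\<^bsub>K\<^esub> k) k \<rho>" for k
  have yh: "\<guillemotleft>y k : \<rho> \<rightarrow> gO (inv\<^bsub>K\<^esub> k) \<sigma>\<guillemotright>" and yy: "gcmp (inv\<^bsub>K\<^esub> k) k \<rho> (gstar k \<rho> (x k)) (x k) = adj C (y k) \<cdot> y k"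
    if "k \<in> F" for k
    using gstar_self[OF FK[OF that] x[OF that] O(1)] by (simp_all add: y_def)
  have pair: "co \<rho> \<rho> \<one>\<^bsub>K\<^esub> (adj A (sg \<rho> \<sigma> k (x k)) \<cdot>\<^bsub>A\<^esub> sg \<rho> \<sigma> l (x l)) = (if l = k then adj C (y k) \<cdot> y k else 0)"
    if k: "k \<in> F" and l: "l \<in> F" for k l
  proof -
    note kK = FK[OF k] and lK = FK[OF l]
    have "inv\<^bsub>K\<^esub> k \<otimes>\<^bsub>K\<^esub> l = \<one>\<^bsub>K\<^esub> \<longleftrightarrow> l = k"
      using kK lK by (metis inv_closed inv_equality inv_inv l_inv)
    then show ?thesis
      using k kK lK yy[OF k]
      by (auto simp: adj_sg[OF kK O(1) x[OF k]]
          cmp_sg[OF inv_closed[OF kK] lK O gstar_hom[OF kK x[OF k] O(1)] x[OF l]]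
          co_sg[OF one_closed m_closed[OF inv_closed[OF kK] lK] O(1)
            gcmp_hom[OF inv_closed[OF kK] lK gstar_hom[OF kK x[OF k] O(1)] x[OF l] O(1)]])
  qed
  have aX: "adj A X = (\<Sum>k\<in>F. adj A (sg \<rho> \<sigma> k (x k)))"
    unfolding Xx by (rule additive_sum[OF O adj_add_A[OF O] sx])
  have asx: "adj A (sg \<rho> \<sigma> k (x k)) \<in> Hom A \<sigma> \<rho>" if "k \<in> F" for k by (rule adj_Hom_A[OF O sx[OF that]])
  have in1: "adj A (sg \<rho> \<sigma> k (x k)) \<cdot>\<^bsub>A\<^esub> X \<in> Hom A \<rho> \<rho>" if "k \<in> F" for k
    by (rule cmp_Hom_A[OF O(1,2,1) asx[OF that] X])
  have "adj A X \<cdot>\<^bsub>A\<^esub> X = (\<Sum>k\<in>F. adj A (sg \<rho> \<sigma> k (x k)) \<cdot>\<^bsub>A\<^esub> X)"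
    unfolding aX by (rule additive_sum[OF O(2,1), where f = "\<lambda>Y. Y \<cdot>\<^bsub>A\<^esub> X"]) (use O X asx in \<open>simp_all add: add_cmp_A\<close>)
  then have "co \<rho> \<rho> \<one>\<^bsub>K\<^esub> (adj A X \<cdot>\<^bsub>A\<^esub> X) = (\<Sum>k\<in>F. co \<rho> \<rho> \<one>\<^bsub>K\<^esub> (adj A (sg \<rho> \<sigma> k (x k)) \<cdot>\<^bsub>A\<^esub> X))"
    using additive_sum[OF O(1,1) co_add[OF one_closed O(1,1)] in1] by simp
  also have "\<dots> = (\<Sum>k\<in>F. \<Sum>l\<in>F. co \<rho> \<rho> \<one>\<^bsub>K\<^esub> (adj A (sg \<rho> \<sigma> k (x k)) \<cdot>\<^bsub>A\<^esub> sg \<rho> \<sigma> l (x l)))"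
  proof (rule sum.cong)
    fix k assume k: "k \<in> F"
    show "co \<rho> \<rho> \<one>\<^bsub>K\<^esub> (adj A (sg \<rho> \<sigma> k (x k)) \<cdot>\<^bsub>A\<^esub> X) = (\<Sum>l\<in>F. co \<rho> \<rho> \<one>\<^bsub>K\<^esub> (adj A (sg \<rho> \<sigma> k (x k)) \<cdot>\<^bsub>A\<^esub> sg \<rho> \<sigma> l (x l)))"
      unfolding Xx
      by (rule additive_sum[OF O, where f = "\<lambda>Y. co \<rho> \<rho> \<one>\<^bsub>K\<^esub> (adj A (sg \<rho> \<sigma> k (x k)) \<cdot>\<^bsub>A\<^esub> Y)"])
        (use O asx[OF k] sx in \<open>simp_all add: cmp_add_A[of \<rho> \<sigma> \<rho>] co_add cmp_Hom_A[of \<rho> \<sigma> \<rho>]\<close>)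
  qed simp
  also have "\<dots> = (\<Sum>k\<in>F. adj C (y k) \<cdot> y k)" using F(1) by (simp add: pair)
  finally have s0: "(\<Sum>k\<in>F. adj C (y k) \<cdot> y k) = co \<rho> \<rho> \<one>\<^bsub>K\<^esub> 0" using zero by simp
  have "co \<rho> \<rho> \<one>\<^bsub>K\<^esub> 0 = 0"
    using co_add[OF one_closed O(1,1) A_closed(1)[OF O(1,1)] A_closed(1)[OF O(1,1)]] by simp
  with s0 have "(\<Sum>k\<in>F. adj C (y k) \<cdot> y k) = 0" by simp
  then have y0: "y k = 0" if "k \<in> F" for k
    by (intro sum_positive_zero[of \<rho> F y "\<lambda>k. gO (inv\<^bsub>K\<^esub> k) \<sigma>" k] sums O(1) F(1) yh that)
  have "x k = 0" if k: "k \<in> F" for k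
  proof (rule gA_faithful[OF inv_closed[OF FK[OF k]] x[OF k]])
    note kK = FK[OF k] and ik = inv_closed[OF FK[OF k]]
    note gx = gA[OF ik x[OF k]] and ww = w[OF ik kK O(1)]
    show "\<guillemotleft>0 : gO k \<rho> \<rightarrow> \<sigma>\<guillemotright>" using kK O by (simp add: hom_zero)
    have "gA (inv\<^bsub>K\<^esub> k) (x k) = y k \<cdot> adj C (w (inv\<^bsub>K\<^esub> k) k \<rho>)"
      unfolding y_def by (simp add: assoc[OF gx ww hom_adj[OF ww]] w_unitary[OF ik kK O(1)] ide_right[OF gx])
    also have "\<dots> = 0" using zero_cmp[OF hom_adj[OF ww]] y0[OF k] ik O kK by simp
    finally show "gA (inv\<^bsub>K\<^esub> k) (x k) = gA (inv\<^bsub>K\<^esub> k) 0" using gA_zero[OF ik O(1)] by simp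
  qed
  then have "sg \<rho> \<sigma> k (x k) = 0" if "k \<in> F" for k
    using sg_scl[OF FK[OF that] O(1) x[OF that], of 0] that by simp
  then show ?thesis using Xx by simp
qed

theorem star_category_A: "star_category A"
proof (rule star_category.intro, unfold Obj_A)
  show "vector_space (scl A)" by (rule vs_A)
  fix \<rho> assume \<rho>: "\<rho> \<in> Obj C"
  show ide: "ide A \<rho> \<in> Hom A \<rho> \<rho>"
    using sg_Hom[OF one_closed \<rho>] hom_ide[OF \<rho>] \<rho> by (simp add: ide_A)
  fix \<sigma> assume \<sigma>: "\<sigma> \<in> Obj C"
  show "VA.subspace (Hom A \<rho> \<sigma>)" by (rule subspace_A[OF \<rho> \<sigma>])
  fix X assume X: "X \<in> Hom A \<rho> \<sigma>"
  have sid: "sg \<rho> \<rho> \<one>\<^bsub>K\<^esub> (ide C \<rho>) \<in> Hom A \<rho> \<rho>" if "\<rho> \<in> Obj C" for \<rho>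
    using sg_Hom[OF one_closed that] hom_ide[OF that] that by simp
  show "ide A \<sigma> \<cdot>\<^bsub>A\<^esub> X = X"
  proof (rule additive_eqI[OF \<rho> \<sigma> X, where f = "\<lambda>X. ide A \<sigma> \<cdot>\<^bsub>A\<^esub> X" and g = "\<lambda>X. X"])
    show "ide A \<sigma> \<cdot>\<^bsub>A\<^esub> sg \<rho> \<sigma> k x = sg \<rho> \<sigma> k x" if k: "k \<in> carrier K" and x: "\<guillemotleft>x : gO k \<rho> \<rightarrow> \<sigma>\<guillemotright>" for k x
      using cmp_sg[OF one_closed k \<rho> \<sigma> _ x, of "ide C \<sigma>" \<sigma>] hom_ide[OF \<sigma>] gcmp_ide[OF k x \<rho> \<sigma>] k \<sigma>
      by (simp add: ide_A)
  qed (use \<rho> \<sigma> sid in \<open>simp_all add: cmp_add_A ide_A\<close>)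
  show "X \<cdot>\<^bsub>A\<^esub> ide A \<rho> = X"
  proof (rule additive_eqI[OF \<rho> \<sigma> X, where f = "\<lambda>X. X \<cdot>\<^bsub>A\<^esub> ide A \<rho>" and g = "\<lambda>X. X"])
    show "sg \<rho> \<sigma> k x \<cdot>\<^bsub>A\<^esub> ide A \<rho> = sg \<rho> \<sigma> k x" if k: "k \<in> carrier K" and x: "\<guillemotleft>x : gO k \<rho> \<rightarrow> \<sigma>\<guillemotright>" for k x
      using cmp_sg[OF k one_closed \<rho> \<rho> x, of "ide C \<rho>"] hom_ide[OF \<rho>] gcmp_ide[OF k x \<rho> \<sigma>] k \<rho>
      by (simp add: ide_A)
  qed (use \<rho> \<sigma> sid in \<open>simp_all add: add_cmp_A ide_A\<close>)
  show aX: "adj A X \<in> Hom A \<sigma> \<rho>" by (rule adj_Hom_A[OF \<rho> \<sigma> X])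
  show "adj A (adj A X) = X"
  proof (rule additive_eqI[OF \<rho> \<sigma> X, where f = "\<lambda>X. adj A (adj A X)" and g = "\<lambda>X. X"])
    show "adj A (adj A (sg \<rho> \<sigma> k x)) = sg \<rho> \<sigma> k x" if k: "k \<in> carrier K" and x: "\<guillemotleft>x : gO k \<rho> \<rightarrow> \<sigma>\<guillemotright>" for k x
      by (simp add: adj_sg[OF k \<rho> x] adj_sg[OF inv_closed[OF k] \<sigma> gstar_hom[OF k x \<rho>]] gstar_gstar[OF k x \<rho> \<sigma>] k)
  qed (use \<rho> \<sigma> in \<open>simp_all add: adj_add_A adj_Hom_A\<close>)
  show "adj A (X + Y) = adj A X + adj A Y" if "Y \<in> Hom A \<rho> \<sigma>" for Y by (rule adj_add_A[OF \<rho> \<sigma> X that])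
  show "adj A (scl A z X) = scl A (cnj z) (adj A X)" for z
  proof (rule additive_eqI[OF \<rho> \<sigma> X, where f = "\<lambda>X. adj A (scl A z X)" and g = "\<lambda>X. scl A (cnj z) (adj A X)"])
    show "adj A (scl A z (sg \<rho> \<sigma> k x)) = scl A (cnj z) (adj A (sg \<rho> \<sigma> k x))"
      if k: "k \<in> carrier K" and x: "\<guillemotleft>x : gO k \<rho> \<rightarrow> \<sigma>\<guillemotright>" for k x
      by (simp add: sg_scl[OF k \<rho> x, symmetric] adj_sg[OF k \<rho> hom_scl[OF x]] adj_sg[OF k \<rho> x] gstar_scl[OF k \<rho> x]
          sg_scl[OF inv_closed[OF k] \<sigma> gstar_hom[OF k x \<rho>]])
  qed (use \<rho> \<sigma> in \<open>simp_all add: adj_add_A A_closed VA.scale_right_distrib\<close>)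
  show "X = 0" if "adj A X \<cdot>\<^bsub>A\<^esub> X = 0" by (rule positive_A[OF \<rho> \<sigma> X that])
  fix \<tau> assume \<tau>: "\<tau> \<in> Obj C"
  fix Y assume Y: "Y \<in> Hom A \<sigma> \<tau>"
  show "Y \<cdot>\<^bsub>A\<^esub> X \<in> Hom A \<rho> \<tau>" by (rule cmp_Hom_A[OF \<rho> \<sigma> \<tau> Y X])
  show "adj A (Y \<cdot>\<^bsub>A\<^esub> X) = adj A X \<cdot>\<^bsub>A\<^esub> adj A Y" by (rule adj_cmp_A[OF \<rho> \<sigma> \<tau> Y X])
  show "(Y + Y') \<cdot>\<^bsub>A\<^esub> X = Y \<cdot>\<^bsub>A\<^esub> X + Y' \<cdot>\<^bsub>A\<^esub> X" if "Y' \<in> Hom A \<sigma> \<tau>" for Y'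
    by (rule add_cmp_A[OF \<rho> \<sigma> \<tau> Y that X])
  show "Y \<cdot>\<^bsub>A\<^esub> (X + X') = Y \<cdot>\<^bsub>A\<^esub> X + Y \<cdot>\<^bsub>A\<^esub> X'" if "X' \<in> Hom A \<rho> \<sigma>" for X'
    by (rule cmp_add_A[OF \<rho> \<sigma> \<tau> Y X that])
  show "Z \<cdot>\<^bsub>A\<^esub> Y \<cdot>\<^bsub>A\<^esub> X = Z \<cdot>\<^bsub>A\<^esub> (Y \<cdot>\<^bsub>A\<^esub> X)" if "\<upsilon> \<in> Obj C" "Z \<in> Hom A \<tau> \<upsilon>" for \<upsilon> Z
    by (rule assoc_A[OF \<rho> \<sigma> \<tau> that(1) that(2) Y X])
  have sc: "scl A z Y \<cdot>\<^bsub>A\<^esub> X = scl A z (Y \<cdot>\<^bsub>A\<^esub> X) \<and> Y \<cdot>\<^bsub>A\<^esub> scl A z X = scl A z (Y \<cdot>\<^bsub>A\<^esub> X)" for z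
  proof
    show "scl A z Y \<cdot>\<^bsub>A\<^esub> X = scl A z (Y \<cdot>\<^bsub>A\<^esub> X)"
    proof (rule additive_eqI[OF \<sigma> \<tau> Y, where f = "\<lambda>Y. scl A z Y \<cdot>\<^bsub>A\<^esub> X" and g = "\<lambda>Y. scl A z (Y \<cdot>\<^bsub>A\<^esub> X)"])
      fix k y assume k: "k \<in> carrier K" and y: "\<guillemotleft>y : gO k \<sigma> \<rightarrow> \<tau>\<guillemotright>"
      note sy = sg_Hom[OF k \<sigma> y]
      show "scl A z (sg \<sigma> \<tau> k y) \<cdot>\<^bsub>A\<^esub> X = scl A z (sg \<sigma> \<tau> k y \<cdot>\<^bsub>A\<^esub> X)"
      proof (rule additive_eqI[OF \<rho> \<sigma> X, where f = "\<lambda>X. scl A z (sg \<sigma> \<tau> k y) \<cdot>\<^bsub>A\<^esub> X" and g = "\<lambda>X. scl A z (sg \<sigma> \<tau> k y \<cdot>\<^bsub>A\<^esub> X)"])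
        show "scl A z (sg \<sigma> \<tau> k y) \<cdot>\<^bsub>A\<^esub> sg \<rho> \<sigma> l x = scl A z (sg \<sigma> \<tau> k y \<cdot>\<^bsub>A\<^esub> sg \<rho> \<sigma> l x)"
          if l: "l \<in> carrier K" and x: "\<guillemotleft>x : gO l \<rho> \<rightarrow> \<sigma>\<guillemotright>" for l x
          by (simp add: sg_scl[OF k \<sigma> y, symmetric] cmp_sg[OF k l \<rho> \<sigma> hom_scl[OF y] x] cmp_sg[OF k l \<rho> \<sigma> y x]
              gcmp_add(3)[OF k l \<rho> y x] sg_scl[OF m_closed[OF k l] \<rho> gcmp_hom[OF k l y x \<rho>]])
      qed (use \<rho> \<sigma> \<tau> sy in \<open>simp_all add: cmp_add_A A_closed VA.scale_right_distrib\<close>)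
    qed (use \<rho> \<sigma> \<tau> X in \<open>simp_all add: add_cmp_A A_closed VA.scale_right_distrib\<close>)
    show "Y \<cdot>\<^bsub>A\<^esub> scl A z X = scl A z (Y \<cdot>\<^bsub>A\<^esub> X)"
    proof (rule additive_eqI[OF \<sigma> \<tau> Y, where f = "\<lambda>Y. Y \<cdot>\<^bsub>A\<^esub> scl A z X" and g = "\<lambda>Y. scl A z (Y \<cdot>\<^bsub>A\<^esub> X)"])
      fix k y assume k: "k \<in> carrier K" and y: "\<guillemotleft>y : gO k \<sigma> \<rightarrow> \<tau>\<guillemotright>"
      note sy = sg_Hom[OF k \<sigma> y]
      show "sg \<sigma> \<tau> k y \<cdot>\<^bsub>A\<^esub> scl A z X = scl A z (sg \<sigma> \<tau> k y \<cdot>\<^bsub>A\<^esub> X)"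
      proof (rule additive_eqI[OF \<rho> \<sigma> X, where f = "\<lambda>X. sg \<sigma> \<tau> k y \<cdot>\<^bsub>A\<^esub> scl A z X" and g = "\<lambda>X. scl A z (sg \<sigma> \<tau> k y \<cdot>\<^bsub>A\<^esub> X)"])
        show "sg \<sigma> \<tau> k y \<cdot>\<^bsub>A\<^esub> scl A z (sg \<rho> \<sigma> l x) = scl A z (sg \<sigma> \<tau> k y \<cdot>\<^bsub>A\<^esub> sg \<rho> \<sigma> l x)"
          if l: "l \<in> carrier K" and x: "\<guillemotleft>x : gO l \<rho> \<rightarrow> \<sigma>\<guillemotright>" for l x
          by (simp add: sg_scl[OF l \<rho> x, symmetric] cmp_sg[OF k l \<rho> \<sigma> y hom_scl[OF x]] cmp_sg[OF k l \<rho> \<sigma> y x]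
              gcmp_add(4)[OF k l \<rho> y x] sg_scl[OF m_closed[OF k l] \<rho> gcmp_hom[OF k l y x \<rho>]])
      qed (use \<rho> \<sigma> \<tau> sy in \<open>simp_all add: cmp_add_A A_closed VA.scale_right_distrib\<close>)
    qed (use \<rho> \<sigma> \<tau> X in \<open>simp_all add: add_cmp_A A_closed VA.scale_right_distrib\<close>)
  qed
  then show "scl A z Y \<cdot>\<^bsub>A\<^esub> X = scl A z (Y \<cdot>\<^bsub>A\<^esub> X)" "Y \<cdot>\<^bsub>A\<^esub> scl A z X = scl A z (Y \<cdot>\<^bsub>A\<^esub> X)" for z
    by blast+
qed

end

context orbit_category
begin

interpretation V: vector_space "scl C" by (rule vs)
interpretation VA: vector_space "scl A" by (rule vs_A)
interpretation A: star_category A by (rule star_category_A)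
interpretation B: star_category "subobject_closure A" by (rule star_category_subobject_closure[OF star_category_A])

section \<open>Decomposition of irreducible objects in the orbit category\<close>

definition stab :: "'o \<Rightarrow> 'k set" where
  "stab \<rho> = {k \<in> carrier K. isomorphic_obj C (gO k \<rho>) \<rho>}"

lemma stab_subgroup:
  assumes \<rho>: "\<rho> \<in> Obj C"
  shows "subgroup (stab \<rho>) K"
proof (rule subgroupI)
  show "stab \<rho> \<subseteq> carrier K" by (auto simp: stab_def)
  show "stab \<rho> \<noteq> {}" using isomorphic_refl[OF \<rho>] \<rho> by (auto simp: stab_def intro!: exI[of _ "\<one>\<^bsub>K\<^esub>"])
  show "inv\<^bsub>K\<^esub> k \<in> stab \<rho>" if "k \<in> stab \<rho>" for k
  proof -
    have k: "k \<in> carrier K" and i: "isomorphic_obj C (gO k \<rho>) \<rho>" using that by (auto simp: stab_def)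
    have "isomorphic_obj C (gO (inv\<^bsub>K\<^esub> k) \<rho>) (gO (inv\<^bsub>K\<^esub> k) (gO k \<rho>))"
      using gA_iso[OF inv_closed[OF k] isomorphic_sym[OF i]] k \<rho> by simp
    moreover have "isomorphic_obj C (gO (inv\<^bsub>K\<^esub> k) (gO k \<rho>)) \<rho>"
      using isomorphic_sym[OF gO_mult_iso[OF inv_closed[OF k] k \<rho>]] k \<rho> by simp
    ultimately show ?thesis using k \<rho> by (auto simp: stab_def intro: isomorphic_trans)
  qed
  show "k \<otimes>\<^bsub>K\<^esub> l \<in> stab \<rho>" if "k \<in> stab \<rho>" "l \<in> stab \<rho>" for k l
  proof -
    have k: "k \<in> carrier K" "isomorphic_obj C (gO k \<rho>) \<rho>" and l: "l \<in> carrier K" "isomorphic_obj C (gO l \<rho>) \<rho>"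
      using that by (auto simp: stab_def)
    have "isomorphic_obj C (gO (k \<otimes>\<^bsub>K\<^esub> l) \<rho>) (gO k \<rho>)"
      using isomorphic_trans[OF gO_mult_iso[OF k(1) l(1) \<rho>] gA_iso[OF k(1) l(2)]] k l \<rho> by simp
    then have "isomorphic_obj C (gO (k \<otimes>\<^bsub>K\<^esub> l) \<rho>) \<rho>" using isomorphic_trans[OF _ k(2)] k l \<rho> by simp
    then show ?thesis using k l by (simp add: stab_def)
  qed
qed

lemma sg_zero: assumes "k \<in> carrier K" "\<rho> \<in> Obj C" "\<sigma> \<in> Obj C" shows "sg \<rho> \<sigma> k 0 = 0"
  using sg_scl[OF assms(1,2) hom_zero, of \<sigma> 0] assms by simp

lemma component_nonzero:
  assumes O: "\<rho> \<in> Obj C" "\<sigma> \<in> Obj C" and X: "X \<in> Hom A \<rho> \<sigma>" "X \<noteq> 0"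
  shows "\<exists>k\<in>carrier K. co \<rho> \<sigma> k X \<noteq> 0"
proof (rule ccontr)
  assume "\<not> ?thesis"
  moreover obtain F where "finite F" "F \<subseteq> carrier K" "X = (\<Sum>k\<in>F. sg \<rho> \<sigma> k (co \<rho> \<sigma> k X))"
    using expand_A[OF O X(1)] by auto
  ultimately have "X = 0" using sum.neutral[of F "\<lambda>k. sg \<rho> \<sigma> k (co \<rho> \<sigma> k X)"] by (auto simp: sg_zero O subset_iff)
  then show False using X by simp
qed

text \<open>Schur's lemma, applied to a nonzero component.\<close>

lemma nonzero_hom_orbit:
  assumes \<rho>: "irreducible_obj C \<rho>" and \<sigma>: "irreducible_obj C \<sigma>" and X: "X \<in> Hom A \<rho> \<sigma>" "X \<noteq> 0"
  shows "\<exists>k\<in>carrier K. isomorphic_obj C (gO k \<rho>) \<sigma>"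
proof -
  note O = irreducibleD(1)[OF \<rho>] irreducibleD(1)[OF \<sigma>]
  obtain k where k: "k \<in> carrier K" "co \<rho> \<sigma> k X \<noteq> 0" using component_nonzero[OF O X] by auto
  then show ?thesis using schur[OF gO_irreducible[OF k(1) \<rho>] \<sigma> co_Hom[OF k(1) O X(1)]] by blast
qed

lemma stab_component_scalar:
  assumes \<rho>: "irreducible_obj C \<rho>" and k: "k \<in> carrier K" and t: "unitary_arr C (gO k \<rho>) \<rho> t"
    and x: "\<guillemotleft>x : gO k \<rho> \<rightarrow> \<rho>\<guillemotright>"
  shows "\<exists>z. x = scl C z t"
proof -
  note O = irreducibleD(1)[OF \<rho>]
  have t': "\<guillemotleft>t : gO k \<rho> \<rightarrow> \<rho>\<guillemotright>" "adj C t \<cdot> t = ide C (gO k \<rho>)"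
    using t k O by (auto simp: unitary_arr_def isometry_def in_hom_def)
  obtain z where z: "x \<cdot> adj C t = scl C z (ide C \<rho>)"
    using irreducibleD(3)[OF \<rho> hom_cmp[OF x hom_adj[OF t'(1)]]] by blast
  have "x = (x \<cdot> adj C t) \<cdot> t" by (simp add: assoc[OF x hom_adj[OF t'(1)] t'(1)] t' ide_right[OF x])
  also have "\<dots> = scl C z t" by (simp add: z scl_cmp[OF hom_ide[OF O] t'(1)] ide_left[OF t'(1)])
  finally show ?thesis by blast
qed

text \<open>
  \<open>End A \<rho>\<close> is the twisted group algebra of the stabilizer of \<open>\<rho>\<close>: by Schur's lemma only the degrees in the
  stabilizer occur, each with multiplicity one.
\<close>

theorem irreducible_decomposes:
  assumes \<rho>: "irreducible_obj C \<rho>" and fin: "finite (stab \<rho>)"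
    and t: "\<And>k. k \<in> stab \<rho> \<Longrightarrow> unitary_arr C (gO k \<rho>) \<rho> (t k)"
  defines "u \<equiv> \<lambda>k. sg \<rho> \<rho> k (t k)"
  defines "c \<equiv> \<lambda>k l. THE z. u k \<cdot>\<^bsub>A\<^esub> u l = scl A z (u (k \<otimes>\<^bsub>K\<^esub> l))"
  defines "L \<equiv> {k \<in> stab \<rho>. \<forall>l\<in>stab \<rho>. c k l = c l k}"
  shows "\<exists>N r. N * N * card L = card (stab \<rho>) \<and> card L > 0 \<and>
    decomposes (subobject_closure A) (\<rho>, ide A \<rho>) N (characters K L) r"
proof -
  note O = irreducibleD(1)[OF \<rho>]
  let ?H = "stab \<rho>" and ?KH = "K\<lparr>carrier := stab \<rho>\<rparr>" and ?B = "subobject_closure A"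
  have sub: "subgroup ?H K" by (rule stab_subgroup[OF O])
  have HK: "k \<in> carrier K" if "k \<in> ?H" for k using that by (simp add: stab_def)
  have tH: "\<guillemotleft>t k : gO k \<rho> \<rightarrow> \<rho>\<guillemotright>" "adj C (t k) \<cdot> t k = ide C (gO k \<rho>)" if "k \<in> ?H" for k
    using t[OF that] HK[OF that] O by (auto simp: unitary_arr_def isometry_def in_hom_def)
  have uM: "u k \<in> Hom A \<rho> \<rho>" if "k \<in> ?H" for k
    unfolding u_def by (rule sg_Hom[OF HK[OF that] O tH(1)[OF that]])
  have u_uni: "adj A (u k) \<cdot>\<^bsub>A\<^esub> u k = ide A \<rho>" "u k \<cdot>\<^bsub>A\<^esub> adj A (u k) = ide A \<rho>" if k: "k \<in> ?H" for k
    using gstar_unitary[OF HK[OF k] O O t[OF k]] HK[OF k]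
    by (simp_all add: u_def ide_A[OF O] adj_sg[OF HK[OF k] O tH(1)[OF k]]
        cmp_sg[OF inv_closed[OF HK[OF k]] HK[OF k] O O gstar_hom[OF HK[OF k] tH(1)[OF k] O] tH(1)[OF k]]
        cmp_sg[OF HK[OF k] inv_closed[OF HK[OF k]] O O tH(1)[OF k] gstar_hom[OF HK[OF k] tH(1)[OF k] O]])
  have iA0: "ide A \<rho> \<noteq> 0"
  proof
    assume "ide A \<rho> = 0"
    then have "co \<rho> \<rho> \<one>\<^bsub>K\<^esub> 0 = ide C \<rho>"
      using co_sg[OF one_closed one_closed O, of "ide C \<rho>" \<rho>] hom_ide[OF O] O by (simp add: ide_A)
    moreover have "co \<rho> \<rho> \<one>\<^bsub>K\<^esub> 0 = 0"
      using co_add[OF one_closed O O A_closed(1)[OF O O] A_closed(1)[OF O O]] by simp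
    ultimately show False using irreducibleD(2)[OF \<rho>] by simp
  qed
  have u0: "u k \<noteq> 0" if "k \<in> ?H" for k
    using u_uni(1)[OF that] iA0 cmp_zero_A[OF O O O adj_Hom_A[OF O O uM[OF that]]] by auto
  have u_mul: "u k \<cdot>\<^bsub>A\<^esub> u l = scl A (c k l) (u (k \<otimes>\<^bsub>K\<^esub> l))" if k: "k \<in> ?H" and l: "l \<in> ?H" for k l
  proof -
    have kl: "k \<otimes>\<^bsub>K\<^esub> l \<in> ?H" by (rule subgroup.m_closed[OF sub k l])
    obtain z where z: "gcmp k l \<rho> (t k) (t l) = scl C z (t (k \<otimes>\<^bsub>K\<^esub> l))"
      using stab_component_scalar[OF \<rho> HK[OF kl] t[OF kl] gcmp_hom[OF HK[OF k] HK[OF l] tH(1)[OF k] tH(1)[OF l] O]]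
      by blast
    have "u k \<cdot>\<^bsub>A\<^esub> u l = scl A z (u (k \<otimes>\<^bsub>K\<^esub> l))"
      by (simp add: u_def cmp_sg[OF HK[OF k] HK[OF l] O O tH(1)[OF k] tH(1)[OF l]] z sg_scl[OF HK[OF kl] O tH(1)[OF kl]])
    moreover from this have "c k l = z" unfolding c_def using u0[OF kl] by (intro the_equality) auto
    ultimately show ?thesis by simp
  qed
  have u_span: "\<exists>z. X = (\<Sum>k\<in>?H. scl A (z k) (u k))" if X: "X \<in> Hom A \<rho> \<rho>" for X
  proof -
    obtain F where F: "finite F" "F \<subseteq> carrier K" "X = (\<Sum>k\<in>F. sg \<rho> \<rho> k (co \<rho> \<rho> k X))"
      using expand_A[OF O O X] by auto
    have "\<forall>k\<in>?H. \<exists>z. co \<rho> \<rho> k X = scl C z (t k)"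
      using stab_component_scalar[OF \<rho>] HK t co_Hom[OF _ O O X] by blast
    then obtain z where z: "\<And>k. k \<in> ?H \<Longrightarrow> co \<rho> \<rho> k X = scl C (z k) (t k)" by metis
    have off: "sg \<rho> \<rho> k (co \<rho> \<rho> k X) = 0" if "k \<in> F - ?H" for k
    proof (rule ccontr)
      assume "sg \<rho> \<rho> k (co \<rho> \<rho> k X) \<noteq> 0"
      moreover have k: "k \<in> carrier K" using that F by auto
      ultimately have "co \<rho> \<rho> k X \<noteq> 0" using sg_zero[OF k O O] by auto
      then have "k \<in> ?H"
        using schur[OF gO_irreducible[OF k \<rho>] \<rho> co_Hom[OF k O O X]] k by (simp add: stab_def)
      with that show False by simp
    qed
    define z' where "z' k = (if k \<in> F then z k else 0)" for k
    have "X = (\<Sum>k\<in>F \<inter> ?H. sg \<rho> \<rho> k (co \<rho> \<rho> k X))"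
      unfolding F(3)[symmetric] using F(1) off by (subst F(3)) (intro sum.mono_neutral_right, auto)
    also have "\<dots> = (\<Sum>k\<in>F \<inter> ?H. scl A (z' k) (u k))"
      by (intro sum.cong) (auto simp: z z'_def u_def sg_scl[OF HK O tH(1)])
    also have "\<dots> = (\<Sum>k\<in>?H. scl A (z' k) (u k))"
      using fin by (intro sum.mono_neutral_left) (auto simp: z'_def)
    finally show ?thesis by blast
  qed
  have span: "Hom A \<rho> \<rho> \<subseteq> VA.span (u ` ?H)"
  proof
    fix X assume "X \<in> Hom A \<rho> \<rho>"
    then obtain z where "X = (\<Sum>k\<in>?H. scl A (z k) (u k))" using u_span by blast
    then show "X \<in> VA.span (u ` ?H)"
      by (simp only:) (intro VA.span_sum VA.span_scale VA.span_base imageI)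
  qed
  interpret E: star_algebra "scl A" "Hom A \<rho> \<rho>" "cmp A" "adj A" "ide A \<rho>"
    by (rule A.endomorphism_algebra[OF _ _ span]) (use O fin in simp_all)
  interpret KH: group ?KH by (rule subgroup_imp_group[OF sub])
  define tr where "tr X = (THE z. co \<rho> \<rho> \<one>\<^bsub>K\<^esub> X = scl C z (ide C \<rho>))" for X
  have tr: "co \<rho> \<rho> \<one>\<^bsub>K\<^esub> X = scl C (tr X) (ide C \<rho>)" if X: "X \<in> Hom A \<rho> \<rho>" for X
  proof -
    obtain z where z: "co \<rho> \<rho> \<one>\<^bsub>K\<^esub> X = scl C z (ide C \<rho>)"
      using irreducibleD(3)[OF \<rho>] co_Hom[OF one_closed O O X] O by auto
    then have "tr X = z" unfolding tr_def using irreducibleD(2)[OF \<rho>] by (intro the_equality) auto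
    then show ?thesis using z by simp
  qed
  have trI: "tr X = z" if "co \<rho> \<rho> \<one>\<^bsub>K\<^esub> X = scl C z (ide C \<rho>)" for X z
    unfolding tr_def using that irreducibleD(2)[OF \<rho>] by (intro the_equality) auto
  have tr_add: "tr (X + Y) = tr X + tr Y" if "X \<in> Hom A \<rho> \<rho>" "Y \<in> Hom A \<rho> \<rho>" for X Y
    by (rule trI) (simp add: co_add[OF one_closed O O that] tr that V.scale_left_distrib)
  have tr_scl: "tr (scl A a X) = a * tr X" if "X \<in> Hom A \<rho> \<rho>" for a X
  proof (rule additive_eqI[OF O O that, where f = "\<lambda>X. tr (scl A a X)" and g = "\<lambda>X. a * tr X"])
    fix k x assume k: "k \<in> carrier K" and x: "\<guillemotleft>x : gO k \<rho> \<rightarrow> \<rho>\<guillemotright>"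
    show "tr (scl A a (sg \<rho> \<rho> k x)) = a * tr (sg \<rho> \<rho> k x)"
      unfolding sg_scl[OF k O x, symmetric]
      using tr[OF sg_Hom[OF k O x]]
      by (intro trI) (auto simp: co_sg[OF one_closed k O x] co_sg[OF one_closed k O hom_scl[OF x]] simp flip: V.scale_scale)
  qed (use O in \<open>simp_all add: tr_add A_closed VA.scale_right_distrib distrib_left\<close>)
  interpret T: twisted_group_algebra "scl A" "Hom A \<rho> \<rho>" "cmp A" "adj A" "ide A \<rho>" ?KH u c tr
  proof unfold_locales
    show "k \<otimes>\<^bsub>?KH\<^esub> l = l \<otimes>\<^bsub>?KH\<^esub> k" if "k \<in> carrier ?KH" "l \<in> carrier ?KH" for k l
      using that HK by (simp add: m_comm)
    show "tr (ide A \<rho>) = 1"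
      using co_sg[OF one_closed one_closed O, of "ide C \<rho>" \<rho>] hom_ide[OF O] O by (intro trI) (simp add: ide_A)
    show "tr (u k) = 0" if "k \<in> carrier ?KH" "k \<noteq> \<one>\<^bsub>?KH\<^esub>" for k
      using that HK tH by (intro trI) (auto simp: u_def co_sg[OF one_closed _ O])
  qed (use fin uM u_uni u_mul u_span tr_add tr_scl in simp_all)
  have L: "T.L = L" by (simp add: T.L_def L_def)
  have chars: "characters ?KH T.L = characters K L" by (simp add: L characters_def)
  obtain N p W where NL: "N * N * card L = card ?H" and
    pW: "\<And>\<eta>. \<eta> \<in> characters K L \<Longrightarrow> E.minimal_proj (p \<eta>) \<and>
      (\<forall>i<N. W \<eta> i \<in> Hom A \<rho> \<rho> \<and> adj A (W \<eta> i) \<cdot>\<^bsub>A\<^esub> W \<eta> i = p \<eta> \<and> W \<eta> i \<cdot>\<^bsub>A\<^esub> p \<eta> = W \<eta> i)" and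
    orth: "\<And>\<eta> \<theta> X. \<eta> \<in> characters K L \<Longrightarrow> \<theta> \<in> characters K L \<Longrightarrow> \<eta> \<noteq> \<theta> \<Longrightarrow> X \<in> Hom A \<rho> \<rho> \<Longrightarrow>
      p \<eta> \<cdot>\<^bsub>A\<^esub> X \<cdot>\<^bsub>A\<^esub> p \<theta> = 0" and
    sW: "(\<Sum>\<eta>\<in>characters K L. \<Sum>i<N. W \<eta> i \<cdot>\<^bsub>A\<^esub> adj A (W \<eta> i)) = ide A \<rho>"
  proof -
    obtain N p W where "N * N * card L = card ?H \<and> finite (characters K L) \<and>
      (\<forall>\<eta>\<in>characters K L. E.minimal_proj (p \<eta>) \<and>
        (\<forall>i<N. W \<eta> i \<in> Hom A \<rho> \<rho> \<and> adj A (W \<eta> i) \<cdot>\<^bsub>A\<^esub> W \<eta> i = p \<eta> \<and> W \<eta> i \<cdot>\<^bsub>A\<^esub> p \<eta> = W \<eta> i)) \<and>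
      (\<forall>\<eta>\<in>characters K L. \<forall>\<theta>\<in>characters K L. \<eta> \<noteq> \<theta> \<longrightarrow> (\<forall>X\<in>Hom A \<rho> \<rho>. p \<eta> \<cdot>\<^bsub>A\<^esub> X \<cdot>\<^bsub>A\<^esub> p \<theta> = 0)) \<and>
      (\<Sum>\<eta>\<in>characters K L. \<Sum>i<N. W \<eta> i \<cdot>\<^bsub>A\<^esub> adj A (W \<eta> i)) = ide A \<rho>"
      using T.decomposition unfolding chars unfolding L by auto
    then show ?thesis by (elim conjE) (rule that[of N p W], assumption, blast, blast, assumption)
  qed
  have pM: "p \<eta> \<in> Hom A \<rho> \<rho>" "p \<eta> \<cdot>\<^bsub>A\<^esub> p \<eta> = p \<eta>" "adj A (p \<eta>) = p \<eta>" "p \<eta> \<noteq> 0" if "\<eta> \<in> characters K L" for \<eta>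
    using E.minimal_projD pW that by blast+
  have OB: "(\<rho>, p \<eta>) \<in> Obj ?B" if "\<eta> \<in> characters K L" for \<eta>
    using pM[OF that] O by (simp add: projection_def)
  have eB: "(\<rho>, ide A \<rho>) \<in> Obj ?B"
    using E.proj_e O by (simp add: projection_def E.proj_def)
  note H = Hom_subobject_closure[OF star_category_A]
  have "irreducible_obj ?B (\<rho>, p \<eta>)" if \<eta>: "\<eta> \<in> characters K L" for \<eta>
  proof (rule B.irreducibleI[OF OB[OF \<eta>]])
    show "ide ?B (\<rho>, p \<eta>) \<noteq> 0" using pM[OF \<eta>] by simp
    fix X assume "B.in_hom X (\<rho>, p \<eta>) (\<rho>, p \<eta>)"
    then have X: "X \<in> Hom A \<rho> \<rho>" "p \<eta> \<cdot>\<^bsub>A\<^esub> X = X" "X \<cdot>\<^bsub>A\<^esub> p \<eta> = X"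
      using H[OF OB[OF \<eta>] OB[OF \<eta>]] B.in_homD(3) by blast+
    obtain a where "p \<eta> \<cdot>\<^bsub>A\<^esub> X \<cdot>\<^bsub>A\<^esub> p \<eta> = scl A a (p \<eta>)" using pW[OF \<eta>] X(1) by (auto simp: E.minimal_proj_def)
    then have "X = scl ?B a (ide ?B (\<rho>, p \<eta>))" using X by simp
    then show "\<exists>z. X = scl ?B z (ide ?B (\<rho>, p \<eta>))" by blast
  qed
  moreover have "\<not> isomorphic_obj ?B (\<rho>, p \<eta>) (\<rho>, p \<theta>)"
    if \<eta>: "\<eta> \<in> characters K L" and \<theta>: "\<theta> \<in> characters K L" and ne: "\<eta> \<noteq> \<theta>" for \<eta> \<theta>
  proof
    assume "isomorphic_obj ?B (\<rho>, p \<eta>) (\<rho>, p \<theta>)"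
    then obtain X Y where X: "X \<in> Hom ?B (\<rho>, p \<eta>) (\<rho>, p \<theta>)" and Y: "Y \<in> Hom ?B (\<rho>, p \<theta>) (\<rho>, p \<eta>)"
      and YX: "Y \<cdot>\<^bsub>A\<^esub> X = p \<eta>"
      by (auto simp: isomorphic_obj_def)
    have X': "X \<in> Hom A \<rho> \<rho>" "p \<theta> \<cdot>\<^bsub>A\<^esub> X = X" "X \<cdot>\<^bsub>A\<^esub> p \<eta> = X" using X H[OF OB[OF \<eta>] OB[OF \<theta>]] by blast+
    have "X = 0" using orth[OF \<theta> \<eta> ne[symmetric] X'(1)] X' by simp
    moreover have "Y \<in> Hom A \<rho> \<rho>" using Y H[OF OB[OF \<theta>] OB[OF \<eta>]] by blast
    ultimately show False using YX pM(4)[OF \<eta>] by simp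
  qed
  moreover have "isometry ?B (\<rho>, p \<eta>) (\<rho>, ide A \<rho>) (W \<eta> i)" if "\<eta> \<in> characters K L" "i < N" for \<eta> i
    using pW[OF that(1)] that(2) by (simp add: isometry_def H[OF OB[OF that(1)] eB])
  ultimately have "decomposes ?B (\<rho>, ide A \<rho>) N (characters K L) (\<lambda>\<eta>. (\<rho>, p \<eta>))"
    unfolding decomposes_def using sW by (intro conjI exI[of _ W]) auto
  moreover have "card L > 0" using T.card_L_pos by (simp add: L)
  ultimately show ?thesis using NL by blast
qed

section \<open>Classification of the irreducible objects\<close>

lemma emb_Obj: "\<rho> \<in> Obj C \<Longrightarrow> (\<rho>, ide A \<rho>) \<in> Obj (subobject_closure A)"
  using A.in_homD(3)[OF A.hom_ide] A.ide_left[OF A.hom_ide] by (simp add: projection_def A.star_ide)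

lemma decomposesD:
  assumes "decomposes (subobject_closure A) (\<rho>, ide A \<rho>) N X r" "c \<in> X"
  shows "irreducible_obj (subobject_closure A) (r c)" "r c \<in> Obj (subobject_closure A)"
  using assms B.irreducibleD(1) by (auto simp: decomposes_def)

lemma decomposes_isometries:
  assumes "decomposes (subobject_closure A) \<pi> N X r"
  shows "\<exists>V. (\<forall>c\<in>X. \<forall>i<N. isometry (subobject_closure A) (r c) \<pi> (V c i)) \<and>
    (\<Sum>c\<in>X. \<Sum>i<N. V c i \<cdot>\<^bsub>subobject_closure A\<^esub> adj (subobject_closure A) (V c i)) = ide (subobject_closure A) \<pi>"
  using assms unfolding decomposes_def by (elim conjE)

text \<open>Composed with the isometries of the components, the isomorphism gives a nonzero arrow from \<open>\<rho>\<close> to \<open>\<sigma>\<close>.\<close>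

lemma components_same_orbit:
  assumes \<rho>: "irreducible_obj C \<rho>" and \<sigma>: "irreducible_obj C \<sigma>"
    and r: "decomposes (subobject_closure A) (\<rho>, ide A \<rho>) N X r" "N > 0" "c \<in> X"
    and s: "decomposes (subobject_closure A) (\<sigma>, ide A \<sigma>) M Y s" "M > 0" "d \<in> Y"
    and iso: "isomorphic_obj (subobject_closure A) (r c) (s d)"
  shows "\<exists>k\<in>carrier K. isomorphic_obj C (gO k \<rho>) \<sigma>"
proof -
  let ?B = "subobject_closure A"
  note O = irreducibleD(1)[OF \<rho>] irreducibleD(1)[OF \<sigma>]
  note OB = emb_Obj[OF O(1)] emb_Obj[OF O(2)]
  note rO = decomposesD[OF r(1,3)] and sO = decomposesD[OF s(1,3)]
  obtain V where iV: "isometry ?B (r c) (\<rho>, ide A \<rho>) V" using decomposes_isometries[OF r(1)] r(2,3) by blast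
  obtain V' where iV': "isometry ?B (s d) (\<sigma>, ide A \<sigma>) V'" using decomposes_isometries[OF s(1)] s(2,3) by blast
  note V = B.isometryD[OF iV rO(2) OB(1)] and V' = B.isometryD[OF iV' sO(2) OB(2)]
  obtain f g where f: "B.in_hom f (r c) (s d)" and g: "B.in_hom g (s d) (r c)" and gf: "g \<cdot>\<^bsub>?B\<^esub> f = ide ?B (r c)"
    by (rule B.isomorphicE[OF iso rO(2) sO(2)])
  have f0: "f \<noteq> 0" using gf B.cmp_zero[OF g rO(2)] B.irreducibleD(2)[OF rO(1)] by auto
  define Z where "Z = V' \<cdot>\<^bsub>?B\<^esub> (f \<cdot>\<^bsub>?B\<^esub> adj ?B V)"
  note fV = B.hom_cmp[OF f V(2)]
  have Z: "B.in_hom Z (\<rho>, ide A \<rho>) (\<sigma>, ide A \<sigma>)" unfolding Z_def by (rule B.hom_cmp[OF V'(1) fV])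
  have "adj ?B V' \<cdot>\<^bsub>?B\<^esub> (Z \<cdot>\<^bsub>?B\<^esub> V) = (adj ?B V' \<cdot>\<^bsub>?B\<^esub> V') \<cdot>\<^bsub>?B\<^esub> (f \<cdot>\<^bsub>?B\<^esub> (adj ?B V \<cdot>\<^bsub>?B\<^esub> V))"
    unfolding Z_def
    by (simp only: B.assoc[OF V'(1) fV V(1)] B.assoc[OF f V(2,1)] B.assoc[OF V'(2,1) B.hom_cmp[OF f B.hom_cmp[OF V(2,1)]]])
  also have "\<dots> = f" by (simp only: V(3) V'(3) B.ide_right[OF f] B.ide_left[OF f])
  finally have "Z \<noteq> 0"
    using f0 B.zero_cmp[OF V(1) OB(2)] B.cmp_zero[OF V'(2) rO(2)] by auto
  moreover have "Z \<in> Hom A \<rho> \<sigma>"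
    using B.in_homD(3)[OF Z] Hom_subobject_closure[OF star_category_A OB] by blast
  ultimately show ?thesis using nonzero_hom_orbit[OF \<rho> \<sigma>] by blast
qed

text \<open>Let \<open>p = (\<tau>, E)\<close>.  Since \<open>E \<noteq> 0\<close>, it does not vanish on some irreducible summand \<open>\<rho>\<close> of \<open>\<tau>\<close> in \<open>C\<close>.  Precomposing with a
  homogeneous arrow \<open>f\<close> from \<open>\<sigma>\<close> to \<open>\<rho>\<close>, for which \<open>f f\<^sup>*\<close> is a nonzero scalar, gives a nonzero arrow from \<open>\<sigma>\<close> to \<open>p\<close>.  It does
  not vanish on some component of \<open>\<sigma>\<close>, which is then isomorphic to \<open>p\<close>.\<close>

lemma irreducible_is_component:
  assumes subobjects: "\<And>\<rho> E. \<rho> \<in> Obj C \<Longrightarrow> projection C \<rho> E \<Longrightarrow> \<exists>\<sigma>\<in>Obj C. \<exists>V. isometry C \<sigma> \<rho> V \<and> V \<cdot> adj C V = E"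
    and fd: "\<And>\<rho>. \<rho> \<in> Obj C \<Longrightarrow> \<exists>B. finite B \<and> module.span (scl C) B = Hom C \<rho> \<rho>"
    and p: "irreducible_obj (subobject_closure A) p"
  shows "\<exists>\<rho>. irreducible_obj C \<rho> \<and> (\<forall>\<sigma> k N X r. irreducible_obj C \<sigma> \<and> k \<in> carrier K \<and> isomorphic_obj C (gO k \<sigma>) \<rho> \<and>
      decomposes (subobject_closure A) (\<sigma>, ide A \<sigma>) N X r \<longrightarrow> (\<exists>c\<in>X. isomorphic_obj (subobject_closure A) (r c) p))"
proof -
  let ?B = "subobject_closure A"
  obtain \<tau> E where pE: "p = (\<tau>, E)" by (cases p)
  note pO = B.irreducibleD(1)[OF p]
  have \<tau>: "\<tau> \<in> Obj C" and E: "projection A \<tau> E" using pO by (simp_all add: pE)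
  note E' = A.projectionD[OF E, unfolded Obj_A, OF \<tau>]
  have E0: "E \<noteq> 0" using B.irreducibleD(2)[OF p] by (simp add: pE)
  obtain B0 where B0: "finite B0" "Hom C \<tau> \<tau> \<subseteq> V.span B0" using fd[OF \<tau>] by auto
  have "\<exists>(P::'a set) \<rho> W. finite P \<and> (\<forall>q\<in>P. irreducible_obj C (\<rho> q) \<and> isometry C (\<rho> q) \<tau> (W q)) \<and>
      (\<Sum>q\<in>P. W q \<cdot> adj C (W q)) = ide C \<tau>"
    by (rule decomposition_into_irreducibles[OF _ \<tau> B0]) (rule subobjects)
  then obtain P :: "'a set" and \<rho> W where PW: "finite P \<and> (\<forall>q\<in>P. irreducible_obj C (\<rho> q) \<and> isometry C (\<rho> q) \<tau> (W q)) \<and>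
      (\<Sum>q\<in>P. W q \<cdot> adj C (W q)) = ide C \<tau>"
    by (elim exE) (rule that)
  then have P: "finite P" "\<And>q. q \<in> P \<Longrightarrow> irreducible_obj C (\<rho> q)"
    "\<And>q. q \<in> P \<Longrightarrow> isometry C (\<rho> q) \<tau> (W q)" "(\<Sum>q\<in>P. W q \<cdot> adj C (W q)) = ide C \<tau>"
    by simp_all
  have \<rho>O: "\<rho> q \<in> Obj C" if "q \<in> P" for q by (rule irreducibleD(1)[OF P(2)[OF that]])
  have W: "\<guillemotleft>W q : \<rho> q \<rightarrow> \<tau>\<guillemotright>" "\<guillemotleft>adj C (W q) : \<tau> \<rightarrow> \<rho> q\<guillemotright>" if "q \<in> P" for q
    using isometryD[OF P(3)[OF that] \<rho>O[OF that] \<tau>] by blast+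
  have WW: "\<guillemotleft>W q \<cdot> adj C (W q) : \<tau> \<rightarrow> \<tau>\<guillemotright>" if "q \<in> P" for q
    by (rule hom_cmp[OF W[OF that]])
  have h1: "\<guillemotleft>x : gO \<one>\<^bsub>K\<^esub> \<rho> \<rightarrow> \<sigma>\<guillemotright>" if "\<guillemotleft>x : \<rho> \<rightarrow> \<sigma>\<guillemotright>" for x \<rho> \<sigma>
    using that in_homD(1)[OF that] by simp
  define e where "e q = sg (\<rho> q) \<tau> \<one>\<^bsub>K\<^esub> (W q)" for q
  define e' where "e' q = sg \<tau> (\<rho> q) \<one>\<^bsub>K\<^esub> (adj C (W q))" for q
  have eH: "A.in_hom (e q) (\<rho> q) \<tau>" "A.in_hom (e' q) \<tau> (\<rho> q)" if "q \<in> P" for q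
    using sg_Hom[OF one_closed \<rho>O[OF that] h1[OF W(1)[OF that]]] sg_Hom[OF one_closed \<tau> h1[OF W(2)[OF that]]] \<rho>O[OF that] \<tau>
    by (simp_all add: e_def e'_def A.in_hom_def)
  have ee: "A.in_hom (e q \<cdot>\<^bsub>A\<^esub> e' q) \<tau> \<tau>" if "q \<in> P" for q by (rule A.hom_cmp[OF eH[OF that]])
  have "e q \<cdot>\<^bsub>A\<^esub> e' q = sg \<tau> \<tau> \<one>\<^bsub>K\<^esub> (W q \<cdot> adj C (W q))" if q: "q \<in> P" for q
    using cmp_sg[OF one_closed one_closed \<tau> \<rho>O[OF q] h1[OF W(1)[OF q]] h1[OF W(2)[OF q]]]
      ide_right[OF W(2)[OF q]] ide_right[OF hom_cmp[OF W(1,2)[OF q]]] \<tau>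
    by (simp add: e_def e'_def gcmp_def gA_one[OF W(2)[OF q]] w_unit)
  then have "(\<Sum>q\<in>P. e q \<cdot>\<^bsub>A\<^esub> e' q) = (\<Sum>q\<in>P. sg \<tau> \<tau> \<one>\<^bsub>K\<^esub> (W q \<cdot> adj C (W q)))" by simp
  also have "\<dots> = sg \<tau> \<tau> \<one>\<^bsub>K\<^esub> (\<Sum>q\<in>P. W q \<cdot> adj C (W q))"
    using P(1) WW
  proof (induction P)
    case empty
    then show ?case using sg_zero[OF one_closed \<tau> \<tau>] by simp
  next
    case (insert q P)
    have "\<guillemotleft>\<Sum>q\<in>P. W q \<cdot> adj C (W q) : \<tau> \<rightarrow> \<tau>\<guillemotright>" using insert by (intro hom_sum \<tau>) auto
    then have "sg \<tau> \<tau> \<one>\<^bsub>K\<^esub> (W q \<cdot> adj C (W q) + (\<Sum>q\<in>P. W q \<cdot> adj C (W q)))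
        = sg \<tau> \<tau> \<one>\<^bsub>K\<^esub> (W q \<cdot> adj C (W q)) + sg \<tau> \<tau> \<one>\<^bsub>K\<^esub> (\<Sum>q\<in>P. W q \<cdot> adj C (W q))"
      using insert by (intro sg_add one_closed \<tau> h1) auto
    then show ?case using insert by simp
  qed
  also have "\<dots> = ide A \<tau>" by (simp add: P(4) ide_A[OF \<tau>])
  finally have eid: "(\<Sum>q\<in>P. e q \<cdot>\<^bsub>A\<^esub> e' q) = ide A \<tau>" .
  have "E = E \<cdot>\<^bsub>A\<^esub> (\<Sum>q\<in>P. e q \<cdot>\<^bsub>A\<^esub> e' q)" by (simp add: eid A.ide_right[OF E'(1)])
  also have "\<dots> = (\<Sum>q\<in>P. E \<cdot>\<^bsub>A\<^esub> (e q \<cdot>\<^bsub>A\<^esub> e' q))"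
    by (rule A.cmp_sum[OF E'(1)]) (use \<tau> ee in simp_all)
  finally have "(\<Sum>q\<in>P. E \<cdot>\<^bsub>A\<^esub> (e q \<cdot>\<^bsub>A\<^esub> e' q)) \<noteq> 0" using E0 by simp
  then obtain q where q: "q \<in> P" "E \<cdot>\<^bsub>A\<^esub> (e q \<cdot>\<^bsub>A\<^esub> e' q) \<noteq> 0" by (rule sum.not_neutral_contains_not_neutral)
  have Ee: "A.in_hom (E \<cdot>\<^bsub>A\<^esub> e q) (\<rho> q) \<tau>" by (rule A.hom_cmp[OF E'(1) eH(1)[OF q(1)]])
  have Ee0: "E \<cdot>\<^bsub>A\<^esub> e q \<noteq> 0"
    using q(2) A.assoc[OF E'(1) eH[OF q(1)]] A.zero_cmp[OF eH(2)[OF q(1)]] \<tau> by auto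
  note \<rho>q = P(2)[OF q(1)] and \<rho>qO = \<rho>O[OF q(1)]
  have "\<exists>c\<in>X. isomorphic_obj ?B (r c) p"
    if \<sigma>: "irreducible_obj C \<sigma>" and k: "k \<in> carrier K" and iso: "isomorphic_obj C (gO k \<sigma>) (\<rho> q)"
      and dec: "decomposes ?B (\<sigma>, ide A \<sigma>) N X r" for \<sigma> k N X r
  proof -
    note \<sigma>O = irreducibleD(1)[OF \<sigma>]
    obtain x y where x: "\<guillemotleft>x : gO k \<sigma> \<rightarrow> \<rho> q\<guillemotright>" and y: "\<guillemotleft>y : \<rho> q \<rightarrow> gO k \<sigma>\<guillemotright>" and xy: "x \<cdot> y = ide C (\<rho> q)"
      by (rule isomorphicE[OF iso gO[OF k \<sigma>O] \<rho>qO])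
    have x0: "x \<noteq> 0" using xy zero_cmp[OF y \<rho>qO] irreducibleD(2)[OF \<rho>q] by auto
    obtain b where b: "x \<cdot> adj C x = scl C b (ide C (\<rho> q))"
      using irreducibleD(3)[OF \<rho>q hom_cmp[OF x hom_adj[OF x]]] by blast
    have b0: "b \<noteq> 0"
    proof
      assume "b = 0"
      then have "adj C (adj C x) \<cdot> adj C x = 0" using b star_star[OF x] by simp
      then have "adj C x = 0" by (rule positive[OF hom_adj[OF x]])
      then show False using star_star[OF x] x0 star_zero[OF \<rho>qO] by simp
    qed
    define f where "f = sg \<sigma> (\<rho> q) k x"
    have f: "A.in_hom f \<sigma> (\<rho> q)" using sg_Hom[OF k \<sigma>O x] \<sigma>O \<rho>qO by (simp add: f_def A.in_hom_def)
    have ff: "f \<cdot>\<^bsub>A\<^esub> adj A f = scl A b (ide A (\<rho> q))"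
      using k sg_scl[OF one_closed \<rho>qO h1[OF hom_ide[OF \<rho>qO]]]
      by (simp add: f_def adj_sg[OF k \<sigma>O x] cmp_sg[OF k inv_closed[OF k] \<rho>qO \<sigma>O x gstar_hom[OF k x \<sigma>O]]
          self_gstar[OF k x \<sigma>O] b ide_A[OF \<rho>qO])
    define g where "g = E \<cdot>\<^bsub>A\<^esub> e q \<cdot>\<^bsub>A\<^esub> f"
    have g: "A.in_hom g \<sigma> \<tau>" unfolding g_def by (rule A.hom_cmp[OF Ee f])
    have "g \<cdot>\<^bsub>A\<^esub> adj A f = scl A b (E \<cdot>\<^bsub>A\<^esub> e q)"
      unfolding g_def A.assoc[OF Ee f A.hom_adj[OF f]] ff
      using A.cmp_scl'[OF Ee A.hom_ide] A.ide_right[OF Ee] \<rho>qO by simp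
    then have g0: "g \<noteq> 0" using Ee0 b0 A.zero_cmp[OF A.hom_adj[OF f]] \<tau> by auto
    note OB = emb_Obj[OF \<sigma>O]
    have "E \<cdot>\<^bsub>A\<^esub> g = g"
      using E'(2) A.assoc[OF E'(1,1) A.hom_cmp[OF eH(1)[OF q(1)] f]] A.assoc[OF E'(1) eH(1)[OF q(1)] f]
      by (simp add: g_def)
    then have "g \<in> Hom ?B (\<sigma>, ide A \<sigma>) p"
      using Hom_subobject_closure[OF star_category_A OB, of \<tau> E g] pO A.in_homD(3)[OF g] A.ide_right[OF g]
      by (simp add: pE)
    then have gB: "B.in_hom g (\<sigma>, ide A \<sigma>) p" using OB pO by (simp add: B.in_hom_def)
    obtain V where "(\<forall>c\<in>X. \<forall>i<N. isometry ?B (r c) (\<sigma>, ide A \<sigma>) (V c i)) \<and>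
        (\<Sum>c\<in>X. \<Sum>i<N. V c i \<cdot>\<^bsub>?B\<^esub> adj ?B (V c i)) = ide ?B (\<sigma>, ide A \<sigma>)"
      using decomposes_isometries[OF dec] by (elim exE) (rule that)
    then have iV: "\<And>c i. c \<in> X \<Longrightarrow> i < N \<Longrightarrow> isometry ?B (r c) (\<sigma>, ide A \<sigma>) (V c i)"
      and sV: "(\<Sum>c\<in>X. \<Sum>i<N. V c i \<cdot>\<^bsub>?B\<^esub> adj ?B (V c i)) = ide ?B (\<sigma>, ide A \<sigma>)"
      by blast+
    note V = B.isometryD[OF iV decomposesD(2)[OF dec] OB]
    show ?thesis
    proof (rule ccontr)
      assume none: "\<not> ?thesis"
      have gV: "g \<cdot>\<^bsub>?B\<^esub> V c i = 0" if "c \<in> X" "i < N" for c i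
        using B.schur[OF decomposesD(1)[OF dec that(1)] p B.hom_cmp[OF gB V(1)[OF that that(1)]]] none that by blast
      have VV: "B.in_hom (V c i \<cdot>\<^bsub>?B\<^esub> adj ?B (V c i)) (\<sigma>, ide A \<sigma>) (\<sigma>, ide A \<sigma>)" if "c \<in> X" "i < N" for c i
        by (rule B.hom_cmp[OF V(1,2)[OF that that(1)]])
      have "g = g \<cdot>\<^bsub>?B\<^esub> (\<Sum>c\<in>X. \<Sum>i<N. V c i \<cdot>\<^bsub>?B\<^esub> adj ?B (V c i))"
        unfolding sV by (rule B.ide_right[OF gB, symmetric])
      also have "\<dots> = (\<Sum>c\<in>X. g \<cdot>\<^bsub>?B\<^esub> (\<Sum>i<N. V c i \<cdot>\<^bsub>?B\<^esub> adj ?B (V c i)))"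
        by (rule B.cmp_sum[OF gB OB]) (rule B.hom_sum[OF OB OB], rule VV, auto)
      also have "\<dots> = (\<Sum>c\<in>X. \<Sum>i<N. g \<cdot>\<^bsub>?B\<^esub> (V c i \<cdot>\<^bsub>?B\<^esub> adj ?B (V c i)))"
        by (intro sum.cong refl B.cmp_sum[OF gB OB] VV) auto
      also have "\<dots> = 0"
      proof (intro sum.neutral ballI)
        fix c i assume ci: "c \<in> X" "i \<in> {..<N}"
        then have ci': "c \<in> X" "i < N" by auto
        show "g \<cdot>\<^bsub>?B\<^esub> (V c i \<cdot>\<^bsub>?B\<^esub> adj ?B (V c i)) = 0"
          unfolding B.assoc[OF gB V(1,2)[OF ci' ci'(1)], symmetric] gV[OF ci']
          by (rule B.zero_cmp[OF V(2)[OF ci' ci'(1)] pO])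
      qed
      finally show False using g0 by simp
    qed
  qed
  then show ?thesis by (intro exI[of _ "\<rho> q"] conjI \<rho>q) auto
qed

end

section \<open>One-dimensional sectors\<close>

sublocale tensor_star_category \<subseteq> star_category C
  by (rule star_category)

context tensor_star_category
begin

lemma hom_tens: "\<lbrakk>\<guillemotleft>X : \<rho> \<rightarrow> \<sigma>\<guillemotright>; \<guillemotleft>X' : \<rho>' \<rightarrow> \<sigma>'\<guillemotright>\<rbrakk> \<Longrightarrow> \<guillemotleft>X \<parallel> X' : \<rho> \<odot> \<rho>' \<rightarrow> \<sigma> \<odot> \<sigma>'\<guillemotright>"
  by (simp add: in_hom_def prd_Obj tens_Hom)

lemma interchange:
  "\<lbrakk>\<guillemotleft>X : \<sigma> \<rightarrow> \<tau>\<guillemotright>; \<guillemotleft>Y : \<rho> \<rightarrow> \<sigma>\<guillemotright>; \<guillemotleft>X' : \<sigma>' \<rightarrow> \<tau>'\<guillemotright>; \<guillemotleft>Y' : \<rho>' \<rightarrow> \<sigma>'\<guillemotright>\<rbrakk>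
    \<Longrightarrow> (X \<parallel> X') \<cdot> (Y \<parallel> Y') = (X \<cdot> Y) \<parallel> (X' \<cdot> Y')"
  by (simp add: in_hom_def tens_cmp[of \<rho> \<sigma> \<tau> \<rho>' \<sigma>' \<tau>'])

lemma star_tens: "\<lbrakk>\<guillemotleft>X : \<rho> \<rightarrow> \<sigma>\<guillemotright>; \<guillemotleft>X' : \<rho>' \<rightarrow> \<sigma>'\<guillemotright>\<rbrakk> \<Longrightarrow> adj C (X \<parallel> X') = adj C X \<parallel> adj C X'"
  by (simp add: in_hom_def adj_tens[of \<rho> \<sigma> \<rho>' \<sigma>'])

lemma tens_assoc': "\<lbrakk>\<guillemotleft>X : \<rho> \<rightarrow> \<sigma>\<guillemotright>; \<guillemotleft>X' : \<rho>' \<rightarrow> \<sigma>'\<guillemotright>; \<guillemotleft>X'' : \<rho>'' \<rightarrow> \<sigma>''\<guillemotright>\<rbrakk>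
    \<Longrightarrow> (X \<parallel> X') \<parallel> X'' = X \<parallel> (X' \<parallel> X'')"
  by (simp add: in_hom_def tens_assoc[of \<rho> \<sigma> \<rho>' \<sigma>' \<rho>'' \<sigma>''])

lemma tens_isomorphic:
  assumes "isomorphic_obj C \<rho> \<sigma>" "isomorphic_obj C \<rho>' \<sigma>'"
    and O: "\<rho> \<in> Obj C" "\<sigma> \<in> Obj C" "\<rho>' \<in> Obj C" "\<sigma>' \<in> Obj C"
  shows "isomorphic_obj C (\<rho> \<odot> \<rho>') (\<sigma> \<odot> \<sigma>')"
proof -
  obtain X Y where X: "\<guillemotleft>X : \<rho> \<rightarrow> \<sigma>\<guillemotright>" and Y: "\<guillemotleft>Y : \<sigma> \<rightarrow> \<rho>\<guillemotright>" and e: "Y \<cdot> X = ide C \<rho>" "X \<cdot> Y = ide C \<sigma>"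
    by (rule isomorphicE[OF assms(1) O(1,2)])
  obtain X' Y' where X': "\<guillemotleft>X' : \<rho>' \<rightarrow> \<sigma>'\<guillemotright>" and Y': "\<guillemotleft>Y' : \<sigma>' \<rightarrow> \<rho>'\<guillemotright>" and e': "Y' \<cdot> X' = ide C \<rho>'" "X' \<cdot> Y' = ide C \<sigma>'"
    by (rule isomorphicE[OF assms(2) O(3,4)])
  show ?thesis
    by (rule isomorphicI[OF hom_tens[OF X X'] hom_tens[OF Y Y']])
      (simp_all add: interchange[OF Y X Y' X'] interchange[OF X Y X' Y'] e e' tens_ide O)
qed

lemma sector_mult_iso_class:
  assumes O: "\<rho> \<in> Obj C" "\<sigma> \<in> Obj C"
  shows "sector_mult C (iso_class C \<rho>) (iso_class C \<sigma>) = iso_class C (\<rho> \<odot> \<sigma>)"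
proof (rule Set.set_eqI)
  fix \<tau>
  have "isomorphic_obj C (\<rho> \<odot> \<sigma>) \<tau>" if "\<tau> \<in> Obj C" "\<rho>' \<in> iso_class C \<rho>" "\<sigma>' \<in> iso_class C \<sigma>"
    "isomorphic_obj C (\<rho>' \<odot> \<sigma>') \<tau>" for \<rho>' \<sigma>'
  proof -
    have O': "\<rho>' \<in> Obj C" "\<sigma>' \<in> Obj C" "isomorphic_obj C \<rho> \<rho>'" "isomorphic_obj C \<sigma> \<sigma>'"
      using that(2,3) by (simp_all add: iso_class_def)
    show ?thesis
      by (rule isomorphic_trans[OF tens_isomorphic[OF O'(3,4) O(1) O'(1) O(2) O'(2)] that(4)])
        (simp_all add: prd_Obj O O' that(1))
  qed
  moreover have "\<rho> \<in> iso_class C \<rho>" "\<sigma> \<in> iso_class C \<sigma>" using O by (simp_all add: iso_class_def isomorphic_refl)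
  ultimately show "\<tau> \<in> sector_mult C (iso_class C \<rho>) (iso_class C \<sigma>) \<longleftrightarrow> \<tau> \<in> iso_class C (\<rho> \<odot> \<sigma>)"
    unfolding sector_mult_def by (auto simp: iso_class_def[of C "\<rho> \<odot> \<sigma>"])
qed

end

locale abelian_crossed_product =
  BTC_star C + even_symmetric_subcategory C S + crossed_product_data C S G T U D
  for C :: "('o, 'a::ab_group_add, 'z) braided_cat_scheme" (structure) and S :: "'o set"
    and G :: "('g, 'm) monoid_scheme" and T :: "'g topology"
    and U :: "('r, 'h::ab_group_add, 'g, 'y) rep_cat_scheme"
    and D :: "('o, 'a, 'r, 'h, 'x) crossed_data_scheme" +
  assumes dim_one: "\<lbrakk>\<gamma> \<in> S; irreducible_obj C \<gamma>\<rbrakk> \<Longrightarrow> has_dimension C \<gamma> 1"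
begin

sublocale R: rep_category G T U by (rule reps)
sublocale F: symmetric_tensor_iso C S G U "Fobj D" "Farr D" by (rule F_iso)

interpretation V: vector_space "scl C" by (rule vs)
interpretation HV: vector_space "hscl U" by (rule R.hvs)

abbreviation H :: "'o \<Rightarrow> 'h set" where "H \<rho> \<equiv> hsp U (Fobj D \<rho>)"
abbreviation Fa :: "'a \<Rightarrow> 'h \<Rightarrow> 'h" where "Fa \<equiv> Farr D"
abbreviation bx :: "'h \<Rightarrow> 'h \<Rightarrow> 'h" (infixl \<open>\<otimes>\<^sub>H\<close> 75) where "bx \<equiv> box U"
abbreviation Om :: 'h where "Om \<equiv> vac U"

lemma FO: "\<rho> \<in> S \<Longrightarrow> Fobj D \<rho> \<in> rObj U"
  using F.Fo_bij by (auto simp: bij_betw_def)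

lemma SO: "\<rho> \<in> S \<Longrightarrow> \<rho> \<in> Obj C"
  using S_Obj by auto

lemma H_closed:
  assumes "\<rho> \<in> S"
  shows "0 \<in> H \<rho>" "\<lbrakk>a \<in> H \<rho>; b \<in> H \<rho>\<rbrakk> \<Longrightarrow> a + b \<in> H \<rho>" "\<lbrakk>a \<in> H \<rho>; b \<in> H \<rho>\<rbrakk> \<Longrightarrow> a - b \<in> H \<rho>"
    "a \<in> H \<rho> \<Longrightarrow> hscl U z a \<in> H \<rho>"
  using R.hsp_subspace[OF FO[OF assms]]
  by (simp_all add: HV.subspace_0 HV.subspace_add HV.subspace_diff HV.subspace_scale)

lemma H_prd: "\<lbrakk>\<rho> \<in> S; \<sigma> \<in> S\<rbrakk> \<Longrightarrow> H (\<rho> \<odot> \<sigma>) = HV.span {a \<otimes>\<^sub>H b |a b. a \<in> H \<rho> \<and> b \<in> H \<sigma>}"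
  using R.box_span FO by (simp add: F.Fo_prd)

lemma H_box: "\<lbrakk>\<rho> \<in> S; \<sigma> \<in> S; a \<in> H \<rho>; b \<in> H \<sigma>\<rbrakk> \<Longrightarrow> a \<otimes>\<^sub>H b \<in> H (\<rho> \<odot> \<sigma>)"
  by (auto simp: H_prd intro!: HV.span_base)

lemma H_unt: "H (unt C) = {hscl U z Om |z. True}"
  by (simp add: F.Fo_unt R.runt_hsp)

lemma Om_H: "Om \<in> H (unt C)"
  unfolding H_unt using HV.scale_one[of Om] by (metis (mono_tags, lifting) mem_Collect_eq)

lemma ip_left:
  assumes "\<rho> \<in> S" "a \<in> H \<rho>" "b \<in> H \<rho>" "c \<in> H \<rho>"
  shows "ip U (a + b) c = ip U a c + ip U b c" "ip U (hscl U z a) c = cnj z * ip U a c" "ip U c 0 = 0" "ip U 0 c = 0"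
proof -
  note r = FO[OF assms(1)] and cl = H_closed[OF assms(1)]
  show "ip U (a + b) c = ip U a c + ip U b c"
    using R.ip_cnj[OF r assms(4) cl(2)[OF assms(2,3)]] R.ip_add[OF r assms(4,2,3)]
      R.ip_cnj[OF r assms(4,2)] R.ip_cnj[OF r assms(4,3)] by simp
  show "ip U (hscl U z a) c = cnj z * ip U a c"
    using R.ip_cnj[OF r assms(4) cl(4)[OF assms(2)]] R.ip_scl[OF r assms(4,2)] R.ip_cnj[OF r assms(4,2)] by simp
  show c0: "ip U c 0 = 0" using R.ip_scl[OF r assms(4) cl(1), of 0] by simp
  show "ip U 0 c = 0" using R.ip_cnj[OF r assms(4) cl(1)] c0 by simp
qed

lemma ip_self_zero: assumes "\<rho> \<in> S" "a \<in> H \<rho>" "ip U a a = 0" shows "a = 0"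
  using R.ip_pos[OF FO[OF assms(1)] assms(2)] assms(3) by fastforce

lemma normalize:
  assumes "\<rho> \<in> S" "a \<in> H \<rho>" "a \<noteq> 0"
  shows "\<exists>z. z \<noteq> 0 \<and> ip U (hscl U z a) (hscl U z a) = 1"
proof -
  note r = FO[OF assms(1)]
  have pos: "Re (ip U a a) > 0" by (rule R.ip_pos[OF r assms(2,3)])
  have "Im (ip U a a) = 0" using R.ip_cnj[OF r assms(2,2)] by (metis complex_cnj_cancel_iff Reals_cnj_iff complex_is_Real_iff)
  then have re: "ip U a a = of_real (Re (ip U a a))" by (simp add: complex_eq_iff)
  define s where "s = 1 / sqrt (Re (ip U a a))"
  have "cnj (of_real s) * (of_real s * ip U a a) = of_real (s * s * Re (ip U a a))"
    by (subst re) simp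
  also have "s * s * Re (ip U a a) = 1" using pos by (simp add: s_def)
  finally have "ip U (hscl U (of_real s) a) (hscl U (of_real s) a) = 1"
    using ip_left(2)[OF assms(1,2,2) H_closed(4)[OF assms(1,2)]] R.ip_scl[OF r assms(2,2)] by simp
  moreover have "s \<noteq> 0" using pos by (simp add: s_def)
  ultimately show ?thesis by (intro exI[of _ "of_real s"]) simp
qed

lemma Fa_hom:
  assumes "\<rho> \<in> S" "\<sigma> \<in> S" "\<guillemotleft>X : \<rho> \<rightarrow> \<sigma>\<guillemotright>"
  shows "a \<in> H \<rho> \<Longrightarrow> Fa X a \<in> H \<sigma>"
    "\<lbrakk>a \<in> H \<rho>; b \<in> H \<rho>\<rbrakk> \<Longrightarrow> Fa X (a + b) = Fa X a + Fa X b"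
    "a \<in> H \<rho> \<Longrightarrow> Fa X (hscl U z a) = hscl U z (Fa X a)"
    "Fa X 0 = 0"
proof -
  have i: "restrict (Fa X) (H \<rho>) \<in> intertwiners G U (Fobj D \<rho>) (Fobj D \<sigma>)"
    using bij_betwE[OF F.Fa_bij[OF assms(1,2)]] in_homD(3)[OF assms(3)] by blast
  then show "a \<in> H \<rho> \<Longrightarrow> Fa X a \<in> H \<sigma>"
    by (auto simp: intertwiners_def PiE_def Pi_def)
  from i have l: "linear_on (hscl U) (H \<rho>) (restrict (Fa X) (H \<rho>))" by (simp add: intertwiners_def)
  show "\<lbrakk>a \<in> H \<rho>; b \<in> H \<rho>\<rbrakk> \<Longrightarrow> Fa X (a + b) = Fa X a + Fa X b"
    using l H_closed(2)[OF assms(1)] by (simp add: linear_on_def)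
  show s: "Fa X (hscl U z a) = hscl U z (Fa X a)" if "a \<in> H \<rho>" for a z
  proof -
    have "restrict (Fa X) (H \<rho>) (hscl U z a) = hscl U z (restrict (Fa X) (H \<rho>) a)"
      using l that unfolding linear_on_def by blast
    then show ?thesis using H_closed(4)[OF assms(1) that] that by simp
  qed
  show "Fa X 0 = 0" using s[OF H_closed(1)[OF assms(1)], of 0] by simp
qed

lemma Fa_faithful:
  assumes "\<rho> \<in> S" "\<sigma> \<in> S" "\<guillemotleft>X : \<rho> \<rightarrow> \<sigma>\<guillemotright>" "\<guillemotleft>Y : \<rho> \<rightarrow> \<sigma>\<guillemotright>" "\<And>a. a \<in> H \<rho> \<Longrightarrow> Fa X a = Fa Y a"
  shows "X = Y"
proof -
  have "restrict (Fa X) (H \<rho>) = restrict (Fa Y) (H \<rho>)" using assms(5) by (auto simp: restrict_def)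
  then show ?thesis
    using F.Fa_bij[OF assms(1,2)] in_homD(3)[OF assms(3)] in_homD(3)[OF assms(4)]
    by (auto simp: bij_betw_def inj_on_def)
qed

lemma Fa_simps:
  "\<lbrakk>\<rho> \<in> S; a \<in> H \<rho>\<rbrakk> \<Longrightarrow> Fa (ide C \<rho>) a = a"
  "\<lbrakk>\<rho> \<in> S; \<sigma> \<in> S; \<tau> \<in> S; \<guillemotleft>X : \<sigma> \<rightarrow> \<tau>\<guillemotright>; \<guillemotleft>Y : \<rho> \<rightarrow> \<sigma>\<guillemotright>; a \<in> H \<rho>\<rbrakk> \<Longrightarrow> Fa (X \<cdot> Y) a = Fa X (Fa Y a)"
  "\<lbrakk>\<rho> \<in> S; \<sigma> \<in> S; \<guillemotleft>X : \<rho> \<rightarrow> \<sigma>\<guillemotright>; a \<in> H \<rho>\<rbrakk> \<Longrightarrow> Fa (scl C z X) a = hscl U z (Fa X a)"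
  "\<lbrakk>\<rho> \<in> S; \<sigma> \<in> S; \<guillemotleft>X : \<rho> \<rightarrow> \<sigma>\<guillemotright>; a \<in> H \<rho>; b \<in> H \<sigma>\<rbrakk> \<Longrightarrow> ip U (Fa (adj C X) b) a = ip U b (Fa X a)"
  "\<lbrakk>\<rho> \<in> S; \<sigma> \<in> S; \<rho>' \<in> S; \<sigma>' \<in> S; \<guillemotleft>X : \<rho> \<rightarrow> \<sigma>\<guillemotright>; \<guillemotleft>X' : \<rho>' \<rightarrow> \<sigma>'\<guillemotright>; a \<in> H \<rho>; b \<in> H \<rho>'\<rbrakk>
    \<Longrightarrow> Fa (X \<parallel> X') (a \<otimes>\<^sub>H b) = Fa X a \<otimes>\<^sub>H Fa X' b"
  using F.Fa_ide F.Fa_cmp[of \<rho> \<sigma> \<tau> X Y a] F.Fa_scl[of \<rho> \<sigma> X a] F.Fa_adj[of \<rho> \<sigma> X a b] F.Fa_tens[of \<rho> \<sigma> \<rho>' \<sigma>' X X' a b]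
  by (simp_all add: in_hom_def)

text \<open>Lines: objects of \<open>S\<close> with one-dimensional image, together with a unit vector of that image.\<close>

definition line :: "'o \<Rightarrow> 'h \<Rightarrow> bool" where
  "line \<rho> v \<longleftrightarrow> \<rho> \<in> S \<and> v \<in> H \<rho> \<and> ip U v v = 1 \<and> H \<rho> = {hscl U z v |z. True}"

lemma lineD: assumes "line \<rho> v" shows "\<rho> \<in> S" "\<rho> \<in> Obj C" "v \<in> H \<rho>" "ip U v v = 1"
    "a \<in> H \<rho> \<Longrightarrow> a = hscl U (ip U v a) v"
proof -
  show l: "\<rho> \<in> S" "v \<in> H \<rho>" "ip U v v = 1" "\<rho> \<in> Obj C" using assms by (auto simp: line_def SO)
  assume "a \<in> H \<rho>"
  then obtain z where "a = hscl U z v" using assms by (auto simp: line_def)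
  then show "a = hscl U (ip U v a) v" using R.ip_scl[OF FO[OF l(1)] l(2,2)] l(3) by simp
qed

lemma line_nonzero: assumes "line \<rho> v" shows "v \<noteq> 0"
  using lineD(4)[OF assms] ip_left(3)[OF lineD(1,3,3,3)[OF assms]] by auto

lemma lineI:
  assumes "\<rho> \<in> S" "v \<in> H \<rho>" "ip U v v = 1" "\<And>a. a \<in> H \<rho> \<Longrightarrow> \<exists>z. a = hscl U z v"
  shows "line \<rho> v"
  using assms H_closed(4)[OF assms(1,2)] by (auto simp: line_def)

lemma line_unt: "line (unt C) Om"
  using S_unt Om_H R.vac_unit by (auto simp: line_def H_unt)

lemma line_faithful:
  assumes "line \<rho> v" "\<sigma> \<in> S" "\<guillemotleft>X : \<rho> \<rightarrow> \<sigma>\<guillemotright>" "\<guillemotleft>Y : \<rho> \<rightarrow> \<sigma>\<guillemotright>" "Fa X v = Fa Y v"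
  shows "X = Y"
proof (rule Fa_faithful[OF lineD(1)[OF assms(1)] assms(2-4)])
  fix a assume "a \<in> H \<rho>"
  then have a: "a = hscl U (ip U v a) v" by (rule lineD(5)[OF assms(1)])
  note S = lineD(1)[OF assms(1)] and v = lineD(3)[OF assms(1)]
  show "Fa X a = Fa Y a"
    by (subst (1 2) a) (simp add: Fa_hom(3)[OF S assms(2,3) v] Fa_hom(3)[OF S assms(2,4) v] assms(5))
qed

lemma line_irreducible: assumes "line \<rho> v" shows "irreducible_obj C \<rho>"
proof (rule irreducibleI[OF lineD(2)[OF assms]])
  note l = lineD[OF assms]
  show "ide C \<rho> \<noteq> 0"
  proof
    assume "ide C \<rho> = 0"
    then have "scl C 0 (ide C \<rho>) = ide C \<rho>" by simp
    then have "v = 0" using Fa_simps(3)[OF l(1,1) hom_ide[OF l(2)] l(3), of 0] Fa_simps(1)[OF l(1,3)] by simp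
    then show False using line_nonzero[OF assms] by simp
  qed
  fix X assume X: "\<guillemotleft>X : \<rho> \<rightarrow> \<rho>\<guillemotright>"
  let ?z = "ip U v (Fa X v)"
  have "X = scl C ?z (ide C \<rho>)"
    using lineD(5)[OF assms Fa_hom(1)[OF l(1,1) X l(3)]] Fa_simps(3)[OF l(1,1) hom_ide[OF l(2)] l(3)] Fa_simps(1)[OF l(1,3)]
    by (intro line_faithful[OF assms l(1) X hom_scl[OF hom_ide[OF l(2)]]]) simp
  then show "\<exists>z. X = scl C z (ide C \<rho>)" by blast
qed

lemma line_prd: assumes v: "line \<rho> v" and w: "line \<sigma> w" shows "line (\<rho> \<odot> \<sigma>) (v \<otimes>\<^sub>H w)"
proof (rule lineI)
  note a = lineD[OF v] and b = lineD[OF w]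
  note fo = FO[OF a(1)] FO[OF b(1)]
  show S: "\<rho> \<odot> \<sigma> \<in> S" by (rule S_prd[OF a(1) b(1)])
  show vw: "v \<otimes>\<^sub>H w \<in> H (\<rho> \<odot> \<sigma>)" by (rule H_box[OF a(1) b(1) a(3) b(3)])
  show "ip U (v \<otimes>\<^sub>H w) (v \<otimes>\<^sub>H w) = 1" using R.box_ip[OF fo a(3,3) b(3,3)] a b by simp
  fix x assume "x \<in> H (\<rho> \<odot> \<sigma>)"
  then have "x \<in> HV.span {a \<otimes>\<^sub>H b |a b. a \<in> H \<rho> \<and> b \<in> H \<sigma>}" by (simp add: H_prd[OF a(1) b(1)])
  then show "\<exists>z. x = hscl U z (v \<otimes>\<^sub>H w)"
  proof (induction rule: HV.span_induct_alt)
    case base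
    show ?case by (intro exI[of _ 0]) simp
  next
    case (step c x y)
    then obtain x1 x2 z where x: "x = x1 \<otimes>\<^sub>H x2" "x1 \<in> H \<rho>" "x2 \<in> H \<sigma>" and y: "y = hscl U z (v \<otimes>\<^sub>H w)" by auto
    have "x = hscl U (ip U v x1) v \<otimes>\<^sub>H hscl U (ip U w x2) w"
      using lineD(5)[OF v x(2)] lineD(5)[OF w x(3)] x(1) by simp
    also have "\<dots> = hscl U (ip U v x1 * ip U w x2) (v \<otimes>\<^sub>H w)"
      using R.box_scl(1)[OF fo a(3) H_closed(4)[OF b(1,3)]] R.box_scl(2)[OF fo a(3) b(3)] by simp
    finally have "hscl U c x + y = hscl U (c * (ip U v x1 * ip U w x2) + z) (v \<otimes>\<^sub>H w)"
      by (simp add: y HV.scale_left_distrib)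
    then show ?case by blast
  qed
qed

lemma iso_line: assumes v: "line \<rho> v" and iso: "isomorphic_obj C \<rho> \<sigma>" and \<sigma>: "\<sigma> \<in> Obj C"
  shows "\<exists>w. line \<sigma> w"
proof -
  note l = lineD[OF v]
  have \<sigma>S: "\<sigma> \<in> S" by (rule S_replete[OF l(1) \<sigma> iso])
  obtain X Y where X: "\<guillemotleft>X : \<rho> \<rightarrow> \<sigma>\<guillemotright>" and Y: "\<guillemotleft>Y : \<sigma> \<rightarrow> \<rho>\<guillemotright>" and e: "Y \<cdot> X = ide C \<rho>" "X \<cdot> Y = ide C \<sigma>"
    by (rule isomorphicE[OF iso l(2) \<sigma>])
  let ?w = "Fa X v"
  have wH: "?w \<in> H \<sigma>" by (rule Fa_hom(1)[OF l(1) \<sigma>S X l(3)])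
  have "?w \<noteq> 0"
    using Fa_simps(2)[OF l(1) \<sigma>S l(1) Y X l(3)] Fa_simps(1)[OF l(1,3)] e(1) Fa_hom(4)[OF \<sigma>S l(1) Y] line_nonzero[OF v] by auto
  then obtain z where z: "z \<noteq> 0" "ip U (hscl U z ?w) (hscl U z ?w) = 1" using normalize[OF \<sigma>S wH] by auto
  have "\<exists>y. a = hscl U y (hscl U z ?w)" if a: "a \<in> H \<sigma>" for a
  proof -
    let ?c = "ip U v (Fa Y a)"
    have "a = Fa X (Fa Y a)" using Fa_simps(2)[OF \<sigma>S l(1) \<sigma>S X Y a] Fa_simps(1)[OF \<sigma>S a] e(2) by simp
    also have "Fa Y a = hscl U ?c v" by (rule lineD(5)[OF v Fa_hom(1)[OF \<sigma>S l(1) Y a]])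
    also have "Fa X (hscl U ?c v) = hscl U (?c / z) (hscl U z ?w)"
      using Fa_hom(3)[OF l(1) \<sigma>S X l(3)] z(1) by simp
    finally show ?thesis by blast
  qed
  then show ?thesis using lineI[OF \<sigma>S H_closed(4)[OF \<sigma>S wH] z(2)] by blast
qed

lemma line_arrow:
  assumes v: "line \<rho> v" and w: "line \<sigma> w" and iso: "isomorphic_obj C \<rho> \<sigma>"
  shows "\<exists>X. \<guillemotleft>X : \<rho> \<rightarrow> \<sigma>\<guillemotright> \<and> Fa X v = w"
proof -
  note l = lineD[OF v] and m = lineD[OF w]
  obtain X Y where X: "\<guillemotleft>X : \<rho> \<rightarrow> \<sigma>\<guillemotright>" and Y: "\<guillemotleft>Y : \<sigma> \<rightarrow> \<rho>\<guillemotright>" and e: "Y \<cdot> X = ide C \<rho>"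
    by (rule isomorphicE[OF iso l(2) m(2)])
  let ?z = "ip U w (Fa X v)"
  have z: "Fa X v = hscl U ?z w" by (rule lineD(5)[OF w Fa_hom(1)[OF l(1) m(1) X l(3)]])
  have "Fa X v \<noteq> 0"
    using Fa_simps(2)[OF l(1) m(1) l(1) Y X l(3)] Fa_simps(1)[OF l(1,3)] e Fa_hom(4)[OF m(1) l(1) Y] line_nonzero[OF v] by auto
  then have "?z \<noteq> 0" using z by auto
  then have "Fa (scl C (1 / ?z) X) v = w"
    using Fa_simps(3)[OF l(1) m(1) X l(3), of "1 / ?z"] arg_cong[OF z, of "hscl U (1 / ?z)"] by simp
  then show ?thesis using hom_scl[OF X] by blast
qed

lemma line_adj:
  assumes v: "line \<rho> v" and w: "line \<sigma> w" and X: "\<guillemotleft>X : \<rho> \<rightarrow> \<sigma>\<guillemotright>" "Fa X v = hscl U z w"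
  shows "Fa (adj C X) w = hscl U (cnj z) v"
proof -
  note l = lineD[OF v] and m = lineD[OF w]
  have aw: "Fa (adj C X) w \<in> H \<rho>" by (rule Fa_hom(1)[OF m(1) l(1) hom_adj[OF X(1)] m(3)])
  have "ip U (Fa (adj C X) w) v = z"
    using Fa_simps(4)[OF l(1) m(1) X(1) l(3) m(3)] X(2) R.ip_scl[OF FO[OF m(1)] m(3,3)] m(4) by simp
  then have "ip U v (Fa (adj C X) w) = cnj z"
    using R.ip_cnj[OF FO[OF l(1)] aw l(3)] by simp
  then show ?thesis using lineD(5)[OF v aw] by simp
qed

lemma line_unitary:
  assumes v: "line \<rho> v" and w: "line \<sigma> w" and X: "\<guillemotleft>X : \<rho> \<rightarrow> \<sigma>\<guillemotright>" "Fa X v = w"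
  shows "Fa (adj C X) w = v" "adj C X \<cdot> X = ide C \<rho>" "X \<cdot> adj C X = ide C \<sigma>"
proof -
  note l = lineD[OF v] and m = lineD[OF w] and X' = hom_adj[OF X(1)]
  show aw: "Fa (adj C X) w = v" using line_adj[OF v w X(1), of 1] X(2) by simp
  show "adj C X \<cdot> X = ide C \<rho>"
    by (rule line_faithful[OF v l(1) hom_cmp[OF X' X(1)] hom_ide[OF l(2)]])
      (simp add: Fa_simps(2)[OF l(1) m(1) l(1) X' X(1) l(3)] X(2) aw Fa_simps(1)[OF l(1,3)])
  show "X \<cdot> adj C X = ide C \<sigma>"
    by (rule line_faithful[OF w m(1) hom_cmp[OF X(1) X'] hom_ide[OF m(2)]])
      (simp add: Fa_simps(2)[OF m(1) l(1) m(1) X(1) X' m(3)] X(2) aw Fa_simps(1)[OF m(1,3)])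
qed

text \<open>
  An irreducible object of dimension one is a line.  The isometries \<open>Rb \<parallel> id\<close> and \<open>id \<parallel> R\<close> agree because \<open>(V - W)\<^sup>* (V - W) = 0\<close>
  if \<open>V\<^sup>* W = V\<^sup>* V = W\<^sup>* W = id\<close>; so \<open>r\<^sub>b \<otimes> a = a \<otimes> r\<close> for the vectors \<open>r\<close>, \<open>r\<^sub>b\<close> that correspond to \<open>R\<close>, \<open>Rb\<close>.  If \<open>a\<close> and \<open>a'\<close> are
  orthogonal, then pairing this with \<open>a \<otimes> y \<otimes> a'\<close> shows that \<open>r\<close> is orthogonal to all \<open>y \<otimes> a'\<close>.  With two
  orthogonal vectors available \<open>r\<close> would vanish.
\<close>

lemma irreducible_line:
  assumes \<gamma>: "\<gamma> \<in> S" and irr: "irreducible_obj C \<gamma>"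
  shows "\<exists>v. line \<gamma> v"
proof -
  obtain \<gamma>b R Rb where \<gamma>bO: "\<gamma>b \<in> Obj C" and nsol: "normalized_solution C \<gamma> \<gamma>b R Rb 1"
    using dim_one[OF \<gamma> irr] by (auto simp: has_dimension_def)
  have sol: "conj_solution C \<gamma> \<gamma>b R Rb" and RR: "adj C R \<cdot> R = ide C (unt C)" "adj C Rb \<cdot> Rb = ide C (unt C)"
    using nsol by (simp_all add: normalized_solution_def)
  have \<gamma>b: "\<gamma>b \<in> S" by (rule S_conj[OF \<gamma> \<gamma>bO sol])
  note O = SO[OF \<gamma>] and u = unt_Obj
  have R: "\<guillemotleft>R : unt C \<rightarrow> \<gamma>b \<odot> \<gamma>\<guillemotright>" and Rb: "\<guillemotleft>Rb : unt C \<rightarrow> \<gamma> \<odot> \<gamma>b\<guillemotright>"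
    using sol O \<gamma>bO by (simp_all add: conj_solution_def in_hom_def unt_Obj prd_Obj)
  note ig = hom_ide[OF O]
  let ?V = "Rb \<parallel> ide C \<gamma>" and ?W = "ide C \<gamma> \<parallel> R"
  have V: "\<guillemotleft>?V : \<gamma> \<rightarrow> \<gamma> \<odot> \<gamma>b \<odot> \<gamma>\<guillemotright>" using hom_tens[OF Rb ig] prd_unt O by simp
  have W: "\<guillemotleft>?W : \<gamma> \<rightarrow> \<gamma> \<odot> \<gamma>b \<odot> \<gamma>\<guillemotright>" using hom_tens[OF ig R] prd_unt O \<gamma>bO by (simp add: prd_assoc)
  note V' = hom_adj[OF V] and W' = hom_adj[OF W]
  have aV: "adj C ?V = adj C Rb \<parallel> ide C \<gamma>" and aW: "adj C ?W = ide C \<gamma> \<parallel> adj C R"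
    by (simp_all add: star_tens[OF Rb ig] star_tens[OF ig R] star_ide O)
  have VV: "adj C ?V \<cdot> ?V = ide C \<gamma>"
    using interchange[OF hom_adj[OF Rb] Rb ig ig] by (simp add: aV RR ide_left[OF ig] tens_ide prd_unt u O)
  have WW: "adj C ?W \<cdot> ?W = ide C \<gamma>"
    using interchange[OF ig ig hom_adj[OF R] R] by (simp add: aW RR ide_left[OF ig] tens_ide prd_unt u O)
  have VW: "adj C ?V \<cdot> ?W = ide C \<gamma>" using sol by (simp add: aV conj_solution_def)
  have WV: "adj C ?W \<cdot> ?V = ide C \<gamma>"
    using arg_cong[OF VW, of "adj C"] by (simp add: star_cmp[OF V' W] star_star[OF V] star_ide O)
  note mV = hom_scl[OF V, of "-1"] and mW = hom_scl[OF W, of "-1"] and mW' = hom_scl[OF W', of "-1"]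
  have D: "\<guillemotleft>?V + scl C (-1) ?W : \<gamma> \<rightarrow> \<gamma> \<odot> \<gamma>b \<odot> \<gamma>\<guillemotright>" by (rule hom_add[OF V mW])
  have "adj C (?V + scl C (-1) ?W) \<cdot> (?V + scl C (-1) ?W) = 0"
    by (simp only: star_add[OF V mW] star_scl[OF W] complex_cnj_minus complex_cnj_one add_cmp[OF V' mW' D]
      cmp_add'[OF V' V mW] cmp_add'[OF mW' V mW] cmp_scl'[OF V' W] scl_cmp[OF W' V] cmp_scl'[OF mW' W] scl_cmp[OF W' W]
      VV WW VW WV) simp
  from positive[OF D this] have eq: "?V = ?W" by simp
  define r where "r = Fa R Om"
  define rb where "rb = Fa Rb Om"
  note gg = S_prd[OF \<gamma>b \<gamma>] S_prd[OF \<gamma> \<gamma>b]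
  have r: "r \<in> H (\<gamma>b \<odot> \<gamma>)" and rb: "rb \<in> H (\<gamma> \<odot> \<gamma>b)"
    unfolding r_def rb_def by (rule Fa_hom(1)[OF S_unt gg(1) R Om_H], rule Fa_hom(1)[OF S_unt gg(2) Rb Om_H])
  have swap: "rb \<otimes>\<^sub>H a = a \<otimes>\<^sub>H r" if a: "a \<in> H \<gamma>" for a
  proof -
    have "Fa ?V (Om \<otimes>\<^sub>H a) = rb \<otimes>\<^sub>H a"
      using Fa_simps(5)[OF S_unt gg(2) \<gamma> \<gamma> Rb ig Om_H a] by (simp add: rb_def Fa_simps(1)[OF \<gamma> a])
    moreover have "Fa ?W (a \<otimes>\<^sub>H Om) = a \<otimes>\<^sub>H r"
      using Fa_simps(5)[OF \<gamma> \<gamma> S_unt gg(1) ig R a Om_H] by (simp add: r_def Fa_simps(1)[OF \<gamma> a])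
    ultimately show ?thesis using R.vac_box[OF FO[OF \<gamma>] a] eq by simp
  qed
  have r0: "r \<noteq> 0"
  proof
    assume "r = 0"
    then have "Fa (ide C (unt C)) Om = 0"
      using Fa_simps(2)[OF S_unt gg(1) S_unt hom_adj[OF R] R Om_H] Fa_hom(4)[OF gg(1) S_unt hom_adj[OF R]]
      by (simp add: RR r_def)
    then show False using Fa_simps(1)[OF S_unt Om_H] line_nonzero[OF line_unt] by simp
  qed
  have orth: "ip U (y \<otimes>\<^sub>H a') r = 0" if a: "a \<in> H \<gamma>" "ip U a a = 1" and a': "a' \<in> H \<gamma>" "ip U a' a = 0" and y: "y \<in> H \<gamma>b" for a a' y
  proof -
    note f = FO[OF \<gamma>] FO[OF \<gamma>b]
    have "ip U (y \<otimes>\<^sub>H a') r = ip U a a * ip U (y \<otimes>\<^sub>H a') r" using a by simp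
    also have "\<dots> = ip U (a \<otimes>\<^sub>H (y \<otimes>\<^sub>H a')) (a \<otimes>\<^sub>H r)"
      by (rule R.box_ip[OF f(1) FO[OF gg(1)] a(1,1) H_box[OF \<gamma>b \<gamma> y a'(1)] r, symmetric])
    also have "\<dots> = ip U ((a \<otimes>\<^sub>H y) \<otimes>\<^sub>H a') (rb \<otimes>\<^sub>H a)"
      by (simp add: swap[OF a(1)] R.box_assoc[OF f(1,2,1) a(1) y a'(1)])
    also have "\<dots> = ip U (a \<otimes>\<^sub>H y) rb * ip U a' a"
      by (rule R.box_ip[OF FO[OF gg(2)] f(1) H_box[OF \<gamma> \<gamma>b a(1) y] rb a'(1) a(1)])
    finally show ?thesis using a' by simp
  qed
  have "\<exists>a\<in>H \<gamma>. a \<noteq> 0"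
  proof (rule ccontr)
    assume z: "\<not> ?thesis"
    have "ide C \<gamma> = 0"
    proof (rule Fa_faithful[OF \<gamma> \<gamma> ig hom_zero[OF O O]])
      fix a assume "a \<in> H \<gamma>"
      then have "a = 0" using z by blast
      then show "Fa (ide C \<gamma>) a = Fa 0 a"
        by (simp add: Fa_hom(4)[OF \<gamma> \<gamma> ig] Fa_hom(4)[OF \<gamma> \<gamma> hom_zero[OF O O]])
    qed
    then show False using irreducibleD(2)[OF irr] by simp
  qed
  then obtain a0 where "a0 \<in> H \<gamma>" "a0 \<noteq> 0" by auto
  then obtain z where "ip U (hscl U z a0) (hscl U z a0) = 1" using normalize[OF \<gamma>] by auto
  then obtain a where a: "a \<in> H \<gamma>" "ip U a a = 1" using H_closed(4)[OF \<gamma> \<open>a0 \<in> H \<gamma>\<close>] by auto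
  note f = FO[OF \<gamma>]
  have perp: "x - hscl U (ip U a x) a \<in> H \<gamma>" "ip U a (x - hscl U (ip U a x) a) = 0" if "x \<in> H \<gamma>" for x
  proof -
    show "x - hscl U (ip U a x) a \<in> H \<gamma>" using H_closed[OF \<gamma>] that a by blast
    show "ip U a (x - hscl U (ip U a x) a) = 0"
      using R.ip_add[OF f a(1) that H_closed(4)[OF \<gamma> a(1)], of "- ip U a x"]
        R.ip_scl[OF f a(1,1), of "- ip U a x"] a(2) by simp
  qed
  have "x = hscl U (ip U a x) a" if x: "x \<in> H \<gamma>" for x
  proof (rule ccontr)
    assume ne: "x \<noteq> hscl U (ip U a x) a"
    define b0 where "b0 = x - hscl U (ip U a x) a"
    have b0: "b0 \<in> H \<gamma>" "ip U a b0 = 0" "b0 \<noteq> 0" using perp[OF x] ne by (simp_all add: b0_def)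
    obtain z where z: "ip U (hscl U z b0) (hscl U z b0) = 1" using normalize[OF \<gamma> b0(1,3)] by auto
    define b where "b = hscl U z b0"
    have b: "b \<in> H \<gamma>" "ip U b b = 1" "ip U a b = 0"
      using H_closed(4)[OF \<gamma> b0(1)] z R.ip_scl[OF f a(1) b0(1)] b0(2) by (simp_all add: b_def)
    have za: "ip U (y \<otimes>\<^sub>H a) r = 0" if "y \<in> H \<gamma>b" for y by (rule orth[OF b(1,2) a(1) b(3) that])
    have zp: "ip U (y \<otimes>\<^sub>H c) r = 0" if y: "y \<in> H \<gamma>b" and c: "c \<in> H \<gamma>" for y c
    proof -
      define c' where "c' = c - hscl U (ip U a c) a"
      have c': "c' \<in> H \<gamma>" "ip U c' a = 0"
        using perp[OF c] R.ip_cnj[OF f a(1) perp(1)[OF c]] by (simp_all add: c'_def)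
      note ya = H_box[OF \<gamma>b \<gamma> y a(1)] and yc' = H_box[OF \<gamma>b \<gamma> y c'(1)]
      have "c = hscl U (ip U a c) a + c'" by (simp add: c'_def)
      then have "y \<otimes>\<^sub>H c = hscl U (ip U a c) (y \<otimes>\<^sub>H a) + y \<otimes>\<^sub>H c'"
        using R.box_add(2)[OF FO[OF \<gamma>b] f y H_closed(4)[OF \<gamma> a(1)] c'(1)] R.box_scl(2)[OF FO[OF \<gamma>b] f y a(1)] by metis
      then show ?thesis
        using ip_left(1)[OF gg(1) H_closed(4)[OF gg(1) ya] yc' r] ip_left(2)[OF gg(1) ya ya r] za[OF y] orth[OF a c' y] by simp
    qed
    have "s \<in> H (\<gamma>b \<odot> \<gamma>) \<and> ip U s r = 0" if "s \<in> HV.span {y \<otimes>\<^sub>H c |y c. y \<in> H \<gamma>b \<and> c \<in> H \<gamma>}" for s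
      using that
    proof (induction rule: HV.span_induct_alt)
      case base
      show ?case using H_closed(1)[OF gg(1)] ip_left(4)[OF gg(1) r r r] by simp
    next
      case (step k x s)
      then obtain y c where x: "x = y \<otimes>\<^sub>H c" "y \<in> H \<gamma>b" "c \<in> H \<gamma>" by auto
      have xH: "x \<in> H (\<gamma>b \<odot> \<gamma>)" using H_box[OF \<gamma>b \<gamma>] x by simp
      show ?case
        using step.IH zp[OF x(2,3)] x(1) H_closed(2,4)[OF gg(1)] xH ip_left(1)[OF gg(1) H_closed(4)[OF gg(1) xH] _ r]
          ip_left(2)[OF gg(1) xH xH r] by simp
    qed
    then have "ip U r r = 0" using r H_prd[OF \<gamma>b \<gamma>] by simp
    then show False using ip_self_zero[OF gg(1) r] r0 by simp
  qed
  then have "line \<gamma> a" using lineI[OF \<gamma> a] by blast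
  then show ?thesis by blast
qed

text \<open>Write the vector of \<open>Rb\<close> as \<open>v \<otimes> y0\<close>.  Under \<open>F\<close> the second conjugate equation says that each vector \<open>y\<close> of the conjugate
  is a multiple of \<open>y0\<close>.\<close>

lemma conj_line:
  assumes v: "line \<rho> v" and O: "\<rho>b \<in> Obj C" and sol: "conj_solution C \<rho> \<rho>b R Rb"
  shows "\<exists>w. line \<rho>b w" "isomorphic_obj C (unt C) (\<rho>b \<odot> \<rho>)"
proof -
  note l = lineD[OF v]
  have \<rho>b: "\<rho>b \<in> S" by (rule S_conj[OF l(1) O sol])
  note gg = S_prd[OF \<rho>b l(1)] S_prd[OF l(1) \<rho>b]
  have R: "\<guillemotleft>R : unt C \<rightarrow> \<rho>b \<odot> \<rho>\<guillemotright>" and Rb: "\<guillemotleft>Rb : unt C \<rightarrow> \<rho> \<odot> \<rho>b\<guillemotright>"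
    using sol l O by (simp_all add: conj_solution_def in_hom_def unt_Obj prd_Obj)
  have e1: "(adj C Rb \<parallel> ide C \<rho>) \<cdot> (ide C \<rho> \<parallel> R) = ide C \<rho>" and e2: "(adj C R \<parallel> ide C \<rho>b) \<cdot> (ide C \<rho>b \<parallel> Rb) = ide C \<rho>b"
    using sol by (simp_all add: conj_solution_def)
  note ig = hom_ide[OF l(2)] and igb = hom_ide[OF O]
  note f = FO[OF l(1)] FO[OF \<rho>b]
  define r where "r = Fa R Om"
  define rb where "rb = Fa Rb Om"
  have r: "r \<in> H (\<rho>b \<odot> \<rho>)" and rb: "rb \<in> H (\<rho> \<odot> \<rho>b)"
    unfolding r_def rb_def by (rule Fa_hom(1)[OF S_unt gg(1) R Om_H], rule Fa_hom(1)[OF S_unt gg(2) Rb Om_H])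
  have hR1: "\<guillemotleft>ide C \<rho> \<parallel> R : \<rho> \<rightarrow> \<rho> \<odot> \<rho>b \<odot> \<rho>\<guillemotright>" using hom_tens[OF ig R] prd_unt l(2) O by (simp add: prd_assoc)
  have hR2: "\<guillemotleft>adj C Rb \<parallel> ide C \<rho> : \<rho> \<odot> \<rho>b \<odot> \<rho> \<rightarrow> \<rho>\<guillemotright>" using hom_tens[OF hom_adj[OF Rb] ig] prd_unt l(2) by simp
  have hR3: "\<guillemotleft>ide C \<rho>b \<parallel> Rb : \<rho>b \<rightarrow> \<rho>b \<odot> \<rho> \<odot> \<rho>b\<guillemotright>" using hom_tens[OF igb Rb] prd_unt l(2) O by (simp add: prd_assoc)
  have hR4: "\<guillemotleft>adj C R \<parallel> ide C \<rho>b : \<rho>b \<odot> \<rho> \<odot> \<rho>b \<rightarrow> \<rho>b\<guillemotright>" using hom_tens[OF hom_adj[OF R] igb] prd_unt O by simp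
  have r0: "r \<noteq> 0"
  proof
    assume r0: "r = 0"
    have "Fa (ide C \<rho> \<parallel> R) (v \<otimes>\<^sub>H Om) = v \<otimes>\<^sub>H r"
      using Fa_simps(5)[OF l(1,1) S_unt gg(1) ig R l(3) Om_H] by (simp add: r_def Fa_simps(1)[OF l(1,3)])
    also have "\<dots> = 0" unfolding r0 using R.box_scl(2)[OF f(1) FO[OF gg(1)] l(3) r, of 0] r0 by simp
    finally have "Fa (ide C \<rho> \<parallel> R) v = 0" using R.vac_box[OF f(1) l(3)] by simp
    then have "v = 0"
      using Fa_simps(2)[OF l(1) S_prd[OF gg(2) l(1)] l(1) hR2 hR1 l(3)] Fa_hom(4)[OF S_prd[OF gg(2) l(1)] l(1) hR2]
      by (simp add: e1 Fa_simps(1)[OF l(1,3)])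
    then show False using line_nonzero[OF v] by simp
  qed
  have "\<exists>y\<in>H \<rho>b. s = v \<otimes>\<^sub>H y" if "s \<in> HV.span {x \<otimes>\<^sub>H y |x y. x \<in> H \<rho> \<and> y \<in> H \<rho>b}" for s
    using that
  proof (induction rule: HV.span_induct_alt)
    case base
    show ?case
      using R.box_scl(2)[OF f l(3) H_closed(1)[OF \<rho>b], of 0] by (intro bexI[of _ 0] H_closed(1)[OF \<rho>b]) simp
  next
    case (step k x s)
    then obtain x1 y1 y where x: "x = x1 \<otimes>\<^sub>H y1" "x1 \<in> H \<rho>" "y1 \<in> H \<rho>b" and s: "s = v \<otimes>\<^sub>H y" "y \<in> H \<rho>b" by auto
    let ?z = "ip U v x1"
    have "x = hscl U ?z v \<otimes>\<^sub>H y1" using lineD(5)[OF v x(2)] x(1) by simp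
    then have "hscl U k x + s = v \<otimes>\<^sub>H (hscl U (k * ?z) y1 + y)"
      using R.box_scl(1)[OF f l(3) x(3)] R.box_scl(2)[OF f l(3) x(3)] R.box_add(2)[OF f l(3) H_closed(4)[OF \<rho>b x(3)] s(2)] s(1) by simp
    then show ?case using H_closed(2)[OF \<rho>b H_closed(4)[OF \<rho>b x(3)] s(2)] by blast
  qed
  then obtain y0 where y0: "y0 \<in> H \<rho>b" "rb = v \<otimes>\<^sub>H y0" using rb H_prd[OF l(1) \<rho>b] by auto
  have span: "\<exists>z. y = hscl U z y0" if y: "y \<in> H \<rho>b" for y
  proof -
    note yv = H_box[OF \<rho>b l(1) y l(3)]
    let ?z = "ip U Om (Fa (adj C R) (y \<otimes>\<^sub>H v))"
    have zO: "Fa (adj C R) (y \<otimes>\<^sub>H v) = hscl U ?z Om"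
      by (rule lineD(5)[OF line_unt Fa_hom(1)[OF gg(1) S_unt hom_adj[OF R] yv]])
    have "Fa (ide C \<rho>b \<parallel> Rb) (y \<otimes>\<^sub>H Om) = y \<otimes>\<^sub>H rb"
      using Fa_simps(5)[OF \<rho>b \<rho>b S_unt gg(2) igb Rb y Om_H] by (simp add: rb_def Fa_simps(1)[OF \<rho>b y])
    also have "\<dots> = (y \<otimes>\<^sub>H v) \<otimes>\<^sub>H y0" by (simp add: y0(2) R.box_assoc[OF f(2,1,2) y l(3) y0(1)])
    finally have "Fa (ide C \<rho>b \<parallel> Rb) y = (y \<otimes>\<^sub>H v) \<otimes>\<^sub>H y0" using R.vac_box[OF f(2) y] by simp
    moreover have "Fa (adj C R \<parallel> ide C \<rho>b) ((y \<otimes>\<^sub>H v) \<otimes>\<^sub>H y0) = hscl U ?z Om \<otimes>\<^sub>H y0"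
      using Fa_simps(5)[OF gg(1) S_unt \<rho>b \<rho>b hom_adj[OF R] igb yv y0(1)] zO by (simp add: Fa_simps(1)[OF \<rho>b y0(1)])
    moreover have "hscl U ?z Om \<otimes>\<^sub>H y0 = hscl U ?z y0"
      using R.box_scl(1)[OF FO[OF S_unt] f(2) Om_H y0(1)] R.vac_box[OF f(2) y0(1)] by simp
    ultimately have "y = hscl U ?z y0"
      using Fa_simps(2)[OF \<rho>b S_prd[OF gg(1) \<rho>b] \<rho>b hR4 hR3 y] by (simp add: e2 Fa_simps(1)[OF \<rho>b y])
    then show ?thesis by blast
  qed
  have "y0 \<noteq> 0"
  proof
    assume "y0 = 0"
    then have H0: "y = 0" if "y \<in> H \<rho>b" for y using span[OF that] by auto
    have "{x \<otimes>\<^sub>H y |x y. x \<in> H \<rho>b \<and> y \<in> H \<rho>} \<subseteq> {0}"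
      using R.box_scl(1)[OF f(2,1) H_closed(1)[OF \<rho>b], of _ 0] H0 by auto
    then have "r \<in> HV.span {0}" using r H_prd[OF \<rho>b l(1)] HV.span_mono by blast
    then show False using r0 by simp
  qed
  then obtain z where z: "z \<noteq> 0" "ip U (hscl U z y0) (hscl U z y0) = 1" using normalize[OF \<rho>b y0(1)] by auto
  have "line \<rho>b (hscl U z y0)"
  proof (rule lineI[OF \<rho>b H_closed(4)[OF \<rho>b y0(1)] z(2)])
    fix a assume "a \<in> H \<rho>b"
    then obtain c where "a = hscl U c y0" using span by auto
    then show "\<exists>c. a = hscl U c (hscl U z y0)" using z(1) by (intro exI[of _ "c / z"]) simp
  qed
  then show ex: "\<exists>w. line \<rho>b w" by blast
  then obtain w where w: "line \<rho>b w" by auto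
  have "R \<noteq> 0"
  proof
    assume "R = 0"
    then have "r = Fa (scl C 0 R) Om" by (simp add: r_def)
    then have "r = 0" using Fa_simps(3)[OF S_unt gg(1) R Om_H, of 0] by simp
    then show False using r0 by simp
  qed
  then show "isomorphic_obj C (unt C) (\<rho>b \<odot> \<rho>)"
    using schur[OF unt_irreducible line_irreducible[OF line_prd[OF w v]] R] by blast
qed

end

section \<open>The crossed product as an orbit category\<close>

context abelian_crossed_product
begin

interpretation V: vector_space "scl C" by (rule vs)
interpretation HV: vector_space "hscl U" by (rule R.hvs)

abbreviation K :: "'o set monoid" where "K \<equiv> sector_group C S"
abbreviation g :: "'o set \<Rightarrow> 'o" where "g \<equiv> rep D"

lemma K_simps [simp]: "carrier K = sub_sectors C S" "k \<otimes>\<^bsub>K\<^esub> l = sector_mult C k l"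
  "\<one>\<^bsub>K\<^esub> = iso_class C (unt C)"
  by (simp_all add: sector_group_def)

lemma line_sector: "line \<rho> v \<Longrightarrow> iso_class C \<rho> \<in> sub_sectors C S"
  using lineD(1) line_irreducible by (auto simp: sub_sectors_def)

lemma rep_sector:
  assumes "k \<in> sub_sectors C S"
  shows "g k \<in> S" "g k \<in> Obj C" "iso_class C (g k) = k" "\<exists>v. line (g k) v"
proof -
  obtain \<gamma> where \<gamma>: "\<gamma> \<in> S" "irreducible_obj C \<gamma>" "k = iso_class C \<gamma>" using assms by (auto simp: sub_sectors_def)
  have g: "g k \<in> Obj C" "isomorphic_obj C \<gamma> (g k)" using rep[OF assms] \<gamma>(3) by (auto simp: iso_class_def)
  show "g k \<in> Obj C" by (rule g)
  show S: "g k \<in> S" by (rule S_replete[OF \<gamma>(1) g])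
  show "iso_class C (g k) = k" using iso_class_eq_iff[OF SO[OF \<gamma>(1)] g(1)] g(2) \<gamma>(3) by simp
  show "\<exists>v. line (g k) v" by (rule irreducible_line[OF S irreducible_iso[OF g(2) \<gamma>(2) g(1)]])
qed

lemma sector_mult_rep:
  assumes "k \<in> sub_sectors C S" "l \<in> sub_sectors C S"
  shows "sector_mult C k l = iso_class C (g k \<odot> g l)" "sector_mult C k l \<in> sub_sectors C S"
proof -
  show eq: "sector_mult C k l = iso_class C (g k \<odot> g l)"
    using sector_mult_iso_class[OF rep_sector(2)[OF assms(1)] rep_sector(2)[OF assms(2)]] rep_sector(3) assms by simp
  show "sector_mult C k l \<in> sub_sectors C S"
    using rep_sector(4)[OF assms(1)] rep_sector(4)[OF assms(2)] line_prd line_sector unfolding eq by blast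
qed

lemma conj_sector:
  assumes k: "k \<in> sub_sectors C S" and \<rho>: "\<rho> \<in> k" and O: "\<rho>b \<in> Obj C" and sol: "conj_solution C \<rho> \<rho>b R Rb"
  shows "iso_class C \<rho>b \<in> sub_sectors C S" "sector_mult C (iso_class C \<rho>b) k = iso_class C (unt C)"
proof -
  have \<rho>': "\<rho> \<in> Obj C" "isomorphic_obj C (g k) \<rho>"
    using \<rho> rep_sector(3)[OF k] by (auto simp: iso_class_def)
  obtain v where v: "line \<rho> v" using rep_sector(4)[OF k] iso_line \<rho>' by blast
  have k': "k = iso_class C \<rho>" using iso_class_eq_iff[OF rep_sector(2)[OF k] \<rho>'(1)] \<rho>'(2) rep_sector(3)[OF k] by simp
  show "iso_class C \<rho>b \<in> sub_sectors C S" using conj_line(1)[OF v O sol] line_sector by blast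
  show "sector_mult C (iso_class C \<rho>b) k = iso_class C (unt C)"
    using iso_class_eq_iff[OF unt_Obj prd_Obj[OF O \<rho>'(1)]] conj_line(2)[OF v O sol]
    by (simp add: k' sector_mult_iso_class O \<rho>'(1))
qed

lemma comm_group_K: "comm_group K"
proof (rule comm_groupI)
  show "x \<otimes>\<^bsub>K\<^esub> y \<in> carrier K" if "x \<in> carrier K" "y \<in> carrier K" for x y
    using sector_mult_rep(2) that by simp
  show "\<one>\<^bsub>K\<^esub> \<in> carrier K" using line_sector[OF line_unt] by simp
  show "x \<otimes>\<^bsub>K\<^esub> y \<otimes>\<^bsub>K\<^esub> z = x \<otimes>\<^bsub>K\<^esub> (y \<otimes>\<^bsub>K\<^esub> z)" if "x \<in> carrier K" "y \<in> carrier K" "z \<in> carrier K" for x y z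
  proof -
    have S: "x \<in> sub_sectors C S" "y \<in> sub_sectors C S" "z \<in> sub_sectors C S" using that by simp_all
    note O = rep_sector(2)[OF S(1)] rep_sector(2)[OF S(2)] rep_sector(2)[OF S(3)]
    have "iso_class C (g x \<odot> g y \<odot> g z) = sector_mult C (sector_mult C x y) z"
      using sector_mult_iso_class[OF prd_Obj[OF O(1,2)] O(3)] rep_sector(3)[OF S(3)] sector_mult_rep(1)[OF S(1,2)] by simp
    moreover have "iso_class C (g x \<odot> (g y \<odot> g z)) = sector_mult C x (sector_mult C y z)"
      using sector_mult_iso_class[OF O(1) prd_Obj[OF O(2,3)]] rep_sector(3)[OF S(1)] sector_mult_rep(1)[OF S(2,3)] by simp
    ultimately show ?thesis by (simp add: prd_assoc O)
  qed
  show "x \<otimes>\<^bsub>K\<^esub> y = y \<otimes>\<^bsub>K\<^esub> x" if "x \<in> carrier K" "y \<in> carrier K" for x y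
  proof -
    have S: "x \<in> sub_sectors C S" "y \<in> sub_sectors C S" using that by simp_all
    note O = rep_sector(2)[OF S(1)] rep_sector(2)[OF S(2)]
    have u: "unitary_arr C (g x \<odot> g y) (g y \<odot> g x) (eps C (g x) (g y))" by (rule eps_unitary[OF O])
    have "\<guillemotleft>eps C (g x) (g y) : g x \<odot> g y \<rightarrow> g y \<odot> g x\<guillemotright>"
      using u prd_Obj O by (simp add: unitary_arr_def isometry_def in_hom_def)
    then have "isomorphic_obj C (g x \<odot> g y) (g y \<odot> g x)"
      using u by (intro isomorphicI[OF _ hom_adj]) (auto simp: unitary_arr_def isometry_def)
    then show ?thesis
      using sector_mult_rep(1)[OF S] sector_mult_rep(1)[OF S(2,1)] iso_class_eq_iff prd_Obj O by simp
  qed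
  show "\<one>\<^bsub>K\<^esub> \<otimes>\<^bsub>K\<^esub> x = x" if "x \<in> carrier K" for x
    using that sector_mult_iso_class[OF unt_Obj rep_sector(2)[of x]] rep_sector(2,3)[of x] by (simp add: prd_unt)
  show "\<exists>y\<in>carrier K. y \<otimes>\<^bsub>K\<^esub> x = \<one>\<^bsub>K\<^esub>" if "x \<in> carrier K" for x
  proof -
    have S: "x \<in> sub_sectors C S" using that by simp
    obtain \<rho>b R Rb where "\<rho>b \<in> Obj C" "conj_solution C (g x) \<rho>b R Rb" using conjugates[OF rep_sector(2)[OF S]] by auto
    then have "iso_class C \<rho>b \<in> carrier K" "iso_class C \<rho>b \<otimes>\<^bsub>K\<^esub> x = \<one>\<^bsub>K\<^esub>"
      using conj_sector[OF S rep[OF S]] by simp_all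
    then show ?thesis by (rule bexI[rotated])
  qed
qed

sublocale KG: comm_group K by (rule comm_group_K)

lemma isomorphic_rep:
  assumes "line \<rho> v" shows "isomorphic_obj C (g (iso_class C \<rho>)) \<rho>"
  using rep[OF line_sector[OF assms]] by (auto simp: iso_class_def intro: isomorphic_sym)

text \<open>By \<open>conj_sector\<close>, conjugates lie in the inverse class.  For every object \<open>\<tau>\<close> of that class, the arrows that correspond under \<open>F\<close> to \<open>w \<otimes> v\<close> and \<open>v \<otimes> w\<close> solve
  the conjugate equations.  The second arrow is obtained from the first by the braiding, which \<open>F\<close> maps to the flip.\<close>

lemma sector_conj_inv:
  assumes k: "k \<in> sub_sectors C S"
  shows "sector_conj C k = inv\<^bsub>K\<^esub> k"
proof (rule Set.set_eqI)
  fix \<tau>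
  have kK: "k \<in> carrier K" using k by simp
  have ik: "inv\<^bsub>K\<^esub> k \<in> sub_sectors C S" using KG.inv_closed[OF kK] by simp
  show "\<tau> \<in> sector_conj C k \<longleftrightarrow> \<tau> \<in> inv\<^bsub>K\<^esub> k"
  proof
    assume "\<tau> \<in> sector_conj C k"
    then obtain \<rho> R Rb where \<tau>: "\<tau> \<in> Obj C" "\<rho> \<in> k" "conj_solution C \<rho> \<tau> R Rb"
      by (auto simp: sector_conj_def)
    have "iso_class C \<tau> = inv\<^bsub>K\<^esub> k"
      using conj_sector[OF k \<tau>(2,1,3)] kK by (intro KG.inv_equality[symmetric]) simp_all
    then show "\<tau> \<in> inv\<^bsub>K\<^esub> k" using isomorphic_refl[OF \<tau>(1)] \<tau>(1) by (auto simp: iso_class_def)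
  next
    assume "\<tau> \<in> inv\<^bsub>K\<^esub> k"
    then have \<tau>: "\<tau> \<in> Obj C" "isomorphic_obj C (g (inv\<^bsub>K\<^esub> k)) \<tau>"
      using rep_sector(3)[OF ik] by (auto simp: iso_class_def)
    obtain w where w: "line \<tau> w" using rep_sector(4)[OF ik] iso_line[OF _ \<tau>(2,1)] by blast
    obtain v where v: "line (g k) v" using rep_sector(4)[OF k] by auto
    note l = lineD[OF v] and m = lineD[OF w]
    have c\<tau>: "iso_class C \<tau> = inv\<^bsub>K\<^esub> k"
      using iso_class_eq_iff[OF rep_sector(2)[OF ik] \<tau>(1)] \<tau>(2) rep_sector(3)[OF ik] by simp
    have "iso_class C (\<tau> \<odot> g k) = iso_class C (unt C)"
      using sector_mult_iso_class[OF \<tau>(1) l(2)] KG.l_inv[OF kK] by (simp add: c\<tau> rep_sector(3)[OF k])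
    then have "isomorphic_obj C (unt C) (\<tau> \<odot> g k)"
      using iso_class_eq_iff[OF prd_Obj[OF \<tau>(1) l(2)] unt_Obj] isomorphic_sym by simp
    then obtain A where A: "\<guillemotleft>A : unt C \<rightarrow> \<tau> \<odot> g k\<guillemotright>" "Fa A Om = w \<otimes>\<^sub>H v"
      using line_arrow[OF line_unt line_prd[OF w v]] by auto
    let ?e = "eps C \<tau> (g k)"
    have e: "\<guillemotleft>?e : \<tau> \<odot> g k \<rightarrow> g k \<odot> \<tau>\<guillemotright>"
      using eps_unitary[OF \<tau>(1) l(2)] prd_Obj \<tau> l by (simp add: unitary_arr_def isometry_def in_hom_def)
    define B where "B = ?e \<cdot> A"
    have B: "\<guillemotleft>B : unt C \<rightarrow> g k \<odot> \<tau>\<guillemotright>" unfolding B_def by (rule hom_cmp[OF e A(1)])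
    note S2 = S_prd[OF m(1) l(1)] S_prd[OF l(1) m(1)]
    have FB: "Fa B Om = v \<otimes>\<^sub>H w"
      using Fa_simps(2)[OF S_unt S2 e A(1) Om_H] F.Fa_eps[OF m(1) l(1) m(3) l(3)] by (simp add: B_def A(2))
    have zig: "(adj C Y \<parallel> ide C \<alpha>) \<cdot> (ide C \<alpha> \<parallel> X) = ide C \<alpha>"
      if a: "line \<alpha> a" and b: "line \<beta> b" and X: "\<guillemotleft>X : unt C \<rightarrow> \<beta> \<odot> \<alpha>\<guillemotright>" "Fa X Om = b \<otimes>\<^sub>H a"
        and Y: "\<guillemotleft>Y : unt C \<rightarrow> \<alpha> \<odot> \<beta>\<guillemotright>" "Fa Y Om = a \<otimes>\<^sub>H b" for \<alpha> \<beta> a b X Y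
    proof -
      note la = lineD[OF a] and lb = lineD[OF b]
      note ia = hom_ide[OF la(2)]
      have h1: "\<guillemotleft>ide C \<alpha> \<parallel> X : \<alpha> \<rightarrow> \<alpha> \<odot> \<beta> \<odot> \<alpha>\<guillemotright>" using hom_tens[OF ia X(1)] prd_unt la(2) lb(2) by (simp add: prd_assoc)
      have h2: "\<guillemotleft>adj C Y \<parallel> ide C \<alpha> : \<alpha> \<odot> \<beta> \<odot> \<alpha> \<rightarrow> \<alpha>\<guillemotright>" using hom_tens[OF hom_adj[OF Y(1)] ia] prd_unt la(2) by simp
      note s = S_prd[OF la(1) lb(1)] S_prd[OF lb(1) la(1)]
      have ab: "a \<otimes>\<^sub>H b \<in> H (\<alpha> \<odot> \<beta>)" by (rule H_box[OF la(1) lb(1) la(3) lb(3)])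
      have "Fa (ide C \<alpha> \<parallel> X) a = a \<otimes>\<^sub>H (b \<otimes>\<^sub>H a)"
        using Fa_simps(5)[OF la(1,1) S_unt s(2) ia X(1) la(3) Om_H] R.vac_box(2)[OF FO[OF la(1)] la(3)]
        by (simp add: X(2) Fa_simps(1)[OF la(1,3)])
      also have "\<dots> = (a \<otimes>\<^sub>H b) \<otimes>\<^sub>H a" by (simp add: R.box_assoc[OF FO[OF la(1)] FO[OF lb(1)] FO[OF la(1)] la(3) lb(3) la(3)])
      finally have "Fa (ide C \<alpha> \<parallel> X) a = (a \<otimes>\<^sub>H b) \<otimes>\<^sub>H a" .
      moreover have "Fa (adj C Y \<parallel> ide C \<alpha>) ((a \<otimes>\<^sub>H b) \<otimes>\<^sub>H a) = a"
        using Fa_simps(5)[OF s(1) S_unt la(1,1) hom_adj[OF Y(1)] ia ab la(3)] line_unitary(1)[OF line_unt line_prd[OF a b] Y]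
          R.vac_box(1)[OF FO[OF la(1)] la(3)] by (simp add: Fa_simps(1)[OF la(1,3)])
      ultimately show ?thesis
        using Fa_simps(2)[OF la(1) S_prd[OF s(1) la(1)] la(1) h2 h1 la(3)]
        by (intro line_faithful[OF a la(1) hom_cmp[OF h2 h1] ia]) (simp add: Fa_simps(1)[OF la(1,3)])
    qed
    have "conj_solution C (g k) \<tau> A B"
      unfolding conj_solution_def
      using in_homD(3)[OF A(1)] in_homD(3)[OF B] zig[OF v w A B FB] zig[OF w v B FB A] by simp
    then show "\<tau> \<in> sector_conj C k" using \<tau>(1) rep[OF k] by (auto simp: sector_conj_def)
  qed
qed

lemma inv_sector: assumes "k \<in> sub_sectors C S"
  shows "inv\<^bsub>K\<^esub> k \<in> sub_sectors C S" "sector_mult C (inv\<^bsub>K\<^esub> k) k = iso_class C (unt C)" "sector_mult C k (inv\<^bsub>K\<^esub> k) = iso_class C (unt C)"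
  using KG.inv_closed[of k] KG.l_inv[of k] KG.r_inv[of k] assms by simp_all

definition h :: "'o set \<Rightarrow> 'h" where
  "h k = (if k = iso_class C (unt C) then Om else SOME v. line (g k) v)"

lemma line_h: "k \<in> sub_sectors C S \<Longrightarrow> line (g k) (h k)"
  using rep_sector(4)[of k] line_unt by (auto simp: h_def rep_unt intro: someI_ex)

text \<open>
  Between the representatives, \<open>W k l\<close> is the arrow with \<open>F (W k l) (h (k l)) = h k \<otimes> h l\<close>.  Any two composites of these arrows
  with the same source and target agree, since \<open>F\<close> is faithful.
\<close>

definition W :: "'o set \<Rightarrow> 'o set \<Rightarrow> 'a" where
  "W k l = (SOME X. \<guillemotleft>X : g (sector_mult C k l) \<rightarrow> g k \<odot> g l\<guillemotright> \<and> Fa X (h (sector_mult C k l)) = h k \<otimes>\<^sub>H h l)"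

lemma W:
  assumes k: "k \<in> sub_sectors C S" and l: "l \<in> sub_sectors C S"
  shows "\<guillemotleft>W k l : g (sector_mult C k l) \<rightarrow> g k \<odot> g l\<guillemotright>" "Fa (W k l) (h (sector_mult C k l)) = h k \<otimes>\<^sub>H h l"
proof -
  have "isomorphic_obj C (g (sector_mult C k l)) (g k \<odot> g l)"
    using isomorphic_rep[OF line_prd[OF line_h[OF k] line_h[OF l]]] sector_mult_rep(1)[OF k l] by simp
  then have "\<exists>X. \<guillemotleft>X : g (sector_mult C k l) \<rightarrow> g k \<odot> g l\<guillemotright> \<and> Fa X (h (sector_mult C k l)) = h k \<otimes>\<^sub>H h l"
    by (rule line_arrow[OF line_h[OF sector_mult_rep(2)[OF k l]] line_prd[OF line_h[OF k] line_h[OF l]]])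
  from someI_ex[OF this] show "\<guillemotleft>W k l : g (sector_mult C k l) \<rightarrow> g k \<odot> g l\<guillemotright>"
    "Fa (W k l) (h (sector_mult C k l)) = h k \<otimes>\<^sub>H h l" by (simp_all add: W_def)
qed

lemma W_unitary:
  assumes k: "k \<in> sub_sectors C S" and l: "l \<in> sub_sectors C S"
  shows "adj C (W k l) \<cdot> W k l = ide C (g (sector_mult C k l))" "W k l \<cdot> adj C (W k l) = ide C (g k \<odot> g l)"
    "Fa (adj C (W k l)) (h k \<otimes>\<^sub>H h l) = h (sector_mult C k l)"
  using line_unitary[OF line_h[OF sector_mult_rep(2)[OF k l]] line_prd[OF line_h[OF k] line_h[OF l]] W[OF k l]] by blast+

lemma W_coherent:
  assumes k: "k \<in> sub_sectors C S" and l: "l \<in> sub_sectors C S" and m: "m \<in> sub_sectors C S"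
  shows "(ide C (g k) \<parallel> W l m) \<cdot> W k (sector_mult C l m) = (W k l \<parallel> ide C (g m)) \<cdot> W (sector_mult C k l) m"
proof -
  let ?kl = "sector_mult C k l" and ?lm = "sector_mult C l m" and ?klm = "sector_mult C k (sector_mult C l m)"
  have kl: "?kl \<in> sub_sectors C S" "?lm \<in> sub_sectors C S" "?klm \<in> sub_sectors C S"
    using sector_mult_rep(2) k l m by simp_all
  have as: "sector_mult C ?kl m = ?klm" using KG.m_assoc[of k l m] k l m by simp
  note a = line_h[OF k] and b = line_h[OF l] and c = line_h[OF m] and d = line_h[OF kl(3)]
  note la = lineD[OF a] and lb = lineD[OF b] and lc = lineD[OF c] and ld = lineD[OF d]
  have h1: "\<guillemotleft>ide C (g k) \<parallel> W l m : g k \<odot> g ?lm \<rightarrow> g k \<odot> (g l \<odot> g m)\<guillemotright>"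
    by (rule hom_tens[OF hom_ide[OF la(2)] W(1)[OF l m]])
  have h2: "\<guillemotleft>W k l \<parallel> ide C (g m) : g ?kl \<odot> g m \<rightarrow> g k \<odot> (g l \<odot> g m)\<guillemotright>"
    using hom_tens[OF W(1)[OF k l] hom_ide[OF lc(2)]] by (simp add: prd_assoc la lb lc)
  have h3: "\<guillemotleft>W ?kl m : g ?klm \<rightarrow> g ?kl \<odot> g m\<guillemotright>" and f3: "Fa (W ?kl m) (h ?klm) = h ?kl \<otimes>\<^sub>H h m"
    using W[OF kl(1) m] as by simp_all
  note sl = lineD[OF line_h[OF kl(1)]] and sr = lineD[OF line_h[OF kl(2)]]
  have S3: "g k \<odot> (g l \<odot> g m) \<in> S" by (intro S_prd la(1) lb(1) lc(1))
  have "Fa ((ide C (g k) \<parallel> W l m) \<cdot> W k ?lm) (h ?klm) = h k \<otimes>\<^sub>H (h l \<otimes>\<^sub>H h m)"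
    using Fa_simps(2)[OF ld(1) S_prd[OF la(1) sr(1)] S3 h1 W(1)[OF k kl(2)] ld(3)]
      Fa_simps(5)[OF la(1,1) sr(1) S_prd[OF lb(1) lc(1)] hom_ide[OF la(2)] W(1)[OF l m] la(3) sr(3)]
    by (simp add: W(2)[OF k kl(2)] W(2)[OF l m] Fa_simps(1)[OF la(1,3)])
  moreover have "Fa ((W k l \<parallel> ide C (g m)) \<cdot> W ?kl m) (h ?klm) = (h k \<otimes>\<^sub>H h l) \<otimes>\<^sub>H h m"
    using Fa_simps(2)[OF ld(1) S_prd[OF sl(1) lc(1)] S3 h2 h3 ld(3)]
      Fa_simps(5)[OF sl(1) S_prd[OF la(1) lb(1)] lc(1,1) W(1)[OF k l] hom_ide[OF lc(2)] sl(3) lc(3)]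
    by (simp add: f3 W(2)[OF k l] Fa_simps(1)[OF lc(1,3)])
  ultimately show ?thesis
    using R.box_assoc[OF FO[OF la(1)] FO[OF lb(1)] FO[OF lc(1)] la(3) lb(3) lc(3)]
    by (intro line_faithful[OF d S3 hom_cmp[OF h1 W(1)[OF k kl(2)]] hom_cmp[OF h2 h3]]) simp
qed

lemma W_unit:
  assumes k: "k \<in> sub_sectors C S"
  shows "W (iso_class C (unt C)) k = ide C (g k)" "W k (iso_class C (unt C)) = ide C (g k)"
proof -
  let ?e = "iso_class C (unt C)"
  have e: "?e \<in> sub_sectors C S" by (rule line_sector[OF line_unt])
  have ek: "sector_mult C ?e k = k" "sector_mult C k ?e = k" using KG.l_one[of k] KG.r_one[of k] k by simp_all
  have he: "h ?e = Om" by (simp add: h_def)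
  note l = lineD[OF line_h[OF k]]
  note x = W[OF e k, unfolded ek] and y = W[OF k e, unfolded ek]
  show "W ?e k = ide C (g k)"
    by (rule line_faithful[OF line_h[OF k] l(1) _ hom_ide[OF l(2)]])
      (use x in \<open>simp_all add: rep_unt prd_unt l(2) he R.vac_box[OF FO[OF l(1)] l(3)] Fa_simps(1)[OF l(1,3)]\<close>)
  show "W k ?e = ide C (g k)"
    by (rule line_faithful[OF line_h[OF k] l(1) _ hom_ide[OF l(2)]])
      (use y in \<open>simp_all add: rep_unt prd_unt l(2) he R.vac_box[OF FO[OF l(1)] l(3)] Fa_simps(1)[OF l(1,3)]\<close>)
qed

definition gO :: "'o set \<Rightarrow> 'o \<Rightarrow> 'o" where "gO k \<rho> = g k \<odot> \<rho>"
definition gA :: "'o set \<Rightarrow> 'a \<Rightarrow> 'a" where "gA k X = ide C (g k) \<parallel> X"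
definition w :: "'o set \<Rightarrow> 'o set \<Rightarrow> 'o \<Rightarrow> 'a" where "w k l \<rho> = W k l \<parallel> ide C \<rho>"

sublocale act: category_action C K gO gA w
proof
  show "gA \<one>\<^bsub>K\<^esub> X = X" if "\<guillemotleft>X : \<rho> \<rightarrow> \<sigma>\<guillemotright>" for X \<rho> \<sigma>
    using that tens_unt(1)[of \<rho> \<sigma> X] by (simp add: gA_def rep_unt in_hom_def)
  fix k assume "k \<in> carrier K"
  then have k: "k \<in> sub_sectors C S" by simp
  note O = rep_sector(2)[OF k] and ik = hom_ide[OF rep_sector(2)[OF k]]
  show "gO k \<rho> \<in> Obj C" if "\<rho> \<in> Obj C" for \<rho> using that O by (simp add: gO_def prd_Obj)
  show "\<guillemotleft>gA k X : gO k \<rho> \<rightarrow> gO k \<sigma>\<guillemotright>" if "\<guillemotleft>X : \<rho> \<rightarrow> \<sigma>\<guillemotright>" for X \<rho> \<sigma>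
    unfolding gA_def gO_def by (rule hom_tens[OF ik that])
  show "gA k (ide C \<rho>) = ide C (gO k \<rho>)" if "\<rho> \<in> Obj C" for \<rho> using that O by (simp add: gA_def gO_def tens_ide)
  show "gA k (X \<cdot> Y) = gA k X \<cdot> gA k Y" if "\<guillemotleft>X : \<sigma> \<rightarrow> \<tau>\<guillemotright>" "\<guillemotleft>Y : \<rho> \<rightarrow> \<sigma>\<guillemotright>" for X Y \<rho> \<sigma> \<tau>
    by (simp add: gA_def interchange[OF ik ik that] ide_left[OF ik])
  show "gA k (X + Y) = gA k X + gA k Y" if "\<guillemotleft>X : \<rho> \<rightarrow> \<sigma>\<guillemotright>" "\<guillemotleft>Y : \<rho> \<rightarrow> \<sigma>\<guillemotright>" for X Y \<rho> \<sigma>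
    using that tens_add(2)[OF O O _ _ ide_Hom[OF O], of \<rho> \<sigma> X Y] by (simp add: gA_def in_hom_def)
  show "gA k (scl C z X) = scl C z (gA k X)" if "\<guillemotleft>X : \<rho> \<rightarrow> \<sigma>\<guillemotright>" for X \<rho> \<sigma> z
    using that tens_scl(2)[OF O O _ _ ide_Hom[OF O], of \<rho> \<sigma> X] by (simp add: gA_def in_hom_def)
  show "gA k (adj C X) = adj C (gA k X)" if "\<guillemotleft>X : \<rho> \<rightarrow> \<sigma>\<guillemotright>" for X \<rho> \<sigma>
    by (simp add: gA_def star_tens[OF ik that] star_ide O)
  show "w \<one>\<^bsub>K\<^esub> k \<rho> = ide C (gO k \<rho>)" "w k \<one>\<^bsub>K\<^esub> \<rho> = ide C (gO k \<rho>)" if "\<rho> \<in> Obj C" for \<rho>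
    using W_unit[OF k] that O by (simp_all add: w_def gO_def tens_ide)
  fix l assume "l \<in> carrier K"
  then have l: "l \<in> sub_sectors C S" by simp
  note Ol = rep_sector(2)[OF l] and il = hom_ide[OF rep_sector(2)[OF l]]
  note kl = sector_mult_rep(2)[OF k l]
  note Okl = rep_sector(2)[OF kl] and ikl = hom_ide[OF rep_sector(2)[OF kl]]
  show wh: "\<guillemotleft>w k l \<rho> : gO (k \<otimes>\<^bsub>K\<^esub> l) \<rho> \<rightarrow> gO k (gO l \<rho>)\<guillemotright>" if "\<rho> \<in> Obj C" for \<rho>
    using hom_tens[OF W(1)[OF k l] hom_ide[OF that]] by (simp add: w_def gO_def prd_assoc O Ol that)
  show "adj C (w k l \<rho>) \<cdot> w k l \<rho> = ide C (gO (k \<otimes>\<^bsub>K\<^esub> l) \<rho>)" "w k l \<rho> \<cdot> adj C (w k l \<rho>) = ide C (gO k (gO l \<rho>))"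
    if r: "\<rho> \<in> Obj C" for \<rho>
    using interchange[OF hom_adj[OF W(1)[OF k l]] W(1)[OF k l] hom_ide[OF r] hom_ide[OF r]]
      interchange[OF W(1)[OF k l] hom_adj[OF W(1)[OF k l]] hom_ide[OF r] hom_ide[OF r]]
    by (simp_all add: w_def gO_def star_tens[OF W(1)[OF k l] hom_ide[OF r]] star_ide r W_unitary[OF k l]
        ide_left[OF hom_ide[OF r]] tens_ide prd_Obj prd_assoc O Ol Okl)
  show "w k l \<sigma> \<cdot> gA (k \<otimes>\<^bsub>K\<^esub> l) X = gA k (gA l X) \<cdot> w k l \<rho>" if X: "\<guillemotleft>X : \<rho> \<rightarrow> \<sigma>\<guillemotright>" for X \<rho> \<sigma>
  proof -
    note r = in_homD(1)[OF X] and s = in_homD(2)[OF X]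
    have "gA k (gA l X) = ide C (g k \<odot> g l) \<parallel> X"
      by (simp add: gA_def tens_ide[OF O Ol, symmetric] tens_assoc'[OF ik il X])
    moreover have "w k l \<sigma> \<cdot> gA (k \<otimes>\<^bsub>K\<^esub> l) X = W k l \<parallel> X"
      by (simp add: w_def gA_def interchange[OF W(1)[OF k l] ikl hom_ide[OF s] X] ide_left[OF X] ide_right[OF W(1)[OF k l]])
    moreover have "(ide C (g k \<odot> g l) \<parallel> X) \<cdot> w k l \<rho> = W k l \<parallel> X"
      by (simp add: w_def interchange[OF hom_ide[OF prd_Obj[OF O Ol]] W(1)[OF k l] X hom_ide[OF r]]
          ide_right[OF X] ide_left[OF W(1)[OF k l]])
    ultimately show ?thesis by simp
  qed
  fix m assume "m \<in> carrier K"
  then have m: "m \<in> sub_sectors C S" by simp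
  note Om' = rep_sector(2)[OF m] and im = hom_ide[OF rep_sector(2)[OF m]]
  note lm = sector_mult_rep(2)[OF l m]
  show "gA k (w l m \<rho>) \<cdot> w k (l \<otimes>\<^bsub>K\<^esub> m) \<rho> = w k l (gO m \<rho>) \<cdot> w (k \<otimes>\<^bsub>K\<^esub> l) m \<rho>" if r: "\<rho> \<in> Obj C" for \<rho>
  proof -
    note ir = hom_ide[OF r]
    have as: "sector_mult C (sector_mult C k l) m = sector_mult C k (sector_mult C l m)"
      using KG.m_assoc[of k l m] k l m by simp
    have a: "gA k (w l m \<rho>) = (ide C (g k) \<parallel> W l m) \<parallel> ide C \<rho>"
      by (simp add: gA_def w_def tens_assoc'[OF ik W(1)[OF l m] ir])
    have b: "w k l (gO m \<rho>) = (W k l \<parallel> ide C (g m)) \<parallel> ide C \<rho>"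
      by (simp add: w_def gO_def tens_ide[OF Om' r, symmetric] tens_assoc'[OF W(1)[OF k l] im ir])
    have Wl: "\<guillemotleft>W (sector_mult C k l) m : g (sector_mult C k (sector_mult C l m)) \<rightarrow> g (sector_mult C k l) \<odot> g m\<guillemotright>"
      using W(1)[OF kl m] as by simp
    show ?thesis
      unfolding a b using interchange[OF hom_tens[OF ik W(1)[OF l m]] W(1)[OF k lm] ir ir]
        interchange[OF hom_tens[OF W(1)[OF k l] im] Wl ir ir] W_coherent[OF k l m]
      by (simp add: w_def)
  qed
qed (simp_all add: gO_def rep_unt prd_unt)

end

context abelian_crossed_product
begin

interpretation V: vector_space "scl C" by (rule vs)
interpretation HV: vector_space "hscl U" by (rule R.hvs)

abbreviation A0 where "A0 \<equiv> crossed_product0 C S U D"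

text \<open>\<open>hbas D k = {b k}\<close>, and \<open>\<beta> k\<close> is the coordinate of \<open>h k\<close> with respect to \<open>b k\<close>.\<close>

definition b :: "'o set \<Rightarrow> 'h" where "b k = (THE b. hbas D k = {b})"
definition \<beta> :: "'o set \<Rightarrow> complex" where "\<beta> k = ip U (b k) (h k)"

lemma hbas_single:
  assumes k: "k \<in> sub_sectors C S"
  shows "hbas D k = {b k}" "b k = hscl U (cnj (\<beta> k)) (h k)" "\<beta> k * cnj (\<beta> k) = 1" "b k \<in> H (g k)"
proof -
  note lh = line_h[OF k]
  note l = lineD[OF lh]
  have B: "HV.span (hbas D k) = H (g k)" "\<And>x y. x \<in> hbas D k \<Longrightarrow> y \<in> hbas D k \<Longrightarrow> ip U x y = (if x = y then 1 else 0)"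
    using hbas[OF k] by (auto simp: orthonormal_basis_def)
  have BH: "x \<in> H (g k)" if "x \<in> hbas D k" for x using HV.span_base[OF that] B(1) by simp
  have "hbas D k \<noteq> {}" using B(1) l(3) line_nonzero[OF lh] by auto
  then obtain x where x: "x \<in> hbas D k" by auto
  have "y = x" if y: "y \<in> hbas D k" for y
  proof (rule ccontr)
    assume "y \<noteq> x"
    then have "ip U y x = 0" using B(2)[OF y x] by simp
    moreover have "ip U y x = ip U (hscl U (ip U (h k) y) (h k)) (hscl U (ip U (h k) x) (h k))"
      using lineD(5)[OF lh BH[OF y]] lineD(5)[OF lh BH[OF x]] by simp
    moreover have "\<dots> = cnj (ip U (h k) y) * ip U (h k) x"
      using ip_left(2)[OF l(1,3,3) H_closed(4)[OF l(1,3)]] R.ip_scl[OF FO[OF l(1)] l(3,3)] l(4) by simp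
    ultimately have "ip U (h k) y = 0 \<or> ip U (h k) x = 0" by simp
    then have "y = 0 \<or> x = 0" using lineD(5)[OF lh BH[OF y]] lineD(5)[OF lh BH[OF x]] by auto
    moreover have "y \<noteq> 0" "x \<noteq> 0" using B(2)[OF y y] B(2)[OF x x] ip_left(3)[OF l(1) BH[OF x] BH[OF x] BH[OF x]]
        ip_left(4)[OF l(1) BH[OF x] BH[OF x] H_closed(1)[OF l(1)]] by auto
    ultimately show False by simp
  qed
  then have hx: "hbas D k = {x}" using x by blast
  then have bx: "b k = x" unfolding b_def by (intro the_equality) auto
  show "hbas D k = {b k}" using hx bx by simp
  show bH: "b k \<in> H (g k)" using BH[OF x] bx by simp
  have c: "ip U (h k) (b k) = cnj (\<beta> k)" unfolding \<beta>_def by (rule R.ip_cnj[OF FO[OF l(1)] bH l(3)])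
  show bh: "b k = hscl U (cnj (\<beta> k)) (h k)" using lineD(5)[OF lh bH] c by simp
  have "ip U (b k) (b k) = 1" using B(2)[OF x x] bx by simp
  moreover have "ip U (b k) (b k) = \<beta> k * cnj (\<beta> k)"
    unfolding bh using ip_left(2)[OF l(1,3,3) H_closed(4)[OF l(1,3)]] R.ip_scl[OF FO[OF l(1)] l(3,3)] l(4) by simp
  ultimately show "\<beta> k * cnj (\<beta> k) = 1" by simp
qed

text \<open>The Hom-spaces of which \<open>vbas\<close> gives orthonormal bases are zero or one-dimensional.\<close>

lemma vbas_single:
  assumes k: "k \<in> sub_sectors C S" and l: "l \<in> sub_sectors C S"
  shows "\<lbrakk>m \<in> sub_sectors C S; vbas D k l m \<noteq> {}\<rbrakk> \<Longrightarrow> m = sector_mult C k l"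
    "\<exists>z. z * cnj z = 1 \<and> vbas D k l (sector_mult C k l) = {scl C z (W k l)}"
proof -
  let ?kl = "sector_mult C k l"
  note lk = line_h[OF k] and ll = line_h[OF l]
  note klS = sector_mult_rep(2)[OF k l]
  note lkl = line_h[OF klS] and lp = line_prd[OF lk ll]
  have hom: "\<guillemotleft>X : g m \<rightarrow> g k \<odot> g l\<guillemotright>" "X \<noteq> 0" "adj C X \<cdot> X = ide C (g m)"
    if m: "m \<in> sub_sectors C S" and X: "X \<in> vbas D k l m" for X m
  proof -
    have "X \<in> V.span (vbas D k l m)" using X by (rule V.span_base)
    then show h: "\<guillemotleft>X : g m \<rightarrow> g k \<odot> g l\<guillemotright>"
      using vbas_span[OF k l m] rep_sector(2)[OF m] lineD(2)[OF lp] by (simp add: in_hom_def)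
    show x: "adj C X \<cdot> X = ide C (g m)" using vbas_orthonormal[OF k l m X X] by simp
    show "X \<noteq> 0"
      using x cmp_zero[OF hom_adj[OF h] rep_sector(2)[OF m]] irreducibleD(2)[OF line_irreducible[OF line_h[OF m]]] by auto
  qed
  show "m = ?kl" if m: "m \<in> sub_sectors C S" and ne: "vbas D k l m \<noteq> {}"
  proof -
    obtain X where X: "X \<in> vbas D k l m" using ne by auto
    have "isomorphic_obj C (g m) (g k \<odot> g l)"
      by (rule schur[OF line_irreducible[OF line_h[OF m]] line_irreducible[OF lp] hom(1,2)[OF m X]])
    then show ?thesis
      using iso_class_eq_iff[OF rep_sector(2)[OF m] lineD(2)[OF lp]] rep_sector(3)[OF m] sector_mult_rep(1)[OF k l] by simp
  qed
  note Wh = W(1)[OF k l]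
  have sc: "\<exists>z. X = scl C z (W k l)" if X: "\<guillemotleft>X : g ?kl \<rightarrow> g k \<odot> g l\<guillemotright>" for X
  proof -
    let ?z = "ip U (h k \<otimes>\<^sub>H h l) (Fa X (h ?kl))"
    have "X = scl C ?z (W k l)"
      using lineD(5)[OF lp Fa_hom(1)[OF lineD(1)[OF lkl] lineD(1)[OF lp] X lineD(3)[OF lkl]]]
        Fa_simps(3)[OF lineD(1)[OF lkl] lineD(1)[OF lp] Wh lineD(3)[OF lkl]]
      by (intro line_faithful[OF lkl lineD(1)[OF lp] X hom_scl[OF Wh]]) (simp add: W(2)[OF k l])
    then show ?thesis by blast
  qed
  have adjm: "adj C (scl C z (W k l)) \<cdot> scl C z' (W k l) = scl C (z' * cnj z) (ide C (g ?kl))" for z z'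
    by (simp add: star_scl[OF Wh] scl_cmp[OF hom_adj[OF Wh] hom_scl[OF Wh]] cmp_scl'[OF hom_adj[OF Wh] Wh]
        W_unitary(1)[OF k l] mult.commute)
  note i0 = irreducibleD(2)[OF line_irreducible[OF lkl]]
  have "W k l \<noteq> 0" using W_unitary(1)[OF k l] cmp_zero[OF hom_adj[OF Wh] rep_sector(2)[OF klS]] i0 by auto
  moreover have "W k l \<in> V.span (vbas D k l ?kl)" using vbas_span[OF k l klS] in_homD(3)[OF Wh] by simp
  ultimately have "vbas D k l ?kl \<noteq> {}" by auto
  then obtain X where X: "X \<in> vbas D k l ?kl" by auto
  obtain z where z: "X = scl C z (W k l)" using sc[OF hom(1)[OF klS X]] by auto
  have "scl C (z * cnj z) (ide C (g ?kl)) = scl C 1 (ide C (g ?kl))"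
    using hom(3)[OF klS X] adjm[of z z] by (simp add: z)
  then have z1: "z * cnj z = 1" using i0 by (simp only: V.scale_cancel_right) simp
  have "Y = X" if Y: "Y \<in> vbas D k l ?kl" for Y
  proof (rule ccontr)
    assume "Y \<noteq> X"
    obtain y where y: "Y = scl C y (W k l)" using sc[OF hom(1)[OF klS Y]] by auto
    have "scl C (z * cnj y) (ide C (g ?kl)) = 0"
      using vbas_orthonormal[OF k l klS Y X] \<open>Y \<noteq> X\<close> adjm[of y z] by (simp add: z y)
    then have "z = 0 \<or> y = 0" using i0 by simp
    then show False using z1 y hom(2)[OF klS Y] by auto
  qed
  then have "vbas D k l ?kl = {X}" using X by blast
  then show "\<exists>z. z * cnj z = 1 \<and> vbas D k l ?kl = {scl C z (W k l)}" using z z1 by blast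
qed

text \<open>\<open>sg \<rho> \<sigma> k x = x \<otimes> h k\<close>.\<close>

definition sg :: "'o \<Rightarrow> 'o \<Rightarrow> 'o set \<Rightarrow> 'a \<Rightarrow> ('o, 'a, 'h) xarr" where
  "sg \<rho> \<sigma> k x = etens C U D \<rho> \<sigma> k x (h k)"

definition co :: "'o \<Rightarrow> 'o \<Rightarrow> 'o set \<Rightarrow> ('o, 'a, 'h) xarr \<Rightarrow> 'a" where
  "co \<rho> \<sigma> k X = scl C (cnj (\<beta> k)) (X (\<rho>, \<sigma>, k, b k))"

lemma sg_apply: "k \<in> sub_sectors C S \<Longrightarrow> sg \<rho> \<sigma> k x p = (if p = (\<rho>, \<sigma>, k, b k) then scl C (\<beta> k) x else 0)"
  by (cases p) (auto simp: sg_def etens_def hbas_single(1) \<beta>_def)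

lemma etens_scl:
  assumes k: "k \<in> sub_sectors C S"
  shows "etens C U D \<rho> \<sigma> k x (hscl U z (h k)) = sg \<rho> \<sigma> k (scl C z x)"
proof -
  note l = lineD[OF line_h[OF k]]
  have "ip U (b k) (hscl U z (h k)) = z * \<beta> k"
    using R.ip_scl[OF FO[OF l(1)] hbas_single(4)[OF k] l(3)] by (simp add: \<beta>_def)
  then show ?thesis
    by (intro ext) (auto simp: sg_def etens_def hbas_single(1)[OF k] \<beta>_def mult.commute)
qed

lemma sg_plus: "k \<in> sub_sectors C S \<Longrightarrow> sg \<rho> \<sigma> k (x + y) = sg \<rho> \<sigma> k x + sg \<rho> \<sigma> k y"
  by (auto simp: fun_eq_iff sg_apply V.scale_right_distrib)

text \<open>The phase of the basis element of \<open>Hom (rep m) (rep k \<odot> rep l)\<close> cancels against the one of its adjoint.\<close>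

lemma ecmp_sg:
  assumes k: "k \<in> sub_sectors C S" and l: "l \<in> sub_sectors C S" and \<rho>: "\<rho> \<in> Obj C"
    and x: "\<guillemotleft>x : gO k \<sigma> \<rightarrow> \<delta>\<guillemotright>" and y: "\<guillemotleft>y : gO l \<rho> \<rightarrow> \<sigma>\<guillemotright>"
  shows "ecmp C S U D \<rho> \<delta> k l x (b k) y (b l) =
    sg \<rho> \<delta> (sector_mult C k l) (scl C (cnj (\<beta> k) * cnj (\<beta> l)) (act.gcmp k l \<rho> x y))"
proof -
  let ?kl = "sector_mult C k l"
  note klS = sector_mult_rep(2)[OF k l]
  note lk = line_h[OF k] and ll = line_h[OF l] and lkl = line_h[OF klS]
  note a = lineD[OF lk] and c = lineD[OF ll]
  note lp = line_prd[OF lk ll]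
  obtain z where z: "z * cnj z = 1" and vb: "vbas D k l ?kl = {scl C z (W k l)}" using vbas_single(2)[OF k l] by auto
  have set: "{m. m \<in> sub_sectors C S \<and> vbas D k l m \<noteq> {}} = {?kl}"
  proof -
    have "vbas D k l ?kl \<noteq> {}" using vb by simp
    then show ?thesis using vbas_single(1)[OF k l] klS by blast
  qed
  note Wh = W(1)[OF k l]
  have "Fa (scl C z (W k l)) (h ?kl) = hscl U z (h k \<otimes>\<^sub>H h l)"
    using Fa_simps(3)[OF lineD(1)[OF lkl] lineD(1)[OF lp] Wh lineD(3)[OF lkl]] by (simp add: W(2)[OF k l])
  from line_adj[OF lkl lp hom_scl[OF Wh] this]
  have aV: "Fa (adj C (scl C z (W k l))) (h k \<otimes>\<^sub>H h l) = hscl U (cnj z) (h ?kl)" .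
  have "b k \<otimes>\<^sub>H b l = hscl U (cnj (\<beta> k) * cnj (\<beta> l)) (h k \<otimes>\<^sub>H h l)"
    using R.box_scl(1)[OF FO[OF a(1)] FO[OF c(1)] a(3) H_closed(4)[OF c(1,3)]] R.box_scl(2)[OF FO[OF a(1)] FO[OF c(1)] a(3) c(3)]
    by (simp add: hbas_single(2)[OF k] hbas_single(2)[OF l])
  then have F: "Fa (adj C (scl C z (W k l))) (b k \<otimes>\<^sub>H b l) = hscl U (cnj (\<beta> k) * cnj (\<beta> l) * cnj z) (h ?kl)"
    using Fa_hom(3)[OF lineD(1)[OF lp] lineD(1)[OF lkl] hom_adj[OF hom_scl[OF Wh]] lineD(3)[OF lp]] aV by simp
  have xy: "\<guillemotleft>x \<cdot> gA k y : gO k (gO l \<rho>) \<rightarrow> \<delta>\<guillemotright>" using hom_cmp[OF x act.gA[of k, OF _ y]] k by simp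
  have wh: "\<guillemotleft>w k l \<rho> : gO ?kl \<rho> \<rightarrow> gO k (gO l \<rho>)\<guillemotright>" using act.w[of k l \<rho>] k l \<rho> by simp
  have "scl C z (W k l) \<parallel> ide C \<rho> = scl C z (w k l \<rho>)"
    using tens_scl(1)[of "g ?kl" "g k \<odot> g l" \<rho> \<rho> "W k l" "ide C \<rho>" z] in_homD[OF Wh] \<rho> by (simp add: w_def ide_Hom)
  then have X: "x \<cdot> (ide C (g k) \<parallel> y) \<cdot> (scl C z (W k l) \<parallel> ide C \<rho>) = scl C z (act.gcmp k l \<rho> x y)"
    using cmp_scl'[OF xy wh] by (simp add: act.gcmp_def gA_def)
  have "ecmp C S U D \<rho> \<delta> k l x (b k) y (b l) =
      etens C U D \<rho> \<delta> ?kl (scl C z (act.gcmp k l \<rho> x y)) (hscl U (cnj (\<beta> k) * cnj (\<beta> l) * cnj z) (h ?kl))"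
    unfolding ecmp_def set by (simp add: vb X F)
  also have "\<dots> = sg \<rho> \<delta> ?kl (scl C (cnj (\<beta> k) * cnj (\<beta> l) * (z * cnj z)) (act.gcmp k l \<rho> x y))"
    by (simp add: etens_scl[OF klS] mult_ac)
  finally show ?thesis by (simp add: z)
qed

text \<open>Up to scalar factors, the solution of the conjugate equations is the one built from \<open>W\<close> and the vectors \<open>h\<close>; the first conjugate equation
  relates the two factors.\<close>

lemma solution_phases:
  assumes k: "k \<in> sub_sectors C S"
  shows "\<exists>r s. s * cnj r = 1 \<and> csol D k = scl C r (W (inv\<^bsub>K\<^esub> k) k) \<and> Fa (csolb D k) Om = hscl U s (h k \<otimes>\<^sub>H h (inv\<^bsub>K\<^esub> k))"
proof -
  let ?i = "inv\<^bsub>K\<^esub> k"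
  note i = inv_sector[OF k]
  note lk = line_h[OF k] and li = line_h[OF i(1)]
  note a = lineD[OF lk] and c = lineD[OF li]
  obtain d where "normalized_solution C (g k) (g ?i) (csol D k) (csolb D k) d"
    using csol[OF k] by (auto simp: sector_conj_inv[OF k])
  then have sol: "conj_solution C (g k) (g ?i) (csol D k) (csolb D k)" by (simp add: normalized_solution_def)
  have R: "\<guillemotleft>csol D k : unt C \<rightarrow> g ?i \<odot> g k\<guillemotright>" and Rb: "\<guillemotleft>csolb D k : unt C \<rightarrow> g k \<odot> g ?i\<guillemotright>"
    and e1: "(adj C (csolb D k) \<parallel> ide C (g k)) \<cdot> (ide C (g k) \<parallel> csol D k) = ide C (g k)"
    using sol a c by (simp_all add: conj_solution_def in_hom_def unt_Obj prd_Obj)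
  note l1 = line_prd[OF li lk] and l2 = line_prd[OF lk li]
  define r where "r = ip U (h ?i \<otimes>\<^sub>H h k) (Fa (csol D k) Om)"
  define s where "s = ip U (h k \<otimes>\<^sub>H h ?i) (Fa (csolb D k) Om)"
  have Fr: "Fa (csol D k) Om = hscl U r (h ?i \<otimes>\<^sub>H h k)"
    unfolding r_def by (rule lineD(5)[OF l1 Fa_hom(1)[OF S_unt lineD(1)[OF l1] R Om_H]])
  have Fs: "Fa (csolb D k) Om = hscl U s (h k \<otimes>\<^sub>H h ?i)"
    unfolding s_def by (rule lineD(5)[OF l2 Fa_hom(1)[OF S_unt lineD(1)[OF l2] Rb Om_H]])
  have W1: "\<guillemotleft>W ?i k : unt C \<rightarrow> g ?i \<odot> g k\<guillemotright>" "Fa (W ?i k) Om = h ?i \<otimes>\<^sub>H h k"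
    using W[OF i(1) k] by (simp_all add: i(2) rep_unt h_def[of "iso_class C (unt C)"])
  have Rw: "csol D k = scl C r (W ?i k)"
    using Fa_simps(3)[OF S_unt lineD(1)[OF l1] W1(1) Om_H]
    by (intro line_faithful[OF line_unt lineD(1)[OF l1] R hom_scl[OF W1(1)]]) (simp add: Fr W1(2))
  note ig = hom_ide[OF a(2)]
  have h1: "\<guillemotleft>ide C (g k) \<parallel> csol D k : g k \<rightarrow> g k \<odot> g ?i \<odot> g k\<guillemotright>" using hom_tens[OF ig R] prd_unt a(2) c(2) by (simp add: prd_assoc)
  have h2: "\<guillemotleft>adj C (csolb D k) \<parallel> ide C (g k) : g k \<odot> g ?i \<odot> g k \<rightarrow> g k\<guillemotright>" using hom_tens[OF hom_adj[OF Rb] ig] prd_unt a(2) by simp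
  have "Fa (ide C (g k) \<parallel> csol D k) (h k) = h k \<otimes>\<^sub>H hscl U r (h ?i \<otimes>\<^sub>H h k)"
    using Fa_simps(5)[OF a(1,1) S_unt lineD(1)[OF l1] ig R a(3) Om_H] R.vac_box(2)[OF FO[OF a(1)] a(3)]
    by (simp add: Fr Fa_simps(1)[OF a(1,3)])
  also have "\<dots> = hscl U r ((h k \<otimes>\<^sub>H h ?i) \<otimes>\<^sub>H h k)"
    using R.box_scl(2)[OF FO[OF a(1)] FO[OF lineD(1)[OF l1]] a(3) lineD(3)[OF l1]]
    by (simp add: R.box_assoc[OF FO[OF a(1)] FO[OF c(1)] FO[OF a(1)] a(3) c(3) a(3)])
  finally have f1: "Fa (ide C (g k) \<parallel> csol D k) (h k) = hscl U r ((h k \<otimes>\<^sub>H h ?i) \<otimes>\<^sub>H h k)" .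
  note l3 = line_prd[OF l2 lk]
  have "Fa (adj C (csolb D k) \<parallel> ide C (g k)) ((h k \<otimes>\<^sub>H h ?i) \<otimes>\<^sub>H h k) = hscl U (cnj s) Om \<otimes>\<^sub>H h k"
    using Fa_simps(5)[OF lineD(1)[OF l2] S_unt a(1,1) hom_adj[OF Rb] ig lineD(3)[OF l2] a(3)] line_adj[OF line_unt l2 Rb Fs]
    by (simp add: Fa_simps(1)[OF a(1,3)])
  also have "\<dots> = hscl U (cnj s) (h k)"
    using R.box_scl(1)[OF FO[OF S_unt] FO[OF a(1)] Om_H a(3)] R.vac_box(1)[OF FO[OF a(1)] a(3)] by simp
  finally have "Fa ((adj C (csolb D k) \<parallel> ide C (g k)) \<cdot> (ide C (g k) \<parallel> csol D k)) (h k) = hscl U (r * cnj s) (h k)"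
    using Fa_simps(2)[OF a(1) lineD(1)[OF l3] a(1) h2 h1 a(3)] Fa_hom(3)[OF lineD(1)[OF l3] a(1) h2 lineD(3)[OF l3]]
    by (simp add: f1)
  then have "hscl U 1 (h k) = hscl U (r * cnj s) (h k)" by (simp add: e1 Fa_simps(1)[OF a(1,3)])
  then have "1 = r * cnj s" using line_nonzero[OF lk] by (simp only: HV.scale_cancel_right) simp
  from arg_cong[OF this, of cnj] have "s * cnj r = 1" by (simp add: mult.commute)
  then show ?thesis using Rw Fs by blast
qed

text \<open>The scalar factors of \<open>csol\<close> and \<open>csolb\<close> enter only through the product \<open>s * cnj r = 1\<close>.\<close>

lemma eadj_sg:
  assumes k: "k \<in> sub_sectors C S" and \<rho>: "\<rho> \<in> Obj C" and x: "\<guillemotleft>x : gO k \<rho> \<rightarrow> \<sigma>\<guillemotright>"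
  shows "eadj C U D \<rho> \<sigma> k x (b k) = sg \<sigma> \<rho> (inv\<^bsub>K\<^esub> k) (scl C (\<beta> k) (act.gstar k \<rho> x))"
proof -
  let ?i = "inv\<^bsub>K\<^esub> k"
  note i = inv_sector[OF k]
  note lk = line_h[OF k] and li = line_h[OF i(1)]
  note a = lineD[OF lk] and c = lineD[OF li]
  note l2 = line_prd[OF lk li]
  obtain r s where rs: "s * cnj r = 1" "csol D k = scl C r (W ?i k)" "Fa (csolb D k) Om = hscl U s (h k \<otimes>\<^sub>H h ?i)"
    using solution_phases[OF k] by auto
  have Hi: "Hsp U D (sector_conj C k) = H (g ?i)" by (simp add: Hsp_def sector_conj_inv[OF k])
  have pair: "ip U (b k \<otimes>\<^sub>H x) (hscl U s (h k \<otimes>\<^sub>H h ?i)) = ip U x (hscl U (\<beta> k * s) (h ?i))" if x: "x \<in> H (g ?i)" for x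
    using R.ip_scl[OF FO[OF lineD(1)[OF l2]] H_box[OF a(1) c(1) hbas_single(4)[OF k] x] lineD(3)[OF l2]]
      R.box_ip[OF FO[OF a(1)] FO[OF c(1)] hbas_single(4)[OF k] a(3) x c(3)] R.ip_scl[OF FO[OF c(1)] x c(3)]
    by (simp add: \<beta>_def)
  have vb: "vbar C U D k (b k) = hscl U (\<beta> k * s) (h ?i)"
    unfolding vbar_def Hi rs(3)
  proof (rule the_equality)
    show "hscl U (\<beta> k * s) (h ?i) \<in> H (g ?i) \<and>
      (\<forall>x\<in>H (g ?i). ip U x (hscl U (\<beta> k * s) (h ?i)) = ip U (b k \<otimes>\<^sub>H x) (hscl U s (h k \<otimes>\<^sub>H h ?i)))"
      using pair H_closed(4)[OF c(1,3)] by simp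
    fix \<phi> assume \<phi>: "\<phi> \<in> H (g ?i) \<and> (\<forall>x\<in>H (g ?i). ip U x \<phi> = ip U (b k \<otimes>\<^sub>H x) (hscl U s (h k \<otimes>\<^sub>H h ?i)))"
    then have "ip U (h ?i) \<phi> = ip U (h ?i) (hscl U (\<beta> k * s) (h ?i))" using pair[OF c(3)] c(3) by simp
    also have "\<dots> = \<beta> k * s" using R.ip_scl[OF FO[OF c(1)] c(3,3)] c(4) by simp
    finally show "\<phi> = hscl U (\<beta> k * s) (h ?i)" using lineD(5)[OF li, of \<phi>] \<phi> by simp
  qed
  have W1: "\<guillemotleft>W ?i k : unt C \<rightarrow> g ?i \<odot> g k\<guillemotright>" using W(1)[OF i(1) k] by (simp add: i(2) rep_unt)
  have "adj C (csol D k) \<parallel> ide C \<rho> = scl C (cnj r) (adj C (w ?i k \<rho>))"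
    using tens_scl(1)[of "g ?i \<odot> g k" "unt C" \<rho> \<rho> "adj C (W ?i k)" "ide C \<rho>" "cnj r"] in_homD[OF hom_adj[OF W1]] \<rho>
    by (simp add: rs(2) star_scl[OF W1] w_def star_tens[OF W1 hom_ide[OF \<rho>]] star_ide ide_Hom)
  moreover have "\<guillemotleft>adj C (w ?i k \<rho>) : gO ?i (gO k \<rho>) \<rightarrow> \<rho>\<guillemotright>"
    using hom_adj[OF act.w[of ?i k \<rho>]] i k \<rho> act.gO_one[OF \<rho>] by simp
  moreover have "\<guillemotleft>gA ?i (adj C x) : gO ?i \<sigma> \<rightarrow> gO ?i (gO k \<rho>)\<guillemotright>" using act.gA[of ?i, OF _ hom_adj[OF x]] i by simp
  ultimately have X: "(adj C (csol D k) \<parallel> ide C \<rho>) \<cdot> (ide C (g ?i) \<parallel> adj C x) = scl C (cnj r) (act.gstar k \<rho> x)"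
    using scl_cmp[of "adj C (w ?i k \<rho>)" "gO ?i (gO k \<rho>)" \<rho> "gA ?i (adj C x)" "gO ?i \<sigma>" "cnj r"]
    by (simp add: act.gstar_def gA_def)
  have "eadj C U D \<rho> \<sigma> k x (b k) = sg \<sigma> \<rho> ?i (scl C (\<beta> k * (s * cnj r)) (act.gstar k \<rho> x))"
    unfolding eadj_def vb sector_conj_inv[OF k] X by (simp add: etens_scl[OF i(1)] mult.assoc)
  then show ?thesis by (simp add: rs)
qed

subsection \<open>Sums over supports\<close>

lemma xsupp_sum:
  assumes "finite P" "xsupp X \<subseteq> P" "\<And>p. p \<in> P \<Longrightarrow> f p 0 = 0"
  shows "(\<Sum>p\<in>xsupp X. f p (X p)) = (\<Sum>p\<in>P. f p (X p))"
  using assms by (intro sum.mono_neutral_left) (auto simp: xsupp_def)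

lemma xsupp_sum_add:
  fixes X Y :: "('o, 'a, 'h) xarr" and f :: "'o \<times> 'o \<times> 'o set \<times> 'h \<Rightarrow> 'a \<Rightarrow> 'c::ab_group_add"
  assumes "finite (xsupp X)" "finite (xsupp Y)" "\<And>p. p \<in> xsupp X \<union> xsupp Y \<Longrightarrow> f p 0 = 0"
    "\<And>p. p \<in> xsupp X \<union> xsupp Y \<Longrightarrow> f p (X p + Y p) = f p (X p) + f p (Y p)"
  shows "(\<Sum>p\<in>xsupp (X + Y). f p ((X + Y) p)) = (\<Sum>p\<in>xsupp X. f p (X p)) + (\<Sum>p\<in>xsupp Y. f p (Y p))"
proof -
  let ?P = "xsupp X \<union> xsupp Y"
  have P: "finite ?P" "xsupp (X + Y) \<subseteq> ?P" using assms(1,2) by (auto simp: xsupp_def)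
  show ?thesis
    using xsupp_sum[OF P(1,2), of f] xsupp_sum[OF P(1), of X f] xsupp_sum[OF P(1), of Y f] assms
    by (simp add: sum.distrib)
qed

lemma Hom_A0:
  assumes "X \<in> Hom A0 \<rho> \<sigma>"
  shows "finite (xsupp X)" "p \<in> xsupp X \<Longrightarrow> \<exists>k\<in>sub_sectors C S. p = (\<rho>, \<sigma>, k, b k)"
    "k \<in> sub_sectors C S \<Longrightarrow> X (\<rho>, \<sigma>, k, c) \<in> Hom C (gO k \<rho>) \<sigma>"
proof -
  have X: "X \<in> xHom C S D \<rho> \<sigma>" using assms by (simp add: crossed_product0_def)
  then show "finite (xsupp X)" "k \<in> sub_sectors C S \<Longrightarrow> X (\<rho>, \<sigma>, k, c) \<in> Hom C (gO k \<rho>) \<sigma>"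
    by (auto simp: xHom_def gO_def)
  show "\<exists>k\<in>sub_sectors C S. p = (\<rho>, \<sigma>, k, b k)" if "p \<in> xsupp X"
    using X that hbas_single(1) by (auto simp: xHom_def)
qed

lemma Hom_A0I:
  assumes "finite (xsupp X)" "\<And>p. p \<in> xsupp X \<Longrightarrow> \<exists>k\<in>sub_sectors C S. p = (\<rho>, \<sigma>, k, b k)"
    "\<And>k c. k \<in> sub_sectors C S \<Longrightarrow> X (\<rho>, \<sigma>, k, c) \<in> Hom C (gO k \<rho>) \<sigma>"
  shows "X \<in> Hom A0 \<rho> \<sigma>"
proof -
  have "xsupp X \<subseteq> {(\<rho>, \<sigma>, k, b) |k b. k \<in> sub_sectors C S \<and> b \<in> hbas D k}"
    using assms(2) hbas_single(1) by fastforce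
  then show ?thesis using assms(1,3) by (simp add: crossed_product0_def xHom_def gO_def)
qed

lemma A0_simps [simp]: "Obj A0 = Obj C" "scl A0 = (\<lambda>z X p. scl C z (X p))"
  "ide A0 = (\<lambda>\<rho>. sg \<rho> \<rho> (iso_class C (unt C)) (ide C \<rho>))"
  by (simp_all add: crossed_product0_def sg_def h_def)

text \<open>The summands of composition and *-operation in the expansion over the supports.\<close>

definition cterm where
  "cterm p x q y = (case p of (\<sigma>, \<delta>, k, c) \<Rightarrow> case q of (\<rho>, \<sigma>', l, c') \<Rightarrow>
     if \<sigma>' = \<sigma> then ecmp C S U D \<rho> \<delta> k l x c y c' else 0)"

definition aterm where
  "aterm p x = (case p of (\<rho>, \<sigma>, k, c) \<Rightarrow> eadj C U D \<rho> \<sigma> k x c)"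

lemma cmp_A0: "X \<cdot>\<^bsub>A0\<^esub> Y = (\<Sum>p\<in>xsupp X. \<Sum>q\<in>xsupp Y. cterm p (X p) q (Y q))"
  unfolding crossed_product0_def cterm_def by (auto intro!: sum.cong split: prod.split)

lemma adj_A0: "adj A0 X = (\<Sum>p\<in>xsupp X. aterm p (X p))"
  unfolding crossed_product0_def aterm_def by (auto intro!: sum.cong split: prod.split)

lemma cterm:
  assumes k: "k \<in> sub_sectors C S" and l: "l \<in> sub_sectors C S" and \<rho>: "\<rho> \<in> Obj C"
    and x: "\<guillemotleft>x : gO k \<sigma> \<rightarrow> \<delta>\<guillemotright>" and y: "\<guillemotleft>y : gO l \<rho> \<rightarrow> \<sigma>\<guillemotright>"
  shows "cterm (\<sigma>, \<delta>, k, b k) x (\<rho>, \<sigma>, l, b l) y =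
    sg \<rho> \<delta> (sector_mult C k l) (scl C (cnj (\<beta> k) * cnj (\<beta> l)) (act.gcmp k l \<rho> x y))"
  by (simp add: cterm_def ecmp_sg[OF k l \<rho> x y])

lemma cterm_add:
  assumes k: "k \<in> sub_sectors C S" and l: "l \<in> sub_sectors C S" and \<rho>: "\<rho> \<in> Obj C"
    and x: "\<guillemotleft>x : gO k \<sigma> \<rightarrow> \<delta>\<guillemotright>" and y: "\<guillemotleft>y : gO l \<rho> \<rightarrow> \<sigma>\<guillemotright>"
  shows "\<guillemotleft>x' : gO k \<sigma> \<rightarrow> \<delta>\<guillemotright> \<Longrightarrow> cterm (\<sigma>, \<delta>, k, b k) (x + x') (\<rho>, \<sigma>, l, b l) y =
      cterm (\<sigma>, \<delta>, k, b k) x (\<rho>, \<sigma>, l, b l) y + cterm (\<sigma>, \<delta>, k, b k) x' (\<rho>, \<sigma>, l, b l) y"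
    "\<guillemotleft>y' : gO l \<rho> \<rightarrow> \<sigma>\<guillemotright> \<Longrightarrow> cterm (\<sigma>, \<delta>, k, b k) x (\<rho>, \<sigma>, l, b l) (y + y') =
      cterm (\<sigma>, \<delta>, k, b k) x (\<rho>, \<sigma>, l, b l) y + cterm (\<sigma>, \<delta>, k, b k) x (\<rho>, \<sigma>, l, b l) y'"
    "cterm (\<sigma>, \<delta>, k, b k) 0 (\<rho>, \<sigma>, l, b l) y = 0" "cterm (\<sigma>, \<delta>, k, b k) x (\<rho>, \<sigma>, l, b l) 0 = 0"
proof -
  have kl: "k \<in> carrier K" "l \<in> carrier K" using k l by simp_all
  note klS = sector_mult_rep(2)[OF k l]
  show 1: "cterm (\<sigma>, \<delta>, k, b k) (x + x') (\<rho>, \<sigma>, l, b l) y =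
      cterm (\<sigma>, \<delta>, k, b k) x (\<rho>, \<sigma>, l, b l) y + cterm (\<sigma>, \<delta>, k, b k) x' (\<rho>, \<sigma>, l, b l) y"
    if x': "\<guillemotleft>x' : gO k \<sigma> \<rightarrow> \<delta>\<guillemotright>" for x'
    by (simp add: cterm[OF k l \<rho> hom_add[OF x x'] y] cterm[OF k l \<rho> x y] cterm[OF k l \<rho> x' y]
        act.gcmp_add(1)[OF kl \<rho> x y x'] V.scale_right_distrib sg_plus[OF klS])
  show 2: "cterm (\<sigma>, \<delta>, k, b k) x (\<rho>, \<sigma>, l, b l) (y + y') =
      cterm (\<sigma>, \<delta>, k, b k) x (\<rho>, \<sigma>, l, b l) y + cterm (\<sigma>, \<delta>, k, b k) x (\<rho>, \<sigma>, l, b l) y'"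
    if y': "\<guillemotleft>y' : gO l \<rho> \<rightarrow> \<sigma>\<guillemotright>" for y'
    by (simp add: cterm[OF k l \<rho> x hom_add[OF y y']] cterm[OF k l \<rho> x y] cterm[OF k l \<rho> x y']
        act.gcmp_add(2)[OF kl \<rho> x y y'] V.scale_right_distrib sg_plus[OF klS])
  show "cterm (\<sigma>, \<delta>, k, b k) 0 (\<rho>, \<sigma>, l, b l) y = 0"
    using 1[OF hom_zero[OF in_homD(1,2)[OF x]]] by simp
  show "cterm (\<sigma>, \<delta>, k, b k) x (\<rho>, \<sigma>, l, b l) 0 = 0"
    using 2[OF hom_zero[OF in_homD(1,2)[OF y]]] by simp
qed

lemma aterm:
  assumes k: "k \<in> sub_sectors C S" and \<rho>: "\<rho> \<in> Obj C" and x: "\<guillemotleft>x : gO k \<rho> \<rightarrow> \<sigma>\<guillemotright>"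
  shows "aterm (\<rho>, \<sigma>, k, b k) x = sg \<sigma> \<rho> (inv\<^bsub>K\<^esub> k) (scl C (\<beta> k) (act.gstar k \<rho> x))"
    "\<guillemotleft>x' : gO k \<rho> \<rightarrow> \<sigma>\<guillemotright> \<Longrightarrow> aterm (\<rho>, \<sigma>, k, b k) (x + x') = aterm (\<rho>, \<sigma>, k, b k) x + aterm (\<rho>, \<sigma>, k, b k) x'"
    "aterm (\<rho>, \<sigma>, k, b k) 0 = 0"
proof -
  have at: "aterm (\<rho>, \<sigma>, k, b k) x = sg \<sigma> \<rho> (inv\<^bsub>K\<^esub> k) (scl C (\<beta> k) (act.gstar k \<rho> x))" if "\<guillemotleft>x : gO k \<rho> \<rightarrow> \<sigma>\<guillemotright>" for x
    by (simp add: aterm_def eadj_sg[OF k \<rho> that])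
  show "aterm (\<rho>, \<sigma>, k, b k) x = sg \<sigma> \<rho> (inv\<^bsub>K\<^esub> k) (scl C (\<beta> k) (act.gstar k \<rho> x))" by (rule at[OF x])
  note i = inv_sector[OF k]
  have wh: "\<guillemotleft>adj C (w (inv\<^bsub>K\<^esub> k) k \<rho>) : gO (inv\<^bsub>K\<^esub> k) (gO k \<rho>) \<rightarrow> \<rho>\<guillemotright>"
    using hom_adj[OF act.w[of "inv\<^bsub>K\<^esub> k" k \<rho>]] i k \<rho> act.gO_one[OF \<rho>] by simp
  have gx: "\<guillemotleft>gA (inv\<^bsub>K\<^esub> k) (adj C x) : gO (inv\<^bsub>K\<^esub> k) \<sigma> \<rightarrow> gO (inv\<^bsub>K\<^esub> k) (gO k \<rho>)\<guillemotright>" if "\<guillemotleft>x : gO k \<rho> \<rightarrow> \<sigma>\<guillemotright>" for x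
    using act.gA[of "inv\<^bsub>K\<^esub> k", OF _ hom_adj[OF that]] i by simp
  show 1: "aterm (\<rho>, \<sigma>, k, b k) (x + x') = aterm (\<rho>, \<sigma>, k, b k) x + aterm (\<rho>, \<sigma>, k, b k) x'"
    if x': "\<guillemotleft>x' : gO k \<rho> \<rightarrow> \<sigma>\<guillemotright>" for x'
  proof -
    have "act.gstar k \<rho> (x + x') = act.gstar k \<rho> x + act.gstar k \<rho> x'"
      using act.gA_add[of "inv\<^bsub>K\<^esub> k", OF _ hom_adj[OF x] hom_adj[OF x']] i cmp_add'[OF wh gx[OF x] gx[OF x']]
      by (simp add: act.gstar_def star_add[OF x x'])
    then show ?thesis
      by (simp add: at[OF x] at[OF x'] at[OF hom_add[OF x x']] V.scale_right_distrib sg_plus[OF i(1)])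
  qed
  show "aterm (\<rho>, \<sigma>, k, b k) 0 = 0"
    using 1[OF hom_zero[OF in_homD(1,2)[OF x]]] by simp
qed

lemma sum_xsupp_sg:
  fixes f :: "'o \<times> 'o \<times> 'o set \<times> 'h \<Rightarrow> 'a \<Rightarrow> 'c::ab_group_add"
  assumes k: "k \<in> sub_sectors C S" and "f (\<rho>, \<sigma>, k, b k) 0 = 0"
  shows "(\<Sum>p\<in>xsupp (sg \<rho> \<sigma> k x). f p (sg \<rho> \<sigma> k x p)) = f (\<rho>, \<sigma>, k, b k) (scl C (\<beta> k) x)"
proof -
  have "xsupp (sg \<rho> \<sigma> k x) \<subseteq> {(\<rho>, \<sigma>, k, b k)}" by (auto simp: xsupp_def sg_apply[OF k] split: if_splits)
  then show ?thesis using xsupp_sum[of "{(\<rho>, \<sigma>, k, b k)}" "sg \<rho> \<sigma> k x" f] assms(2) by (simp add: sg_apply[OF k])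
qed

sublocale orb: orbit_category C K gO gA w A0 sg co
proof (rule orbit_category.intro[OF act.category_action_axioms], rule orbit_category_axioms.intro)
  show "\<exists>\<tau>\<in>Obj C. is_direct_sum C \<rho> \<sigma> \<tau>" if "\<rho> \<in> Obj C" "\<sigma> \<in> Obj C" for \<rho> \<sigma>
    by (rule direct_sums[OF that])
  show "Obj A0 = Obj C" by simp
  show vsA: "vector_space (scl A0)"
    by unfold_locales (auto simp: fun_eq_iff V.scale_right_distrib V.scale_left_distrib)
  show "ide A0 \<rho> = sg \<rho> \<rho> \<one>\<^bsub>K\<^esub> (ide C \<rho>)" for \<rho> by simp
  fix \<rho> assume \<rho>: "\<rho> \<in> Obj C"
  interpret VA: vector_space "scl A0" by (rule vsA)
  have Hk: "gO k \<rho> \<in> Obj C" if "k \<in> sub_sectors C S" for k using act.gO[of k \<rho>] that \<rho> by simp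
  show "VA.subspace (Hom A0 \<rho> \<sigma>)" if \<sigma>: "\<sigma> \<in> Obj C" for \<sigma>
    unfolding VA.subspace_def
  proof (intro conjI ballI allI)
    have z: "0 \<in> Hom C (gO k \<rho>) \<sigma>" if "k \<in> sub_sectors C S" for k
      using in_homD(3)[OF hom_zero[OF Hk[OF that] \<sigma>]] .
    show "0 \<in> Hom A0 \<rho> \<sigma>" by (rule Hom_A0I) (use z in \<open>auto simp: xsupp_def\<close>)
    fix X c assume X: "X \<in> Hom A0 \<rho> \<sigma>"
    note HX = Hom_A0[OF X]
    have X': "\<guillemotleft>X (\<rho>, \<sigma>, k, d) : gO k \<rho> \<rightarrow> \<sigma>\<guillemotright>" if "k \<in> sub_sectors C S" for k d
      using HX(3)[OF that] Hk[OF that] \<sigma> by (simp add: in_hom_def)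
    show "scl A0 c X \<in> Hom A0 \<rho> \<sigma>"
    proof (rule Hom_A0I)
      have sub: "xsupp (scl A0 c X) \<subseteq> xsupp X" by (auto simp: xsupp_def)
      then show "finite (xsupp (scl A0 c X))" using HX(1) finite_subset by blast
      show "\<exists>k\<in>sub_sectors C S. p = (\<rho>, \<sigma>, k, b k)" if "p \<in> xsupp (scl A0 c X)" for p using that sub HX(2) by blast
      show "scl A0 c X (\<rho>, \<sigma>, k, d) \<in> Hom C (gO k \<rho>) \<sigma>" if "k \<in> sub_sectors C S" for k d
        using in_homD(3)[OF hom_scl[OF X'[OF that]]] by simp
    qed
    fix Y assume Y: "Y \<in> Hom A0 \<rho> \<sigma>"
    note HY = Hom_A0[OF Y]
    have Y': "\<guillemotleft>Y (\<rho>, \<sigma>, k, d) : gO k \<rho> \<rightarrow> \<sigma>\<guillemotright>" if "k \<in> sub_sectors C S" for k d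
      using HY(3)[OF that] Hk[OF that] \<sigma> by (simp add: in_hom_def)
    show "X + Y \<in> Hom A0 \<rho> \<sigma>"
    proof (rule Hom_A0I)
      have sub: "xsupp (X + Y) \<subseteq> xsupp X \<union> xsupp Y" by (auto simp: xsupp_def)
      then show "finite (xsupp (X + Y))" using HX(1) HY(1) finite_subset by blast
      show "\<exists>k\<in>sub_sectors C S. p = (\<rho>, \<sigma>, k, b k)" if "p \<in> xsupp (X + Y)" for p using that sub HX(2) HY(2) by blast
      show "(X + Y) (\<rho>, \<sigma>, k, d) \<in> Hom C (gO k \<rho>) \<sigma>" if "k \<in> sub_sectors C S" for k d
        using in_homD(3)[OF hom_add[OF X'[OF that] Y'[OF that]]] by simp
    qed
  qed
  fix k assume "k \<in> carrier K"
  then have k: "k \<in> sub_sectors C S" by simp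
  show "sg \<rho> \<sigma> k x \<in> Hom A0 \<rho> \<sigma>" if x: "\<guillemotleft>x : gO k \<rho> \<rightarrow> \<sigma>\<guillemotright>" for x \<sigma>
  proof (rule Hom_A0I)
    have sub: "xsupp (sg \<rho> \<sigma> k x) \<subseteq> {(\<rho>, \<sigma>, k, b k)}" by (auto simp: xsupp_def sg_apply[OF k] split: if_splits)
    then show "finite (xsupp (sg \<rho> \<sigma> k x))" using finite_subset by blast
    show "\<exists>k\<in>sub_sectors C S. p = (\<rho>, \<sigma>, k, b k)" if "p \<in> xsupp (sg \<rho> \<sigma> k x)" for p using that sub k by blast
    show "sg \<rho> \<sigma> k x (\<rho>, \<sigma>, l, d) \<in> Hom C (gO l \<rho>) \<sigma>" if "l \<in> sub_sectors C S" for l d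
      using in_homD(3)[OF hom_scl[OF x]] in_homD(3)[OF hom_zero[OF Hk[OF that] in_homD(2)[OF x]]]
      by (auto simp: sg_apply[OF k])
  qed
  show "\<guillemotleft>co \<rho> \<sigma> k X : gO k \<rho> \<rightarrow> \<sigma>\<guillemotright>" if "\<sigma> \<in> Obj C" "X \<in> Hom A0 \<rho> \<sigma>" for \<sigma> X
    unfolding co_def using Hom_A0(3)[OF that(2) k] Hk[OF k] that(1) by (intro hom_scl in_homI)
  show "sg \<rho> \<sigma> k (x + y) = sg \<rho> \<sigma> k x + sg \<rho> \<sigma> k y" for x y \<sigma> by (rule sg_plus[OF k])
  show "sg \<rho> \<sigma> k (scl C z x) = scl A0 z (sg \<rho> \<sigma> k x)" for z x \<sigma>
    by (auto simp: fun_eq_iff sg_apply[OF k] mult.commute)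
  show "co \<rho> \<sigma> k (X + Y) = co \<rho> \<sigma> k X + co \<rho> \<sigma> k Y" for X Y \<sigma> by (simp add: co_def V.scale_right_distrib)
  show "co \<rho> \<sigma> k (sg \<rho> \<sigma> l x) = (if k = l then x else 0)" if "l \<in> carrier K" for l x \<sigma>
    using that hbas_single(3)[OF k] by (auto simp: co_def sg_apply mult.commute)
  show "adj A0 (sg \<rho> \<sigma> k x) = sg \<sigma> \<rho> (inv\<^bsub>K\<^esub> k) (act.gstar k \<rho> x)" if x: "\<guillemotleft>x : gO k \<rho> \<rightarrow> \<sigma>\<guillemotright>" for x \<sigma>
    unfolding adj_A0
    using sum_xsupp_sg[where f = aterm, OF k aterm(3)[OF k \<rho> x], of x] hbas_single(3)[OF k] k \<rho>
    by (simp add: aterm(1)[OF k \<rho> hom_scl[OF x]] act.gstar_scl[OF _ \<rho> x])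
  fix \<sigma> assume \<sigma>: "\<sigma> \<in> Obj C"
  show "sg \<sigma> \<delta> k x \<cdot>\<^bsub>A0\<^esub> sg \<rho> \<sigma> l y = sg \<rho> \<delta> (k \<otimes>\<^bsub>K\<^esub> l) (act.gcmp k l \<rho> x y)"
    if "l \<in> carrier K" and x: "\<guillemotleft>x : gO k \<sigma> \<rightarrow> \<delta>\<guillemotright>" and y: "\<guillemotleft>y : gO l \<rho> \<rightarrow> \<sigma>\<guillemotright>" for l x y \<delta>
  proof -
    have l: "l \<in> sub_sectors C S" using that by simp
    have kl: "k \<in> carrier K" "l \<in> carrier K" using k l by simp_all
    have 1: "(\<Sum>q\<in>xsupp (sg \<rho> \<sigma> l y). cterm (\<sigma>, \<delta>, k, b k) x' q (sg \<rho> \<sigma> l y q)) =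
        cterm (\<sigma>, \<delta>, k, b k) x' (\<rho>, \<sigma>, l, b l) (scl C (\<beta> l) y)" if "\<guillemotleft>x' : gO k \<sigma> \<rightarrow> \<delta>\<guillemotright>" for x'
      by (rule sum_xsupp_sg[where f = "cterm (\<sigma>, \<delta>, k, b k) x'", OF l cterm_add(4)[OF k l \<rho> that y]])
    have z: "(\<Sum>q\<in>xsupp (sg \<rho> \<sigma> l y). cterm (\<sigma>, \<delta>, k, b k) 0 q (sg \<rho> \<sigma> l y q)) = 0"
      using 1[OF hom_zero[OF in_homD(1,2)[OF x]]] cterm_add(3)[OF k l \<rho> x hom_scl[OF y]] by simp
    have "sg \<sigma> \<delta> k x \<cdot>\<^bsub>A0\<^esub> sg \<rho> \<sigma> l y = cterm (\<sigma>, \<delta>, k, b k) (scl C (\<beta> k) x) (\<rho>, \<sigma>, l, b l) (scl C (\<beta> l) y)"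
      unfolding cmp_A0
      using sum_xsupp_sg[where f = "\<lambda>p x. \<Sum>q\<in>xsupp (sg \<rho> \<sigma> l y). cterm p x q (sg \<rho> \<sigma> l y q)", OF k z, of x]
        1[OF hom_scl[OF x]] by simp
    also have "\<dots> = sg \<rho> \<delta> (sector_mult C k l) (scl C ((\<beta> k * cnj (\<beta> k)) * (\<beta> l * cnj (\<beta> l))) (act.gcmp k l \<rho> x y))"
      by (simp add: cterm[OF k l \<rho> hom_scl[OF x] hom_scl[OF y]] act.gcmp_add(3)[OF kl \<rho> x hom_scl[OF y]]
          act.gcmp_add(4)[OF kl \<rho> x y] mult_ac)
    finally show ?thesis by (simp add: hbas_single(3)[OF k] hbas_single(3)[OF l])
  qed
next
  fix \<rho> \<sigma> assume \<rho>: "\<rho> \<in> Obj C" and \<sigma>: "\<sigma> \<in> Obj C"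
  have xh: "\<guillemotleft>X (\<rho>, \<sigma>, k, d) : gO k \<rho> \<rightarrow> \<sigma>\<guillemotright>" if "X \<in> Hom A0 \<rho> \<sigma>" "k \<in> sub_sectors C S" "\<rho> \<in> Obj C" "\<sigma> \<in> Obj C" for X k d \<rho> \<sigma>
    using Hom_A0(3)[OF that(1,2)] act.gO[of k \<rho>] that by (simp add: in_hom_def)
  show "\<exists>F. finite F \<and> F \<subseteq> carrier K \<and> X = (\<Sum>k\<in>F. sg \<rho> \<sigma> k (co \<rho> \<sigma> k X))" if X: "X \<in> Hom A0 \<rho> \<sigma>" for X
  proof -
    define F where "F = (\<lambda>(\<rho>, \<sigma>, k, c). k) ` xsupp X"
    have F: "finite F" "F \<subseteq> sub_sectors C S" using Hom_A0[OF X] by (force simp: F_def)+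
    have "X p = (\<Sum>k\<in>F. sg \<rho> \<sigma> k (co \<rho> \<sigma> k X)) p" for p
    proof -
      have "(\<Sum>k\<in>F. sg \<rho> \<sigma> k (co \<rho> \<sigma> k X)) p = (\<Sum>k\<in>F. sg \<rho> \<sigma> k (co \<rho> \<sigma> k X) p)"
        using F(1) by (induction F) simp_all
      also have "\<dots> = (\<Sum>k\<in>F. if p = (\<rho>, \<sigma>, k, b k) then X p else 0)"
        using F(2) hbas_single(3) by (intro sum.cong) (auto simp: sg_apply co_def subset_iff)
      also have "\<dots> = X p"
      proof (cases "p \<in> xsupp X")
        case True
        then obtain l where l: "l \<in> sub_sectors C S" "p = (\<rho>, \<sigma>, l, b l)" using Hom_A0(2)[OF X] by blast
        then have "l \<in> F" using True by (force simp: F_def)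
        then have "(\<Sum>k\<in>F. if p = (\<rho>, \<sigma>, k, b k) then X p else 0) = (\<Sum>k\<in>F. if k = l then X p else 0)"
          using l by (intro sum.cong) auto
        then show ?thesis using F(1) \<open>l \<in> F\<close> by simp
      next
        case False
        then show ?thesis by (intro trans[OF sum.neutral]) (auto simp: xsupp_def)
      qed
      finally show ?thesis by simp
    qed
    then have "X = (\<Sum>k\<in>F. sg \<rho> \<sigma> k (co \<rho> \<sigma> k X))" by (rule ext)
    then show ?thesis using F by (intro exI[of _ F]) simp
  qed
  show "adj A0 (X + Y) = adj A0 X + adj A0 Y" if X: "X \<in> Hom A0 \<rho> \<sigma>" and Y: "Y \<in> Hom A0 \<rho> \<sigma>" for X Y
    unfolding adj_A0
  proof (rule xsupp_sum_add[OF Hom_A0(1)[OF X] Hom_A0(1)[OF Y]])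
    fix p assume "p \<in> xsupp X \<union> xsupp Y"
    then obtain k where k: "k \<in> sub_sectors C S" "p = (\<rho>, \<sigma>, k, b k)" using Hom_A0(2)[OF X] Hom_A0(2)[OF Y] by blast
    show "aterm p 0 = 0" "aterm p (X p + Y p) = aterm p (X p) + aterm p (Y p)"
      unfolding k(2) using aterm(2,3)[OF k(1) \<rho> xh[OF X k(1) \<rho> \<sigma>]] xh[OF Y k(1) \<rho> \<sigma>] by blast+
  qed
  fix \<delta> assume \<delta>: "\<delta> \<in> Obj C"
  show "(X + X') \<cdot>\<^bsub>A0\<^esub> Y = X \<cdot>\<^bsub>A0\<^esub> Y + X' \<cdot>\<^bsub>A0\<^esub> Y"
    if X: "X \<in> Hom A0 \<sigma> \<delta>" and X': "X' \<in> Hom A0 \<sigma> \<delta>" and Y: "Y \<in> Hom A0 \<rho> \<sigma>" for X X' Y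
    unfolding cmp_A0
  proof (rule xsupp_sum_add[OF Hom_A0(1)[OF X] Hom_A0(1)[OF X'], where f = "\<lambda>p x. \<Sum>q\<in>xsupp Y. cterm p x q (Y q)"])
    fix p assume "p \<in> xsupp X \<union> xsupp X'"
    then obtain k where k: "k \<in> sub_sectors C S" "p = (\<sigma>, \<delta>, k, b k)" using Hom_A0(2)[OF X] Hom_A0(2)[OF X'] by blast
    have t: "cterm p 0 q (Y q) = 0 \<and> cterm p (X p + X' p) q (Y q) = cterm p (X p) q (Y q) + cterm p (X' p) q (Y q)"
      if q: "q \<in> xsupp Y" for q
    proof -
      obtain l where l: "l \<in> sub_sectors C S" "q = (\<rho>, \<sigma>, l, b l)" using Hom_A0(2)[OF Y q] by blast
      show ?thesis unfolding k(2) l(2)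
        using cterm_add(1,3)[OF k(1) l(1) \<rho> xh[OF X k(1) \<sigma> \<delta>] xh[OF Y l(1) \<rho> \<sigma>]] xh[OF X' k(1) \<sigma> \<delta>] by blast
    qed
    show "(\<Sum>q\<in>xsupp Y. cterm p 0 q (Y q)) = 0" using t by simp
    show "(\<Sum>q\<in>xsupp Y. cterm p (X p + X' p) q (Y q)) = (\<Sum>q\<in>xsupp Y. cterm p (X p) q (Y q)) + (\<Sum>q\<in>xsupp Y. cterm p (X' p) q (Y q))"
      using t by (simp add: sum.distrib)
  qed
  show "X \<cdot>\<^bsub>A0\<^esub> (Y + Y') = X \<cdot>\<^bsub>A0\<^esub> Y + X \<cdot>\<^bsub>A0\<^esub> Y'"
    if X: "X \<in> Hom A0 \<sigma> \<delta>" and Y: "Y \<in> Hom A0 \<rho> \<sigma>" and Y': "Y' \<in> Hom A0 \<rho> \<sigma>" for X Y Y'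
    unfolding cmp_A0 sum.distrib[symmetric]
  proof (rule sum.cong)
    fix p assume p: "p \<in> xsupp X"
    obtain k where k: "k \<in> sub_sectors C S" "p = (\<sigma>, \<delta>, k, b k)" using Hom_A0(2)[OF X p] by blast
    show "(\<Sum>q\<in>xsupp (Y + Y'). cterm p (X p) q ((Y + Y') q)) = (\<Sum>q\<in>xsupp Y. cterm p (X p) q (Y q)) + (\<Sum>q\<in>xsupp Y'. cterm p (X p) q (Y' q))"
    proof (rule xsupp_sum_add[OF Hom_A0(1)[OF Y] Hom_A0(1)[OF Y'], where f = "cterm p (X p)"])
      fix q assume "q \<in> xsupp Y \<union> xsupp Y'"
      then obtain l where l: "l \<in> sub_sectors C S" "q = (\<rho>, \<sigma>, l, b l)" using Hom_A0(2)[OF Y] Hom_A0(2)[OF Y'] by blast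
      show "cterm p (X p) q 0 = 0" "cterm p (X p) q (Y q + Y' q) = cterm p (X p) q (Y q) + cterm p (X p) q (Y' q)"
        unfolding k(2) l(2)
        using cterm_add(2,4)[OF k(1) l(1) \<rho> xh[OF X k(1) \<sigma> \<delta>] xh[OF Y l(1) \<rho> \<sigma>]] xh[OF Y' l(1) \<rho> \<sigma>] by blast+
    qed
  qed simp
qed

end

section \<open>The classification theorem\<close>

context star_category
begin

text \<open>The operators \<open>Y\<^sub>k Y\<^sub>k\<^sup>*\<close> are linearly independent elements of \<open>End \<tau>\<close>: compressing a linear relation with \<open>Y\<^sub>k\<close> leaves, by
  Schur's lemma, only the term of index \<open>k\<close>.\<close>

lemma finite_multiplicity:
  assumes \<tau>: "\<tau> \<in> Obj C" and B: "finite B" "Hom C \<tau> \<tau> \<subseteq> module.span (scl C) B"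
    and irr: "\<And>k. k \<in> I \<Longrightarrow> irreducible_obj C (\<gamma> k)"
    and ne: "\<And>k l. k \<in> I \<Longrightarrow> l \<in> I \<Longrightarrow> k \<noteq> l \<Longrightarrow> \<not> isomorphic_obj C (\<gamma> k) (\<gamma> l)"
    and Y: "\<And>k. k \<in> I \<Longrightarrow> \<guillemotleft>Y k : \<gamma> k \<rightarrow> \<tau>\<guillemotright>" and Y0: "\<And>k. k \<in> I \<Longrightarrow> Y k \<noteq> 0"
  shows "finite I"
proof -
  interpret V: vector_space "scl C" by (rule vs)
  define P where "P k = Y k \<cdot> adj C (Y k)" for k
  have P: "\<guillemotleft>P k : \<tau> \<rightarrow> \<tau>\<guillemotright>" if "k \<in> I" for k unfolding P_def by (rule hom_cmp[OF Y[OF that] hom_adj[OF Y[OF that]]])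
  have sandwich: "adj C (Y k) \<cdot> (P l \<cdot> Y k) = (adj C (Y k) \<cdot> Y l) \<cdot> (adj C (Y l) \<cdot> Y k)" if k: "k \<in> I" and l: "l \<in> I" for k l
    unfolding P_def
    by (simp add: assoc[OF Y[OF l] hom_adj[OF Y[OF l]] Y[OF k]]
        assoc[OF hom_adj[OF Y[OF k]] Y[OF l] hom_cmp[OF hom_adj[OF Y[OF l]] Y[OF k]]])
  have off: "adj C (Y k) \<cdot> (P l \<cdot> Y k) = 0" if k: "k \<in> I" and l: "l \<in> I" and kl: "k \<noteq> l" for k l
  proof -
    have "adj C (Y l) \<cdot> Y k = 0"
      using schur[OF irr[OF k] irr[OF l] hom_cmp[OF hom_adj[OF Y[OF l]] Y[OF k]]] ne[OF k l kl] by blast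
    then show ?thesis
      using sandwich[OF k l] cmp_zero[OF hom_cmp[OF hom_adj[OF Y[OF k]] Y[OF l]] irreducibleD(1)[OF irr[OF k]]] by simp
  qed
  have diag: "adj C (Y k) \<cdot> (P k \<cdot> Y k) \<noteq> 0" if k: "k \<in> I" for k
  proof -
    note i = hom_ide[OF irreducibleD(1)[OF irr[OF k]]]
    obtain a where a: "adj C (Y k) \<cdot> Y k = scl C a (ide C (\<gamma> k))"
      using irreducibleD(3)[OF irr[OF k] hom_cmp[OF hom_adj[OF Y[OF k]] Y[OF k]]] by blast
    have "a \<noteq> 0" using a positive[OF Y[OF k]] Y0[OF k] by auto
    then show ?thesis
      using irreducibleD(2)[OF irr[OF k]]
      by (simp add: sandwich[OF k k] a scl_cmp[OF i hom_scl[OF i]] ide_left[OF hom_scl[OF i]])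
  qed
  have inj: "inj_on P I"
  proof (rule inj_onI)
    fix k l assume "k \<in> I" "l \<in> I" "P k = P l"
    then show "k = l" using off[of k l] diag[of k] by auto
  qed
  have "V.independent (P ` I)"
  proof (subst V.independent_explicit_finite_subsets, intro allI impI ballI)
    fix Q u p assume Q: "Q \<subseteq> P ` I" "finite Q" "(\<Sum>p\<in>Q. scl C (u p) p) = 0" and p: "p \<in> Q"
    obtain k where k: "k \<in> I" "p = P k" using Q p by auto
    note k' = irreducibleD(1)[OF irr[OF k(1)]]
    have hq: "\<guillemotleft>q : \<tau> \<rightarrow> \<tau>\<guillemotright>" if "q \<in> Q" for q using Q P that by auto
    note yk = Y[OF k(1)] and yk' = hom_adj[OF Y[OF k(1)]]
    have "0 = adj C (Y k) \<cdot> ((\<Sum>q\<in>Q. scl C (u q) q) \<cdot> Y k)"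
      using Q(3) zero_cmp[OF yk \<tau>] cmp_zero[OF yk' k'] by simp
    also have "(\<Sum>q\<in>Q. scl C (u q) q) \<cdot> Y k = (\<Sum>q\<in>Q. scl C (u q) q \<cdot> Y k)"
      by (rule sum_cmp[OF yk \<tau>]) (rule hom_scl[OF hq])
    also have "adj C (Y k) \<cdot> \<dots> = (\<Sum>q\<in>Q. adj C (Y k) \<cdot> (scl C (u q) q \<cdot> Y k))"
      by (rule cmp_sum[OF yk' k']) (rule hom_cmp[OF hom_scl[OF hq] yk])
    also have "\<dots> = (\<Sum>q\<in>Q. if q = p then scl C (u p) (adj C (Y k) \<cdot> (P k \<cdot> Y k)) else 0)"
    proof (rule sum.cong)
      fix q assume q: "q \<in> Q"
      have e: "adj C (Y k) \<cdot> (scl C (u q) q \<cdot> Y k) = scl C (u q) (adj C (Y k) \<cdot> (q \<cdot> Y k))"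
        by (simp add: scl_cmp[OF hq[OF q] yk] cmp_scl'[OF yk' hom_cmp[OF hq[OF q] yk]])
      obtain l where l: "l \<in> I" "q = P l" using Q q by auto
      show "adj C (Y k) \<cdot> (scl C (u q) q \<cdot> Y k) = (if q = p then scl C (u p) (adj C (Y k) \<cdot> (P k \<cdot> Y k)) else 0)"
      proof (cases "q = p")
        case False
        then have "k \<noteq> l" using k l by auto
        then have "adj C (Y k) \<cdot> (q \<cdot> Y k) = 0" unfolding l(2) by (rule off[OF k(1) l(1)])
        then show ?thesis using e False by simp
      qed (use e k in simp)
    qed simp
    also have "\<dots> = scl C (u p) (adj C (Y k) \<cdot> (P k \<cdot> Y k))" using Q(2) p by simp
    finally show "u p = 0" using diag[OF k(1)] by simp
  qed
  moreover have "P ` I \<subseteq> V.span B" using P B(2) in_homD(3) by fast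
  ultimately have "finite (P ` I)" using V.independent_span_bound[OF B(1)] by blast
  then show ?thesis using inj finite_imageD by blast
qed

end

context category_action
begin

lemma orbit_sym:
  assumes "\<exists>k\<in>carrier K. isomorphic_obj C (gO k \<rho>) \<sigma>" and O: "\<rho> \<in> Obj C" "\<sigma> \<in> Obj C"
  shows "\<exists>k\<in>carrier K. isomorphic_obj C (gO k \<sigma>) \<rho>"
proof -
  obtain k where k: "k \<in> carrier K" "isomorphic_obj C (gO k \<rho>) \<sigma>" using assms by auto
  note ik = inv_closed[OF k(1)]
  have "isomorphic_obj C (gO (inv\<^bsub>K\<^esub> k) \<sigma>) (gO (inv\<^bsub>K\<^esub> k) (gO k \<rho>))"
    by (rule gA_iso[OF ik isomorphic_sym[OF k(2)]]) (use k O in simp_all)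
  moreover have "isomorphic_obj C (gO (inv\<^bsub>K\<^esub> k) (gO k \<rho>)) \<rho>"
    using isomorphic_sym[OF gO_mult_iso[OF ik k(1) O(1)]] k O by simp
  ultimately have "isomorphic_obj C (gO (inv\<^bsub>K\<^esub> k) \<sigma>) \<rho>"
    using isomorphic_trans k ik O by (meson gO)
  then show ?thesis using ik by blast
qed

lemma orbit_trans:
  assumes "\<exists>k\<in>carrier K. isomorphic_obj C (gO k \<rho>) \<sigma>" "\<exists>k\<in>carrier K. isomorphic_obj C (gO k \<sigma>) \<tau>"
    and O: "\<rho> \<in> Obj C" "\<sigma> \<in> Obj C" "\<tau> \<in> Obj C"
  shows "\<exists>k\<in>carrier K. isomorphic_obj C (gO k \<rho>) \<tau>"
proof -
  obtain k l where k: "k \<in> carrier K" "isomorphic_obj C (gO k \<rho>) \<sigma>" and l: "l \<in> carrier K" "isomorphic_obj C (gO l \<sigma>) \<tau>"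
    using assms by auto
  have 1: "isomorphic_obj C (gO l (gO k \<rho>)) (gO l \<sigma>)" by (rule gA_iso[OF l(1) k(2)]) (use k O in simp_all)
  have 2: "isomorphic_obj C (gO (l \<otimes>\<^bsub>K\<^esub> k) \<rho>) (gO l \<sigma>)"
    by (rule isomorphic_trans[OF gO_mult_iso[OF l(1) k(1) O(1)] 1]) (use k l O in simp_all)
  have "isomorphic_obj C (gO (l \<otimes>\<^bsub>K\<^esub> k) \<rho>) \<tau>"
    by (rule isomorphic_trans[OF 2 l(2)]) (use k l O in simp_all)
  then show ?thesis using k l by blast
qed

end

context abelian_crossed_product
begin

interpretation V: vector_space "scl C" by (rule vs)
interpretation B: star_category "subobject_closure A0" by (rule star_category_subobject_closure[OF orb.star_category_A])

text \<open>Frobenius reciprocity: \<open>\<gamma> \<rho> \<rightarrow> \<rho>\<close> corresponds to \<open>\<gamma> \<rightarrow> \<rho> \<rho>\<^sub>b\<close>, so that the sectors in the stabilizer of \<open>\<rho>\<close> are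
  mutually inequivalent subobjects of \<open>\<rho> \<rho>\<^sub>b\<close>.\<close>

lemma finite_stab:
  assumes \<rho>: "irreducible_obj C \<rho>"
  shows "finite (orb.stab \<rho>)"
proof -
  note O = irreducibleD(1)[OF \<rho>]
  obtain \<rho>b R Rb where Ob: "\<rho>b \<in> Obj C" and sol: "conj_solution C \<rho> \<rho>b R Rb" using conjugates[OF O] by auto
  have R: "\<guillemotleft>R : unt C \<rightarrow> \<rho>b \<odot> \<rho>\<guillemotright>" and Rb: "\<guillemotleft>Rb : unt C \<rightarrow> \<rho> \<odot> \<rho>b\<guillemotright>"
    and e1: "(adj C Rb \<parallel> ide C \<rho>) \<cdot> (ide C \<rho> \<parallel> R) = ide C \<rho>"
    using sol O Ob by (simp_all add: conj_solution_def in_hom_def unt_Obj prd_Obj)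
  note i = hom_ide[OF O] and ib = hom_ide[OF Ob]
  have h1: "\<guillemotleft>ide C \<rho> \<parallel> R : \<rho> \<rightarrow> \<rho> \<odot> \<rho>b \<odot> \<rho>\<guillemotright>" using hom_tens[OF i R] prd_unt O Ob by (simp add: prd_assoc)
  have h2: "\<guillemotleft>adj C Rb \<parallel> ide C \<rho> : \<rho> \<odot> \<rho>b \<odot> \<rho> \<rightarrow> \<rho>\<guillemotright>" using hom_tens[OF hom_adj[OF Rb] i] prd_unt O by simp
  have r1: "\<guillemotleft>Rb \<parallel> ide C \<rho> : \<rho> \<rightarrow> \<rho> \<odot> \<rho>b \<odot> \<rho>\<guillemotright>" using hom_tens[OF Rb i] prd_unt O by simp
  have r2: "\<guillemotleft>ide C \<rho> \<parallel> adj C R : \<rho> \<odot> \<rho>b \<odot> \<rho> \<rightarrow> \<rho>\<guillemotright>" using hom_tens[OF i hom_adj[OF R]] prd_unt O Ob by (simp add: prd_assoc)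
  have e2: "(ide C \<rho> \<parallel> adj C R) \<cdot> (Rb \<parallel> ide C \<rho>) = ide C \<rho>"
    using arg_cong[OF e1, of "adj C"]
    by (simp add: star_cmp[OF h2 h1] star_tens[OF i R] star_tens[OF hom_adj[OF Rb] i] star_star[OF Rb] star_ide O)
  have "\<forall>k\<in>orb.stab \<rho>. \<exists>Y. \<guillemotleft>Y : g k \<rightarrow> \<rho> \<odot> \<rho>b\<guillemotright> \<and> Y \<noteq> 0"
  proof
    fix k assume "k \<in> orb.stab \<rho>"
    then have k: "k \<in> sub_sectors C S" and iso: "isomorphic_obj C (gO k \<rho>) \<rho>" by (auto simp: orb.stab_def)
    note Ok = rep_sector(2)[OF k]
    note ik = hom_ide[OF Ok]
    have gO: "gO k \<rho> \<in> Obj C" using O Ok by (simp add: gO_def prd_Obj)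
    obtain X X' where X: "\<guillemotleft>X : gO k \<rho> \<rightarrow> \<rho>\<guillemotright>" and X': "\<guillemotleft>X' : \<rho> \<rightarrow> gO k \<rho>\<guillemotright>" and XX: "X \<cdot> X' = ide C \<rho>"
      by (rule isomorphicE[OF iso gO O])
    have X0: "X \<noteq> 0" using XX zero_cmp[OF X' O] irreducibleD(2)[OF \<rho>] by auto
    define Y where "Y = (X \<parallel> ide C \<rho>b) \<cdot> (ide C (g k) \<parallel> Rb)"
    have Xb: "\<guillemotleft>X \<parallel> ide C \<rho>b : g k \<odot> (\<rho> \<odot> \<rho>b) \<rightarrow> \<rho> \<odot> \<rho>b\<guillemotright>"
      using hom_tens[OF X ib] by (simp add: gO_def prd_assoc O Ob Ok)
    have kR: "\<guillemotleft>ide C (g k) \<parallel> Rb : g k \<rightarrow> g k \<odot> (\<rho> \<odot> \<rho>b)\<guillemotright>" using hom_tens[OF ik Rb] prd_unt Ok by simp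
    have Y: "\<guillemotleft>Y : g k \<rightarrow> \<rho> \<odot> \<rho>b\<guillemotright>" unfolding Y_def by (rule hom_cmp[OF Xb kR])
    have "Y \<noteq> 0"
    proof
      assume Y0: "Y = 0"
      have "Y \<parallel> ide C \<rho> = 0"
        using tens_scl(1)[of "g k" "\<rho> \<odot> \<rho>b" \<rho> \<rho> Y "ide C \<rho>" 0] in_homD[OF Y] O Y0 by (simp add: ide_Hom)
      moreover have "Y \<parallel> ide C \<rho> = (X \<parallel> ide C (\<rho>b \<odot> \<rho>)) \<cdot> (ide C (g k) \<parallel> (Rb \<parallel> ide C \<rho>))"
        using interchange[OF Xb kR i i] tens_assoc'[OF X ib i] tens_assoc'[OF ik Rb i]
        by (simp add: Y_def ide_left[OF i] tens_ide O Ob)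
      moreover have "(ide C \<rho> \<parallel> adj C R) \<cdot> (X \<parallel> ide C (\<rho>b \<odot> \<rho>)) = X \<cdot> (ide C (g k) \<parallel> (ide C \<rho> \<parallel> adj C R))"
      proof -
        have ibr: "\<guillemotleft>ide C (\<rho>b \<odot> \<rho>) : \<rho>b \<odot> \<rho> \<rightarrow> \<rho>b \<odot> \<rho>\<guillemotright>" using hom_ide prd_Obj O Ob by simp
        have "(ide C \<rho> \<parallel> adj C R) \<cdot> (X \<parallel> ide C (\<rho>b \<odot> \<rho>)) = X \<parallel> adj C R"
          using interchange[OF i X hom_adj[OF R] ibr] by (simp add: ide_left[OF X] ide_right[OF hom_adj[OF R]])
        also have "\<dots> = (X \<parallel> ide C (unt C)) \<cdot> (ide C (gO k \<rho>) \<parallel> adj C R)"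
          using interchange[OF X hom_ide[OF gO] hom_ide[OF unt_Obj] hom_adj[OF R]]
          by (simp add: ide_right[OF X] ide_left[OF hom_adj[OF R]])
        also have "X \<parallel> ide C (unt C) = X" using tens_unt(2) in_homD[OF X] by blast
        also have "ide C (gO k \<rho>) \<parallel> adj C R = ide C (g k) \<parallel> (ide C \<rho> \<parallel> adj C R)"
          using tens_assoc'[OF ik i hom_adj[OF R]] by (simp add: gO_def tens_ide O Ok)
        finally show ?thesis .
      qed
      moreover have kr1: "\<guillemotleft>ide C (g k) \<parallel> (Rb \<parallel> ide C \<rho>) : gO k \<rho> \<rightarrow> g k \<odot> (\<rho> \<odot> \<rho>b \<odot> \<rho>)\<guillemotright>"
        using hom_tens[OF ik r1] by (simp add: gO_def)
      moreover have kr2: "\<guillemotleft>ide C (g k) \<parallel> (ide C \<rho> \<parallel> adj C R) : g k \<odot> (\<rho> \<odot> \<rho>b \<odot> \<rho>) \<rightarrow> gO k \<rho>\<guillemotright>"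
        using hom_tens[OF ik r2] by (simp add: gO_def)
      moreover have "(ide C (g k) \<parallel> (ide C \<rho> \<parallel> adj C R)) \<cdot> (ide C (g k) \<parallel> (Rb \<parallel> ide C \<rho>)) = ide C (gO k \<rho>)"
        by (simp add: interchange[OF ik ik r2 r1] e2 ide_left[OF ik] gO_def tens_ide O Ok)
      moreover have "\<guillemotleft>X \<parallel> ide C (\<rho>b \<odot> \<rho>) : g k \<odot> (\<rho> \<odot> \<rho>b \<odot> \<rho>) \<rightarrow> \<rho> \<odot> \<rho>b \<odot> \<rho>\<guillemotright>"
        using hom_tens[OF X hom_ide[OF prd_Obj[OF Ob O]]] by (simp add: gO_def prd_assoc prd_Obj O Ob Ok)
      ultimately have "X = (ide C \<rho> \<parallel> adj C R) \<cdot> 0"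
        using assoc[OF r2 \<open>\<guillemotleft>X \<parallel> ide C (\<rho>b \<odot> \<rho>) : _ \<rightarrow> _\<guillemotright>\<close> kr1] assoc[OF X kr2 kr1] ide_right[OF X] by simp
      then show False using cmp_zero[OF r2 gO] X0 by simp
    qed
    with Y show "\<exists>Y. \<guillemotleft>Y : g k \<rightarrow> \<rho> \<odot> \<rho>b\<guillemotright> \<and> Y \<noteq> 0" by blast
  qed
  then obtain Y where Y: "\<And>k. k \<in> orb.stab \<rho> \<Longrightarrow> \<guillemotleft>Y k : g k \<rightarrow> \<rho> \<odot> \<rho>b\<guillemotright>" "\<And>k. k \<in> orb.stab \<rho> \<Longrightarrow> Y k \<noteq> 0" by metis
  have rr: "\<rho> \<odot> \<rho>b \<in> Obj C" by (rule prd_Obj[OF O Ob])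
  obtain B where B: "finite B" "Hom C (\<rho> \<odot> \<rho>b) (\<rho> \<odot> \<rho>b) \<subseteq> V.span B" using Hom_fin_dim[OF rr rr] by auto
  show ?thesis
  proof (rule finite_multiplicity[OF rr B, of _ g])
    fix k l assume k: "k \<in> orb.stab \<rho>" and l: "l \<in> orb.stab \<rho>"
    then have S: "k \<in> sub_sectors C S" "l \<in> sub_sectors C S" by (auto simp: orb.stab_def)
    show "irreducible_obj C (g k)" by (rule line_irreducible[OF line_h[OF S(1)]])
    show "\<not> isomorphic_obj C (g k) (g l)" if "k \<noteq> l"
      using that iso_class_eq_iff[OF rep_sector(2)[OF S(1)] rep_sector(2)[OF S(2)]] rep_sector(3) S by simp
  qed (use Y in auto)
qed

lemma Kgrp_stab: "Kgrp C S D \<rho> = orb.stab \<rho>"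
  by (simp add: Kgrp_def orb.stab_def gO_def)

lemma stab_facts:
  assumes "irreducible_obj C \<rho>" shows "finite (Kgrp C S D \<rho>)" "card (Kgrp C S D \<rho>) > 0"
proof -
  show f: "finite (Kgrp C S D \<rho>)" using finite_stab[OF assms] by (simp add: Kgrp_stab)
  have "\<one>\<^bsub>K\<^esub> \<in> Kgrp C S D \<rho>"
    using subgroup.one_closed[OF orb.stab_subgroup[OF irreducibleD(1)[OF assms]]] by (simp add: Kgrp_stab)
  then show "card (Kgrp C S D \<rho>) > 0" using f card_gt_0_iff by blast
qed

text \<open>The vectors \<open>\<psi> k\<close> are multiples of \<open>h k\<close> by phases, which can be moved into the unitaries \<open>t k\<close>.\<close>

lemma components_exist:
  assumes \<rho>: "irreducible_obj C \<rho>" and ch: "stabilizer_choice C S U D \<rho> t \<psi>"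
  shows "\<exists>r. component_family C S U D \<rho> t \<psi> r" "card (Lgrp C S U D \<rho> t \<psi>) > 0"
proof -
  note O = irreducibleD(1)[OF \<rho>]
  define \<alpha> where "\<alpha> k = ip U (h k) (\<psi> k)" for k
  define t' where "t' k = scl C (\<alpha> k) (t k)" for k
  have sS: "k \<in> sub_sectors C S" if "k \<in> orb.stab \<rho>" for k using that by (auto simp: orb.stab_def)
  have c: "unitary_arr C (gO k \<rho>) \<rho> (t k)" "\<psi> k = hscl U (\<alpha> k) (h k)" "\<alpha> k * cnj (\<alpha> k) = 1" if k: "k \<in> orb.stab \<rho>" for k
  proof -
    note l = lineD[OF line_h[OF sS[OF k]]]
    have p: "\<psi> k \<in> H (g k)" "ip U (\<psi> k) (\<psi> k) = 1" and t: "unitary_arr C (gO k \<rho>) \<rho> (t k)"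
      using ch k unfolding stabilizer_choice_def Kgrp_stab by (auto simp: Hsp_def gO_def)
    show "unitary_arr C (gO k \<rho>) \<rho> (t k)" by (rule t)
    show ps: "\<psi> k = hscl U (\<alpha> k) (h k)" unfolding \<alpha>_def by (rule l(5)[OF p(1)])
    show "\<alpha> k * cnj (\<alpha> k) = 1"
      using p(2) unfolding ps using ip_left(2)[OF l(1,3,3) H_closed(4)[OF l(1,3)]] R.ip_scl[OF FO[OF l(1)] l(3,3)] l(4)
      by (simp add: mult.commute)
  qed
  have t': "unitary_arr C (gO k \<rho>) \<rho> (t' k)" if k: "k \<in> orb.stab \<rho>" for k
  proof -
    have th: "\<guillemotleft>t k : gO k \<rho> \<rightarrow> \<rho>\<guillemotright>" and u: "adj C (t k) \<cdot> t k = ide C (gO k \<rho>)" "t k \<cdot> adj C (t k) = ide C \<rho>"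
      using c(1)[OF k] act.gO[of k \<rho>] sS[OF k] O by (auto simp: unitary_arr_def isometry_def in_hom_def)
    show ?thesis
      unfolding unitary_arr_def isometry_def t'_def
      using in_homD(3)[OF hom_scl[OF th]] c(3)[OF k]
      by (simp add: star_scl[OF th] scl_cmp[OF hom_adj[OF th] hom_scl[OF th]] cmp_scl'[OF hom_adj[OF th] th]
          scl_cmp[OF th hom_scl[OF hom_adj[OF th]]] cmp_scl'[OF th hom_adj[OF th]] u mult.commute)
  qed
  have u: "etens C U D \<rho> \<rho> k (t k) (\<psi> k) = sg \<rho> \<rho> k (t' k)" if k: "k \<in> orb.stab \<rho>" for k
    by (simp add: c(2)[OF k] etens_scl[OF sS[OF k]] t'_def)
  have co: "cocycle C S U D \<rho> t \<psi> k l =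
      (THE z. sg \<rho> \<rho> k (t' k) \<cdot>\<^bsub>A0\<^esub> sg \<rho> \<rho> l (t' l) = scl A0 z (sg \<rho> \<rho> (k \<otimes>\<^bsub>K\<^esub> l) (t' (k \<otimes>\<^bsub>K\<^esub> l))))"
    if k: "k \<in> orb.stab \<rho>" and l: "l \<in> orb.stab \<rho>" for k l
    using subgroup.m_closed[OF orb.stab_subgroup[OF O] k l]
    by (simp add: cocycle_def crossed_product_def Let_def u[OF k] u[OF l] u)
  define L where "L = {k \<in> orb.stab \<rho>. \<forall>l\<in>orb.stab \<rho>.
      (THE z. sg \<rho> \<rho> k (t' k) \<cdot>\<^bsub>A0\<^esub> sg \<rho> \<rho> l (t' l) = scl A0 z (sg \<rho> \<rho> (k \<otimes>\<^bsub>K\<^esub> l) (t' (k \<otimes>\<^bsub>K\<^esub> l)))) =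
      (THE z. sg \<rho> \<rho> l (t' l) \<cdot>\<^bsub>A0\<^esub> sg \<rho> \<rho> k (t' k) = scl A0 z (sg \<rho> \<rho> (l \<otimes>\<^bsub>K\<^esub> k) (t' (l \<otimes>\<^bsub>K\<^esub> k))))}"
  have L: "Lgrp C S U D \<rho> t \<psi> = L"
    unfolding Lgrp_def Kgrp_stab L_def by (auto simp: co simp del: K_simps A0_simps)
  obtain N r where N: "N * N * card L = card (orb.stab \<rho>)" "card L > 0"
    "decomposes (subobject_closure A0) (\<rho>, ide A0 \<rho>) N (characters K L) r"
    using orb.irreducible_decomposes[OF \<rho> finite_stab[OF \<rho>] t'] unfolding L_def by blast
  have "real (card (orb.stab \<rho>)) = real N * real N * real (card L)" by (simp flip: N(1))
  then have "real (card (orb.stab \<rho>)) / real (card L) = (real N)\<^sup>2" using N(2) by (simp add: power2_eq_square)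
  then have "real N = sqrt (real (card (orb.stab \<rho>)) / real (card L))" by simp
  then show "\<exists>r. component_family C S U D \<rho> t \<psi> r"
    unfolding component_family_def Kgrp_stab L crossed_product_def crossed_embed_def using N(3) by blast
  show "card (Lgrp C S U D \<rho> t \<psi>) > 0" using N(2) L by simp
qed

lemma component_familyD:
  assumes \<rho>: "irreducible_obj C \<rho>" and ch: "stabilizer_choice C S U D \<rho> t \<psi>" and "component_family C S U D \<rho> t \<psi> r"
  shows "\<exists>N>0. decomposes (subobject_closure A0) (\<rho>, ide A0 \<rho>) N (characters K (Lgrp C S U D \<rho> t \<psi>)) r"
proof -
  obtain N where N: "real N = sqrt (real (card (Kgrp C S D \<rho>)) / real (card (Lgrp C S U D \<rho> t \<psi>)))"
    "decomposes (subobject_closure A0) (\<rho>, ide A0 \<rho>) N (characters K (Lgrp C S U D \<rho> t \<psi>)) r"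
    using assms(3) unfolding component_family_def crossed_product_def crossed_embed_def by blast
  have "real N > 0" unfolding N(1) using stab_facts(2)[OF \<rho>] components_exist(2)[OF \<rho> ch] by simp
  then show ?thesis using N(2) by auto
qed

lemma sector_orbit_iff:
  assumes "\<rho> \<in> Obj C" "\<sigma> \<in> Obj C"
  shows "iso_class C \<sigma> \<in> sector_orbit C S (iso_class C \<rho>) \<longleftrightarrow> (\<exists>k\<in>carrier K. isomorphic_obj C (gO k \<rho>) \<sigma>)"
proof -
  have "sector_mult C k (iso_class C \<rho>) = iso_class C \<sigma> \<longleftrightarrow> isomorphic_obj C (gO k \<rho>) \<sigma>" if k: "k \<in> sub_sectors C S" for k
    using sector_mult_iso_class[OF rep_sector(2)[OF k] assms(1)] rep_sector(3)[OF k]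
      iso_class_eq_iff[OF prd_Obj[OF rep_sector(2)[OF k] assms(1)] assms(2)] by (simp add: gO_def)
  then show ?thesis unfolding sector_orbit_def by auto
qed

lemma sector_orbit_eq:
  assumes O: "\<rho> \<in> Obj C" "\<sigma> \<in> Obj C" and k: "\<exists>k\<in>carrier K. isomorphic_obj C (gO k \<rho>) \<sigma>"
  shows "sector_orbit C S (iso_class C \<rho>) = sector_orbit C S (iso_class C \<sigma>)"
proof -
  have sub: "sector_orbit C S (iso_class C \<rho>) \<subseteq> sector_orbit C S (iso_class C \<sigma>)"
    if O: "\<rho> \<in> Obj C" "\<sigma> \<in> Obj C" and k: "\<exists>k\<in>carrier K. isomorphic_obj C (gO k \<rho>) \<sigma>" for \<rho> \<sigma>
  proof
    fix x assume x: "x \<in> sector_orbit C S (iso_class C \<rho>)"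
    then obtain l where l: "l \<in> sub_sectors C S" "x = sector_mult C l (iso_class C \<rho>)" by (auto simp: sector_orbit_def)
    note Ol = prd_Obj[OF rep_sector(2)[OF l(1)] O(1)]
    have x': "x = iso_class C (g l \<odot> \<rho>)"
      using sector_mult_iso_class[OF rep_sector(2)[OF l(1)] O(1)] rep_sector(3)[OF l(1)] l(2) by simp
    have "\<exists>k\<in>carrier K. isomorphic_obj C (gO k \<rho>) (g l \<odot> \<rho>)" using x sector_orbit_iff[OF O(1) Ol] x' by simp
    then have "\<exists>k\<in>carrier K. isomorphic_obj C (gO k \<sigma>) (g l \<odot> \<rho>)"
      by (rule act.orbit_trans[OF act.orbit_sym[OF k O] _ O(2,1) Ol])
    then show "x \<in> sector_orbit C S (iso_class C \<sigma>)" using sector_orbit_iff[OF O(2) Ol] x' by simp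
  qed
  show ?thesis
    by (rule equalityI[OF sub[OF O k] sub[OF O(2,1) act.orbit_sym[OF k O]]])
qed

text \<open>Components of representatives of different orbits are inequivalent, and every irreducible object is a component of the
  representative of the orbit of some irreducible object of \<open>C\<close>.\<close>

theorem component_bijection:
  fixes t :: "'o \<Rightarrow> 'o set \<Rightarrow> 'a" and \<psi> :: "'o \<Rightarrow> 'o set \<Rightarrow> 'h"
  assumes ch: "\<And>\<rho>. irreducible_obj C \<rho> \<Longrightarrow> stabilizer_choice C S U D \<rho> (t \<rho>) (\<psi> \<rho>)"
    and r: "\<And>\<Theta>. \<Theta> \<in> sector_orbits C S \<Longrightarrow> irreducible_obj C (orep \<Theta>) \<and> iso_class C (orep \<Theta>) \<in> \<Theta> \<and>
         component_family C S U D (orep \<Theta>) (t (orep \<Theta>)) (\<psi> (orep \<Theta>)) (r \<Theta>)"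
  shows "bij_betw (\<lambda>(\<Theta>, c). iso_class (crossed_product C S U D) (r \<Theta> c))
        (SIGMA \<Theta>:sector_orbits C S.
           characters (sector_group C S) (Lgrp C S U D (orep \<Theta>) (t (orep \<Theta>)) (\<psi> (orep \<Theta>))))
        (sectors (crossed_product C S U D))"
proof -
  let ?B = "subobject_closure A0" and ?X = "\<lambda>\<Theta>. characters K (Lgrp C S U D (orep \<Theta>) (t (orep \<Theta>)) (\<psi> (orep \<Theta>)))"
  have irr: "irreducible_obj C (orep \<Theta>)" if "\<Theta> \<in> sector_orbits C S" for \<Theta> using r[OF that] by simp
  have dec: "\<exists>N>0. decomposes ?B (orep \<Theta>, ide A0 (orep \<Theta>)) N (?X \<Theta>) (r \<Theta>)" if "\<Theta> \<in> sector_orbits C S" for \<Theta>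
    using component_familyD[OF irr[OF that] ch[OF irr[OF that]]] r[OF that] by blast
  have orbit: "\<Theta> = sector_orbit C S (iso_class C (orep \<Theta>))" if \<Theta>: "\<Theta> \<in> sector_orbits C S" for \<Theta>
  proof -
    obtain \<rho> where \<rho>: "irreducible_obj C \<rho>" "\<Theta> = sector_orbit C S (iso_class C \<rho>)"
      using \<Theta> by (auto simp: sector_orbits_def sectors_def)
    note O = irreducibleD(1)[OF \<rho>(1)] irreducibleD(1)[OF irr[OF \<Theta>]]
    have "iso_class C (orep \<Theta>) \<in> sector_orbit C S (iso_class C \<rho>)" using r[OF \<Theta>] \<rho>(2) by simp
    then have "\<exists>k\<in>carrier K. isomorphic_obj C (gO k \<rho>) (orep \<Theta>)" by (simp only: sector_orbit_iff[OF O])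
    from sector_orbit_eq[OF O this] show ?thesis using \<rho>(2) by simp
  qed
  have rB: "irreducible_obj ?B (r \<Theta> c)" "r \<Theta> c \<in> Obj ?B" if "\<Theta> \<in> sector_orbits C S" "c \<in> ?X \<Theta>" for \<Theta> c
    using dec[OF that(1)] orb.decomposesD[OF _ that(2)] by blast+
  show ?thesis
    unfolding crossed_product_def
  proof (rule bij_betw_imageI)
    show "inj_on (\<lambda>(\<Theta>, c). iso_class ?B (r \<Theta> c)) (SIGMA \<Theta>:sector_orbits C S. ?X \<Theta>)"
    proof (rule inj_onI, clarify)
      fix \<Theta> c \<Theta>' c'
      assume \<Theta>: "\<Theta> \<in> sector_orbits C S" "c \<in> ?X \<Theta>" and \<Theta>': "\<Theta>' \<in> sector_orbits C S" "c' \<in> ?X \<Theta>'"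
        and eq: "iso_class ?B (r \<Theta> c) = iso_class ?B (r \<Theta>' c')"
      have iso: "isomorphic_obj ?B (r \<Theta> c) (r \<Theta>' c')"
        using eq B.iso_class_eq_iff[OF rB(2)[OF \<Theta>] rB(2)[OF \<Theta>']] by simp
      obtain N M where N: "N > 0" "decomposes ?B (orep \<Theta>, ide A0 (orep \<Theta>)) N (?X \<Theta>) (r \<Theta>)"
        and M: "M > 0" "decomposes ?B (orep \<Theta>', ide A0 (orep \<Theta>')) M (?X \<Theta>') (r \<Theta>')"
        using dec[OF \<Theta>(1)] dec[OF \<Theta>'(1)] by blast
      note i = irr[OF \<Theta>(1)] irr[OF \<Theta>'(1)]
      have "\<exists>k\<in>carrier K. isomorphic_obj C (gO k (orep \<Theta>)) (orep \<Theta>')"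
        by (rule orb.components_same_orbit[where r = "r \<Theta>" and s = "r \<Theta>'", OF i N(2,1) \<Theta>(2) M(2,1) \<Theta>'(2) iso])
      from sector_orbit_eq[OF irreducibleD(1)[OF i(1)] irreducibleD(1)[OF i(2)] this]
      have \<Theta>\<Theta>': "\<Theta> = \<Theta>'" using orbit[OF \<Theta>(1)] orbit[OF \<Theta>'(1)] by simp
      moreover have "c = c'"
        using N(2) iso \<Theta>(2) \<Theta>'(2) unfolding decomposes_def \<Theta>\<Theta>' by blast
      ultimately show "\<Theta> = \<Theta>' \<and> c = c'" by simp
    qed
    show "(\<lambda>(\<Theta>, c). iso_class ?B (r \<Theta> c)) ` (SIGMA \<Theta>:sector_orbits C S. ?X \<Theta>) = sectors ?B"
    proof
      show "(\<lambda>(\<Theta>, c). iso_class ?B (r \<Theta> c)) ` (SIGMA \<Theta>:sector_orbits C S. ?X \<Theta>) \<subseteq> sectors ?B"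
        using rB(1) by (auto simp: sectors_def)
      show "sectors ?B \<subseteq> (\<lambda>(\<Theta>, c). iso_class ?B (r \<Theta> c)) ` (SIGMA \<Theta>:sector_orbits C S. ?X \<Theta>)"
      proof
        fix x assume "x \<in> sectors ?B"
        then obtain p where p: "irreducible_obj ?B p" "x = iso_class ?B p" by (auto simp: sectors_def)
        have "\<exists>\<rho>. irreducible_obj C \<rho> \<and> (\<forall>\<sigma> k N (X :: ('o set \<Rightarrow> complex) set) r. irreducible_obj C \<sigma> \<and> k \<in> carrier K \<and> isomorphic_obj C (gO k \<sigma>) \<rho> \<and>
            decomposes ?B (\<sigma>, ide A0 \<sigma>) N X r \<longrightarrow> (\<exists>c\<in>X. isomorphic_obj ?B (r c) p))"
          by (rule orb.irreducible_is_component[OF _ _ p(1)]) (rule subobjects, assumption+, rule Hom_fin_dim)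
        then obtain \<rho> where \<rho>: "irreducible_obj C \<rho>"
          and comp: "\<And>\<sigma> k N (X :: ('o set \<Rightarrow> complex) set) r. irreducible_obj C \<sigma> \<Longrightarrow> k \<in> carrier K \<Longrightarrow> isomorphic_obj C (gO k \<sigma>) \<rho> \<Longrightarrow>
            decomposes ?B (\<sigma>, ide A0 \<sigma>) N X r \<Longrightarrow> \<exists>c\<in>X. isomorphic_obj ?B (r c) p"
          by blast
        define \<Theta> where "\<Theta> = sector_orbit C S (iso_class C \<rho>)"
        have \<Theta>: "\<Theta> \<in> sector_orbits C S" using \<rho> by (auto simp: \<Theta>_def sector_orbits_def sectors_def)
        note O = irreducibleD(1)[OF \<rho>] irreducibleD(1)[OF irr[OF \<Theta>]]
        have "iso_class C (orep \<Theta>) \<in> sector_orbit C S (iso_class C \<rho>)" using r[OF \<Theta>] by (simp add: \<Theta>_def)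
        then have "\<exists>k\<in>carrier K. isomorphic_obj C (gO k \<rho>) (orep \<Theta>)" by (simp only: sector_orbit_iff[OF O])
        then obtain k where k: "k \<in> carrier K" "isomorphic_obj C (gO k (orep \<Theta>)) \<rho>" using act.orbit_sym[OF _ O] by blast
        obtain N where "decomposes ?B (orep \<Theta>, ide A0 (orep \<Theta>)) N (?X \<Theta>) (r \<Theta>)" using dec[OF \<Theta>] by blast
        from comp[of "orep \<Theta>" k N "?X \<Theta>" "r \<Theta>", OF irr[OF \<Theta>] k this] obtain c where c: "c \<in> ?X \<Theta>" "isomorphic_obj ?B (r \<Theta> c) p" by blast
        have "x = iso_class ?B (r \<Theta> c)"
          using B.iso_class_eq_iff[OF rB(2)[OF \<Theta> c(1)] B.irreducibleD(1)[OF p(1)]] c(2) p(2) by simp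
        then show "x \<in> (\<lambda>(\<Theta>, c). iso_class ?B (r \<Theta> c)) ` (SIGMA \<Theta>:sector_orbits C S. ?X \<Theta>)"
          using \<Theta> c(1) by (intro image_eqI[of _ _ "(\<Theta>, c)"]) auto
      qed
    qed
  qed
qed

end

theorem corollary5p3:
  fixes C :: "('o, 'a::ab_group_add) braided_cat" and S :: "'o set"
    and G :: "'g monoid" and T :: "'g topology"
    and U :: "('r, 'h::ab_group_add, 'g) rep_cat"
    and D :: "('o, 'a, 'r, 'h) crossed_data"
    and t :: "'o \<Rightarrow> 'o set \<Rightarrow> 'a" and \<psi> :: "'o \<Rightarrow> 'o set \<Rightarrow> 'h"
  assumes "BTC_star C"
    and "even_symmetric_subcategory C S"
    and "\<And>\<gamma>. \<lbrakk>\<gamma> \<in> S; irreducible_obj C \<gamma>\<rbrakk> \<Longrightarrow> has_dimension C \<gamma> 1"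
    and "crossed_product_data C S G T U D"
    and "\<And>\<rho>. irreducible_obj C \<rho> \<Longrightarrow> stabilizer_choice C S U D \<rho> (t \<rho>) (\<psi> \<rho>)"
  shows "(\<forall>\<rho>. irreducible_obj C \<rho> \<longrightarrow> (\<exists>r. component_family C S U D \<rho> (t \<rho>) (\<psi> \<rho>) r)) \<and>
    (\<forall>orep r.
      (\<forall>\<Theta> \<in> sector_orbits C S. irreducible_obj C (orep \<Theta>) \<and> iso_class C (orep \<Theta>) \<in> \<Theta> \<and>
         component_family C S U D (orep \<Theta>) (t (orep \<Theta>)) (\<psi> (orep \<Theta>)) (r \<Theta>)) \<longrightarrow>
      bij_betw (\<lambda>(\<Theta>, c). iso_class (crossed_product C S U D) (r \<Theta> c))
        (SIGMA \<Theta>:sector_orbits C S.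
           characters (sector_group C S) (Lgrp C S U D (orep \<Theta>) (t (orep \<Theta>)) (\<psi> (orep \<Theta>))))
        (sectors (crossed_product C S U D)))"
proof -
  interpret abelian_crossed_product C S G T U D
    by (intro abelian_crossed_product.intro abelian_crossed_product_axioms.intro assms)
  show ?thesis
  proof (intro conjI allI impI)
    show "\<exists>r. component_family C S U D \<rho> (t \<rho>) (\<psi> \<rho>) r" if "irreducible_obj C \<rho>" for \<rho>
      by (rule components_exist(1)[OF that assms(5)[OF that]])
  qed (rule component_bijection[OF assms(5)], assumption, blast)
qed

end
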